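(* Let $G=SL_n$ (over $\mathbb{C}$), let $P$ be a parabolic subgroup of $G$, let $X=G/P$, and let $d=\dim X$. Then there exist an algebraic torus $Z$, a $G$-equivariant principal $Z$-bundle over $X$, and a nowhere vanishing, $G$-invariant, holomorphic form $\Omega$ of degree $d$ defined on (the total space of) this principal $Z$-bundle.
   Context: An algebraic torus is a group isomorphic to $(\mathbb{C}^\times)^r$ for some $r\ge 0$. A principal $Z$-bundle $E\to X$ is $G$-equivariant if $G$ acts on $E$ (algebraically), commuting with the $Z$-action, so that $E\to X$ is $G$-equivariant for the natural left action of $G$ on $X=G/P$. $G$-invariance of $\Omega$ refers to this action. *)

theory Defs
  imports
    "HOL-Analysis.Abstract_Topology"
    "HOL-Analysis.Infinite_Sum"
    "HOL-Algebra.Left_Coset"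
    "HOL-Algebra.Group_Action"
    "HOL-Algebra.Solvable_Groups"
    "HOL-Library.Extended_Nat"
    "Jordan_Normal_Form.Determinant"
begin

section \<open>Complex varieties as spaces with functions\<close>

text \<open>
  A variety over the complex numbers is a set of closed points with its Zariski topology and,
  for every open set, the algebra of regular complex-valued functions on it (varieties in the
  style of Serre's FAC, Borel and Springer).  A function on \<open>U\<close> is represented by any total function,
  whose values outside \<open>U\<close> are irrelevant; the predicate \<open>space_with_functions\<close> below
  enforces this irrelevance.
\<close>

record 'a fspace =
  zariski :: "'a topology"
  regular :: "'a set \<Rightarrow> ('a \<Rightarrow> complex) set"

abbreviation points :: "'a fspace \<Rightarrow> 'a set"
  where "points X \<equiv> topspace (zariski X)"

definition space_with_functions :: "'a fspace \<Rightarrow> bool" where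
  "space_with_functions X \<longleftrightarrow>
     (\<forall>U. openin (zariski X) U \<longrightarrow>
        (\<forall>c. (\<lambda>_. c) \<in> regular X U) \<and>
        (\<forall>f\<in>regular X U. \<forall>g\<in>regular X U.
            (\<lambda>x. f x + g x) \<in> regular X U \<and> (\<lambda>x. f x * g x) \<in> regular X U) \<and>
        (\<forall>f\<in>regular X U. \<forall>g. (\<forall>x\<in>U. g x = f x) \<longrightarrow> g \<in> regular X U) \<and>
        (\<forall>f\<in>regular X U. \<forall>V. openin (zariski X) V \<and> V \<subseteq> U \<longrightarrow> f \<in> regular X V)) \<and>
     (\<forall>\<U> f. (\<forall>U\<in>\<U>. openin (zariski X) U \<and> f \<in> regular X U) \<longrightarrow> f \<in> regular X (\<Union>\<U>))"

definition morphism :: "'a fspace \<Rightarrow> 'b fspace \<Rightarrow> ('a \<Rightarrow> 'b) \<Rightarrow> bool" where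
  "morphism X Y \<phi> \<longleftrightarrow>
     continuous_map (zariski X) (zariski Y) \<phi> \<and>
     (\<forall>V f. openin (zariski Y) V \<and> f \<in> regular Y V \<longrightarrow>
        f \<circ> \<phi> \<in> regular X {x \<in> points X. \<phi> x \<in> V})"

definition isomorphism :: "'a fspace \<Rightarrow> 'b fspace \<Rightarrow> ('a \<Rightarrow> 'b) \<Rightarrow> bool" where
  "isomorphism X Y \<phi> \<longleftrightarrow>
     bij_betw \<phi> (points X) (points Y) \<and> morphism X Y \<phi> \<and>
     morphism Y X (inv_into (points X) \<phi>)"

definition open_subspace :: "'a fspace \<Rightarrow> 'a set \<Rightarrow> 'a fspace" where
  "open_subspace X U = \<lparr>zariski = subtopology (zariski X) U, regular = regular X\<rparr>"

inductive_set polynomial_functions :: "('a \<Rightarrow> complex) set \<Rightarrow> ('a \<Rightarrow> complex) set"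
  for cs :: "('a \<Rightarrow> complex) set" where
  const: "(\<lambda>_. c) \<in> polynomial_functions cs"
| coord: "f \<in> cs \<Longrightarrow> f \<in> polynomial_functions cs"
| add: "f \<in> polynomial_functions cs \<Longrightarrow> g \<in> polynomial_functions cs \<Longrightarrow>
          (\<lambda>x. f x + g x) \<in> polynomial_functions cs"
| mult: "f \<in> polynomial_functions cs \<Longrightarrow> g \<in> polynomial_functions cs \<Longrightarrow>
          (\<lambda>x. f x * g x) \<in> polynomial_functions cs"

text \<open>
  The structure induced on a subset \<open>V\<close> of an affine space with coordinate functions \<open>cs\<close>:
  the principal open sets \<open>{p \<noteq> 0}\<close> generate the topology, and a function is
  regular if it is locally a quotient of polynomials.
\<close>

definition induced_space :: "('a \<Rightarrow> complex) set \<Rightarrow> 'a set \<Rightarrow> 'a fspace" where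
  "induced_space cs V = \<lparr>
     zariski = topology_generated_by {{x \<in> V. p x \<noteq> 0} | p. p \<in> polynomial_functions cs},
     regular = (\<lambda>U. {f. \<forall>x\<in>U. \<exists>p\<in>polynomial_functions cs. \<exists>q\<in>polynomial_functions cs.
                        q x \<noteq> 0 \<and> (\<forall>y\<in>U. q y \<noteq> 0 \<longrightarrow> f y = p y / q y)})\<rparr>"

definition vec_coords :: "nat \<Rightarrow> (complex vec \<Rightarrow> complex) set"
  where "vec_coords N = (\<lambda>i v. v $ i) ` {..<N}"

definition affine_space :: "nat \<Rightarrow> complex vec fspace"
  where "affine_space N = induced_space (vec_coords N) (carrier_vec N)"

definition affine_variety :: "'a fspace \<Rightarrow> bool" where
  "affine_variety X \<longleftrightarrow>
     (\<exists>N V \<phi>. closedin (zariski (affine_space N)) V \<and>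
        isomorphism X (induced_space (vec_coords N) V) \<phi>)"

text \<open>
  Serre's construction of the product: locally the regular functions are quotients of functions
  \<open>\<Sum>i. f\<^sub>i \<otimes> g\<^sub>i\<close> with \<open>f\<^sub>i\<close>, \<open>g\<^sub>i\<close> regular on open subsets of the factors.
  The topology is finer than the product of the two Zariski topologies.
\<close>

definition tensors ::
  "'a fspace \<Rightarrow> 'b fspace \<Rightarrow> 'a set \<Rightarrow> 'b set \<Rightarrow> ('a \<times> 'b \<Rightarrow> complex) set" where
  "tensors X Y U V =
     {(\<lambda>(x, y). \<Sum>i<m. f i x * g i y) | (m::nat) f g.
        \<forall>i<m. f i \<in> regular X U \<and> g i \<in> regular Y V}"

definition prod_space :: "'a fspace \<Rightarrow> 'b fspace \<Rightarrow> ('a \<times> 'b) fspace" where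
  "prod_space X Y = \<lparr>
     zariski = topology_generated_by
       {{p \<in> U \<times> V. h p \<noteq> 0} | U V h.
          openin (zariski X) U \<and> openin (zariski Y) V \<and> h \<in> tensors X Y U V},
     regular = (\<lambda>W. {F. \<forall>p\<in>W. \<exists>U V. openin (zariski X) U \<and> openin (zariski Y) V \<and> p \<in> U \<times> V \<and>
        (\<exists>h\<in>tensors X Y U V. \<exists>k\<in>tensors X Y U V. h p \<noteq> 0 \<and>
           (\<forall>q \<in> W \<inter> (U \<times> V). h q \<noteq> 0 \<longrightarrow> F q = k q / h q))})\<rparr>"

definition variety :: "'a fspace \<Rightarrow> bool" where
  "variety X \<longleftrightarrow>
     space_with_functions X \<and>
     (\<exists>\<U>. finite \<U> \<and> \<Union>\<U> = points X \<and>
        (\<forall>U\<in>\<U>. openin (zariski X) U \<and> affine_variety (open_subspace X U))) \<and>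
     closedin (zariski (prod_space X X)) {(x, x) | x. x \<in> points X}"

definition irreducible_closed :: "'a topology \<Rightarrow> 'a set \<Rightarrow> bool" where
  "irreducible_closed T C \<longleftrightarrow>
     closedin T C \<and> C \<noteq> {} \<and>
     (\<forall>A B. closedin T A \<and> closedin T B \<and> C = A \<union> B \<longrightarrow> C = A \<or> C = B)"

definition krull_dimension :: "'a fspace \<Rightarrow> enat" where
  "krull_dimension X = Sup {enat k | k. \<exists>C. (\<forall>i\<le>k. irreducible_closed (zariski X) (C i)) \<and>
                                     (\<forall>i<k. C i \<subset> C (Suc i))}"

definition quotient_space :: "'a fspace \<Rightarrow> ('a \<Rightarrow> 'b) \<Rightarrow> 'b fspace" where
  "quotient_space X p = \<lparr>
     zariski = topology (\<lambda>U. U \<subseteq> p ` points X \<and> openin (zariski X) {x \<in> points X. p x \<in> U}),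
     regular = (\<lambda>U. {f. f \<circ> p \<in> regular X {x \<in> points X. p x \<in> U}})\<rparr>"

lemma istopology_quotient:
  "istopology (\<lambda>U. U \<subseteq> p ` topspace T \<and> openin T {x \<in> topspace T. p x \<in> U})"
proof -
  have "openin T {x \<in> topspace T. p x \<in> \<Union>\<K>}"
    if "\<And>K. K \<in> \<K> \<Longrightarrow> openin T {x \<in> topspace T. p x \<in> K}" for \<K>
  proof -
    have "{x \<in> topspace T. p x \<in> \<Union>\<K>} = \<Union>((\<lambda>K. {x \<in> topspace T. p x \<in> K}) ` \<K>)" by auto
    then show ?thesis using that by (metis (mono_tags, lifting) imageE openin_Union)
  qed
  moreover have "{x \<in> topspace T. p x \<in> S \<inter> S'} =
      {x \<in> topspace T. p x \<in> S} \<inter> {x \<in> topspace T. p x \<in> S'}" for S S' by auto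
  ultimately show ?thesis unfolding istopology_def by (auto simp: openin_Int)
qed

lemma openin_quotient_space:
  "openin (zariski (quotient_space X p)) U \<longleftrightarrow>
     U \<subseteq> p ` points X \<and> openin (zariski X) {x \<in> points X. p x \<in> U}"
  unfolding quotient_space_def by (simp add: topology_inverse'[OF istopology_quotient])

lemma points_quotient_space [simp]: "points (quotient_space X p) = p ` points X"
proof -
  have "{x \<in> points X. p x \<in> p ` points X} = points X" by auto
  then have "openin (zariski (quotient_space X p)) (p ` points X)"
    by (simp add: openin_quotient_space)
  moreover have "points (quotient_space X p) \<subseteq> p ` points X"
    using openin_quotient_space openin_topspace by metis
  ultimately show ?thesis by (meson openin_subset subset_antisym)
qed

lemma points_induced_space [simp]: "points (induced_space cs V) = V"
proof -
  have "V = {x \<in> V. (\<lambda>_. 1 :: complex) x \<noteq> 0}" by simp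
  then have "V \<in> {{x \<in> V. p x \<noteq> 0} | p. p \<in> polynomial_functions cs}"
    using polynomial_functions.const[of 1 cs] by (intro CollectI exI[of _ "\<lambda>_. 1"] conjI)
  then show ?thesis unfolding induced_space_def by auto
qed


section \<open>Algebraic groups\<close>

record 'a algebraic_group = "'a monoid" +
  underlying_variety :: "'a fspace"

definition SL :: "nat \<Rightarrow> complex mat algebraic_group" where
  "SL n = (let S = {A \<in> carrier_mat n n. det A = 1} in
     \<lparr>carrier = S, mult = (*), one = 1\<^sub>m n,
      underlying_variety = induced_space {\<lambda>A. A $$ (i, j) | i j. i < n \<and> j < n} S\<rparr>)"

lemma group_SL: "group (SL n)"
proof (rule groupI)
  fix A assume "A \<in> carrier (SL n)"
  then have A: "A \<in> carrier_mat n n" "det A = 1" by (auto simp: SL_def Let_def)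
  then have inv: "adj_mat A \<in> carrier_mat n n" "adj_mat A * A = 1\<^sub>m n"
    using adj_mat[of A n] by auto
  then have "det (adj_mat A) = 1" using A det_mult[of "adj_mat A" n A] by simp
  then show "\<exists>B\<in>carrier (SL n). B \<otimes>\<^bsub>SL n\<^esub> A = \<one>\<^bsub>SL n\<^esub>"
    using inv by (auto simp: SL_def Let_def)
qed (auto simp: SL_def Let_def det_mult)

definition closed_subgroup :: "nat \<Rightarrow> complex mat set \<Rightarrow> bool" where
  "closed_subgroup n H \<longleftrightarrow> subgroup H (SL n) \<and> closedin (zariski (underlying_variety (SL n))) H"

definition closed_connected_solvable :: "nat \<Rightarrow> complex mat set \<Rightarrow> bool" where
  "closed_connected_solvable n H \<longleftrightarrow>
     closed_subgroup n H \<and> connectedin (zariski (underlying_variety (SL n))) H \<and>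
     solvable ((SL n)\<lparr>carrier := H\<rparr>)"

definition borel_subgroup :: "nat \<Rightarrow> complex mat set \<Rightarrow> bool" where
  "borel_subgroup n B \<longleftrightarrow>
     closed_connected_solvable n B \<and>
     (\<forall>H. closed_connected_solvable n H \<and> B \<subseteq> H \<longrightarrow> H = B)"

definition parabolic_subgroup :: "nat \<Rightarrow> complex mat set \<Rightarrow> bool" where
  "parabolic_subgroup n P \<longleftrightarrow> closed_subgroup n P \<and> (\<exists>B. borel_subgroup n B \<and> B \<subseteq> P)"

definition homogeneous_space :: "nat \<Rightarrow> complex mat set \<Rightarrow> complex mat set fspace" where
  "homogeneous_space n P = quotient_space (underlying_variety (SL n)) (\<lambda>g. g <#\<^bsub>SL n\<^esub> P)"

lemma points_homogeneous_space: "points (homogeneous_space n P) = lcosets\<^bsub>SL n\<^esub> P"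
  by (auto simp: homogeneous_space_def LCOSETS_def SL_def Let_def)

definition standard_torus :: "nat \<Rightarrow> complex vec algebraic_group" where
  "standard_torus r = (let S = {v \<in> carrier_vec r. \<forall>i<r. v $ i \<noteq> 0} in
     \<lparr>carrier = S, mult = (\<lambda>u v. vec r (\<lambda>i. u $ i * v $ i)), one = vec r (\<lambda>_. 1),
      underlying_variety = induced_space (vec_coords r) S\<rparr>)"

definition algebraic_torus :: "'a algebraic_group \<Rightarrow> bool" where
  "algebraic_torus Z \<longleftrightarrow>
     group Z \<and> points (underlying_variety Z) = carrier Z \<and>
     (\<exists>r. \<exists>\<phi> \<in> iso Z (standard_torus r).
        isomorphism (underlying_variety Z) (underlying_variety (standard_torus r)) \<phi>)"

definition algebraic_action ::
  "'g algebraic_group \<Rightarrow> 'e fspace \<Rightarrow> ('g \<Rightarrow> 'e \<Rightarrow> 'e) \<Rightarrow> bool" where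
  "algebraic_action G E act \<longleftrightarrow>
     group_action G (points E) act \<and>
     morphism (prod_space (underlying_variety G) E) E (\<lambda>(g, e). act g e)"


section \<open>Principal bundles\<close>

text \<open>
  Local triviality is required in the Zariski topology; for tori this is the same as
  local triviality in the etale topology, by Hilbert's Theorem 90.
\<close>

definition principal_bundle ::
  "'z algebraic_group \<Rightarrow> 'e fspace \<Rightarrow> ('z \<Rightarrow> 'e \<Rightarrow> 'e) \<Rightarrow> ('e \<Rightarrow> 'x) \<Rightarrow> 'x fspace \<Rightarrow> bool" where
  "principal_bundle Z E act \<pi> X \<longleftrightarrow>
     variety X \<and> variety E \<and> morphism E X \<pi> \<and> algebraic_action Z E act \<and>
     (\<forall>x\<in>points X. \<exists>U \<tau>. openin (zariski X) U \<and> x \<in> U \<and>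
        isomorphism (prod_space (open_subspace X U) (underlying_variety Z))
                    (open_subspace E {e \<in> points E. \<pi> e \<in> U}) \<tau> \<and>
        (\<forall>u\<in>U. \<forall>z\<in>carrier Z. \<pi> (\<tau> (u, z)) = u \<and>
           (\<forall>z'\<in>carrier Z. \<tau> (u, z' \<otimes>\<^bsub>Z\<^esub> z) = act z' (\<tau> (u, z)))))"

definition equivariant_principal_bundle ::
  "'g algebraic_group \<Rightarrow> ('g \<Rightarrow> 'e \<Rightarrow> 'e) \<Rightarrow> ('g \<Rightarrow> 'x \<Rightarrow> 'x) \<Rightarrow>
   'z algebraic_group \<Rightarrow> 'e fspace \<Rightarrow> ('z \<Rightarrow> 'e \<Rightarrow> 'e) \<Rightarrow> ('e \<Rightarrow> 'x) \<Rightarrow> 'x fspace \<Rightarrow> bool" where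
  "equivariant_principal_bundle G actE actX Z E act \<pi> X \<longleftrightarrow>
     principal_bundle Z E act \<pi> X \<and> algebraic_action G E actE \<and>
     (\<forall>g\<in>carrier G. \<forall>e\<in>points E.
        \<pi> (actE g e) = actX g (\<pi> e) \<and>
        (\<forall>z\<in>carrier Z. actE g (act z e) = act z (actE g e)))"


section \<open>Holomorphic forms on a complex variety\<close>

definition regular_at :: "'a fspace \<Rightarrow> 'a \<Rightarrow> ('a \<Rightarrow> complex) \<Rightarrow> bool" where
  "regular_at X x f \<longleftrightarrow> (\<exists>U. openin (zariski X) U \<and> x \<in> U \<and> f \<in> regular X U)"

text \<open>
  Tangent vectors at \<open>x\<close> are the point derivations of the local ring at \<open>x\<close>.  They are represented
  by functionals on all functions, which depend only on the germ at \<open>x\<close> and take the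
  dummy value \<open>0\<close> on functions that are not regular at \<open>x\<close>.
\<close>

type_synonym 'a functional = "('a \<Rightarrow> complex) \<Rightarrow> complex"

definition tangent_space :: "'a fspace \<Rightarrow> 'a \<Rightarrow> 'a functional set" where
  "tangent_space X x = {D.
     (\<forall>f. \<not> regular_at X x f \<longrightarrow> D f = 0) \<and>
     (\<forall>f g. regular_at X x f \<and> regular_at X x g \<longrightarrow>
        ((\<exists>U. openin (zariski X) U \<and> x \<in> U \<and> (\<forall>y\<in>U. f y = g y)) \<longrightarrow> D f = D g) \<and>
        (\<forall>a b. D (\<lambda>y. a * f y + b * g y) = a * D f + b * D g) \<and>
        D (\<lambda>y. f y * g y) = f x * D g + g x * D f)}"

definition differential ::
  "'a fspace \<Rightarrow> 'b fspace \<Rightarrow> ('a \<Rightarrow> 'b) \<Rightarrow> 'a \<Rightarrow> 'a functional \<Rightarrow> 'b functional" where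
  "differential X Y \<phi> x D = (\<lambda>f. if regular_at Y (\<phi> x) f then D (f \<circ> \<phi>) else 0)"

text \<open>
  The classical topology on the points of a variety is the coarsest one in which Zariski open
  sets are open and regular functions are continuous.
\<close>

definition analytic_topology :: "'a fspace \<Rightarrow> 'a topology" where
  "analytic_topology X = topology_generated_by
     {{x \<in> U. f x \<in> B} | U f B. openin (zariski X) U \<and> f \<in> regular X U \<and> open B}"

text \<open>
  A function is holomorphic at \<open>x\<close> if near \<open>x\<close> it is given by a convergent power series in finitely
  many regular functions vanishing at \<open>x\<close>, i.e. if it is locally the restriction of a holomorphic
  function on an ambient affine space.
\<close>

definition multi_indices :: "nat \<Rightarrow> (nat \<Rightarrow> nat) set"
  where "multi_indices N = {\<alpha>. \<forall>i\<ge>N. \<alpha> i = 0}"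

definition holomorphic_at :: "'a fspace \<Rightarrow> 'a \<Rightarrow> ('a \<Rightarrow> complex) \<Rightarrow> bool" where
  "holomorphic_at X x h \<longleftrightarrow>
     (\<exists>N f (c :: (nat \<Rightarrow> nat) \<Rightarrow> complex) \<rho> W.
        (\<forall>i<N. regular_at X x (f i) \<and> f i x = 0) \<and>
        \<rho> > 0 \<and> (\<lambda>\<alpha>. cmod (c \<alpha>) * \<rho> ^ (\<Sum>i<N. \<alpha> i)) summable_on multi_indices N \<and>
        openin (analytic_topology X) W \<and> x \<in> W \<and>
        (\<forall>y\<in>W. (\<forall>i<N. cmod (f i y) < \<rho>) \<and>
           ((\<lambda>\<alpha>. c \<alpha> * (\<Prod>i<N. f i y ^ \<alpha> i)) has_sum h y) (multi_indices N)))"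

text \<open>
  A form of degree \<open>d\<close> assigns to a point and to tangent vectors \<open>v 0, \<dots>, v (d - 1)\<close> at
  that point a number.  It is holomorphic if locally it is \<open>\<Sum>k. h\<^sub>k df\<^sub>k\<^sub>0 \<and> \<dots> \<and> df\<^sub>k\<^sub>,\<^sub>d\<^sub>-\<^sub>1\<close>
  with \<open>h\<^sub>k\<close> holomorphic and \<open>f\<^sub>k\<^sub>b\<close> regular.  In particular it is alternating and multilinear in
  every point.
\<close>

type_synonym 'a form = "'a \<Rightarrow> (nat \<Rightarrow> 'a functional) \<Rightarrow> complex"

definition wedge_differentials ::
  "nat \<Rightarrow> (nat \<Rightarrow> 'a \<Rightarrow> complex) \<Rightarrow> (nat \<Rightarrow> 'a functional) \<Rightarrow> complex" where
  "wedge_differentials d f v = det (mat d d (\<lambda>(a, b). v a (f b)))"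

definition holomorphic_form :: "'a fspace \<Rightarrow> nat \<Rightarrow> 'a form \<Rightarrow> bool" where
  "holomorphic_form X d \<Omega> \<longleftrightarrow>
     (\<forall>x\<in>points X. \<exists>W (m::nat) h f. openin (analytic_topology X) W \<and> x \<in> W \<and>
        (\<forall>y\<in>W. \<forall>k<m. holomorphic_at X y (h k) \<and> (\<forall>b<d. regular_at X y (f k b))) \<and>
        (\<forall>y\<in>W. \<forall>v. (\<forall>a<d. v a \<in> tangent_space X y) \<longrightarrow>
           \<Omega> y v = (\<Sum>k<m. h k y * wedge_differentials d (f k) v)))"

definition nowhere_vanishing :: "'a fspace \<Rightarrow> nat \<Rightarrow> 'a form \<Rightarrow> bool" where
  "nowhere_vanishing X d \<Omega> \<longleftrightarrow>
     (\<forall>x\<in>points X. \<exists>v. (\<forall>a<d. v a \<in> tangent_space X x) \<and> \<Omega> x v \<noteq> 0)"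

definition invariant_form ::
  "'g algebraic_group \<Rightarrow> ('g \<Rightarrow> 'a \<Rightarrow> 'a) \<Rightarrow> 'a fspace \<Rightarrow> nat \<Rightarrow> 'a form \<Rightarrow> bool" where
  "invariant_form G act X d \<Omega> \<longleftrightarrow>
     (\<forall>g\<in>carrier G. \<forall>x\<in>points X. \<forall>v. (\<forall>a<d. v a \<in> tangent_space X x) \<longrightarrow>
        \<Omega> (act g x) (\<lambda>a. differential X X (act g) x (v a)) = \<Omega> x v)"

end

(*
  By the theorem of Lie and Kolchin, a conjugate Q of P contains the upper triangular matrices, and
  elimination with transvections shows that Q consists of the matrices in SL_n whose entries vanish
  outside a preorder R on the indices.  Right translation identifies G/P with G/Q.  Let chi be the
  determinant of the adjoint action of Q on Lie G / Lie Q.  The bundle E = G x^Q C^* given by chi is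
  the canonical line bundle of G/Q without its zero section, and the tautological form on it is
  Omega.  A character of Q is trivial on its unipotent elements, so Omega is c du_1 ... du_N in the
  coordinates (u, c) of every translate of the big cell, and translates of the big cell by elements
  of G cover G/Q.  The big cell is affine N-space, so dim X = N; the dimension of affine space
  comes from comparing the number of monomials of bounded degree in N and in N + 1 functions.
*)
theory Submission
  imports Defs "HOL-Computational_Algebra.Polynomial" "Jordan_Normal_Form.Spectral_Radius"
begin

section \<open>Algebras of functions\<close>

text \<open>The form is defined point by point: at the class of \<open>(x, z)\<close> it is
  \<open>z\<close> times the wedge of the cell coordinates of the chart centred at \<open>x\<close>.
  Left translation by \<open>g\<close> carries the chart at \<open>x\<close> to the chart at
  \<open>g * x\<close>, so invariance is built in, and the factor \<open>chi\<close> in the gluing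
  makes the value independent of the representative. What has to be proved is regularity along a
  chart: passing from the centre \<open>g\<close> to a centre \<open>g * u\<close> with
  \<open>u\<close> in the cell changes the coordinates by a unitriangular matrix, hence by
  determinant one. The charts rest on one explicit device, the factorisation of a matrix of the big
  cell as \<open>u * q\<close> by Cramer's rule. It is rational in the entries and its first factor
  depends only on the coset, so it supplies regular local sections; from these come the affine
  charts, separatedness, local triviality and the coordinate changes. The reduction to a standard
  parabolic is needed because only there do these coordinates become matrix entries; the conjugation
  is hidden in the projection, so that the given space itself, not a copy of it, is the base of the
  bundle.\<close>

definition function_algebra :: "'a set \<Rightarrow> ('a \<Rightarrow> complex) set \<Rightarrow> bool" where
  "function_algebra D F \<longleftrightarrow>
     (\<forall>c. (\<lambda>_. c) \<in> F) \<and>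
     (\<forall>f\<in>F. \<forall>g\<in>F. (\<lambda>x. f x + g x) \<in> F \<and> (\<lambda>x. f x * g x) \<in> F) \<and>
     (\<forall>f\<in>F. \<forall>g. (\<forall>x\<in>D. g x = f x) \<longrightarrow> g \<in> F)"

context
  fixes D :: "'a set" and F
  assumes alg: "function_algebra D F"
begin

lemma fa_const: "(\<lambda>_. c) \<in> F"
  and fa_add: "f \<in> F \<Longrightarrow> g \<in> F \<Longrightarrow> (\<lambda>x. f x + g x) \<in> F"
  and fa_mult: "f \<in> F \<Longrightarrow> g \<in> F \<Longrightarrow> (\<lambda>x. f x * g x) \<in> F"
  and fa_cong: "f \<in> F \<Longrightarrow> (\<And>x. x \<in> D \<Longrightarrow> g x = f x) \<Longrightarrow> g \<in> F"
  using alg unfolding function_algebra_def by blast+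

lemma fa_uminus: "f \<in> F \<Longrightarrow> (\<lambda>x. - f x) \<in> F"
  using fa_mult[OF fa_const[of "-1"], of f] by simp

lemma fa_diff: "f \<in> F \<Longrightarrow> g \<in> F \<Longrightarrow> (\<lambda>x. f x - g x) \<in> F"
  using fa_add[OF _ fa_uminus] by fastforce

lemma fa_sum: "(\<And>i. i \<in> I \<Longrightarrow> f i \<in> F) \<Longrightarrow> (\<lambda>x. \<Sum>i\<in>I. f i x) \<in> F"
  by (induction I rule: infinite_finite_induct) (auto intro: fa_const fa_add)

lemma fa_prod: "(\<And>i. i \<in> I \<Longrightarrow> f i \<in> F) \<Longrightarrow> (\<lambda>x. \<Prod>i\<in>I. f i x) \<in> F"
  by (induction I rule: infinite_finite_induct) (auto intro: fa_const fa_mult)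

lemma fa_polynomial:
  assumes "p \<in> polynomial_functions cs" "\<And>c. c \<in> cs \<Longrightarrow> (\<lambda>x. c (\<phi> x)) \<in> F"
  shows "(\<lambda>x. p (\<phi> x)) \<in> F"
  using assms by (induction rule: polynomial_functions.induct) (auto intro: fa_const fa_add fa_mult)

text \<open>\<open>F\<close> consists of scalar functions, so regularity of a matrix-valued map is
  tracked by this predicate. Sizes are fixed on \<open>D\<close> only, which suffices because
  members of \<open>F\<close> may be altered outside \<open>D\<close>.\<close>

definition mat_entries :: "nat \<Rightarrow> nat \<Rightarrow> ('a \<Rightarrow> complex mat) \<Rightarrow> bool" where
  "mat_entries m k M \<longleftrightarrow> (\<forall>x\<in>D. M x \<in> carrier_mat m k) \<and> (\<forall>i<m. \<forall>j<k. (\<lambda>x. M x $$ (i, j)) \<in> F)"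

lemma mat_entries_const: "A \<in> carrier_mat m k \<Longrightarrow> mat_entries m k (\<lambda>_. A)"
  by (simp add: mat_entries_def fa_const)

lemma mat_entriesD: "mat_entries m k M \<Longrightarrow> i < m \<Longrightarrow> j < k \<Longrightarrow> (\<lambda>x. M x $$ (i, j)) \<in> F"
  by (simp add: mat_entries_def)

lemma mat_entries_mult:
  assumes "mat_entries m k M" "mat_entries k l N"
  shows "mat_entries m l (\<lambda>x. M x * N x)"
proof -
  have "(\<lambda>x. (M x * N x) $$ (i, j)) \<in> F" if "i < m" "j < l" for i j
  proof (rule fa_cong[of "\<lambda>x. \<Sum>a<k. M x $$ (i, a) * N x $$ (a, j)"])
    show "(\<lambda>x. \<Sum>a<k. M x $$ (i, a) * N x $$ (a, j)) \<in> F"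
      using assms that by (intro fa_sum fa_mult) (auto simp: mat_entries_def)
    show "(M x * N x) $$ (i, j) = (\<Sum>a<k. M x $$ (i, a) * N x $$ (a, j))" if "x \<in> D" for x
    proof -
      have "M x \<in> carrier_mat m k" "N x \<in> carrier_mat k l" using assms that by (auto simp: mat_entries_def)
      then show ?thesis using \<open>i < m\<close> \<open>j < l\<close>
        by (auto simp: scalar_prod_def lessThan_atLeast0 intro!: sum.cong)
    qed
  qed
  then show ?thesis using assms by (auto simp: mat_entries_def)
qed

lemma fa_det:
  assumes "mat_entries m m M"
  shows "(\<lambda>x. det (M x)) \<in> F"
proof (rule fa_cong)
  show "(\<lambda>x. \<Sum>p | p permutes {0..<m}. signof p * (\<Prod>i = 0..<m. M x $$ (i, p i))) \<in> F"
    using assms by (intro fa_sum fa_mult fa_prod fa_const) (auto simp: mat_entries_def)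
  show "det (M x) = (\<Sum>p | p permutes {0..<m}. signof p * (\<Prod>i = 0..<m. M x $$ (i, p i)))" if "x \<in> D" for x
    using assms that by (intro det_def') (auto simp: mat_entries_def)
qed

lemma mat_entries_delete:
  assumes "mat_entries m m M" "i < m" "j < m"
  shows "mat_entries (m - 1) (m - 1) (\<lambda>x. mat_delete (M x) i j)"
proof -
  have "(\<lambda>x. mat_delete (M x) i j $$ (a, b)) \<in> F" if "a < m - 1" "b < m - 1" for a b
  proof (rule fa_cong)
    show "(\<lambda>x. M x $$ (if a < i then a else Suc a, if b < j then b else Suc b)) \<in> F"
      using assms that by (auto simp: mat_entries_def)
    show "mat_delete (M x) i j $$ (a, b) = M x $$ (if a < i then a else Suc a, if b < j then b else Suc b)"
      if "x \<in> D" for x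
    proof -
      have "M x \<in> carrier_mat m m" using assms that by (auto simp: mat_entries_def)
      then show ?thesis using \<open>a < m - 1\<close> \<open>b < m - 1\<close> by (auto simp: mat_delete_def)
    qed
  qed
  then show ?thesis using assms by (auto simp: mat_entries_def mat_delete_def)
qed

lemma mat_entries_adj:
  assumes "mat_entries m m M"
  shows "mat_entries m m (\<lambda>x. adj_mat (M x))"
proof -
  have "(\<lambda>x. adj_mat (M x) $$ (i, j)) \<in> F" if "i < m" "j < m" for i j
  proof (rule fa_cong)
    show "(\<lambda>x. (-1) ^ (j + i) * det (mat_delete (M x) j i)) \<in> F"
      using assms that by (intro fa_mult fa_const fa_det[OF mat_entries_delete])
    show "adj_mat (M x) $$ (i, j) = (-1) ^ (j + i) * det (mat_delete (M x) j i)" if "x \<in> D" for x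
    proof -
      have "M x \<in> carrier_mat m m" using assms that by (auto simp: mat_entries_def)
      then show ?thesis using \<open>i < m\<close> \<open>j < m\<close> by (auto simp: adj_mat_def cofactor_def)
    qed
  qed
  then show ?thesis using assms by (auto simp: mat_entries_def adj_mat(1))
qed

lemma mat_entries_mat:
  assumes "\<And>i j. i < m \<Longrightarrow> j < k \<Longrightarrow> (\<lambda>x. f x (i, j)) \<in> F"
  shows "mat_entries m k (\<lambda>x. mat m k (f x))"
  using assms by (auto simp: mat_entries_def)

end

text \<open>With \<open>UNIV\<close> as domain, agreement on the domain is equality of functions, so
  the third closure condition becomes trivial and only the ring operations remain.\<close>

lemma function_algebra_polynomial_functions: "function_algebra UNIV (polynomial_functions cs)"
proof -
  have "g = f" if "\<forall>x\<in>UNIV. g x = f x" for f g :: "'a \<Rightarrow> complex" using that by auto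
  then show ?thesis unfolding function_algebra_def
    by (metis polynomial_functions.const polynomial_functions.add polynomial_functions.mult)
qed

lemma function_algebra_polynomial_on:
  "function_algebra K {f. \<exists>p\<in>polynomial_functions cs. \<forall>x\<in>K. f x = p x}"
  (is "function_algebra K ?F")
proof -
  have "(\<lambda>_. c) \<in> ?F" for c by (auto intro: bexI[of _ "\<lambda>_. c"] polynomial_functions.const)
  moreover have "(\<lambda>x. f x + g x) \<in> ?F \<and> (\<lambda>x. f x * g x) \<in> ?F" if fg: "f \<in> ?F" "g \<in> ?F" for f g
  proof -
    obtain p q where "p \<in> polynomial_functions cs" "\<forall>x\<in>K. f x = p x"
      "q \<in> polynomial_functions cs" "\<forall>x\<in>K. g x = q x" using fg by blast
    then show ?thesis
      using polynomial_functions.add[of p cs q] polynomial_functions.mult[of p cs q] by force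
  qed
  moreover have "g \<in> ?F" if "f \<in> ?F" "\<forall>x\<in>K. g x = f x" for f g using that by fastforce
  ultimately show ?thesis unfolding function_algebra_def by blast
qed

section \<open>Spaces with functions\<close>

text \<open>The addition to \<open>space_with_functions\<close> is what makes the stalks local
  rings: nonvanishing is an open condition, and inverses are regular there. It allows division of
  regular functions and passes to open subspaces, quotients and products.\<close>

definition local_fspace :: "'a fspace \<Rightarrow> bool" where
  "local_fspace X \<longleftrightarrow> space_with_functions X \<and>
     (\<forall>U f. openin (zariski X) U \<and> f \<in> regular X U \<longrightarrow>
        openin (zariski X) {x \<in> U. f x \<noteq> 0} \<and> (\<lambda>x. inverse (f x)) \<in> regular X {x \<in> U. f x \<noteq> 0})"

context
  fixes X :: "'a fspace"
  assumes X: "local_fspace X"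
begin

lemma function_algebra_regular:
  assumes "openin (zariski X) U"
  shows "function_algebra U (regular X U)"
proof -
  note a = X[unfolded local_fspace_def space_with_functions_def, THEN conjunct1, THEN conjunct1,
      THEN spec, of U, THEN mp, OF assms]
  show ?thesis unfolding function_algebra_def
    using a[THEN conjunct1] a[THEN conjunct2, THEN conjunct1] a[THEN conjunct2, THEN conjunct2, THEN conjunct1]
    by (intro conjI)
qed

lemma regular_cong:
  "openin (zariski X) U \<Longrightarrow> f \<in> regular X U \<Longrightarrow> (\<And>x. x \<in> U \<Longrightarrow> g x = f x) \<Longrightarrow> g \<in> regular X U"
  by (rule fa_cong[OF function_algebra_regular])

lemma regular_mono:
  assumes "openin (zariski X) U" "f \<in> regular X U" "openin (zariski X) V" "V \<subseteq> U"
  shows "f \<in> regular X V"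
  using X[unfolded local_fspace_def space_with_functions_def, THEN conjunct1, THEN conjunct1,
      THEN spec, of U, THEN mp, OF assms(1), THEN conjunct2, THEN conjunct2, THEN conjunct2,
      THEN bspec, OF assms(2), THEN spec, of V] assms(3,4) by simp

lemma regular_local:
  assumes "\<And>x. x \<in> U \<Longrightarrow> \<exists>V. openin (zariski X) V \<and> x \<in> V \<and> V \<subseteq> U \<and> f \<in> regular X V"
  shows "f \<in> regular X U"
proof -
  let ?U = "{V. openin (zariski X) V \<and> V \<subseteq> U \<and> f \<in> regular X V}"
  have "\<Union>?U = U" using assms by blast
  moreover have "f \<in> regular X (\<Union>?U)"
    using X[unfolded local_fspace_def space_with_functions_def, THEN conjunct1, THEN conjunct2,
        THEN spec, of ?U, THEN spec, of f] by simp
  ultimately show ?thesis by simp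
qed

lemma openin_nonzero:
  "openin (zariski X) U \<Longrightarrow> f \<in> regular X U \<Longrightarrow> openin (zariski X) {x \<in> U. f x \<noteq> 0}"
  using X[unfolded local_fspace_def, THEN conjunct2, THEN spec, of U, THEN spec, of f] by simp

lemma regular_inverse:
  assumes "openin (zariski X) U" "f \<in> regular X U" "\<And>x. x \<in> U \<Longrightarrow> f x \<noteq> 0"
  shows "(\<lambda>x. inverse (f x)) \<in> regular X U"
proof -
  have "{x \<in> U. f x \<noteq> 0} = U" using assms by auto
  then show ?thesis
    using X[unfolded local_fspace_def, THEN conjunct2, THEN spec, of U, THEN spec, of f] assms by simp
qed

lemma regular_divide:
  assumes "openin (zariski X) U" "f \<in> regular X U" "g \<in> regular X U" "\<And>x. x \<in> U \<Longrightarrow> f x \<noteq> 0"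
  shows "(\<lambda>x. g x / f x) \<in> regular X U"
  using fa_mult[OF function_algebra_regular[OF assms(1)] assms(3) regular_inverse[OF assms(1,2,4)]]
  by (simp add: divide_inverse)

end

lemma local_fspaceI:
  assumes const: "\<And>U c. openin (zariski X) U \<Longrightarrow> (\<lambda>_. c) \<in> regular X U"
    and add: "\<And>U f g. openin (zariski X) U \<Longrightarrow> f \<in> regular X U \<Longrightarrow> g \<in> regular X U \<Longrightarrow>
      (\<lambda>x. f x + g x) \<in> regular X U"
    and mult: "\<And>U f g. openin (zariski X) U \<Longrightarrow> f \<in> regular X U \<Longrightarrow> g \<in> regular X U \<Longrightarrow>
      (\<lambda>x. f x * g x) \<in> regular X U"
    and cong: "\<And>U f g. openin (zariski X) U \<Longrightarrow> f \<in> regular X U \<Longrightarrow> \<forall>x\<in>U. g x = f x \<Longrightarrow> g \<in> regular X U"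
    and mono: "\<And>U f V. openin (zariski X) U \<Longrightarrow> f \<in> regular X U \<Longrightarrow> openin (zariski X) V \<Longrightarrow> V \<subseteq> U \<Longrightarrow>
      f \<in> regular X V"
    and glue: "\<And>\<U> f. \<forall>U\<in>\<U>. openin (zariski X) U \<and> f \<in> regular X U \<Longrightarrow> f \<in> regular X (\<Union>\<U>)"
    and nonzero: "\<And>U f. openin (zariski X) U \<Longrightarrow> f \<in> regular X U \<Longrightarrow> openin (zariski X) {x \<in> U. f x \<noteq> 0}"
    and inv: "\<And>U f. openin (zariski X) U \<Longrightarrow> f \<in> regular X U \<Longrightarrow>
      (\<lambda>x. inverse (f x)) \<in> regular X {x \<in> U. f x \<noteq> 0}"
  shows "local_fspace X"
  unfolding local_fspace_def space_with_functions_def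
  apply (intro conjI allI ballI impI)
  subgoal by (rule const)
  subgoal by (rule add)
  subgoal by (rule mult)
  subgoal by (rule cong)
  subgoal by (elim conjE) (rule mono)
  subgoal by (rule glue)
  subgoal by (elim conjE) (rule nonzero)
  subgoal by (elim conjE) (rule inv)
  done

text \<open>A generating family in which intersections can be refined around each point is a base.
  Openness then has a neighbourhood criterion, and the inductive generation of the topology need not
  be unfolded again.\<close>

lemma openin_topology_generated_by_base:
  assumes "\<And>A B x. A \<in> \<B> \<Longrightarrow> B \<in> \<B> \<Longrightarrow> x \<in> A \<Longrightarrow> x \<in> B \<Longrightarrow> \<exists>C\<in>\<B>. x \<in> C \<and> C \<subseteq> A \<inter> B"
  shows "openin (topology_generated_by \<B>) U \<longleftrightarrow> (\<forall>x\<in>U. \<exists>A\<in>\<B>. x \<in> A \<and> A \<subseteq> U)"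
proof
  assume "openin (topology_generated_by \<B>) U"
  then have "generate_topology_on \<B> U" by (simp add: openin_topology_generated_by_iff)
  then show "\<forall>x\<in>U. \<exists>A\<in>\<B>. x \<in> A \<and> A \<subseteq> U"
  proof induction
    case (Int a b)
    show ?case
    proof
      fix x assume "x \<in> a \<inter> b"
      then obtain A B where "A \<in> \<B>" "B \<in> \<B>" "x \<in> A" "x \<in> B" "A \<subseteq> a" "B \<subseteq> b" using Int by blast
      with assms[of A B x] show "\<exists>A\<in>\<B>. x \<in> A \<and> A \<subseteq> a \<inter> b" by blast
    qed
  next
    case (UN K)
    then show ?case by (metis Union_iff Union_upper subset_trans)
  qed auto
next
  assume r: "\<forall>x\<in>U. \<exists>A\<in>\<B>. x \<in> A \<and> A \<subseteq> U"
  show "openin (topology_generated_by \<B>) U"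
  proof (subst openin_subopen, intro ballI)
    fix x assume "x \<in> U"
    then obtain A where "A \<in> \<B>" "x \<in> A" "A \<subseteq> U" using r by blast
    then show "\<exists>T. openin (topology_generated_by \<B>) T \<and> x \<in> T \<and> T \<subseteq> U"
      using topology_generated_by_Basis by blast
  qed
qed

lemma openin_induced_space:
  "openin (zariski (induced_space cs V)) U \<longleftrightarrow>
     U \<subseteq> V \<and> (\<forall>x\<in>U. \<exists>p\<in>polynomial_functions cs. p x \<noteq> 0 \<and> {y \<in> V. p y \<noteq> 0} \<subseteq> U)"
proof -
  let ?B = "{{x \<in> V. p x \<noteq> 0} | p. p \<in> polynomial_functions cs}"
  have "\<exists>C\<in>?B. x \<in> C \<and> C \<subseteq> A \<inter> B" if "A \<in> ?B" "B \<in> ?B" "x \<in> A" "x \<in> B" for A B x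
  proof -
    obtain p q where pq: "p \<in> polynomial_functions cs" "A = {x \<in> V. p x \<noteq> 0}"
      "q \<in> polynomial_functions cs" "B = {x \<in> V. q x \<noteq> 0}" using \<open>A \<in> ?B\<close> \<open>B \<in> ?B\<close> by blast
    \<comment> \<open>The product of two polynomials is nonzero exactly where both factors are, so
      principal open sets are closed under intersection.\<close>
    have "{x \<in> V. p x * q x \<noteq> 0} \<in> ?B"
      using polynomial_functions.mult[OF pq(1,3)] by (intro CollectI exI[of _ "\<lambda>x. p x * q x"]) auto
    then show ?thesis using pq that by (intro bexI[of _ "{x \<in> V. p x * q x \<noteq> 0}"]) auto
  qed
  then have "openin (zariski (induced_space cs V)) U \<longleftrightarrow> (\<forall>x\<in>U. \<exists>A\<in>?B. x \<in> A \<and> A \<subseteq> U)"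
    unfolding induced_space_def using openin_topology_generated_by_base[of ?B] by simp
  also have "(\<lambda>x. \<exists>A\<in>?B. x \<in> A \<and> A \<subseteq> U) =
      (\<lambda>x. x \<in> V \<and> (\<exists>p\<in>polynomial_functions cs. p x \<noteq> 0 \<and> {y \<in> V. p y \<noteq> 0} \<subseteq> U))"
  proof (intro ext iffI)
    fix x assume "\<exists>A\<in>?B. x \<in> A \<and> A \<subseteq> U"
    then show "x \<in> V \<and> (\<exists>p\<in>polynomial_functions cs. p x \<noteq> 0 \<and> {y \<in> V. p y \<noteq> 0} \<subseteq> U)" by (elim bexE CollectE exE) auto
  next
    fix x assume "x \<in> V \<and> (\<exists>p\<in>polynomial_functions cs. p x \<noteq> 0 \<and> {y \<in> V. p y \<noteq> 0} \<subseteq> U)"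
    then obtain p where "x \<in> V" "p \<in> polynomial_functions cs" "p x \<noteq> 0" "{y \<in> V. p y \<noteq> 0} \<subseteq> U"
      by (elim conjE bexE)
    then show "\<exists>A\<in>?B. x \<in> A \<and> A \<subseteq> U"
      by (intro bexI[of _ "{y \<in> V. p y \<noteq> 0}"] CollectI exI[of _ p] conjI) auto
  qed
  also have "(\<forall>x\<in>U. x \<in> V \<and> (\<exists>p\<in>polynomial_functions cs. p x \<noteq> 0 \<and> {y \<in> V. p y \<noteq> 0} \<subseteq> U)) \<longleftrightarrow>
      U \<subseteq> V \<and> (\<forall>x\<in>U. \<exists>p\<in>polynomial_functions cs. p x \<noteq> 0 \<and> {y \<in> V. p y \<noteq> 0} \<subseteq> U)"
    by (simp add: subset_iff ball_conj_distrib) (simp add: Ball_def)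
  finally show ?thesis .
qed

lemma openin_induced_principal:
  "p \<in> polynomial_functions cs \<Longrightarrow> openin (zariski (induced_space cs V)) {y \<in> V. p y \<noteq> 0}"
  unfolding openin_induced_space by auto

lemma mem_regular_induced_space:
  "f \<in> regular (induced_space cs V) U \<longleftrightarrow>
     (\<forall>x\<in>U. \<exists>p\<in>polynomial_functions cs. \<exists>q\<in>polynomial_functions cs.
        q x \<noteq> 0 \<and> (\<forall>y\<in>U. q y \<noteq> 0 \<longrightarrow> f y = p y / q y))"
  by (simp add: induced_space_def)

lemma mem_regular_inducedE:
  assumes "f \<in> regular (induced_space cs V) U" "x \<in> U"
  obtains p q where "p \<in> polynomial_functions cs" "q \<in> polynomial_functions cs" "q x \<noteq> 0"
    "\<forall>y\<in>U. q y \<noteq> 0 \<longrightarrow> f y = p y / q y"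
  using bspec[OF assms(1)[unfolded mem_regular_induced_space] assms(2)] by (elim bexE conjE)

lemma openin_inducedE:
  assumes "openin (zariski (induced_space cs V)) U" "x \<in> U"
  obtains p where "p \<in> polynomial_functions cs" "p x \<noteq> 0" "{y \<in> V. p y \<noteq> 0} \<subseteq> U"
  using bspec[OF assms(1)[unfolded openin_induced_space, THEN conjunct2] assms(2)] by (elim bexE conjE)

lemma polynomial_regular_induced:
  "p \<in> polynomial_functions cs \<Longrightarrow> p \<in> regular (induced_space cs V) U"
  unfolding mem_regular_induced_space
  using polynomial_functions.const[of 1 cs] by (intro ballI bexI[of _ p] bexI[of _ "\<lambda>_. 1"]) auto

lemma local_fspace_induced: "local_fspace (induced_space cs V)"
proof (rule local_fspaceI)
  let ?X = "induced_space cs V" and ?P = "polynomial_functions cs"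
  note mem = mem_regular_induced_space
  note mul = polynomial_functions.mult and add = polynomial_functions.add
  show "(\<lambda>_. c) \<in> regular ?X U" for U c
    by (intro polynomial_regular_induced polynomial_functions.const)
  show "g \<in> regular ?X U" if "f \<in> regular ?X U" "\<forall>x\<in>U. g x = f x" for f g U
    using that unfolding mem by simp
  show "f \<in> regular ?X W" if f: "f \<in> regular ?X U" "W \<subseteq> U" for f U W
    unfolding mem
  proof
    fix x assume "x \<in> W"
    then have x: "x \<in> U" using f(2) by blast
    obtain p q where pq: "p \<in> ?P" "q \<in> ?P" "q x \<noteq> 0" "\<forall>y\<in>U. q y \<noteq> 0 \<longrightarrow> f y = p y / q y"
      by (rule mem_regular_inducedE[OF f(1) x])
    show "\<exists>a\<in>?P. \<exists>b\<in>?P. b x \<noteq> 0 \<and> (\<forall>y\<in>W. b y \<noteq> 0 \<longrightarrow> f y = a y / b y)"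
      using pq f(2) by (intro bexI[of _ p] bexI[of _ q]) auto
  qed
  fix U f assume f: "f \<in> regular ?X U"
  show "(\<lambda>x. f x + g x) \<in> regular ?X U" if g: "g \<in> regular ?X U" for g
    unfolding mem
  proof
    fix x assume x: "x \<in> U"
    obtain p q where pq: "p \<in> ?P" "q \<in> ?P" "q x \<noteq> 0" "\<forall>y\<in>U. q y \<noteq> 0 \<longrightarrow> f y = p y / q y"
      by (rule mem_regular_inducedE[OF f x])
    obtain r s where rs: "r \<in> ?P" "s \<in> ?P" "s x \<noteq> 0" "\<forall>y\<in>U. s y \<noteq> 0 \<longrightarrow> g y = r y / s y"
      by (rule mem_regular_inducedE[OF g x])
    show "\<exists>a\<in>?P. \<exists>b\<in>?P. b x \<noteq> 0 \<and> (\<forall>y\<in>U. b y \<noteq> 0 \<longrightarrow> f y + g y = a y / b y)"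
      using pq(3,4) rs(3,4) add[OF mul[OF pq(1) rs(2)] mul[OF rs(1) pq(2)]] mul[OF pq(2) rs(2)]
      by (intro bexI[of _ "\<lambda>y. p y * s y + r y * q y"] bexI[of _ "\<lambda>y. q y * s y"])
        (auto simp: field_simps)
  qed
  show "(\<lambda>x. f x * g x) \<in> regular ?X U" if g: "g \<in> regular ?X U" for g
    unfolding mem
  proof
    fix x assume x: "x \<in> U"
    obtain p q where pq: "p \<in> ?P" "q \<in> ?P" "q x \<noteq> 0" "\<forall>y\<in>U. q y \<noteq> 0 \<longrightarrow> f y = p y / q y"
      by (rule mem_regular_inducedE[OF f x])
    obtain r s where rs: "r \<in> ?P" "s \<in> ?P" "s x \<noteq> 0" "\<forall>y\<in>U. s y \<noteq> 0 \<longrightarrow> g y = r y / s y"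
      by (rule mem_regular_inducedE[OF g x])
    show "\<exists>a\<in>?P. \<exists>b\<in>?P. b x \<noteq> 0 \<and> (\<forall>y\<in>U. b y \<noteq> 0 \<longrightarrow> f y * g y = a y / b y)"
      using pq(3,4) rs(3,4) mul[OF pq(1) rs(1)] mul[OF pq(2) rs(2)]
      by (intro bexI[of _ "\<lambda>y. p y * r y"] bexI[of _ "\<lambda>y. q y * s y"]) auto
  qed
  show "(\<lambda>x. inverse (f x)) \<in> regular ?X {x \<in> U. f x \<noteq> 0}"
    unfolding mem
  proof
    fix x assume x: "x \<in> {x \<in> U. f x \<noteq> 0}"
    then have xU: "x \<in> U" by simp
    obtain p q where pq: "p \<in> ?P" "q \<in> ?P" "q x \<noteq> 0" "\<forall>y\<in>U. q y \<noteq> 0 \<longrightarrow> f y = p y / q y"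
      by (rule mem_regular_inducedE[OF f xU])
    \<comment> \<open>The inverse is written as \<open>q * q / (q * p)\<close> instead of
      \<open>q / p\<close>: the extra factor in the denominator forces
      \<open>q y \<noteq> 0\<close>, and only there is \<open>f y\<close> known to equal
      \<open>p y / q y\<close>.\<close>
    show "\<exists>a\<in>?P. \<exists>b\<in>?P. b x \<noteq> 0 \<and> (\<forall>y\<in>{x \<in> U. f x \<noteq> 0}. b y \<noteq> 0 \<longrightarrow> inverse (f y) = a y / b y)"
      using pq(3,4) x mul[OF pq(2,2)] mul[OF pq(2,1)]
      by (intro bexI[of _ "\<lambda>y. q y * q y"] bexI[of _ "\<lambda>y. q y * p y"]) auto
  qed
  assume U: "openin (zariski ?X) U"
  show "openin (zariski ?X) {x \<in> U. f x \<noteq> 0}"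
    unfolding openin_induced_space
  proof (intro conjI ballI)
    show "{x \<in> U. f x \<noteq> 0} \<subseteq> V" using U unfolding openin_induced_space by blast
    fix x assume x: "x \<in> {x \<in> U. f x \<noteq> 0}"
    then have xU: "x \<in> U" by simp
    obtain p q where pq: "p \<in> ?P" "q \<in> ?P" "q x \<noteq> 0" "\<forall>y\<in>U. q y \<noteq> 0 \<longrightarrow> f y = p y / q y"
      by (rule mem_regular_inducedE[OF f xU])
    obtain s where s: "s \<in> ?P" "s x \<noteq> 0" "{y \<in> V. s y \<noteq> 0} \<subseteq> U" by (rule openin_inducedE[OF U xU])
    have "p x \<noteq> 0" using pq(3,4) x by auto
    \<comment> \<open>Of the three factors of the witness, \<open>s\<close> keeps the point inside
      \<open>U\<close>, \<open>q\<close> makes the fraction valid, and \<open>p\<close> keeps the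
      value nonzero.\<close>
    then show "\<exists>p\<in>?P. p x \<noteq> 0 \<and> {y \<in> V. p y \<noteq> 0} \<subseteq> {x \<in> U. f x \<noteq> 0}"
      using pq(3,4) s(2,3) mul[OF pq(1) mul[OF pq(2) s(1)]]
      by (intro bexI[of _ "\<lambda>y. p y * (q y * s y)"]) auto
  qed
next
  let ?X = "induced_space cs V" and ?P = "polynomial_functions cs"
  fix \<U> f assume U: "\<forall>U\<in>\<U>. openin (zariski ?X) U \<and> f \<in> regular ?X U"
  show "f \<in> regular ?X (\<Union>\<U>)"
    unfolding mem_regular_induced_space
  proof
    fix x assume "x \<in> \<Union>\<U>"
    then obtain U where xU: "U \<in> \<U>" "x \<in> U" by blast
    then have fU: "f \<in> regular ?X U" "openin (zariski ?X) U" using U by auto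
    obtain p q where pq: "p \<in> ?P" "q \<in> ?P" "q x \<noteq> 0" "\<forall>y\<in>U. q y \<noteq> 0 \<longrightarrow> f y = p y / q y"
      by (rule mem_regular_inducedE[OF fU(1) xU(2)])
    obtain s where s: "s \<in> ?P" "s x \<noteq> 0" "{y \<in> V. s y \<noteq> 0} \<subseteq> U" by (rule openin_inducedE[OF fU(2) xU(2)])
    have V: "\<Union>\<U> \<subseteq> V" using U unfolding openin_induced_space by blast
    note mul = polynomial_functions.mult
    \<comment> \<open>Expanding by \<open>s\<close> confines the points with nonzero denominator to
      the single member \<open>U\<close>, where the fraction represents \<open>f\<close>.\<close>
    show "\<exists>p\<in>?P. \<exists>q\<in>?P. q x \<noteq> 0 \<and> (\<forall>y\<in>\<Union>\<U>. q y \<noteq> 0 \<longrightarrow> f y = p y / q y)"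
      using pq(3,4) s(2,3) V mul[OF pq(1) s(1)] mul[OF pq(2) s(1)]
      by (intro bexI[of _ "\<lambda>y. p y * s y"] bexI[of _ "\<lambda>y. q y * s y"]) (auto simp: subset_iff)
  qed
qed

lemma points_open_subspace [simp]: "points (open_subspace X U) = points X \<inter> U"
  by (simp add: open_subspace_def)

lemma regular_open_subspace [simp]: "regular (open_subspace X U) = regular X"
  by (simp add: open_subspace_def)

lemma openin_open_subspace:
  "openin (zariski X) U \<Longrightarrow> openin (zariski (open_subspace X U)) V \<longleftrightarrow> openin (zariski X) V \<and> V \<subseteq> U"
  by (simp add: open_subspace_def openin_open_subtopology)

lemma local_fspace_open_subspace:
  assumes X: "local_fspace X" and U: "openin (zariski X) U"
  shows "local_fspace (open_subspace X U)"
proof (rule local_fspaceI, unfold regular_open_subspace openin_open_subspace[OF U])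
  fix \<U> f assume "\<forall>V\<in>\<U>. (openin (zariski X) V \<and> V \<subseteq> U) \<and> f \<in> regular X V"
  then show "f \<in> regular X (\<Union>\<U>)" by (intro regular_local[OF X]) blast
next
  fix V f assume V: "openin (zariski X) V \<and> V \<subseteq> U" and f: "f \<in> regular X V"
  then have V': "openin (zariski X) V" by simp
  note fa = function_algebra_regular[OF X V']
  show "(\<lambda>x. f x + g x) \<in> regular X V" "(\<lambda>x. f x * g x) \<in> regular X V" if "g \<in> regular X V" for g
    by (rule fa_add[OF fa f that] fa_mult[OF fa f that])+
  show "g \<in> regular X V" if "\<forall>x\<in>V. g x = f x" for g by (rule fa_cong[OF fa f]) (use that in simp)
  show "f \<in> regular X W" if "openin (zariski X) W \<and> W \<subseteq> U" "W \<subseteq> V" for W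
    using regular_mono[OF X V' f] that by simp
  have op: "openin (zariski X) {x \<in> V. f x \<noteq> 0}" by (rule openin_nonzero[OF X V' f])
  then show "openin (zariski X) {x \<in> V. f x \<noteq> 0} \<and> {x \<in> V. f x \<noteq> 0} \<subseteq> U" using V by auto
  show "(\<lambda>x. inverse (f x)) \<in> regular X {x \<in> V. f x \<noteq> 0}"
    by (rule regular_inverse[OF X op regular_mono[OF X V' f op]]) auto
next
  fix V and c :: complex assume "openin (zariski X) V \<and> V \<subseteq> U"
  then show "(\<lambda>_. c) \<in> regular X V" by (intro fa_const[OF function_algebra_regular[OF X]]) simp
qed

lemma regular_quotient_space:
  "f \<in> regular (quotient_space X p) U \<longleftrightarrow> f \<circ> p \<in> regular X {x \<in> points X. p x \<in> U}"
  by (simp add: quotient_space_def)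

text \<open>Openness and regularity on the quotient are defined by pulling back along
  \<open>p\<close>, so each axiom is the corresponding axiom of \<open>X\<close> on a preimage; the
  nonzero locus of \<open>f\<close> pulls back to that of \<open>f \<circ> p\<close>.\<close>

lemma local_fspace_quotient:
  assumes X: "local_fspace X"
  shows "local_fspace (quotient_space X p)"
proof (rule local_fspaceI)
  let ?Q = "quotient_space X p" and ?I = "\<lambda>U. {x \<in> points X. p x \<in> U}"
  note op = openin_quotient_space and reg = regular_quotient_space
  fix U assume U: "openin (zariski ?Q) U"
  then have I: "openin (zariski X) (?I U)" by (simp add: op)
  note fa = function_algebra_regular[OF X I]
  show "(\<lambda>_. c) \<in> regular ?Q U" for c unfolding reg comp_def by (rule fa_const[OF fa])
  fix f assume "f \<in> regular ?Q U"
  then have f: "(\<lambda>x. f (p x)) \<in> regular X (?I U)" by (simp add: reg comp_def)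
  show "(\<lambda>x. f x + g x) \<in> regular ?Q U" "(\<lambda>x. f x * g x) \<in> regular ?Q U" if "g \<in> regular ?Q U" for g
    using fa_add[OF fa f, of "\<lambda>x. g (p x)"] fa_mult[OF fa f, of "\<lambda>x. g (p x)"] that
    by (simp_all add: reg comp_def)
  show "g \<in> regular ?Q U" if "\<forall>x\<in>U. g x = f x" for g
    unfolding reg comp_def by (rule fa_cong[OF fa f]) (use that in simp)
  show "f \<in> regular ?Q V" if V: "openin (zariski ?Q) V" "V \<subseteq> U" for V
    unfolding reg comp_def by (rule regular_mono[OF X I f]) (use V in \<open>auto simp: op\<close>)
  have eq: "?I {x \<in> U. f x \<noteq> 0} = {x \<in> ?I U. f (p x) \<noteq> 0}" by auto
  have 2: "openin (zariski X) {x \<in> ?I U. f (p x) \<noteq> 0}" by (rule openin_nonzero[OF X I f])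
  then show "openin (zariski ?Q) {x \<in> U. f x \<noteq> 0}" using U unfolding op eq by auto
  show "(\<lambda>x. inverse (f x)) \<in> regular ?Q {x \<in> U. f x \<noteq> 0}"
    unfolding reg comp_def eq by (rule regular_inverse[OF X 2 regular_mono[OF X I f 2]]) auto
next
  let ?Q = "quotient_space X p" and ?I = "\<lambda>U. {x \<in> points X. p x \<in> U}"
  fix \<U> f assume U: "\<forall>U\<in>\<U>. openin (zariski ?Q) U \<and> f \<in> regular ?Q U"
  show "f \<in> regular ?Q (\<Union>\<U>)"
    unfolding regular_quotient_space
  proof (rule regular_local[OF X])
    fix x assume "x \<in> ?I (\<Union>\<U>)"
    then obtain U' where "U' \<in> \<U>" "x \<in> ?I U'" by blast
    then show "\<exists>V. openin (zariski X) V \<and> x \<in> V \<and> V \<subseteq> ?I (\<Union>\<U>) \<and> f \<circ> p \<in> regular X V"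
      using U unfolding openin_quotient_space regular_quotient_space by (intro exI[of _ "?I U'"]) auto
  qed
qed

section \<open>Morphisms\<close>

lemma morphismD:
  assumes "morphism X Y \<phi>"
  shows "x \<in> points X \<Longrightarrow> \<phi> x \<in> points Y"
    and "openin (zariski Y) V \<Longrightarrow> openin (zariski X) {x \<in> points X. \<phi> x \<in> V}"
    and "openin (zariski Y) V \<Longrightarrow> f \<in> regular Y V \<Longrightarrow> f \<circ> \<phi> \<in> regular X {x \<in> points X. \<phi> x \<in> V}"
  using assms unfolding morphism_def continuous_map by (auto simp: vimage_def)

lemma morphismI:
  assumes "\<And>x. x \<in> points X \<Longrightarrow> \<phi> x \<in> points Y"
    and "\<And>V. openin (zariski Y) V \<Longrightarrow> openin (zariski X) {x \<in> points X. \<phi> x \<in> V}"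
    and "\<And>V f. openin (zariski Y) V \<Longrightarrow> f \<in> regular Y V \<Longrightarrow> f \<circ> \<phi> \<in> regular X {x \<in> points X. \<phi> x \<in> V}"
  shows "morphism X Y \<phi>"
  using assms unfolding morphism_def continuous_map by auto

lemma morphism_comp:
  assumes f: "morphism X Y f" and g: "morphism Y Z g"
  shows "morphism X Z (\<lambda>x. g (f x))"
proof (rule morphismI)
  show "g (f x) \<in> points Z" if "x \<in> points X" for x using that f g morphismD(1) by metis
  fix V assume V: "openin (zariski Z) V"
  have eq: "{x \<in> points X. g (f x) \<in> V} = {x \<in> points X. f x \<in> {y \<in> points Y. g y \<in> V}}"
    using morphismD(1)[OF f] by auto
  show "openin (zariski X) {x \<in> points X. g (f x) \<in> V}"
    unfolding eq by (intro morphismD(2)[OF f] morphismD(2)[OF g] V)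
  show "h \<circ> (\<lambda>x. g (f x)) \<in> regular X {x \<in> points X. g (f x) \<in> V}" if h: "h \<in> regular Z V" for h
    using morphismD(3)[OF f morphismD(2)[OF g V] morphismD(3)[OF g V h]] unfolding eq by (simp add: comp_def)
qed

lemma morphism_cong:
  assumes X: "local_fspace X" and f: "morphism X Y f" and eq: "\<And>x. x \<in> points X \<Longrightarrow> g x = f x"
  shows "morphism X Y g"
proof (rule morphismI)
  show "g x \<in> points Y" if "x \<in> points X" for x using that eq morphismD(1)[OF f] by metis
  fix V assume V: "openin (zariski Y) V"
  have eqV: "{x \<in> points X. g x \<in> V} = {x \<in> points X. f x \<in> V}" using eq by auto
  show op: "openin (zariski X) {x \<in> points X. g x \<in> V}" using morphismD(2)[OF f V] unfolding eqV .
  show "h \<circ> g \<in> regular X {x \<in> points X. g x \<in> V}" if h: "h \<in> regular Y V" for h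
    by (rule regular_cong[OF X op]) (use morphismD(3)[OF f V h] in \<open>auto simp: eqV eq comp_def\<close>)
qed

lemma morphism_local:
  assumes X: "local_fspace X"
    and loc: "\<And>x. x \<in> points X \<Longrightarrow> \<exists>U. openin (zariski X) U \<and> x \<in> U \<and> morphism (open_subspace X U) Y \<phi>"
  shows "morphism X Y \<phi>"
proof -
  have nbhd: "\<exists>W. openin (zariski X) W \<and> x \<in> W \<and> W \<subseteq> {x \<in> points X. \<phi> x \<in> V} \<and>
      (\<forall>f\<in>regular Y V. f \<circ> \<phi> \<in> regular X W)" if V: "openin (zariski Y) V" and x: "x \<in> points X" "\<phi> x \<in> V" for x V
  proof -
    obtain U where U: "openin (zariski X) U" "x \<in> U" "morphism (open_subspace X U) Y \<phi>" using loc x by blast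
    let ?W = "{y \<in> points (open_subspace X U). \<phi> y \<in> V}"
    have "openin (zariski X) ?W" using morphismD(2)[OF U(3) V] openin_open_subspace[OF U(1)] by metis
    moreover have "f \<circ> \<phi> \<in> regular X ?W" if "f \<in> regular Y V" for f
      using morphismD(3)[OF U(3) V that] by simp
    ultimately show ?thesis using x U(2) by (intro exI[of _ ?W]) auto
  qed
  show ?thesis
  proof (rule morphismI)
    show "\<phi> x \<in> points Y" if x: "x \<in> points X" for x
      using loc[OF x] morphismD(1)[where \<phi>=\<phi>] x by (metis IntI points_open_subspace)
    fix V assume V: "openin (zariski Y) V"
    show "openin (zariski X) {x \<in> points X. \<phi> x \<in> V}"
      by (subst openin_subopen) (use nbhd[OF V] in blast)
    show "f \<circ> \<phi> \<in> regular X {x \<in> points X. \<phi> x \<in> V}" if "f \<in> regular Y V" for f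
      by (rule regular_local[OF X]) (use nbhd[OF V] that in blast)
  qed
qed

lemma morphism_restrict:
  assumes X: "local_fspace X" and f: "morphism X Y \<phi>" and U: "openin (zariski X) U"
  shows "morphism (open_subspace X U) Y \<phi>"
proof (rule morphismI)
  show "\<phi> x \<in> points Y" if "x \<in> points (open_subspace X U)" for x using that morphismD(1)[OF f] by auto
  fix V assume V: "openin (zariski Y) V"
  have eq: "{x \<in> points (open_subspace X U). \<phi> x \<in> V} = {x \<in> points X. \<phi> x \<in> V} \<inter> U" by auto
  have op: "openin (zariski X) ({x \<in> points X. \<phi> x \<in> V} \<inter> U)" using morphismD(2)[OF f V] U by auto
  show "openin (zariski (open_subspace X U)) {x \<in> points (open_subspace X U). \<phi> x \<in> V}"
    unfolding eq openin_open_subspace[OF U] using op by auto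
  show "h \<circ> \<phi> \<in> regular (open_subspace X U) {x \<in> points (open_subspace X U). \<phi> x \<in> V}"
    if h: "h \<in> regular Y V" for h
    unfolding eq using regular_mono[OF X morphismD(2)[OF f V] morphismD(3)[OF f V h] op] by auto
qed

lemma morphism_into_open_subspace:
  assumes f: "morphism X Y \<phi>" and U: "openin (zariski Y) U" and im: "\<And>x. x \<in> points X \<Longrightarrow> \<phi> x \<in> U"
  shows "morphism X (open_subspace Y U) \<phi>"
  using morphismD[OF f] im by (intro morphismI) (auto simp: openin_open_subspace[OF U])

lemma morphism_from_open_subspace:
  assumes f: "morphism X (open_subspace Y U) \<phi>" and Y: "local_fspace Y" and U: "openin (zariski Y) U"
  shows "morphism X Y \<phi>"
proof (rule morphismI)
  show "\<phi> x \<in> points Y" if "x \<in> points X" for x using morphismD(1)[OF f that] by simp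
  fix V assume V: "openin (zariski Y) V"
  have im: "\<phi> x \<in> U" if "x \<in> points X" for x using morphismD(1)[OF f that] by simp
  have eq: "{x \<in> points X. \<phi> x \<in> V} = {x \<in> points X. \<phi> x \<in> V \<inter> U}" using im by auto
  have op: "openin (zariski (open_subspace Y U)) (V \<inter> U)" using U V by (auto simp: openin_open_subspace)
  show "openin (zariski X) {x \<in> points X. \<phi> x \<in> V}" unfolding eq by (rule morphismD(2)[OF f op])
  show "h \<circ> \<phi> \<in> regular X {x \<in> points X. \<phi> x \<in> V}" if h: "h \<in> regular Y V" for h
    unfolding eq using morphismD(3)[OF f op] regular_mono[OF Y V h _ Int_lower1] U V by auto
qed

text \<open>Coordinates generate all polynomials. A principal open set then pulls back to the
  nonzero locus of a regular function, and a local fraction \<open>p / q\<close> pulls back to a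
  quotient that is regular where the denominator does not vanish.\<close>

lemma morphism_induced:
  assumes X: "local_fspace X" and im: "\<And>x. x \<in> points X \<Longrightarrow> \<phi> x \<in> V"
    and cs: "\<And>c. c \<in> cs \<Longrightarrow> (\<lambda>x. c (\<phi> x)) \<in> regular X (points X)"
  shows "morphism X (induced_space cs V) \<phi>"
proof -
  let ?I = "\<lambda>U. {x \<in> points X. \<phi> x \<in> U}"
  have poly: "(\<lambda>x. p (\<phi> x)) \<in> regular X (points X)" if "p \<in> polynomial_functions cs" for p
    using fa_polynomial[OF function_algebra_regular[OF X openin_topspace] that cs] .
  have op: "openin (zariski X) (?I U)" if U: "openin (zariski (induced_space cs V)) U" for U
  proof (subst openin_subopen, intro ballI)
    fix x assume x: "x \<in> ?I U"
    then have xU: "\<phi> x \<in> U" by simp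
    obtain p where p: "p \<in> polynomial_functions cs" "p (\<phi> x) \<noteq> 0" "{y \<in> V. p y \<noteq> 0} \<subseteq> U"
      by (rule openin_inducedE[OF U xU])
    have "openin (zariski X) {x \<in> points X. p (\<phi> x) \<noteq> 0}"
      by (rule openin_nonzero[OF X openin_topspace poly[OF p(1)]])
    then show "\<exists>T. openin (zariski X) T \<and> x \<in> T \<and> T \<subseteq> ?I U"
      using p x im by (intro exI[of _ "{x \<in> points X. p (\<phi> x) \<noteq> 0}"]) auto
  qed
  show ?thesis
  proof (rule morphismI)
    show "\<phi> x \<in> points (induced_space cs V)" if "x \<in> points X" for x using im that by simp
    fix U assume U: "openin (zariski (induced_space cs V)) U"
    show "openin (zariski X) (?I U)" by (rule op[OF U])
    show "f \<circ> \<phi> \<in> regular X (?I U)" if f: "f \<in> regular (induced_space cs V) U" for f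
    proof (rule regular_local[OF X])
      fix x assume x: "x \<in> ?I U"
      then have xU: "\<phi> x \<in> U" by simp
      obtain p q where pq: "p \<in> polynomial_functions cs" "q \<in> polynomial_functions cs" "q (\<phi> x) \<noteq> 0"
        "\<forall>y\<in>U. q y \<noteq> 0 \<longrightarrow> f y = p y / q y"
        by (rule mem_regular_inducedE[OF f xU])
      let ?W = "{x \<in> ?I U. q (\<phi> x) \<noteq> 0}"
      have qU: "(\<lambda>x. q (\<phi> x)) \<in> regular X (?I U)"
        by (rule regular_mono[OF X openin_topspace poly[OF pq(2)] op[OF U]]) auto
      have W: "openin (zariski X) ?W" by (rule openin_nonzero[OF X op[OF U] qU])
      have "(\<lambda>x. p (\<phi> x) / q (\<phi> x)) \<in> regular X ?W"
        by (rule regular_divide[OF X W regular_mono[OF X op[OF U] qU W]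
              regular_mono[OF X openin_topspace poly[OF pq(1)] W]]) auto
      then have "f \<circ> \<phi> \<in> regular X ?W"
        by (rule regular_cong[OF X W]) (use pq in auto)
      then show "\<exists>W. openin (zariski X) W \<and> x \<in> W \<and> W \<subseteq> ?I U \<and> f \<circ> \<phi> \<in> regular X W"
        using W x pq by (intro exI[of _ ?W]) auto
    qed
  qed
qed

lemma isomorphismI:
  assumes Y: "local_fspace Y" and f: "morphism X Y f" and g: "morphism Y X g"
    and gf: "\<And>x. x \<in> points X \<Longrightarrow> g (f x) = x" and fg: "\<And>y. y \<in> points Y \<Longrightarrow> f (g y) = y"
  shows "isomorphism X Y f"
proof -
  have bij: "bij_betw f (points X) (points Y)"
    using morphismD(1)[OF f] morphismD(1)[OF g] gf fg by (intro bij_betwI[of _ _ _ g]) auto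
  moreover have "inv_into (points X) f y = g y" if "y \<in> points Y" for y
    using that bij morphismD(1)[OF g] fg by (intro inv_into_f_eq) (auto simp: bij_betw_def)
  ultimately show ?thesis unfolding isomorphism_def using f morphism_cong[OF Y g] by auto
qed

lemma morphism_quotient_projection:
  "morphism X (quotient_space X p) p"
  by (rule morphismI) (auto simp: openin_quotient_space regular_quotient_space)

text \<open>The universal property of the quotient over an open part \<open>U\<close>: the map
  upstairs need only be a morphism on the preimage of \<open>U\<close> and constant on fibres, the
  latter being encoded by the existence of \<open>\<psi>\<close>.\<close>

lemma morphism_from_quotient:
  assumes X: "local_fspace X" and U: "openin (zariski (quotient_space X p)) U"
    and f: "morphism (open_subspace X {x \<in> points X. p x \<in> U}) Y \<phi>"
    and eq: "\<And>x. x \<in> points X \<Longrightarrow> p x \<in> U \<Longrightarrow> \<psi> (p x) = \<phi> x"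
  shows "morphism (open_subspace (quotient_space X p) U) Y \<psi>"
proof (rule morphismI)
  let ?I = "{x \<in> points X. p x \<in> U}"
  have I: "openin (zariski X) ?I" and UI: "U \<subseteq> p ` points X" using U by (auto simp: openin_quotient_space)
  show "\<psi> y \<in> points Y" if y: "y \<in> points (open_subspace (quotient_space X p) U)" for y
  proof -
    obtain x where "x \<in> points X" "y = p x" "p x \<in> U" using y by auto
    then show ?thesis using morphismD(1)[OF f, of x] eq by auto
  qed
  fix V assume V: "openin (zariski Y) V"
  let ?W = "{y \<in> points (open_subspace (quotient_space X p) U). \<psi> y \<in> V}"
  have eqW: "{x \<in> points X. p x \<in> ?W} = {x \<in> points (open_subspace X ?I). \<phi> x \<in> V}"
    using eq by auto (metis eq)+
  have op: "openin (zariski X) {x \<in> points X. p x \<in> ?W}"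
    unfolding eqW using morphismD(2)[OF f V] openin_open_subspace[OF I] by blast
  show "openin (zariski (open_subspace (quotient_space X p) U)) ?W"
    unfolding openin_open_subspace[OF U] openin_quotient_space using op by auto
  show "h \<circ> \<psi> \<in> regular (open_subspace (quotient_space X p) U) ?W" if h: "h \<in> regular Y V" for h
    unfolding regular_open_subspace regular_quotient_space
    by (rule regular_cong[OF X op])
      (use morphismD(3)[OF f V h, folded eqW] in \<open>auto simp: eq comp_def\<close>)
qed

text \<open>A section \<open>\<phi>\<close> with a retraction \<open>\<psi>\<close> that is constant
  on fibres identifies the quotient over \<open>U\<close> with \<open>C\<close>. This is how the
  quotient of the group gets its affine charts.\<close>

lemma quotient_chart:
  assumes X: "local_fspace X" and C: "local_fspace C" and U: "openin (zariski (quotient_space X p)) U"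
    and \<phi>: "morphism C X \<phi>" "\<And>c. c \<in> points C \<Longrightarrow> p (\<phi> c) \<in> U"
    and \<psi>: "morphism (open_subspace X {x \<in> points X. p x \<in> U}) C \<psi>"
    and inv: "\<And>c. c \<in> points C \<Longrightarrow> \<psi> (\<phi> c) = c"
      "\<And>x. x \<in> points X \<Longrightarrow> p x \<in> U \<Longrightarrow> p (\<phi> (\<psi> x)) = p x"
    and \<theta>: "\<And>x. x \<in> points X \<Longrightarrow> p x \<in> U \<Longrightarrow> \<theta> (p x) = \<psi> x"
  shows "isomorphism (open_subspace (quotient_space X p) U) C \<theta>"
proof (rule isomorphismI[OF C, of _ _ "\<lambda>c. p (\<phi> c)"])
  show "morphism (open_subspace (quotient_space X p) U) C \<theta>"
    by (rule morphism_from_quotient[OF X U \<psi>]) (auto simp: \<theta>)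
  show "morphism C (open_subspace (quotient_space X p) U) (\<lambda>c. p (\<phi> c))"
    by (rule morphism_into_open_subspace[OF morphism_comp[OF \<phi>(1) morphism_quotient_projection] U \<phi>(2)])
  show "\<theta> (p (\<phi> c)) = c" if "c \<in> points C" for c
    using that \<theta>[of "\<phi> c"] inv(1) \<phi>(2) morphismD(1)[OF \<phi>(1)] by auto
  show "p (\<phi> (\<theta> y)) = y" if y: "y \<in> points (open_subspace (quotient_space X p) U)" for y
    using y \<theta> inv(2) by auto
qed

section \<open>Products\<close>

lemma tensorsE:
  assumes "h \<in> tensors X Y U V"
  obtains m f g where "h = (\<lambda>p. \<Sum>i<m::nat. f i (fst p) * g i (snd p))"
    "\<forall>i<m. f i \<in> regular X U \<and> g i \<in> regular Y V"
  using assms unfolding tensors_def by (auto simp: case_prod_unfold)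

text \<open>Arbitrary finite index sets are allowed so that a product of tensors can be indexed by
  pairs and a sum by a disjoint union.\<close>

lemma tensorsI:
  assumes "finite I" "\<And>i. i \<in> I \<Longrightarrow> f i \<in> regular X U \<and> g i \<in> regular Y V"
  shows "(\<lambda>p. \<Sum>i\<in>I. f i (fst p) * g i (snd p)) \<in> tensors X Y U V"
proof -
  obtain e where e: "bij_betw e {0..<card I} I" using ex_bij_betw_nat_finite[OF assms(1)] by blast
  have "(\<lambda>p. \<Sum>i\<in>I. f i (fst p) * g i (snd p)) = (\<lambda>(x, y). \<Sum>i<card I. f (e i) x * g (e i) y)"
    using sum.reindex_bij_betw[OF e, symmetric]
    by (intro ext) (simp add: lessThan_atLeast0 case_prod_unfold)
  moreover have "\<forall>i<card I. f (e i) \<in> regular X U \<and> g (e i) \<in> regular Y V"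
    using assms(2) bij_betwE[OF e] by simp
  ultimately show ?thesis unfolding tensors_def
    by (intro CollectI exI[of _ "card I"] exI[of _ "\<lambda>i. f (e i)"] exI[of _ "\<lambda>i. g (e i)"]) auto
qed

lemma tensors_mult:
  assumes X: "local_fspace X" "openin (zariski X) U" and Y: "local_fspace Y" "openin (zariski Y) V"
    and h: "h \<in> tensors X Y U V" and k: "k \<in> tensors X Y U V"
  shows "(\<lambda>p. h p * k p) \<in> tensors X Y U V"
proof -
  obtain m f g where h: "h = (\<lambda>p. \<Sum>i<m::nat. f i (fst p) * g i (snd p))"
    "\<forall>i<m. f i \<in> regular X U \<and> g i \<in> regular Y V" using h by (rule tensorsE)
  obtain m' f' g' where k: "k = (\<lambda>p. \<Sum>i<m'::nat. f' i (fst p) * g' i (snd p))"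
    "\<forall>i<m'. f' i \<in> regular X U \<and> g' i \<in> regular Y V" using k by (rule tensorsE)
  have "(\<lambda>p. \<Sum>ij\<in>{..<m}\<times>{..<m'}. (f (fst ij) (fst p) * f' (snd ij) (fst p)) *
      (g (fst ij) (snd p) * g' (snd ij) (snd p))) \<in> tensors X Y U V"
    using h k
    by (intro tensorsI[where f="\<lambda>ij x. f (fst ij) x * f' (snd ij) x" and
          g="\<lambda>ij x. g (fst ij) x * g' (snd ij) x"]
        conjI fa_mult[OF function_algebra_regular[OF X]] fa_mult[OF function_algebra_regular[OF Y]]) auto
  moreover have "(\<Sum>ij\<in>{..<m}\<times>{..<m'}. (f (fst ij) (fst p) * f' (snd ij) (fst p)) *
      (g (fst ij) (snd p) * g' (snd ij) (snd p))) = h p * k p" for p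
    unfolding h k sum_product sum.cartesian_product by (intro sum.cong) (auto simp: mult_ac)
  ultimately show ?thesis by simp
qed

lemma tensors_add:
  assumes h: "h \<in> tensors X Y U V" and k: "k \<in> tensors X Y U V"
  shows "(\<lambda>p. h p + k p) \<in> tensors X Y U V"
proof -
  obtain m f g where h: "h = (\<lambda>p. \<Sum>i<m::nat. f i (fst p) * g i (snd p))"
    "\<forall>i<m. f i \<in> regular X U \<and> g i \<in> regular Y V" using h by (rule tensorsE)
  obtain m' f' g' where k: "k = (\<lambda>p. \<Sum>i<m'::nat. f' i (fst p) * g' i (snd p))"
    "\<forall>i<m'. f' i \<in> regular X U \<and> g' i \<in> regular Y V" using k by (rule tensorsE)
  have "(\<lambda>p. \<Sum>i\<in>Inl ` {..<m} \<union> Inr ` {..<m'}. (case i of Inl i \<Rightarrow> f i | Inr i \<Rightarrow> f' i) (fst p) *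
      (case i of Inl i \<Rightarrow> g i | Inr i \<Rightarrow> g' i) (snd p)) \<in> tensors X Y U V"
    using h k by (intro tensorsI) auto
  moreover have "(\<Sum>i\<in>Inl ` {..<m} \<union> Inr ` {..<m'}. (case i of Inl i \<Rightarrow> f i | Inr i \<Rightarrow> f' i) (fst p) *
      (case i of Inl i \<Rightarrow> g i | Inr i \<Rightarrow> g' i) (snd p)) = h p + k p" for p
    unfolding h k by (subst sum.union_disjoint) (auto simp: sum.reindex)
  ultimately show ?thesis by simp
qed

lemma tensors_rank_one:
  assumes "f \<in> regular X U" "g \<in> regular Y V"
  shows "(\<lambda>p. f (fst p) * g (snd p)) \<in> tensors X Y U V"
  using tensorsI[of "{()}" "\<lambda>_. f" X U "\<lambda>_. g" Y V] assms by simp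

lemma tensors_const:
  assumes X: "local_fspace X" "openin (zariski X) U" and Y: "local_fspace Y" "openin (zariski Y) V"
  shows "(\<lambda>_. c) \<in> tensors X Y U V"
  using tensors_rank_one[OF fa_const[OF function_algebra_regular[OF X], of c]
      fa_const[OF function_algebra_regular[OF Y], of 1]] by simp

lemma tensors_mono:
  assumes X: "local_fspace X" "openin (zariski X) U" and Y: "local_fspace Y" "openin (zariski Y) V"
    and h: "h \<in> tensors X Y U V" and U': "openin (zariski X) U'" "U' \<subseteq> U" and V': "openin (zariski Y) V'" "V' \<subseteq> V"
  shows "h \<in> tensors X Y U' V'"
proof -
  obtain m f g where h: "h = (\<lambda>p. \<Sum>i<m::nat. f i (fst p) * g i (snd p))"
    "\<forall>i<m. f i \<in> regular X U \<and> g i \<in> regular Y V" using h by (rule tensorsE)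
  show ?thesis unfolding h(1)
    using h(2) regular_mono[OF X _ U'] regular_mono[OF Y _ V'] by (intro tensorsI) auto
qed

context
  fixes X :: "'a fspace" and Y :: "'b fspace"
  assumes X: "local_fspace X" and Y: "local_fspace Y"
begin

lemma openin_prod_space:
  "openin (zariski (prod_space X Y)) W \<longleftrightarrow>
     (\<forall>p\<in>W. \<exists>U V h. openin (zariski X) U \<and> openin (zariski Y) V \<and> h \<in> tensors X Y U V \<and>
        p \<in> U \<times> V \<and> h p \<noteq> 0 \<and> {q \<in> U \<times> V. h q \<noteq> 0} \<subseteq> W)"
proof -
  let ?B = "{{p \<in> U \<times> V. h p \<noteq> 0} | U V h.
          openin (zariski X) U \<and> openin (zariski Y) V \<and> h \<in> tensors X Y U V}"
  have "\<exists>C\<in>?B. x \<in> C \<and> C \<subseteq> A \<inter> B" if AB: "A \<in> ?B" "B \<in> ?B" and x: "x \<in> A" "x \<in> B" for A B x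
  proof -
    obtain U V h where h: "openin (zariski X) U" "openin (zariski Y) V" "h \<in> tensors X Y U V"
      "A = {p \<in> U \<times> V. h p \<noteq> 0}" using AB(1) by blast
    obtain U' V' h' where h': "openin (zariski X) U'" "openin (zariski Y) V'" "h' \<in> tensors X Y U' V'"
      "B = {p \<in> U' \<times> V'. h' p \<noteq> 0}" using AB(2) by blast
    have op: "openin (zariski X) (U \<inter> U')" "openin (zariski Y) (V \<inter> V')" using h h' by auto
    have "h \<in> tensors X Y (U \<inter> U') (V \<inter> V')" "h' \<in> tensors X Y (U \<inter> U') (V \<inter> V')"
      using tensors_mono[OF X h(1) Y h(2,3)] tensors_mono[OF X h'(1) Y h'(2,3)] op by auto
    then have "(\<lambda>p. h p * h' p) \<in> tensors X Y (U \<inter> U') (V \<inter> V')" by (rule tensors_mult[OF X op(1) Y op(2)])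
    then have "{p \<in> (U \<inter> U') \<times> (V \<inter> V'). h p * h' p \<noteq> 0} \<in> ?B"
      using op by (intro CollectI exI[of _ "U \<inter> U'"] exI[of _ "V \<inter> V'"] exI[of _ "\<lambda>p. h p * h' p"]) auto
    then show ?thesis by (rule bexI[rotated]) (use x h h' in auto)
  qed
  then have "openin (zariski (prod_space X Y)) W \<longleftrightarrow> (\<forall>x\<in>W. \<exists>A\<in>?B. x \<in> A \<and> A \<subseteq> W)"
    unfolding prod_space_def using openin_topology_generated_by_base[of ?B] by simp
  also have "(\<lambda>p. \<exists>A\<in>?B. p \<in> A \<and> A \<subseteq> W) =
      (\<lambda>p. \<exists>U V h. openin (zariski X) U \<and> openin (zariski Y) V \<and> h \<in> tensors X Y U V \<and>
        p \<in> U \<times> V \<and> h p \<noteq> 0 \<and> {q \<in> U \<times> V. h q \<noteq> 0} \<subseteq> W)" (is "?l = ?r")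
  proof (intro ext iffI)
    fix p assume "?l p"
    then obtain U V h where "openin (zariski X) U" "openin (zariski Y) V" "h \<in> tensors X Y U V"
        "p \<in> {q \<in> U \<times> V. h q \<noteq> 0}" "{q \<in> U \<times> V. h q \<noteq> 0} \<subseteq> W"
      by (elim bexE CollectE exE conjE) simp
    then show "?r p" by (intro exI[of _ U] exI[of _ V] exI[of _ h] conjI) auto
  next
    fix p assume "?r p"
    then obtain U V h where "openin (zariski X) U" "openin (zariski Y) V" "h \<in> tensors X Y U V"
        "p \<in> U \<times> V" "h p \<noteq> 0" "{q \<in> U \<times> V. h q \<noteq> 0} \<subseteq> W"
      by (elim exE conjE)
    then show "?l p"
      by (intro bexI[of _ "{q \<in> U \<times> V. h q \<noteq> 0}"] CollectI exI[of _ U] exI[of _ V] exI[of _ h] conjI) auto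
  qed
  finally show ?thesis .
qed

lemma openin_prodE:
  assumes "openin (zariski (prod_space X Y)) W" "p \<in> W"
  obtains U V h where "openin (zariski X) U" "openin (zariski Y) V" "h \<in> tensors X Y U V"
        "p \<in> U \<times> V" "h p \<noteq> 0" "{q \<in> U \<times> V. h q \<noteq> 0} \<subseteq> W"
  using bspec[OF assms(1)[unfolded openin_prod_space] assms(2)] by (elim exE conjE)

lemma openin_prod_Times:
  assumes "openin (zariski X) U" "openin (zariski Y) V"
  shows "openin (zariski (prod_space X Y)) (U \<times> V)"
  unfolding openin_prod_space
  using assms tensors_const[OF X assms(1) Y assms(2), of 1]
  by (intro ballI exI[of _ U] exI[of _ V] exI[of _ "\<lambda>_. 1"]) auto

lemma points_prod_space: "points (prod_space X Y) = points X \<times> points Y"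
proof
  show "points X \<times> points Y \<subseteq> points (prod_space X Y)"
    using openin_prod_Times[OF openin_topspace openin_topspace] by (rule openin_subset)
  show "points (prod_space X Y) \<subseteq> points X \<times> points Y"
  proof
    fix p assume "p \<in> points (prod_space X Y)"
    then obtain U V where "openin (zariski X) U" "openin (zariski Y) V" "p \<in> U \<times> V"
      using openin_prodE[OF openin_topspace] by metis
    then show "p \<in> points X \<times> points Y" using openin_subset[of _ U] openin_subset[of _ V] by auto
  qed
qed

lemma mem_regular_prod_space:
  "F \<in> regular (prod_space X Y) W \<longleftrightarrow>
     (\<forall>p\<in>W. \<exists>U V. openin (zariski X) U \<and> openin (zariski Y) V \<and> p \<in> U \<times> V \<and>
        (\<exists>h\<in>tensors X Y U V. \<exists>k\<in>tensors X Y U V. h p \<noteq> 0 \<and>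
           (\<forall>q \<in> W \<inter> (U \<times> V). h q \<noteq> 0 \<longrightarrow> F q = k q / h q)))"
  by (simp add: prod_space_def)

lemma mem_regular_prodE:
  assumes "F \<in> regular (prod_space X Y) W" "p \<in> W"
  obtains U V h k where "openin (zariski X) U" "openin (zariski Y) V" "p \<in> U \<times> V"
    "h \<in> tensors X Y U V" "k \<in> tensors X Y U V" "h p \<noteq> 0"
    "\<forall>q. q \<in> W \<longrightarrow> q \<in> U \<times> V \<longrightarrow> h q \<noteq> 0 \<longrightarrow> F q = k q / h q"
  using bspec[OF assms(1)[unfolded mem_regular_prod_space] assms(2)]
  by (elim exE bexE conjE) (auto intro: that)

lemma mem_regular_prodI:
  assumes "\<And>p. p \<in> W \<Longrightarrow> \<exists>U V h k. openin (zariski X) U \<and> openin (zariski Y) V \<and> p \<in> U \<times> V \<and>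
     h \<in> tensors X Y U V \<and> k \<in> tensors X Y U V \<and> h p \<noteq> 0 \<and>
     (\<forall>q. q \<in> W \<longrightarrow> q \<in> U \<times> V \<longrightarrow> h q \<noteq> 0 \<longrightarrow> F q = k q / h q)"
  shows "F \<in> regular (prod_space X Y) W"
  unfolding mem_regular_prod_space
proof
  fix p assume "p \<in> W"
  from assms[OF this] obtain U V h k where 1: "openin (zariski X) U" "openin (zariski Y) V" "p \<in> U \<times> V"
    "h \<in> tensors X Y U V" "k \<in> tensors X Y U V" "h p \<noteq> 0"
    "\<forall>q. q \<in> W \<longrightarrow> q \<in> U \<times> V \<longrightarrow> h q \<noteq> 0 \<longrightarrow> F q = k q / h q" by blast
  show "\<exists>U V. openin (zariski X) U \<and> openin (zariski Y) V \<and> p \<in> U \<times> V \<and>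
        (\<exists>h\<in>tensors X Y U V. \<exists>k\<in>tensors X Y U V. h p \<noteq> 0 \<and>
           (\<forall>q \<in> W \<inter> (U \<times> V). h q \<noteq> 0 \<longrightarrow> F q = k q / h q))"
    by (rule exI[of _ U], rule exI[of _ V]) (use 1 in blast)
qed

text \<open>Two local descriptions of functions on the product come with different boxes; they are
  compared on the intersection, to which tensors restrict.\<close>

lemma tensors_common_box:
  assumes "openin (zariski X) U" "openin (zariski Y) V" "openin (zariski X) U'" "openin (zariski Y) V'"
  shows "openin (zariski X) (U \<inter> U')" "openin (zariski Y) (V \<inter> V')"
    "tensors X Y U V \<subseteq> tensors X Y (U \<inter> U') (V \<inter> V')"
    "tensors X Y U' V' \<subseteq> tensors X Y (U \<inter> U') (V \<inter> V')"
    "\<And>h k. h \<in> tensors X Y (U \<inter> U') (V \<inter> V') \<Longrightarrow> k \<in> tensors X Y (U \<inter> U') (V \<inter> V') \<Longrightarrow>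
       (\<lambda>p. h p * k p) \<in> tensors X Y (U \<inter> U') (V \<inter> V')"
proof -
  show 1: "openin (zariski X) (U \<inter> U')" and 2: "openin (zariski Y) (V \<inter> V')" using assms by auto
  show "tensors X Y U V \<subseteq> tensors X Y (U \<inter> U') (V \<inter> V')"
    "tensors X Y U' V' \<subseteq> tensors X Y (U \<inter> U') (V \<inter> V')"
    using tensors_mono[OF X _ Y _ _ 1 _ 2] assms by auto
  show "(\<lambda>p. h p * k p) \<in> tensors X Y (U \<inter> U') (V \<inter> V')"
    if "h \<in> tensors X Y (U \<inter> U') (V \<inter> V')" "k \<in> tensors X Y (U \<inter> U') (V \<inter> V')" for h k
    using tensors_mult[OF X 1 Y 2 that] .
qed

lemma local_fspace_prod: "local_fspace (prod_space X Y)"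
proof -
  let ?P = "prod_space X Y"
  have const: "(\<lambda>_. c) \<in> regular ?P W" if "openin (zariski ?P) W" for c W
  proof (rule mem_regular_prodI)
    fix p assume "p \<in> W"
    then have "p \<in> points X \<times> points Y" using that openin_subset points_prod_space by blast
    then show "\<exists>U V h k. openin (zariski X) U \<and> openin (zariski Y) V \<and> p \<in> U \<times> V \<and>
     h \<in> tensors X Y U V \<and> k \<in> tensors X Y U V \<and> h p \<noteq> 0 \<and>
     (\<forall>q. q \<in> W \<longrightarrow> q \<in> U \<times> V \<longrightarrow> h q \<noteq> 0 \<longrightarrow> c = k q / h q)"
      using tensors_const[OF X openin_topspace Y openin_topspace]
      by (intro exI[of _ "points X"] exI[of _ "points Y"] exI[of _ "\<lambda>_. 1"] exI[of _ "\<lambda>_. c"]) auto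
  qed
  have ring: "(\<lambda>x. F x + G x) \<in> regular ?P W" "(\<lambda>x. F x * G x) \<in> regular ?P W"
    if F: "F \<in> regular ?P W" and G: "G \<in> regular ?P W" for F G W
  proof -
    \<comment> \<open>One box and one denominator \<open>h\<close> serve both the sum (numerator
      \<open>k\<close>) and the product (numerator \<open>l\<close>), so the two descriptions are
      intersected only once.\<close>
    have "\<exists>U V h k l. openin (zariski X) U \<and> openin (zariski Y) V \<and> p \<in> U \<times> V \<and>
     h \<in> tensors X Y U V \<and> k \<in> tensors X Y U V \<and> l \<in> tensors X Y U V \<and> h p \<noteq> 0 \<and>
     (\<forall>q. q \<in> W \<longrightarrow> q \<in> U \<times> V \<longrightarrow> h q \<noteq> 0 \<longrightarrow> F q + G q = k q / h q \<and> F q * G q = l q / h q)"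
      if p: "p \<in> W" for p
    proof -
      obtain U V h k where 1: "openin (zariski X) U" "openin (zariski Y) V" "p \<in> U \<times> V"
        "h \<in> tensors X Y U V" "k \<in> tensors X Y U V" "h p \<noteq> 0"
        "\<forall>q. q \<in> W \<longrightarrow> q \<in> U \<times> V \<longrightarrow> h q \<noteq> 0 \<longrightarrow> F q = k q / h q" by (rule mem_regular_prodE[OF F p])
      obtain U' V' h' k' where 2: "openin (zariski X) U'" "openin (zariski Y) V'" "p \<in> U' \<times> V'"
        "h' \<in> tensors X Y U' V'" "k' \<in> tensors X Y U' V'" "h' p \<noteq> 0"
        "\<forall>q. q \<in> W \<longrightarrow> q \<in> U' \<times> V' \<longrightarrow> h' q \<noteq> 0 \<longrightarrow> G q = k' q / h' q" by (rule mem_regular_prodE[OF G p])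
      note box = tensors_common_box[OF 1(1,2) 2(1,2)]
      have "\<forall>q. q \<in> W \<longrightarrow> q \<in> (U \<inter> U') \<times> (V \<inter> V') \<longrightarrow> h q * h' q \<noteq> 0 \<longrightarrow>
        F q + G q = (k q * h' q + k' q * h q) / (h q * h' q) \<and> F q * G q = k q * k' q / (h q * h' q)"
        using 1(7) 2(7) by (auto simp: add_frac_eq)
      moreover have "(\<lambda>q. h q * h' q) \<in> tensors X Y (U \<inter> U') (V \<inter> V')"
        "(\<lambda>q. k q * h' q + k' q * h q) \<in> tensors X Y (U \<inter> U') (V \<inter> V')"
        "(\<lambda>q. k q * k' q) \<in> tensors X Y (U \<inter> U') (V \<inter> V')"
        using 1 2 box(3,4) by (intro tensors_add box(5); blast)+
      moreover have "p \<in> (U \<inter> U') \<times> (V \<inter> V')" "h p * h' p \<noteq> 0" using 1(3,6) 2(3,6) by auto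
      ultimately show ?thesis using box(1,2) by blast
    qed
    note ex = this
    show "(\<lambda>x. F x + G x) \<in> regular ?P W"
    proof (rule mem_regular_prodI)
      fix p assume "p \<in> W"
      from ex[OF this] obtain U V h l where "openin (zariski X) U \<and> openin (zariski Y) V \<and> p \<in> U \<times> V \<and>
        h \<in> tensors X Y U V \<and> l \<in> tensors X Y U V \<and> h p \<noteq> 0 \<and>
        (\<forall>q. q \<in> W \<longrightarrow> q \<in> U \<times> V \<longrightarrow> h q \<noteq> 0 \<longrightarrow> F q + G q = l q / h q)"
        apply (elim exE conjE)
        subgoal for U V h k l by (rule that[of U V h k]) simp
        done
      then show "\<exists>U V h k. openin (zariski X) U \<and> openin (zariski Y) V \<and> p \<in> U \<times> V \<and>
        h \<in> tensors X Y U V \<and> k \<in> tensors X Y U V \<and> h p \<noteq> 0 \<and>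
        (\<forall>q. q \<in> W \<longrightarrow> q \<in> U \<times> V \<longrightarrow> h q \<noteq> 0 \<longrightarrow> F q + G q = k q / h q)"
        by (intro exI)
    qed
    show "(\<lambda>x. F x * G x) \<in> regular ?P W"
    proof (rule mem_regular_prodI)
      fix p assume "p \<in> W"
      from ex[OF this] obtain U V h l where "openin (zariski X) U \<and> openin (zariski Y) V \<and> p \<in> U \<times> V \<and>
        h \<in> tensors X Y U V \<and> l \<in> tensors X Y U V \<and> h p \<noteq> 0 \<and>
        (\<forall>q. q \<in> W \<longrightarrow> q \<in> U \<times> V \<longrightarrow> h q \<noteq> 0 \<longrightarrow> F q * G q = l q / h q)"
        apply (elim exE conjE)
        subgoal for U V h k l by (rule that[of U V h l]) simp
        done
      then show "\<exists>U V h k. openin (zariski X) U \<and> openin (zariski Y) V \<and> p \<in> U \<times> V \<and>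
        h \<in> tensors X Y U V \<and> k \<in> tensors X Y U V \<and> h p \<noteq> 0 \<and>
        (\<forall>q. q \<in> W \<longrightarrow> q \<in> U \<times> V \<longrightarrow> h q \<noteq> 0 \<longrightarrow> F q * G q = k q / h q)"
        by (intro exI)
    qed
  qed
  have cong: "G \<in> regular ?P W" if "F \<in> regular ?P W" "\<forall>x\<in>W. G x = F x" for F G W
    using that unfolding mem_regular_prod_space by simp
  have mono: "F \<in> regular ?P W'" if F: "F \<in> regular ?P W" "W' \<subseteq> W" for F W W'
    by (rule mem_regular_prodI, rule mem_regular_prodE[OF F(1)]) (use F(2) in blast)+
  have glue: "F \<in> regular ?P (\<Union>\<U>)" if U: "\<forall>U\<in>\<U>. openin (zariski ?P) U \<and> F \<in> regular ?P U" for \<U> F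
  proof (rule mem_regular_prodI)
    fix p assume "p \<in> \<Union>\<U>"
    then obtain W where W: "W \<in> \<U>" "p \<in> W" by blast
    then have F: "F \<in> regular ?P W" and oW: "openin (zariski ?P) W" using U by auto
    obtain U V h k where 1: "openin (zariski X) U" "openin (zariski Y) V" "p \<in> U \<times> V"
        "h \<in> tensors X Y U V" "k \<in> tensors X Y U V" "h p \<noteq> 0"
        "\<forall>q. q \<in> W \<longrightarrow> q \<in> U \<times> V \<longrightarrow> h q \<noteq> 0 \<longrightarrow> F q = k q / h q" by (rule mem_regular_prodE[OF F W(2)])
    obtain U' V' h' where 2: "openin (zariski X) U'" "openin (zariski Y) V'" "h' \<in> tensors X Y U' V'"
       "p \<in> U' \<times> V'" "h' p \<noteq> 0" "{q \<in> U' \<times> V'. h' q \<noteq> 0} \<subseteq> W"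
      by (rule openin_prodE[OF oW W(2)])
    note box = tensors_common_box[OF 1(1,2) 2(1,2)]
    \<comment> \<open>The factor \<open>h'\<close> in the denominator confines the argument to
      \<open>W\<close>, the only member of the cover on which \<open>F = k / h\<close> is
      known.\<close>
    have "(\<lambda>q. h q * h' q) \<in> tensors X Y (U \<inter> U') (V \<inter> V')" "(\<lambda>q. k q * h' q) \<in> tensors X Y (U \<inter> U') (V \<inter> V')"
      using 1 2 box(3,4) by (intro box(5); blast)+
    moreover have "F q = k q * h' q / (h q * h' q)" if "q \<in> (U \<inter> U') \<times> (V \<inter> V')" "h q * h' q \<noteq> 0" for q
    proof -
      have "q \<in> U \<times> V" "q \<in> U' \<times> V'" "h q \<noteq> 0" "h' q \<noteq> 0" using that by auto
      then have "q \<in> W" using 2(6) by blast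
      then show ?thesis using 1(7) \<open>q \<in> U \<times> V\<close> \<open>h q \<noteq> 0\<close> \<open>h' q \<noteq> 0\<close> by auto
    qed
    moreover have "p \<in> (U \<inter> U') \<times> (V \<inter> V')" "h p * h' p \<noteq> 0" using 1(3,6) 2(4,5) by auto
    ultimately show "\<exists>U V h k. openin (zariski X) U \<and> openin (zariski Y) V \<and> p \<in> U \<times> V \<and>
     h \<in> tensors X Y U V \<and> k \<in> tensors X Y U V \<and> h p \<noteq> 0 \<and>
     (\<forall>q. q \<in> \<Union>\<U> \<longrightarrow> q \<in> U \<times> V \<longrightarrow> h q \<noteq> 0 \<longrightarrow> F q = k q / h q)"
      using box(1,2) by blast
  qed
  have op: "openin (zariski ?P) {x \<in> W. F x \<noteq> 0}" if oW: "openin (zariski ?P) W" and F: "F \<in> regular ?P W" for W F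
    unfolding openin_prod_space
  proof
    fix p assume p: "p \<in> {x \<in> W. F x \<noteq> 0}"
    then have pW: "p \<in> W" by simp
    obtain U V h k where 1: "openin (zariski X) U" "openin (zariski Y) V" "p \<in> U \<times> V"
        "h \<in> tensors X Y U V" "k \<in> tensors X Y U V" "h p \<noteq> 0"
        "\<forall>q. q \<in> W \<longrightarrow> q \<in> U \<times> V \<longrightarrow> h q \<noteq> 0 \<longrightarrow> F q = k q / h q" by (rule mem_regular_prodE[OF F pW])
    obtain U' V' h' where 2: "openin (zariski X) U'" "openin (zariski Y) V'" "h' \<in> tensors X Y U' V'"
       "p \<in> U' \<times> V'" "h' p \<noteq> 0" "{q \<in> U' \<times> V'. h' q \<noteq> 0} \<subseteq> W"
      by (rule openin_prodE[OF oW pW])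
    note box = tensors_common_box[OF 1(1,2) 2(1,2)]
    have "k p \<noteq> 0" using 1(3,6,7) p by auto
    then have "p \<in> (U \<inter> U') \<times> (V \<inter> V')" "h p * h' p * k p \<noteq> 0" using 1(3,6) 2(4,5) by auto
    \<comment> \<open>Here \<open>h\<close> makes the fraction valid, \<open>h'\<close> keeps the
      point in \<open>W\<close>, and \<open>k\<close> makes the value of \<open>F\<close>
      nonzero.\<close>
    moreover have "(\<lambda>q. h q * h' q * k q) \<in> tensors X Y (U \<inter> U') (V \<inter> V')"
      using 1 2 box(3,4) by (intro box(5); blast)
    moreover have "{q \<in> (U \<inter> U') \<times> (V \<inter> V'). h q * h' q * k q \<noteq> 0} \<subseteq> {x \<in> W. F x \<noteq> 0}"
    proof
      fix q assume q: "q \<in> {q \<in> (U \<inter> U') \<times> (V \<inter> V'). h q * h' q * k q \<noteq> 0}"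
      then have "q \<in> W" using 2(6) by auto
      moreover have "q \<in> U \<times> V" using q by auto
      ultimately show "q \<in> {x \<in> W. F x \<noteq> 0}" using 1(7) q by auto
    qed
    ultimately show "\<exists>U V h. openin (zariski X) U \<and> openin (zariski Y) V \<and> h \<in> tensors X Y U V \<and>
        p \<in> U \<times> V \<and> h p \<noteq> 0 \<and> {q \<in> U \<times> V. h q \<noteq> 0} \<subseteq> {x \<in> W. F x \<noteq> 0}"
      using box(1,2) by blast
  qed
  have inv: "(\<lambda>x. inverse (F x)) \<in> regular ?P {x \<in> W. F x \<noteq> 0}" if F: "F \<in> regular ?P W" for W F
  proof (rule mem_regular_prodI)
    fix p assume p: "p \<in> {x \<in> W. F x \<noteq> 0}"
    then have pW: "p \<in> W" by simp
    obtain U V h k where 1: "openin (zariski X) U" "openin (zariski Y) V" "p \<in> U \<times> V"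
        "h \<in> tensors X Y U V" "k \<in> tensors X Y U V" "h p \<noteq> 0"
        "\<forall>q. q \<in> W \<longrightarrow> q \<in> U \<times> V \<longrightarrow> h q \<noteq> 0 \<longrightarrow> F q = k q / h q" by (rule mem_regular_prodE[OF F pW])
    have "h p * k p \<noteq> 0" using 1(3,6,7) p by auto
    moreover have "(\<lambda>q. h q * k q) \<in> tensors X Y U V" "(\<lambda>q. h q * h q) \<in> tensors X Y U V"
      using 1(4,5) by (intro tensors_mult[OF X 1(1) Y 1(2)]; blast)+
    moreover have "\<forall>q. q \<in> {x \<in> W. F x \<noteq> 0} \<longrightarrow> q \<in> U \<times> V \<longrightarrow> h q * k q \<noteq> 0 \<longrightarrow>
        inverse (F q) = h q * h q / (h q * k q)"
      using 1(7) by auto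
    ultimately show "\<exists>U V h k. openin (zariski X) U \<and> openin (zariski Y) V \<and> p \<in> U \<times> V \<and>
     h \<in> tensors X Y U V \<and> k \<in> tensors X Y U V \<and> h p \<noteq> 0 \<and>
     (\<forall>q. q \<in> {x \<in> W. F x \<noteq> 0} \<longrightarrow> q \<in> U \<times> V \<longrightarrow> h q \<noteq> 0 \<longrightarrow> inverse (F q) = k q / h q)"
      using 1(1-3) by blast
  qed
  show ?thesis
    by (rule local_fspaceI) (rule const ring cong mono glue op inv; assumption)+
qed

lemma morphism_fst: "morphism (prod_space X Y) X fst"
  and morphism_snd: "morphism (prod_space X Y) Y snd"
proof -
  have "morphism (prod_space X Y) X fst \<and> morphism (prod_space X Y) Y snd"
  proof (intro conjI morphismI)
    fix U assume U: "openin (zariski X) U"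
    have eq: "{p \<in> points (prod_space X Y). fst p \<in> U} = U \<times> points Y"
      using openin_subset[OF U] by (auto simp: points_prod_space)
    show "openin (zariski (prod_space X Y)) {p \<in> points (prod_space X Y). fst p \<in> U}"
      unfolding eq using U by (intro openin_prod_Times) auto
    show "f \<circ> fst \<in> regular (prod_space X Y) {p \<in> points (prod_space X Y). fst p \<in> U}"
      if f: "f \<in> regular X U" for f
    proof (rule mem_regular_prodI)
      fix p assume p: "p \<in> {p \<in> points (prod_space X Y). fst p \<in> U}"
      have "(\<lambda>p. f (fst p) * (\<lambda>_. 1) (snd p)) \<in> tensors X Y U (points Y)"
        by (intro tensors_rank_one f fa_const[OF function_algebra_regular[OF Y]]) auto
      then show "\<exists>U' V h k. openin (zariski X) U' \<and> openin (zariski Y) V \<and> p \<in> U' \<times> V \<and>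
        h \<in> tensors X Y U' V \<and> k \<in> tensors X Y U' V \<and> h p \<noteq> 0 \<and>
        (\<forall>q. q \<in> {p \<in> points (prod_space X Y). fst p \<in> U} \<longrightarrow> q \<in> U' \<times> V \<longrightarrow> h q \<noteq> 0 \<longrightarrow> (f \<circ> fst) q = k q / h q)"
        using p U tensors_const[OF X U Y openin_topspace, of 1] unfolding eq
        by (intro exI[of _ U] exI[of _ "points Y"] exI[of _ "\<lambda>_. 1"] exI[of _ "\<lambda>p. f (fst p)"]) auto
    qed
  next
    fix V assume V: "openin (zariski Y) V"
    have eq: "{p \<in> points (prod_space X Y). snd p \<in> V} = points X \<times> V"
      using openin_subset[OF V] by (auto simp: points_prod_space)
    show "openin (zariski (prod_space X Y)) {p \<in> points (prod_space X Y). snd p \<in> V}"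
      unfolding eq using V by (intro openin_prod_Times) auto
    show "f \<circ> snd \<in> regular (prod_space X Y) {p \<in> points (prod_space X Y). snd p \<in> V}"
      if f: "f \<in> regular Y V" for f
    proof (rule mem_regular_prodI)
      fix p assume p: "p \<in> {p \<in> points (prod_space X Y). snd p \<in> V}"
      have "(\<lambda>p. (\<lambda>_. 1) (fst p) * f (snd p)) \<in> tensors X Y (points X) V"
        by (intro tensors_rank_one f fa_const[OF function_algebra_regular[OF X]]) auto
      then show "\<exists>U V' h k. openin (zariski X) U \<and> openin (zariski Y) V' \<and> p \<in> U \<times> V' \<and>
        h \<in> tensors X Y U V' \<and> k \<in> tensors X Y U V' \<and> h p \<noteq> 0 \<and>
        (\<forall>q. q \<in> {p \<in> points (prod_space X Y). snd p \<in> V} \<longrightarrow> q \<in> U \<times> V' \<longrightarrow> h q \<noteq> 0 \<longrightarrow> (f \<circ> snd) q = k q / h q)"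
        using p V tensors_const[OF X openin_topspace Y V, of 1] unfolding eq
        by (intro exI[of _ "points X"] exI[of _ V] exI[of _ "\<lambda>_. 1"] exI[of _ "\<lambda>p. f (snd p)"]) auto
    qed
  qed (auto simp: points_prod_space)
  then show "morphism (prod_space X Y) X fst" "morphism (prod_space X Y) Y snd" by auto
qed

text \<open>The universal property of the product. A tensor pulls back to a sum of products of
  regular functions on the intersection of two preimages, and everything on the product is built
  locally from tensors.\<close>

lemma morphism_pair:
  assumes W: "local_fspace W" and a: "morphism W X a" and b: "morphism W Y b"
  shows "morphism W (prod_space X Y) (\<lambda>w. (a w, b w))"
proof -
  have ten: "openin (zariski W) {w \<in> points W. a w \<in> U \<and> b w \<in> V} \<and>
      (\<lambda>w. h (a w, b w)) \<in> regular W {w \<in> points W. a w \<in> U \<and> b w \<in> V}"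
    if U: "openin (zariski X) U" and V: "openin (zariski Y) V" and h: "h \<in> tensors X Y U V" for U V h
  proof -
    let ?A = "{w \<in> points W. a w \<in> U}" and ?B = "{w \<in> points W. b w \<in> V}"
    have eq: "{w \<in> points W. a w \<in> U \<and> b w \<in> V} = ?A \<inter> ?B" by auto
    have A: "openin (zariski W) ?A" and B: "openin (zariski W) ?B"
      using morphismD(2)[OF a U] morphismD(2)[OF b V] by auto
    then have AB: "openin (zariski W) (?A \<inter> ?B)" by auto
    obtain m f g where h: "h = (\<lambda>p. \<Sum>i<m::nat. f i (fst p) * g i (snd p))"
      "\<forall>i<m. f i \<in> regular X U \<and> g i \<in> regular Y V" using h by (rule tensorsE)
    have "(\<lambda>w. f i (a w)) \<in> regular W (?A \<inter> ?B)" if "i < m" for i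
      using regular_mono[OF W A morphismD(3)[OF a U] AB] h(2) that by (auto simp: comp_def)
    moreover have "(\<lambda>w. g i (b w)) \<in> regular W (?A \<inter> ?B)" if "i < m" for i
      using regular_mono[OF W B morphismD(3)[OF b V] AB] h(2) that by (auto simp: comp_def)
    ultimately have "(\<lambda>w. h (a w, b w)) \<in> regular W (?A \<inter> ?B)"
      unfolding h(1) by (auto intro!: fa_sum[OF function_algebra_regular[OF W AB]]
          fa_mult[OF function_algebra_regular[OF W AB]])
    then show ?thesis unfolding eq using AB by simp
  qed
  have op: "openin (zariski W) {w \<in> points W. (a w, b w) \<in> N}" if N: "openin (zariski (prod_space X Y)) N" for N
  proof (subst openin_subopen, intro ballI)
    fix w assume w: "w \<in> {w \<in> points W. (a w, b w) \<in> N}"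
    then have wN: "(a w, b w) \<in> N" by simp
    obtain U V h where h: "openin (zariski X) U" "openin (zariski Y) V" "h \<in> tensors X Y U V"
      "(a w, b w) \<in> U \<times> V" "h (a w, b w) \<noteq> 0" "{q \<in> U \<times> V. h q \<noteq> 0} \<subseteq> N"
      by (rule openin_prodE[OF N wN])
    note t = ten[OF h(1-3)]
    show "\<exists>T. openin (zariski W) T \<and> w \<in> T \<and> T \<subseteq> {w \<in> points W. (a w, b w) \<in> N}"
      using openin_nonzero[OF W t[THEN conjunct1] t[THEN conjunct2]] w h(4-6)
      by (intro exI[of _ "{x \<in> {w \<in> points W. a w \<in> U \<and> b w \<in> V}. h (a x, b x) \<noteq> 0}"]) auto
  qed
  show ?thesis
  proof (rule morphismI)
    show "(a w, b w) \<in> points (prod_space X Y)" if "w \<in> points W" for w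
      using that morphismD(1)[OF a] morphismD(1)[OF b] by (simp add: points_prod_space)
    fix N assume N: "openin (zariski (prod_space X Y)) N"
    let ?I = "{w \<in> points W. (a w, b w) \<in> N}"
    show I: "openin (zariski W) ?I" by (rule op[OF N])
    show "F \<circ> (\<lambda>w. (a w, b w)) \<in> regular W ?I" if F: "F \<in> regular (prod_space X Y) N" for F
    proof (rule regular_local[OF W])
      fix w assume w: "w \<in> ?I"
      then have wN: "(a w, b w) \<in> N" by simp
      obtain U V h k where 1: "openin (zariski X) U" "openin (zariski Y) V" "(a w, b w) \<in> U \<times> V"
        "h \<in> tensors X Y U V" "k \<in> tensors X Y U V" "h (a w, b w) \<noteq> 0"
        "\<forall>q. q \<in> N \<longrightarrow> q \<in> U \<times> V \<longrightarrow> h q \<noteq> 0 \<longrightarrow> F q = k q / h q" by (rule mem_regular_prodE[OF F wN])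
      let ?T = "{w \<in> points W. a w \<in> U \<and> b w \<in> V} \<inter> ?I"
      have T: "openin (zariski W) ?T" using ten[OF 1(1,2,4)] I by auto
      have ht: "(\<lambda>w. h (a w, b w)) \<in> regular W ?T" "(\<lambda>w. k (a w, b w)) \<in> regular W ?T"
        using ten[OF 1(1,2,4)] ten[OF 1(1,2,5)] T by (auto intro: regular_mono[OF W])
      let ?S = "{w \<in> ?T. h (a w, b w) \<noteq> 0}"
      have S: "openin (zariski W) ?S" by (rule openin_nonzero[OF W T ht(1)])
      have "(\<lambda>w. k (a w, b w) / h (a w, b w)) \<in> regular W ?S"
        by (rule regular_divide[OF W S regular_mono[OF W T ht(1) S] regular_mono[OF W T ht(2) S]]) auto
      then have "F \<circ> (\<lambda>w. (a w, b w)) \<in> regular W ?S"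
        by (rule regular_cong[OF W S]) (use 1(7) in auto)
      then show "\<exists>S. openin (zariski W) S \<and> w \<in> S \<and> S \<subseteq> ?I \<and> F \<circ> (\<lambda>w. (a w, b w)) \<in> regular W S"
        using S w 1(3,6) by (intro exI[of _ ?S]) auto
    qed
  qed
qed

end

text \<open>A function that vanishes on the diagonal but not at \<open>(x, y)\<close> has an open
  nonzero locus which separates \<open>(x, y)\<close> from the diagonal. Separatedness is thereby
  reduced to exhibiting one regular function for each pair.\<close>

lemma closedin_diagonal:
  assumes X: "local_fspace X"
    and sep: "\<And>x y. x \<in> points X \<Longrightarrow> y \<in> points X \<Longrightarrow> x \<noteq> y \<Longrightarrow>
      \<exists>W F. openin (zariski (prod_space X X)) W \<and> (x, y) \<in> W \<and> F \<in> regular (prod_space X X) W \<and>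
        F (x, y) \<noteq> 0 \<and> (\<forall>z. (z, z) \<in> W \<longrightarrow> F (z, z) = 0)"
  shows "closedin (zariski (prod_space X X)) {(x, x) | x. x \<in> points X}"
  unfolding closedin_def
proof
  show "{(x, x) | x. x \<in> points X} \<subseteq> points (prod_space X X)" by (auto simp: points_prod_space[OF X X])
  show "openin (zariski (prod_space X X)) (points (prod_space X X) - {(x, x) | x. x \<in> points X})"
  proof (subst openin_subopen, intro ballI)
    fix p assume "p \<in> points (prod_space X X) - {(x, x) | x. x \<in> points X}"
    then obtain x y where xy: "p = (x, y)" "x \<in> points X" "y \<in> points X" "x \<noteq> y"
      by (auto simp: points_prod_space[OF X X])
    obtain W F where W: "openin (zariski (prod_space X X)) W" "(x, y) \<in> W" "F \<in> regular (prod_space X X) W"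
        "F (x, y) \<noteq> 0" "\<forall>z. (z, z) \<in> W \<longrightarrow> F (z, z) = 0" using sep[OF xy(2-4)] by blast
    have "openin (zariski (prod_space X X)) {q \<in> W. F q \<noteq> 0}"
      by (rule openin_nonzero[OF local_fspace_prod[OF X X] W(1,3)])
    then show "\<exists>T. openin (zariski (prod_space X X)) T \<and> p \<in> T \<and>
        T \<subseteq> points (prod_space X X) - {(x, x) | x. x \<in> points X}"
      using W xy openin_subset[OF W(1)] by (intro exI[of _ "{q \<in> W. F q \<noteq> 0}"]) auto
  qed
qed

section \<open>Special linear matrices\<close>

definition SLset :: "nat \<Rightarrow> complex mat set" where
  "SLset n = {A \<in> carrier_mat n n. det A = 1}"

lemma SL_simps [simp]:
  "carrier (SL n) = SLset n" "mult (SL n) = (*)" "one (SL n) = 1\<^sub>m n"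
  "underlying_variety (SL n) = induced_space {\<lambda>A. A $$ (i, j) | i j. i < n \<and> j < n} (SLset n)"
  by (simp_all add: SL_def SLset_def Let_def)

lemma SLset_carrier: "A \<in> SLset n \<Longrightarrow> A \<in> carrier_mat n n"
  and SLset_det: "A \<in> SLset n \<Longrightarrow> det A = 1"
  by (simp_all add: SLset_def)

lemma SLset_dim [simp]: "A \<in> SLset n \<Longrightarrow> dim_row A = n" "A \<in> SLset n \<Longrightarrow> dim_col A = n"
  by (auto simp: SLset_def)

lemma SLset_one [simp]: "1\<^sub>m n \<in> SLset n"
  by (simp add: SLset_def)

lemma SLset_mult [simp]: "A \<in> SLset n \<Longrightarrow> B \<in> SLset n \<Longrightarrow> A * B \<in> SLset n"
  by (auto simp: SLset_def det_mult)

text \<open>For determinant one the adjugate is the inverse. Inversion is thus polynomial in the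
  entries, and \<open>adj_mat\<close> is used as the inverse throughout.\<close>

lemma SLset_adj:
  assumes "A \<in> SLset n"
  shows "adj_mat A \<in> SLset n" "A * adj_mat A = 1\<^sub>m n" "adj_mat A * A = 1\<^sub>m n"
proof -
  have A: "A \<in> carrier_mat n n" "det A = 1" using assms by (auto simp: SLset_def)
  show 1: "A * adj_mat A = 1\<^sub>m n" and "adj_mat A * A = 1\<^sub>m n" using adj_mat[OF A(1)] A(2) by auto
  have "det A * det (adj_mat A) = 1" using det_mult[OF A(1) adj_mat(1)[OF A(1)]] 1 by simp
  then show "adj_mat A \<in> SLset n" using adj_mat(1)[OF A(1)] A(2) by (simp add: SLset_def)
qed

lemma SLset_assoc: "A \<in> SLset n \<Longrightarrow> B \<in> SLset n \<Longrightarrow> C \<in> SLset n \<Longrightarrow> A * B * C = A * (B * C)"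
  by (rule assoc_mult_mat[of _ n n _ n _ n]) (auto simp: SLset_def)

lemma SLset_one_mult [simp]: "A \<in> SLset n \<Longrightarrow> 1\<^sub>m n * A = A" "A \<in> SLset n \<Longrightarrow> A * 1\<^sub>m n = A"
  by (auto simp: SLset_def)

lemma SLset_cancel:
  assumes "A \<in> SLset n" "B \<in> SLset n"
  shows "adj_mat A * (A * B) = B" "A * (adj_mat A * B) = B" "B * A * adj_mat A = B" "B * adj_mat A * A = B"
  using assms SLset_adj[OF assms(1)] by (simp_all flip: SLset_assoc) (simp_all add: SLset_assoc)

lemma SLset_inverse_unique:
  assumes "A \<in> SLset n" "B \<in> SLset n" "A * B = 1\<^sub>m n"
  shows "B = adj_mat A"
  using SLset_cancel(1)[OF assms(1,2)] assms SLset_adj(1)[OF assms(1)] by simp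

lemma SLset_adj_mult:
  assumes "A \<in> SLset n" "B \<in> SLset n"
  shows "adj_mat (A * B) = adj_mat B * adj_mat A"
proof -
  have "A * B * (adj_mat B * adj_mat A) = 1\<^sub>m n"
    using assms SLset_adj[OF assms(1)] SLset_adj[OF assms(2)] SLset_cancel(2)[of B n "adj_mat A"]
    by (simp add: SLset_assoc)
  then show ?thesis
    using SLset_inverse_unique[of "A * B" n "adj_mat B * adj_mat A"] assms SLset_adj(1)[OF assms(1)] SLset_adj(1)[OF assms(2)]
    by simp
qed

lemma SLset_adj_adj: "A \<in> SLset n \<Longrightarrow> adj_mat (adj_mat A) = A"
  using SLset_inverse_unique[of "adj_mat A" n A] SLset_adj[of A n] by simp

lemma SLset_adj_one [simp]: "adj_mat (1\<^sub>m n :: complex mat) = 1\<^sub>m n"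
  using SLset_inverse_unique[of "1\<^sub>m n" n "1\<^sub>m n"] by simp

lemma inv_SL: "A \<in> SLset n \<Longrightarrow> inv\<^bsub>SL n\<^esub> A = adj_mat A"
  using group.inv_equality[OF group_SL[of n], of "adj_mat A" A] SLset_adj[of A n] by simp

lemma index_mult_sum:
  assumes "A \<in> carrier_mat m k" "B \<in> carrier_mat k l" "i < m" "j < l"
  shows "(A * B) $$ (i, j) = (\<Sum>a<k. A $$ (i, a) * B $$ (a, j))"
  using assms by (auto simp: scalar_prod_def lessThan_atLeast0 intro!: sum.cong)

section \<open>Leading minors, and signed row permutations that make them nonzero\<close>

definition leading :: "nat \<Rightarrow> complex mat \<Rightarrow> complex mat" where
  "leading k A = mat k k (\<lambda>(a, b). A $$ (a, b))"

lemma leading_carrier [simp]: "leading k A \<in> carrier_mat k k"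
  and leading_index: "a < k \<Longrightarrow> b < k \<Longrightarrow> leading k A $$ (a, b) = A $$ (a, b)"
  by (simp_all add: leading_def)

text \<open>Under either vanishing condition the summation index of the matrix product can be
  restricted to the first \<open>k\<close> values.\<close>

lemma leading_mult:
  assumes "A \<in> carrier_mat n n" "B \<in> carrier_mat n n" "k \<le> n"
    and "(\<forall>a<k. \<forall>b. k \<le> b \<longrightarrow> b < n \<longrightarrow> A $$ (a, b) = 0) \<or> (\<forall>b<k. \<forall>a. k \<le> a \<longrightarrow> a < n \<longrightarrow> B $$ (a, b) = 0)"
  shows "leading k (A * B) = leading k A * leading k B"
proof (rule eq_matI)
  fix i j assume "i < dim_row (leading k A * leading k B)" "j < dim_col (leading k A * leading k B)"
  then have ij: "i < k" "j < k" by (auto simp: leading_def)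
  have "leading k (A * B) $$ (i, j) = (\<Sum>a<n. A $$ (i, a) * B $$ (a, j))"
    using index_mult_sum[OF assms(1,2)] ij assms(3) by (simp add: leading_index)
  also have "\<dots> = (\<Sum>a<k. A $$ (i, a) * B $$ (a, j))"
    using assms(3,4) ij by (intro sum.mono_neutral_right) (auto simp: not_less)
  also have "\<dots> = (leading k A * leading k B) $$ (i, j)"
    using index_mult_sum[OF leading_carrier leading_carrier ij] ij by (simp add: leading_index)
  finally show "leading k (A * B) $$ (i, j) = (leading k A * leading k B) $$ (i, j)" .
qed (auto simp: leading_def)

lemma det_unitriangular:
  assumes "A \<in> carrier_mat n n" "\<And>i j. i < n \<Longrightarrow> j < n \<Longrightarrow> i \<le> j \<Longrightarrow> A $$ (i, j) = (if i = j then 1 else 0)"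
  shows "det A = (1 :: complex)"
proof -
  have "det A = prod_list (diag_mat A)"
    by (rule det_lower_triangular[of n]) (use assms in auto)
  also have "diag_mat A = map (\<lambda>_. 1) [0..<n]" using assms by (auto simp: diag_mat_def)
  also have "prod_list \<dots> = 1" by (induction n) auto
  finally show ?thesis .
qed

text \<open>Expansion along the last column yields a row \<open>i\<close> whose removal leaves a
  nonzero minor. By induction the remaining rows can be ordered so that their leading minors are
  nonzero, and row \<open>i\<close> is put last.\<close>

lemma exists_row_permutation:
  assumes "A \<in> carrier_mat n n" "det (A :: complex mat) \<noteq> 0"
  shows "\<exists>\<sigma>. \<sigma> permutes {0..<n} \<and> (\<forall>k\<le>n. det (mat k k (\<lambda>(a, b). A $$ (\<sigma> a, b))) \<noteq> 0)"
  using assms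
proof (induction n arbitrary: A)
  case 0
  then show ?case by (intro exI[of _ id]) (auto simp: permutes_id)
next
  case (Suc n)
  have "\<exists>i<Suc n. cofactor A i n \<noteq> 0"
  proof (rule ccontr)
    assume "\<not> (\<exists>i<Suc n. cofactor A i n \<noteq> 0)"
    then show False using laplace_expansion_column[OF Suc.prems(1), of n] Suc.prems(2) by simp
  qed
  then obtain i where i: "i < Suc n" "det (mat_delete A i n) \<noteq> 0" by (auto simp: cofactor_def)
  have D: "mat_delete A i n \<in> carrier_mat n n" using Suc.prems(1) mat_delete_carrier[of A "Suc n" "Suc n"] by simp
  from Suc.IH[OF D i(2)] obtain \<sigma> where \<sigma>: "\<sigma> permutes {0..<n}"
    "\<forall>k\<le>n. det (mat k k (\<lambda>(a, b). mat_delete A i n $$ (\<sigma> a, b))) \<noteq> 0" by blast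
  \<comment> \<open>This turns row numbers of \<open>mat_delete A i n\<close> into row numbers of
    \<open>A\<close>, skipping the deleted row \<open>i\<close>.\<close>
  let ?ins = "\<lambda>a. if a < i then a else Suc a"
  define \<tau> where "\<tau> a = (if a < n then ?ins (\<sigma> a) else if a = n then i else a)" for a
  have \<sigma>n: "\<sigma> a < n \<longleftrightarrow> a < n" for a using permutes_in_image[OF \<sigma>(1), of a] by simp
  have \<sigma>inj: "\<sigma> a = \<sigma> b \<Longrightarrow> a = b" for a b using permutes_inj[OF \<sigma>(1)] by (auto dest: injD)
  have inj: "inj_on \<tau> {0..<Suc n}"
  proof (rule inj_onI)
    fix a b assume ab: "a \<in> {0..<Suc n}" "b \<in> {0..<Suc n}" and eq: "\<tau> a = \<tau> b"
    have ins: "?ins s \<noteq> i" "?ins s = ?ins t \<Longrightarrow> s = t" for s t by (auto split: if_splits)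
    consider "a = n" "b = n" | "a < n" "b = n" | "a = n" "b < n" | "a < n" "b < n" using ab by force
    then show "a = b"
    proof cases
      case 4
      then show ?thesis using eq ins(2)[of "\<sigma> a" "\<sigma> b"] \<sigma>inj[of a b] by (simp add: \<tau>_def)
    next
      case 2
      then show ?thesis using eq ins(1)[of "\<sigma> a"] by (simp add: \<tau>_def)
    next
      case 3
      then show ?thesis using eq ins(1)[of "\<sigma> b"] by (simp add: \<tau>_def)
    qed simp
  qed
  have img: "\<tau> ` {0..<Suc n} \<subseteq> {0..<Suc n}"
  proof
    fix t assume "t \<in> \<tau> ` {0..<Suc n}"
    then obtain a where a: "a < Suc n" "t = \<tau> a" by auto
    show "t \<in> {0..<Suc n}"
    proof (cases "a < n")
      case True
      then have "\<sigma> a < n" using \<sigma>n by simp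
      then show ?thesis using a True by (simp add: \<tau>_def)
    next
      case False
      then show ?thesis using a i(1) by (simp add: \<tau>_def)
    qed
  qed
  have "bij_betw \<tau> {0..<Suc n} {0..<Suc n}"
    using inj img by (simp add: bij_betw_def endo_inj_surj)
  then have perm: "\<tau> permutes {0..<Suc n}" by (rule bij_imp_permutes) (auto simp: \<tau>_def)
  have small: "mat k k (\<lambda>(a, b). A $$ (\<tau> a, b)) = mat k k (\<lambda>(a, b). mat_delete A i n $$ (\<sigma> a, b))" if "k \<le> n" for k
    using that Suc.prems(1) \<sigma>n by (intro eq_matI) (auto simp: \<tau>_def mat_delete_def)
  have "det (mat k k (\<lambda>(a, b). A $$ (\<tau> a, b))) \<noteq> 0" if k: "k \<le> Suc n" for k
  proof (cases "k \<le> n")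
    case True then show ?thesis using small \<sigma>(2) by simp
  next
    case False
    then have "k = Suc n" using k by simp
    then show ?thesis using det_permute_rows[OF Suc.prems(1) perm] Suc.prems(2) by (simp add: sign_def)
  qed
  then show ?case using perm by blast
qed

text \<open>The first row carries the sign of the permutation, so that odd permutations also give
  determinant one.\<close>

definition row_permutation :: "nat \<Rightarrow> (nat \<Rightarrow> nat) \<Rightarrow> complex mat" where
  "row_permutation n \<sigma> = mat n n (\<lambda>(a, b). if b = \<sigma> a then (if a = 0 then signof \<sigma> else 1) else 0)"

lemma row_permutation_factor:
  "row_permutation n \<sigma> = mat n n (\<lambda>(a, b). if a = b then (if a = 0 then signof \<sigma> else 1) else 0) *
     mat n n (\<lambda>(a, b). 1\<^sub>m n $$ (\<sigma> a, b))" (is "_ = ?D * ?S") if "\<sigma> permutes {0..<n}"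
proof (rule eq_matI)
  fix i j assume "i < dim_row (?D * ?S)" "j < dim_col (?D * ?S)"
  then have ij: "i < n" "j < n" by auto
  have "\<sigma> i < n" using permutes_in_image[OF that, of i] ij by simp
  have "(?D * ?S) $$ (i, j) = (\<Sum>a<n. ?D $$ (i, a) * ?S $$ (a, j))"
    by (rule index_mult_sum) (use ij in auto)
  also have "\<dots> = (\<Sum>a<n. if a = i then ?D $$ (i, i) * ?S $$ (i, j) else 0)"
    using ij by (intro sum.cong) auto
  also have "\<dots> = row_permutation n \<sigma> $$ (i, j)"
    using ij \<open>\<sigma> i < n\<close> by (auto simp: row_permutation_def)
  finally show "row_permutation n \<sigma> $$ (i, j) = (?D * ?S) $$ (i, j)" by simp
qed (auto simp: row_permutation_def)

lemma det_sign_diag: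
  "det (mat k k (\<lambda>(a, b). if a = b then (if a = 0 then s else 1) else 0)) = (if k = 0 then 1 else s :: complex)"
proof -
  let ?D = "mat k k (\<lambda>(a, b). if a = b then (if a = 0 then s else 1) else 0)"
  have "det ?D = prod_list (diag_mat ?D)" by (rule det_lower_triangular[of k]) auto
  also have "diag_mat ?D = map (\<lambda>a. if a = 0 then s else 1) [0..<k]" by (auto simp: diag_mat_def)
  also have "prod_list \<dots> = (if k = 0 then 1 else s)" by (induction k) auto
  finally show ?thesis .
qed

lemma row_permutation_SL:
  assumes "\<sigma> permutes {0..<n}" "n \<ge> 1"
  shows "row_permutation n \<sigma> \<in> SLset n"
proof -
  have "signof \<sigma> * signof \<sigma> = (1::complex)" by (simp add: sign_def)
  then have "det (row_permutation n \<sigma>) = 1"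
    unfolding row_permutation_factor[OF assms(1)]
    using assms(2) det_permute_rows[OF one_carrier_mat assms(1), where 'a=complex]
    by (subst det_mult[of _ n]) (simp_all add: det_sign_diag)
  then show ?thesis by (simp add: SLset_def row_permutation_def)
qed

lemma leading_row_permutation:
  assumes "\<sigma> permutes {0..<n}" "A \<in> carrier_mat n n" "k \<le> n"
  shows "det (leading k (row_permutation n \<sigma> * A)) =
    (if k = 0 then 1 else signof \<sigma>) * det (mat k k (\<lambda>(a, b). A $$ (\<sigma> a, b)))"
proof -
  let ?D = "\<lambda>k. mat k k (\<lambda>(a, b). if a = b then (if a = 0 then signof \<sigma> else 1) else 0) :: complex mat"
  let ?S = "\<lambda>k. mat k k (\<lambda>(a, b). A $$ (\<sigma> a, b))"
  have "leading k (row_permutation n \<sigma> * A) = ?D k * ?S k"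
  proof (rule eq_matI)
    fix i j assume "i < dim_row (?D k * ?S k)" "j < dim_col (?D k * ?S k)"
    then have ij: "i < k" "j < k" by auto
    have "\<sigma> i < n" using permutes_in_image[OF assms(1), of i] ij assms(3) by simp
    have "leading k (row_permutation n \<sigma> * A) $$ (i, j) = (\<Sum>a<n. row_permutation n \<sigma> $$ (i, a) * A $$ (a, j))"
      using ij assms index_mult_sum[of "row_permutation n \<sigma>" n n A n i j]
      by (simp add: leading_index row_permutation_def)
    also have "\<dots> = (\<Sum>a<n. if a = \<sigma> i then (if i = 0 then signof \<sigma> else 1) * A $$ (a, j) else 0)"
      using ij assms by (intro sum.cong) (auto simp: row_permutation_def)
    also have "\<dots> = (if i = 0 then signof \<sigma> else 1) * A $$ (\<sigma> i, j)" using \<open>\<sigma> i < n\<close> by simp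
    also have "\<dots> = (\<Sum>a<k. if a = i then ?D k $$ (i, i) * ?S k $$ (i, j) else 0)" using ij by simp
    also have "\<dots> = (\<Sum>a<k. ?D k $$ (i, a) * ?S k $$ (a, j))" using ij by (intro sum.cong) auto
    also have "\<dots> = (?D k * ?S k) $$ (i, j)" by (rule index_mult_sum[symmetric]) (use ij in auto)
    finally show "leading k (row_permutation n \<sigma> * A) $$ (i, j) = (?D k * ?S k) $$ (i, j)" .
  qed (auto simp: leading_def)
  then show ?thesis by (simp add: det_mult[of "?D k" k "?S k"] det_sign_diag)
qed

section \<open>Block triangular subgroups and their big cells\<close>

text \<open>For a preorder \<open>R\<close> containing \<open>\<le>\<close> this is a standard
  parabolic subgroup of block upper triangular matrices; \<open>\<le>\<close> itself gives the
  standard Borel subgroup.\<close>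

definition pattern_group :: "nat \<Rightarrow> (nat \<Rightarrow> nat \<Rightarrow> bool) \<Rightarrow> complex mat set" where
  "pattern_group n R = {h \<in> SLset n. \<forall>i<n. \<forall>j<n. \<not> R i j \<longrightarrow> h $$ (i, j) = 0}"

lemma pattern_group_mult:
  assumes R: "\<And>i j k. i < n \<Longrightarrow> j < n \<Longrightarrow> k < n \<Longrightarrow> R i j \<Longrightarrow> R j k \<Longrightarrow> R i k"
    and g: "g \<in> pattern_group n R" and h: "h \<in> pattern_group n R"
  shows "g * h \<in> pattern_group n R"
proof -
  have "(g * h) $$ (i, j) = 0" if ij: "i < n" "j < n" "\<not> R i j" for i j
  proof -
    have "(g * h) $$ (i, j) = (\<Sum>a<n. g $$ (i, a) * h $$ (a, j))"
      using g h ij by (intro index_mult_sum) (auto simp: pattern_group_def SLset_carrier)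
    also have "\<dots> = 0"
    proof (intro sum.neutral ballI)
      fix a assume a: "a \<in> {..<n}"
      have "\<not> R i a \<or> \<not> R a j" using R[of i a j] ij a by auto
      then show "g $$ (i, a) * h $$ (a, j) = 0" using g h ij a by (auto simp: pattern_group_def)
    qed
    finally show ?thesis .
  qed
  then show ?thesis using g h by (auto simp: pattern_group_def)
qed

text \<open>Closure under inverses is an assumption because in the application the pattern group is
  known to equal a given subgroup, which provides it at once.\<close>

locale pattern =
  fixes n :: nat and R :: "nat \<Rightarrow> nat \<Rightarrow> bool"
  assumes n: "n \<ge> 1"
    and R_le: "\<And>i j. i \<le> j \<Longrightarrow> j < n \<Longrightarrow> R i j"
    and R_trans: "\<And>i j k. i < n \<Longrightarrow> j < n \<Longrightarrow> k < n \<Longrightarrow> R i j \<Longrightarrow> R j k \<Longrightarrow> R i k"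
    and P_adj: "\<And>h. h \<in> pattern_group n R \<Longrightarrow> adj_mat h \<in> pattern_group n R"
begin

abbreviation "P \<equiv> pattern_group n R"

lemma P_SL: "h \<in> P \<Longrightarrow> h \<in> SLset n" by (simp add: pattern_group_def)

lemma P_zero: "h \<in> P \<Longrightarrow> i < n \<Longrightarrow> j < n \<Longrightarrow> \<not> R i j \<Longrightarrow> h $$ (i, j) = 0"
  by (simp add: pattern_group_def)

lemma P_one [simp]: "1\<^sub>m n \<in> P"
  using R_le by (auto simp: pattern_group_def)

lemma P_mult: "g \<in> P \<Longrightarrow> h \<in> P \<Longrightarrow> g * h \<in> P"
  by (rule pattern_group_mult[OF R_trans])

definition kap :: "nat \<Rightarrow> nat" where "kap j = (LEAST k. \<forall>i<n. R i j \<longrightarrow> i < k)"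

text \<open>Each column of \<open>R\<close> is an initial segment: \<open>i \<le> i'\<close> gives
  \<open>R i i'\<close>, and transitivity passes from \<open>R i' j\<close> to \<open>R i j\<close>.
  Its length \<open>kap j\<close> is the index just after the diagonal block that contains
  \<open>j\<close>.\<close>

lemma kap:
  assumes "j < n"
  shows "i < n \<Longrightarrow> R i j \<longleftrightarrow> i < kap j" "kap j \<le> n" "j < kap j"
proof -
  have P: "\<forall>i<n. R i j \<longrightarrow> i < kap j" unfolding kap_def by (rule LeastI[of _ n]) auto
  show "kap j \<le> n" unfolding kap_def by (rule Least_le) auto
  show "j < kap j" using P assms R_le by blast
  show "R i j \<longleftrightarrow> i < kap j" if "i < n" for i
  proof
    assume "i < kap j"
    then have "\<not> (\<forall>i'<n. R i' j \<longrightarrow> i' < i)" using not_less_Least unfolding kap_def by blast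
    then obtain i' where "i' < n" "R i' j" "i \<le> i'" by auto
    then show "R i j" using R_le[of i i'] R_trans[of i i' j] that assms by blast
  qed (use P that in blast)
qed

text \<open>The big cell, the product of \<open>cell\<close> and \<open>P\<close>, described by
  minors so that its openness is visible.\<close>

definition big :: "complex mat set" where
  "big = {x \<in> SLset n. \<forall>j<n. det (leading (kap j) x) \<noteq> 0}"

text \<open>The unipotent radical of the opposite parabolic. Its free entries sit at the positions
  outside \<open>R\<close> and serve as coordinates of the quotient.\<close>

definition cell :: "complex mat set" where
  "cell = {A \<in> carrier_mat n n. \<forall>i<n. \<forall>j<n. R i j \<longrightarrow> A $$ (i, j) = (if i = j then 1 else 0)}"

text \<open>Cramer's rule: column \<open>j\<close> solves the linear system of the leading block of
  size \<open>kap j\<close> with a unit vector on the right, which forces the entries of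
  \<open>x * rfac x\<close> at the positions in \<open>R\<close>. It is the inverse of the
  \<open>P\<close>-factor of \<open>x\<close>.\<close>

definition rfac :: "complex mat \<Rightarrow> complex mat" where
  "rfac x = mat n n (\<lambda>(l, j). if l < kap j
     then adj_mat (leading (kap j) x) $$ (l, j) / det (leading (kap j) x) else 0)"

definition ufac :: "complex mat \<Rightarrow> complex mat" where "ufac x = x * rfac x"

lemma big_SL: "x \<in> big \<Longrightarrow> x \<in> SLset n" by (simp add: big_def)

lemma cell_carrier: "A \<in> cell \<Longrightarrow> A \<in> carrier_mat n n" by (simp add: cell_def)

lemma cell_index: "A \<in> cell \<Longrightarrow> i < n \<Longrightarrow> j < n \<Longrightarrow> R i j \<Longrightarrow> A $$ (i, j) = (if i = j then 1 else 0)"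
  by (simp add: cell_def)

lemma cell_SL: "A \<in> cell \<Longrightarrow> A \<in> SLset n"
  using det_unitriangular[of A n] cell_index[of A] R_le by (auto simp: SLset_def cell_carrier)

lemma one_cell [simp]: "1\<^sub>m n \<in> cell" by (simp add: cell_def)

lemma cell_big:
  assumes "A \<in> cell"
  shows "A \<in> big"
proof -
  have "det (leading (kap j) A) = 1" if j: "j < n" for j
  proof (rule det_unitriangular[OF leading_carrier])
    fix i k assume "i < kap j" "k < kap j" "i \<le> k"
    then show "leading (kap j) A $$ (i, k) = (if i = k then 1 else 0)"
      using kap(2)[OF j] cell_index[OF assms, of i k] R_le[of i k] by (simp add: leading_index)
  qed
  then show ?thesis using cell_SL[OF assms] by (simp add: big_def)
qed

lemma ufac_index:
  assumes x: "x \<in> big" and ij: "i < n" "j < n" "R i j"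
  shows "ufac x $$ (i, j) = (if i = j then 1 else 0)"
proof -
  let ?k = "kap j" let ?L = "leading (kap j) x"
  have ik: "i < ?k" using kap(1)[OF ij(2)] ij by blast
  have xc: "x \<in> carrier_mat n n" using x by (simp add: big_SL SLset_carrier)
  have d: "det ?L \<noteq> 0" using x ij by (simp add: big_def)
  have "ufac x $$ (i, j) = (\<Sum>a<n. x $$ (i, a) * rfac x $$ (a, j))"
    unfolding ufac_def by (rule index_mult_sum[OF xc _ ij(1,2)]) (simp add: rfac_def)
  also have "\<dots> = (\<Sum>a<?k. x $$ (i, a) * (adj_mat ?L $$ (a, j) / det ?L))"
    using kap(2)[OF ij(2)] ij by (intro sum.mono_neutral_cong_right) (auto simp: rfac_def)
  also have "\<dots> = (\<Sum>a<?k. ?L $$ (i, a) * adj_mat ?L $$ (a, j)) / det ?L"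
    using ik by (simp add: sum_divide_distrib leading_index)
  also have "(\<Sum>a<?k. ?L $$ (i, a) * adj_mat ?L $$ (a, j)) = (?L * adj_mat ?L) $$ (i, j)"
    using ik kap(3)[OF ij(2)] by (intro index_mult_sum[symmetric]) (auto intro: adj_mat(1))
  also have "\<dots> = det ?L * (if i = j then 1 else 0)"
    using adj_mat(2)[OF leading_carrier] ik kap(3)[OF ij(2)] by simp
  finally show ?thesis using d by simp
qed

lemma rfac_carrier: "rfac x \<in> carrier_mat n n" by (simp add: rfac_def)

lemma ufac_cell: "x \<in> big \<Longrightarrow> ufac x \<in> cell"
  using ufac_index[of x] mult_carrier_mat[OF SLset_carrier[OF big_SL[of x]] rfac_carrier[of x]]
  by (auto simp: cell_def ufac_def)

text \<open>The determinant comes from the other factor: \<open>x * rfac x\<close> lies in the cell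
  and is therefore unitriangular.\<close>

lemma rfac_P:
  assumes x: "x \<in> big"
  shows "rfac x \<in> P"
proof -
  have "det x * det (rfac x) = 1"
    using SLset_det[OF cell_SL[OF ufac_cell[OF x]]] det_mult[OF SLset_carrier[OF big_SL[OF x]] rfac_carrier]
    by (simp add: ufac_def)
  then have "rfac x \<in> SLset n" using SLset_det[OF big_SL[OF x]] rfac_carrier by (simp add: SLset_def)
  moreover have "rfac x $$ (i, j) = 0" if "i < n" "j < n" "\<not> R i j" for i j
    using that kap(1)[of j i] by (simp add: rfac_def)
  ultimately show ?thesis by (simp add: pattern_group_def)
qed

text \<open>Each coset of \<open>P\<close> meets the cell at most once, by forward substitution: as
  \<open>A\<close> is lower unitriangular, the entries of \<open>q\<close> at positions in
  \<open>R\<close> are determined row by row from the top, and the others vanish anyway.\<close>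

lemma cell_unique:
  assumes A: "A \<in> cell" and q: "q \<in> P" and Aq: "A * q \<in> cell"
  shows "q = 1\<^sub>m n"
proof -
  have qc: "q \<in> carrier_mat n n" using P_SL[OF q] SLset_carrier by blast
  have *: "q $$ (i, j) = (if i = j then 1 else 0)" if "i < n" "j < n" "R i j" for i j
    using that
  proof (induction i rule: less_induct)
    case (less i)
    have "(if i = j then 1 else 0) = (\<Sum>l<n. A $$ (i, l) * q $$ (l, j))"
      using cell_index[OF Aq] index_mult_sum[OF cell_carrier[OF A] qc] less.prems by metis
    also have "\<dots> = (\<Sum>l<n. if l = i then q $$ (i, j) else 0)"
    proof (intro sum.cong refl)
      fix l assume "l \<in> {..<n}"
      then have l: "l < n" by simp
      show "A $$ (i, l) * q $$ (l, j) = (if l = i then q $$ (i, j) else 0)"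
      proof (cases "R i l")
        case True
        then show ?thesis using cell_index[OF A _ l] less.prems by auto
      next
        case False
        then have li: "l < i" using R_le[of i l] l by force
        then have Rlj: "R l j" using R_le[of l i] R_trans[of l i j] less.prems l by auto
        have "l \<noteq> j" using False less.prems by auto
        then show ?thesis using less.IH[OF li l less.prems(2) Rlj] li by simp
      qed
    qed
    also have "\<dots> = q $$ (i, j)" using less.prems by simp
    finally show ?case by simp
  qed
  show ?thesis
  proof (rule eq_matI)
    show "q $$ (i, j) = 1\<^sub>m n $$ (i, j)" if "i < dim_row (1\<^sub>m n)" "j < dim_col (1\<^sub>m n)" for i j
      using that *[of i j] P_zero[OF q, of i j] R_le[of i j] by (cases "R i j") auto
  qed (use qc in auto)
qed

text \<open>Elements of \<open>P\<close> are block upper triangular, so the leading minors at the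
  block ends are multiplicative; those of \<open>q\<close> cannot vanish because \<open>q\<close>
  has an inverse in \<open>P\<close>.\<close>

lemma big_mult:
  assumes x: "x \<in> big" and q: "q \<in> P"
  shows "x * q \<in> big"
proof -
  have lead: "det (leading (kap j) (y * p)) = det (leading (kap j) y) * det (leading (kap j) p)"
    if "y \<in> SLset n" "p \<in> P" "j < n" for y p j
  proof -
    have "p $$ (a, b) = 0" if ab: "b < kap j" "kap j \<le> a" "a < n" for a b
    proof -
      have bn: "b < n" using ab by simp
      have "R b j" using kap(1)[OF \<open>j < n\<close> bn] ab by simp
      then have "\<not> R a b" using R_trans[of a b j] kap(1)[OF \<open>j < n\<close> ab(3)] ab bn \<open>j < n\<close> by auto
      then show ?thesis using P_zero[OF \<open>p \<in> P\<close>] ab by simp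
    qed
    then have "leading (kap j) (y * p) = leading (kap j) y * leading (kap j) p"
      using kap(2)[OF \<open>j < n\<close>] that by (intro leading_mult[of _ n]) (auto simp: SLset_carrier P_SL)
    then show ?thesis by (simp add: det_mult[OF leading_carrier leading_carrier])
  qed
  have "det (leading (kap j) q) \<noteq> 0" if j: "j < n" for j
  proof -
    have "det (leading (kap j) (adj_mat q)) * det (leading (kap j) q) = det (leading (kap j) (1\<^sub>m n))"
      using lead[OF P_SL[OF P_adj[OF q]] q j] SLset_adj(3)[OF P_SL[OF q]] by simp
    moreover have "1\<^sub>m n \<in> big" by (rule cell_big) simp
    ultimately show ?thesis using j by (auto simp: big_def)
  qed
  then show ?thesis using lead[OF big_SL[OF x] q] x q by (auto simp: big_def P_SL)
qed

text \<open>\<open>ufac x\<close> and \<open>ufac (x * q)\<close> are two cell elements of the same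
  coset, so \<open>cell_unique\<close> applies. This makes \<open>ufac\<close> a function on the
  quotient.\<close>

lemma ufac_mult:
  assumes x: "x \<in> big" and q: "q \<in> P"
  shows "ufac (x * q) = ufac x"
proof -
  note xq = big_mult[OF x q]
  note sl = big_SL[OF x] P_SL[OF q] P_SL[OF rfac_P[OF x]] P_SL[OF rfac_P[OF xq]]
  let ?q = "adj_mat (rfac x) * (q * rfac (x * q))"
  have "ufac x * ?q = ufac (x * q)"
    unfolding ufac_def using sl SLset_adj(1)[OF sl(3)]
    by (simp add: SLset_assoc SLset_cancel)
  moreover have "?q \<in> P" by (intro P_mult P_adj rfac_P x xq q)
  ultimately have "?q = 1\<^sub>m n" using cell_unique[OF ufac_cell[OF x]] ufac_cell[OF xq] by metis
  then show ?thesis using \<open>ufac x * ?q = ufac (x * q)\<close> cell_SL[OF ufac_cell[OF x]] by simp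
qed

lemma ufac_of_cell: "A \<in> cell \<Longrightarrow> ufac A = A"
  using cell_unique[of A "rfac A"] rfac_P[OF cell_big] ufac_cell[OF cell_big] cell_SL[of A]
  by (simp add: ufac_def)

lemma ufac_rfac: "x \<in> big \<Longrightarrow> x = ufac x * adj_mat (rfac x)"
  unfolding ufac_def using SLset_cancel(3)[OF P_SL[OF rfac_P] big_SL] by simp

text \<open>The definition of a variety asks for a finite affine cover; the translates of the big
  cell by the finitely many signed permutation matrices provide it.\<close>

lemma big_cover:
  assumes x: "x \<in> SLset n"
  shows "\<exists>\<sigma>. \<sigma> permutes {0..<n} \<and> row_permutation n \<sigma> * x \<in> big"
proof -
  obtain \<sigma> where \<sigma>: "\<sigma> permutes {0..<n}" "\<forall>k\<le>n. det (mat k k (\<lambda>(a, b). x $$ (\<sigma> a, b))) \<noteq> 0"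
    using exists_row_permutation[OF SLset_carrier[OF x]] SLset_det[OF x] by auto
  have "det (leading (kap j) (row_permutation n \<sigma> * x)) \<noteq> 0" if "j < n" for j
    using leading_row_permutation[OF \<sigma>(1) SLset_carrier[OF x] kap(2)[OF that]] \<sigma>(2) kap(2)[OF that]
    by (simp add: sign_def)
  then show ?thesis using \<sigma>(1) row_permutation_SL[OF \<sigma>(1) n] x by (auto simp: big_def)
qed

lemma regular_rfac:
  assumes W: "local_fspace W" and U: "openin (zariski W) U"
    and M: "mat_entries U (regular W U) n n M" and big: "\<And>w. w \<in> U \<Longrightarrow> M w \<in> big"
  shows "mat_entries U (regular W U) n n (\<lambda>w. rfac (M w))"
    and "mat_entries U (regular W U) n n (\<lambda>w. ufac (M w))"
proof -
  note fa = function_algebra_regular[OF W U]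
  show 1: "mat_entries U (regular W U) n n (\<lambda>w. rfac (M w))"
    unfolding rfac_def
  proof (rule mat_entries_mat[OF fa])
    fix i j assume ij: "i < n" "j < n"
    have L: "mat_entries U (regular W U) (kap j) (kap j) (\<lambda>w. leading (kap j) (M w))"
      unfolding leading_def using kap(2)[OF ij(2)] mat_entriesD[OF fa M]
      by (intro mat_entries_mat[OF fa]) auto
    have "(\<lambda>w. adj_mat (leading (kap j) (M w)) $$ (i, j) / det (leading (kap j) (M w))) \<in> regular W U"
      if "i < kap j"
      using ij big kap(3)[OF ij(2)] that
      by (intro regular_divide[OF W U] fa_det[OF fa L] mat_entriesD[OF fa mat_entries_adj[OF fa L]])
        (auto simp: big_def)
    then show "(\<lambda>w. (\<lambda>(l, j). if l < kap j then adj_mat (leading (kap j) (M w)) $$ (l, j) / det (leading (kap j) (M w)) else 0) (i, j)) \<in> regular W U"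
      using fa_const[OF fa] by (cases "i < kap j") simp_all
  qed
  show "mat_entries U (regular W U) n n (\<lambda>w. ufac (M w))"
    unfolding ufac_def by (rule mat_entries_mult[OF fa M 1])
qed

section \<open>The modular character\<close>

text \<open>A position \<open>(i, j)\<close> is coded by \<open>i * n + j\<close>, so the increasing
  list runs through the positions row by row. Within a fixed column the order is therefore the order
  of the rows, which the triangularity argument for \<open>Ad\<close> uses.\<close>

definition plist :: "nat list" where
  "plist = sorted_list_of_set {t. t < n * n \<and> \<not> R (t div n) (t mod n)}"

definition N :: nat where "N = length plist"
definition ei :: "nat \<Rightarrow> nat" where "ei b = plist ! b div n"
definition ej :: "nat \<Rightarrow> nat" where "ej b = plist ! b mod n"

lemma e_range:
  assumes "b < N"
  shows "ei b < n" "ej b < n" "\<not> R (ei b) (ej b)"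
proof -
  have "plist ! b \<in> set plist" using assms by (simp add: N_def)
  then have "plist ! b < n * n \<and> \<not> R (plist ! b div n) (plist ! b mod n)" by (simp add: plist_def)
  then show "ei b < n" "ej b < n" "\<not> R (ei b) (ej b)"
    using n by (auto simp: ei_def ej_def less_mult_imp_div_less)
qed

lemma e_surj:
  assumes "i < n" "j < n" "\<not> R i j"
  obtains b where "b < N" "ei b = i" "ej b = j"
proof -
  have "i * n + j < Suc i * n" using assms(2) by simp
  also have "\<dots> \<le> n * n" using assms(1) by (intro mult_right_mono) auto
  finally have "i * n + j < n * n" .
  moreover have dm: "(i * n + j) div n = i" "(i * n + j) mod n = j" using assms by auto
  ultimately have "i * n + j \<in> set plist" using assms by (simp add: plist_def)
  then obtain b where "b < N" "plist ! b = i * n + j" by (auto simp: in_set_conv_nth N_def)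
  then show ?thesis using that assms by (simp add: ei_def ej_def)
qed

lemma e_less: "b < c \<Longrightarrow> c < N \<Longrightarrow> plist ! b < plist ! c"
  using strict_sorted_list_of_set[of "{t. t < n * n \<and> \<not> R (t div n) (t mod n)}"]
  unfolding plist_def[symmetric] N_def by (simp add: sorted_wrt_nth_less)

lemma e_inj: "b < N \<Longrightarrow> c < N \<Longrightarrow> ei b = ei c \<Longrightarrow> ej b = ej c \<Longrightarrow> b = c"
  using e_less[of b c] e_less[of c b] unfolding ei_def ej_def
  by (metis div_mult_mod_eq less_irrefl linorder_neqE_nat)

lemma e_bij: "bij_betw (\<lambda>b. (ei b, ej b)) {..<N} {(i, j). i < n \<and> j < n \<and> \<not> R i j}"
  unfolding bij_betw_def
proof
  show "inj_on (\<lambda>b. (ei b, ej b)) {..<N}" using e_inj by (auto intro!: inj_onI)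
  show "(\<lambda>b. (ei b, ej b)) ` {..<N} = {(i, j). i < n \<and> j < n \<and> \<not> R i j}"
    using e_range by (auto simp: image_iff) (metis e_surj lessThan_iff)
qed

text \<open>The hypothesis expresses that the directions along the Lie algebra of \<open>P\<close>
  do not contribute; the remaining positions are exactly the chart coordinates.\<close>

lemma sum_pairs:
  fixes F :: "nat \<Rightarrow> nat \<Rightarrow> complex"
  assumes "\<And>i j. i < n \<Longrightarrow> j < n \<Longrightarrow> R i j \<Longrightarrow> F i j = 0"
  shows "(\<Sum>b<N. F (ei b) (ej b)) = (\<Sum>i<n. \<Sum>j<n. F i j)"
proof -
  have "(\<Sum>b<N. F (ei b) (ej b)) = (\<Sum>(i, j)\<in>{(i, j). i < n \<and> j < n \<and> \<not> R i j}. F i j)"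
    using sum.reindex_bij_betw[OF e_bij, of "\<lambda>(i, j). F i j"] by simp
  also have "\<dots> = (\<Sum>(i, j)\<in>{..<n} \<times> {..<n}. F i j)"
    using assms by (intro sum.mono_neutral_left) auto
  finally show ?thesis by (simp add: sum.cartesian_product)
qed

text \<open>The matrix of \<open>y \<mapsto> a * y * q\<close> on the matrix units outside
  \<open>R\<close>, that is, modulo the Lie algebra of \<open>P\<close>. The arguments are
  independent because a change of chart multiplies by unrelated matrices on the two sides.\<close>

definition Ad :: "complex mat \<Rightarrow> complex mat \<Rightarrow> complex mat" where
  "Ad a q = mat N N (\<lambda>(b, c). a $$ (ei b, ei c) * q $$ (ej c, ej b))"

text \<open>The determinant of the adjoint action on \<open>Lie G / Lie P\<close>, with the matrix units \<open>e\<^sub>i\<^sub>j\<close>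
  (not \<open>R i j\<close>) as basis.\<close>

definition chi :: "complex mat \<Rightarrow> complex" where "chi q = det (Ad (adj_mat q) q)"

lemma Ad_carrier [simp]: "Ad a q \<in> carrier_mat N N" by (simp add: Ad_def)

text \<open>Composing the two maps modulo the Lie algebra loses nothing: if \<open>R s t\<close>,
  then \<open>R (ei b) s\<close> and \<open>R t (ej b)\<close> cannot both hold, since transitivity
  would put \<open>(ei b, ej b)\<close> into \<open>R\<close>. So one of the two factors from
  \<open>q\<close> vanishes there.\<close>

lemma chi_mult:
  assumes p: "p \<in> P" and q: "q \<in> P"
  shows "chi (p * q) = chi p * chi q"
proof -
  note pa = P_adj[OF p] and qa = P_adj[OF q]
  note c = SLset_carrier[OF P_SL[OF p]] SLset_carrier[OF P_SL[OF q]]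
    SLset_carrier[OF P_SL[OF pa]] SLset_carrier[OF P_SL[OF qa]]
  have "Ad (adj_mat (p * q)) (p * q) = Ad (adj_mat q) q * Ad (adj_mat p) p"
  proof (rule eq_matI)
    fix b d assume "b < dim_row (Ad (adj_mat q) q * Ad (adj_mat p) p)" "d < dim_col (Ad (adj_mat q) q * Ad (adj_mat p) p)"
    then have bd: "b < N" "d < N" by (auto simp: Ad_def)
    note eb = e_range[OF bd(1)] and ed = e_range[OF bd(2)]
    let ?F = "\<lambda>s t. (adj_mat q $$ (ei b, s) * q $$ (t, ej b)) * (adj_mat p $$ (s, ei d) * p $$ (ej d, t))"
    have "?F s t = 0" if st: "s < n" "t < n" "R s t" for s t
    proof -
      have "\<not> R (ei b) s \<or> \<not> R t (ej b)"
        using R_trans[of "ei b" s t] R_trans[of "ei b" t "ej b"] st eb by blast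
      then show ?thesis using P_zero[OF qa, of "ei b" s] P_zero[OF q, of t "ej b"] st eb by auto
    qed
    from sum_pairs[of ?F, OF this]
    have "(\<Sum>x<N. ?F (ei x) (ej x)) = (\<Sum>s<n. \<Sum>t<n. ?F s t)" by simp
    also have "\<dots> = (\<Sum>s<n. adj_mat q $$ (ei b, s) * adj_mat p $$ (s, ei d)) * (\<Sum>t<n. p $$ (ej d, t) * q $$ (t, ej b))"
      unfolding sum_product by (intro sum.cong refl) (simp add: mult_ac)
    also have "(\<Sum>s<n. adj_mat q $$ (ei b, s) * adj_mat p $$ (s, ei d)) = adj_mat (p * q) $$ (ei b, ei d)"
      using index_mult_sum[OF c(4,3) eb(1) ed(1)] SLset_adj_mult[OF P_SL[OF p] P_SL[OF q]] by simp
    also have "(\<Sum>t<n. p $$ (ej d, t) * q $$ (t, ej b)) = (p * q) $$ (ej d, ej b)"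
      using index_mult_sum[OF c(1,2) ed(2) eb(2)] by simp
    also have "adj_mat (p * q) $$ (ei b, ei d) * (p * q) $$ (ej d, ej b) = Ad (adj_mat (p * q)) (p * q) $$ (b, d)"
      using bd by (simp add: Ad_def)
    finally have 1: "Ad (adj_mat (p * q)) (p * q) $$ (b, d) = (\<Sum>x<N. ?F (ei x) (ej x))" by simp
    have "(Ad (adj_mat q) q * Ad (adj_mat p) p) $$ (b, d) = (\<Sum>x<N. Ad (adj_mat q) q $$ (b, x) * Ad (adj_mat p) p $$ (x, d))"
      by (rule index_mult_sum[OF Ad_carrier Ad_carrier bd])
    also have "\<dots> = (\<Sum>x<N. ?F (ei x) (ej x))" using bd by (intro sum.cong refl) (simp add: Ad_def)
    finally show "Ad (adj_mat (p * q)) (p * q) $$ (b, d) = (Ad (adj_mat q) q * Ad (adj_mat p) p) $$ (b, d)"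
      using 1 by simp
  qed (auto simp: Ad_def)
  then show ?thesis unfolding chi_def by (simp add: det_mult[OF Ad_carrier Ad_carrier] mult.commute)
qed

text \<open>With trivial right factor only positions in the same column interact, and within a
  column the enumeration follows the rows. Hence the matrix inherits the lower unitriangular shape
  of \<open>A\<close>.\<close>

lemma det_Ad_unitriangular:
  assumes "\<And>i j. i < n \<Longrightarrow> j < n \<Longrightarrow> i \<le> j \<Longrightarrow> A $$ (i, j) = (if i = j then 1 else 0)"
  shows "det (Ad A (1\<^sub>m n)) = 1"
proof (rule det_unitriangular[OF Ad_carrier])
  fix b c assume bc: "b < N" "c < N" "b \<le> c"
  note eb = e_range[OF bc(1)] and ec = e_range[OF bc(2)]
  show "Ad A (1\<^sub>m n) $$ (b, c) = (if b = c then 1 else 0)"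
  proof (cases "b = c")
    case True
    then show ?thesis using bc eb assms[of "ei b" "ei b"] by (simp add: Ad_def)
  next
    case False
    then have less: "plist ! b < plist ! c" using bc e_less by simp
    show ?thesis
    proof (cases "ej b = ej c")
      case True
      then have "ei b < ei c" using less unfolding ei_def ej_def
        by (metis add_less_cancel_right div_mult_mod_eq mult_less_cancel2)
      then show ?thesis using False bc eb ec assms[of "ei b" "ei c"] by (simp add: Ad_def)
    next
      case False
      then show ?thesis using bc eb ec by (auto simp: Ad_def)
    qed
  qed
qed

lemma chi_one [simp]: "chi (1\<^sub>m n) = 1"
  using det_Ad_unitriangular[of "1\<^sub>m n"] by (simp add: chi_def)

lemma chi_nonzero: "q \<in> P \<Longrightarrow> chi q \<noteq> 0"
  using chi_mult[of q "adj_mat q"] P_adj[of q] SLset_adj(2)[OF P_SL[of q]] by auto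

lemma chi_adj: "q \<in> P \<Longrightarrow> chi (adj_mat q) = inverse (chi q)"
  using chi_mult[of q "adj_mat q"] P_adj[of q] SLset_adj(2)[OF P_SL[of q]] by (auto simp: inverse_unique)

lemma fa_chi:
  assumes fa: "function_algebra D F" and M: "mat_entries D F n n M"
  shows "(\<lambda>x. chi (M x)) \<in> F"
  unfolding chi_def
proof (rule fa_det[OF fa])
  show "mat_entries D F N N (\<lambda>x. Ad (adj_mat (M x)) (M x))"
    unfolding Ad_def using e_range
    by (intro mat_entries_mat[OF fa])
      (auto intro!: fa_mult[OF fa] mat_entriesD[OF fa mat_entries_adj[OF fa M]] mat_entriesD[OF fa M])
qed

end

lemma mat_entries_pullback:
  assumes X: "local_fspace X" and Y: "local_fspace Y" and f: "morphism Y X \<phi>"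
    and M: "mat_entries U (regular X U) m k M" and U: "openin (zariski X) U"
    and V: "openin (zariski Y) V" and sub: "\<And>y. y \<in> V \<Longrightarrow> \<phi> y \<in> U"
  shows "mat_entries V (regular Y V) m k (\<lambda>y. M (\<phi> y))"
proof -
  have VY: "V \<subseteq> points Y" using V by (rule openin_subset)
  have "(\<lambda>y. M (\<phi> y) $$ (i, j)) \<in> regular Y V" if "i < m" "j < k" for i j
  proof -
    have "(\<lambda>x. M x $$ (i, j)) \<in> regular X U" using M that function_algebra_regular[OF X U] by (simp add: mat_entries_def)
    from regular_mono[OF Y morphismD(2)[OF f U] morphismD(3)[OF f U this] V]
    show ?thesis using sub VY by (auto simp: comp_def)
  qed
  then show ?thesis using M sub function_algebra_regular[OF Y V] function_algebra_regular[OF X U]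
    by (simp add: mat_entries_def)
qed

lemma mat_entries_left:
  "function_algebra D F \<Longrightarrow> A \<in> carrier_mat m m \<Longrightarrow> mat_entries D F m m M \<Longrightarrow> mat_entries D F m m (\<lambda>x. A * M x)"
  using mat_entries_mult[OF _ mat_entries_const] by blast

lemma regular_pullback:
  assumes X: "local_fspace X" and Y: "local_fspace Y" and f: "morphism Y X \<phi>"
    and M: "g \<in> regular X U" and U: "openin (zariski X) U"
    and V: "openin (zariski Y) V" and sub: "\<And>y. y \<in> V \<Longrightarrow> \<phi> y \<in> U"
  shows "(\<lambda>y. g (\<phi> y)) \<in> regular Y V"
  using regular_mono[OF Y morphismD(2)[OF f U] morphismD(3)[OF f U M] V] sub openin_subset[OF V]
  by (auto simp: comp_def)

lemma morphism_from_quotient_global: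
  assumes X: "local_fspace X" and f: "morphism X Y \<phi>" and eq: "\<And>x. x \<in> points X \<Longrightarrow> \<psi> (p x) = \<phi> x"
  shows "morphism (quotient_space X p) Y \<psi>"
proof (rule morphism_local[OF local_fspace_quotient[OF X]])
  fix y assume y: "y \<in> points (quotient_space X p)"
  let ?T = "points (quotient_space X p)"
  have "{x \<in> points X. p x \<in> ?T} = points X" by auto
  then have "morphism (open_subspace X {x \<in> points X. p x \<in> ?T}) Y \<phi>"
    using morphism_restrict[OF X f openin_topspace] by simp
  then have "morphism (open_subspace (quotient_space X p) ?T) Y \<psi>"
    by (intro morphism_from_quotient[OF X openin_topspace]) (auto simp: eq)
  then show "\<exists>U. openin (zariski (quotient_space X p)) U \<and> y \<in> U \<and> morphism (open_subspace (quotient_space X p) U) Y \<psi>"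
    using y openin_topspace by blast
qed

abbreviation mat_coords :: "nat \<Rightarrow> (complex mat \<Rightarrow> complex) set" where
  "mat_coords n \<equiv> {\<lambda>A. A $$ (i, j) | i j. i < n \<and> j < n}"

abbreviation SL_space :: "nat \<Rightarrow> complex mat fspace" where
  "SL_space n \<equiv> induced_space (mat_coords n) (SLset n)"

lemma mat_coord_polynomial: "i < n \<Longrightarrow> j < n \<Longrightarrow> (\<lambda>A. A $$ (i, j)) \<in> polynomial_functions (mat_coords n)"
  by (intro polynomial_functions.coord) auto

lemma SL_space_entries:
  "U \<subseteq> SLset n \<Longrightarrow> function_algebra U F \<Longrightarrow> (\<And>f. f \<in> polynomial_functions (mat_coords n) \<Longrightarrow> f \<in> F) \<Longrightarrow>
    mat_entries U F n n (\<lambda>x. x)"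
  using mat_coord_polynomial[of _ n] by (auto simp: mat_entries_def SLset_carrier)

lemma morphism_SL_space:
  assumes W: "local_fspace W" and M: "mat_entries (points W) (regular W (points W)) n n M"
    and im: "\<And>w. w \<in> points W \<Longrightarrow> M w \<in> SLset n"
  shows "morphism W (SL_space n) M"
  using mat_entriesD[OF function_algebra_regular[OF W openin_topspace] M] im
  by (intro morphism_induced[OF W]) auto

section \<open>The torus\<close>

definition Gm :: "complex vec algebraic_group" where "Gm = standard_torus 1"

lemma Gm_simps [simp]:
  "carrier Gm = {v \<in> carrier_vec 1. v $ 0 \<noteq> 0}"
  "mult Gm = (\<lambda>u v. vec 1 (\<lambda>i. u $ i * v $ i))" "one Gm = vec 1 (\<lambda>_. 1)"
  "underlying_variety Gm = induced_space (vec_coords 1) {v \<in> carrier_vec 1. v $ 0 \<noteq> 0}"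
  by (simp_all add: Gm_def standard_torus_def Let_def)

lemma group_Gm: "group Gm"
proof (rule groupI)
  fix x assume "x \<in> carrier Gm"
  then show "\<exists>y\<in>carrier Gm. y \<otimes>\<^bsub>Gm\<^esub> x = \<one>\<^bsub>Gm\<^esub>"
    by (intro bexI[of _ "vec 1 (\<lambda>_. inverse (x $ 0))"]) auto
qed (auto simp: mult.assoc)

lemma isomorphism_id: "local_fspace X \<Longrightarrow> isomorphism X X id"
proof -
  assume X: "local_fspace X"
  have "{x \<in> points X. x \<in> V} = V" if "openin (zariski X) V" for V using openin_subset[OF that] by auto
  then have "morphism X X id" by (intro morphismI) (auto simp: comp_def)
  then show ?thesis by (intro isomorphismI[OF X, of _ _ id]) auto
qed

lemma torus_Gm: "algebraic_torus Gm"
  unfolding algebraic_torus_def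
proof (intro conjI exI[of _ 1] bexI[of _ id], unfold Gm_def [symmetric])
  show "id \<in> iso Gm Gm" by (auto simp: iso_def hom_def)
  show "isomorphism (underlying_variety Gm) (underlying_variety Gm) id"
    by (rule isomorphism_id) (simp add: local_fspace_induced)
qed (simp_all add: group_Gm)

lemma coord_regular_vec:
  assumes "i < m"
  shows "(\<lambda>v. v $ i) \<in> regular (induced_space (vec_coords m) V) U"
  by (intro polynomial_regular_induced polynomial_functions.coord) (use assms in \<open>auto simp: vec_coords_def\<close>)

section \<open>The homogeneous space and the associated bundle\<close>

text \<open>The projection enters only through its fibres. Its values may thus be cosets of another,
  conjugate subgroup, which is what the final theorem needs.\<close>

locale flag_quotient = pattern +
  fixes p :: "complex mat \<Rightarrow> 'x"
  assumes p_eq: "\<And>x y. x \<in> SLset n \<Longrightarrow> y \<in> SLset n \<Longrightarrow> p x = p y \<longleftrightarrow> (\<exists>q\<in>P. y = x * q)"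
begin

definition X :: "'x fspace" where "X = quotient_space (SL_space n) p"

definition S' :: "(complex mat \<times> complex) set" where "S' = SLset n \<times> (UNIV - {0})"

definition hat_coords :: "(complex mat \<times> complex \<Rightarrow> complex) set" where
  "hat_coords = insert snd {\<lambda>w. fst w $$ (i, j) | i j. i < n \<and> j < n}"

text \<open>The group times the multiplicative group, given by polynomial coordinates rather than as
  a \<open>prod_space\<close>: regular functions on it are then local fractions of polynomials,
  \<open>1 / z\<close> among them.\<close>

definition H :: "(complex mat \<times> complex) fspace" where "H = induced_space hat_coords S'"

text \<open>The pair \<open>(x, z)\<close> is encoded as the matrix \<open>x\<close> with its first column scaled by \<open>z\<close>, so that
  the classes of pairs become sets of matrices.\<close>

definition enc :: "complex mat \<times> complex \<Rightarrow> complex mat" where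
  "enc w = fst w * mat n n (\<lambda>(a, b). if a = b then (if a = 0 then snd w else 1) else 0)"

definition ph :: "complex mat \<times> complex \<Rightarrow> complex mat set" where
  "ph w = {enc (fst w * q, inverse (chi q) * snd w) | q. q \<in> P}"

definition E :: "complex mat set fspace" where "E = quotient_space H ph"

lemma S'_iff: "(x, z) \<in> S' \<longleftrightarrow> x \<in> SLset n \<and> z \<noteq> 0" by (simp add: S'_def)

lemma local_X: "local_fspace X" and local_H: "local_fspace H" and local_E: "local_fspace E"
  by (simp_all add: X_def E_def H_def local_fspace_quotient local_fspace_induced)

lemma points_X: "points X = p ` SLset n" and points_H [simp]: "points H = S'" and points_E: "points E = ph ` S'"
  by (simp_all add: X_def E_def H_def)

text \<open>The determinant of the encoded matrix is \<open>z\<close>, because \<open>x\<close> has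
  determinant one; undoing the scaling of the first column then recovers \<open>x\<close>.\<close>

lemma enc_inj:
  assumes "(x, z) \<in> S'" "(y, w) \<in> S'" "enc (x, z) = enc (y, w)"
  shows "(x, z) = (y, w)"
proof -
  let ?D = "\<lambda>z::complex. mat n n (\<lambda>(a, b). if a = b then (if a = 0 then z else 1) else 0) :: complex mat"
  have c: "x \<in> carrier_mat n n" "y \<in> carrier_mat n n" using assms by (auto simp: S'_iff SLset_carrier)
  have d: "det (v * ?D t) = t" if "v \<in> SLset n" for v t
    using n that by (subst det_mult[of _ n]) (auto simp: det_sign_diag SLset_carrier SLset_det)
  have "z = w" using d[of x z] d[of y w] assms(3) assms(1,2)[unfolded S'_iff] unfolding enc_def fst_conv snd_conv by metis
  have "?D z * ?D (inverse z) = 1\<^sub>m n"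
  proof (rule eq_matI)
    fix i j assume "i < dim_row (1\<^sub>m n :: complex mat)" "j < dim_col (1\<^sub>m n :: complex mat)"
    then have ij: "i < n" "j < n" by auto
    have "(?D z * ?D (inverse z)) $$ (i, j) = (\<Sum>a<n. ?D z $$ (i, a) * ?D (inverse z) $$ (a, j))"
      by (rule index_mult_sum) (use ij in auto)
    also have "\<dots> = (\<Sum>a<n. if a = i then ?D z $$ (i, i) * ?D (inverse z) $$ (i, j) else 0)"
      using ij by (intro sum.cong) auto
    also have "\<dots> = (1\<^sub>m n :: complex mat) $$ (i, j)" using ij assms by (auto simp: S'_iff)
    finally show "(?D z * ?D (inverse z)) $$ (i, j) = (1\<^sub>m n :: complex mat) $$ (i, j)" .
  qed auto
  then have "x * ?D z * ?D (inverse z) = x" "y * ?D z * ?D (inverse z) = y"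
    using c by (simp_all add: assoc_mult_mat[of _ n n _ n _ n])
  then show ?thesis using assms(3) \<open>z = w\<close> unfolding enc_def fst_conv snd_conv by metis
qed

lemma hat_act: "(x, z) \<in> S' \<Longrightarrow> q \<in> P \<Longrightarrow> (x * q, inverse (chi q) * z) \<in> S'"
  by (simp add: S'_iff P_SL chi_nonzero)

lemma ph_eq:
  assumes w: "(x, z) \<in> S'" "(y, t) \<in> S'"
  shows "ph (x, z) = ph (y, t) \<longleftrightarrow> (\<exists>q\<in>P. y = x * q \<and> t = inverse (chi q) * z)"
proof
  assume eq: "ph (x, z) = ph (y, t)"
  have "enc (y * 1\<^sub>m n, inverse (chi (1\<^sub>m n)) * t) \<in> ph (y, t)"
    unfolding ph_def by (rule CollectI, rule exI[of _ "1\<^sub>m n"]) simp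
  then have "enc (y, t) \<in> ph (y, t)" using w by (simp add: S'_iff)
  then obtain q where q: "q \<in> P" "enc (y, t) = enc (x * q, inverse (chi q) * z)"
    unfolding eq[symmetric] by (auto simp: ph_def)
  then show "\<exists>q\<in>P. y = x * q \<and> t = inverse (chi q) * z"
    using enc_inj[OF w(2) hat_act[OF w(1) q(1)] q(2)] by auto
next
  assume "\<exists>q\<in>P. y = x * q \<and> t = inverse (chi q) * z"
  then obtain q where q: "q \<in> P" "y = x * q" "t = inverse (chi q) * z" by blast
  note sl = P_SL[OF q(1)]
  \<comment> \<open>An orbit contains the orbit of each of its points. Applied to \<open>q\<close>
    and to its inverse this gives both inclusions.\<close>
  have sub: "ph (v * r, inverse (chi r) * s) \<subseteq> ph (v, s)" if vs: "(v, s) \<in> S'" "r \<in> P" for v s r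
  proof
    fix A assume "A \<in> ph (v * r, inverse (chi r) * s)"
    then obtain q' where q': "q' \<in> P" "A = enc (v * r * q', inverse (chi q') * (inverse (chi r) * s))"
      by (auto simp: ph_def)
    have "v * r * q' = v * (r * q')" using vs P_SL[OF vs(2)] P_SL[OF q'(1)] by (simp add: S'_iff SLset_assoc[of v n r q'])
    then have "A = enc (v * (r * q'), inverse (chi (r * q')) * s)"
      using q' by (simp add: chi_mult[OF vs(2) q'(1)] mult_ac)
    then show "A \<in> ph (v, s)" using P_mult[OF vs(2) q'(1)] by (auto simp: ph_def)
  qed
  have "ph (y, t) \<subseteq> ph (x, z)" using sub[OF w(1) q(1)] q by simp
  moreover have "ph (x, z) \<subseteq> ph (y, t)"
    using sub[OF w(2) P_adj[OF q(1)]] q w sl chi_nonzero[OF q(1)]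
    by (simp add: SLset_cancel chi_adj S'_iff flip: mult.assoc)
  ultimately show "ph (x, z) = ph (y, t)" by blast
qed

lemma ph_act: "(x, z) \<in> S' \<Longrightarrow> q \<in> P \<Longrightarrow> ph (x * q, inverse (chi q) * z) = ph (x, z)"
  using ph_eq[OF _ hat_act] by blast

lemma p_act: "x \<in> SLset n \<Longrightarrow> q \<in> P \<Longrightarrow> p (x * q) = p x"
  using p_eq[of x "x * q"] P_SL by auto

section \<open>Local sections over the translates of the big cell\<close>

definition repX :: "'x \<Rightarrow> complex mat" where "repX x = (SOME a. a \<in> SLset n \<and> p a = x)"
definition rep :: "complex mat set \<Rightarrow> complex mat \<times> complex" where "rep e = (SOME w. w \<in> S' \<and> ph w = e)"

lemma repX: "a \<in> SLset n \<Longrightarrow> \<exists>q\<in>P. repX (p a) = a * q"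
proof -
  assume a: "a \<in> SLset n"
  then have "repX (p a) \<in> SLset n \<and> p (repX (p a)) = p a" unfolding repX_def
    by (intro someI[of "\<lambda>b. b \<in> SLset n \<and> p b = p a" a]) simp
  then show ?thesis using p_eq[OF a] by metis
qed

lemma rep:
  assumes "(x, z) \<in> S'"
  shows "\<exists>q\<in>P. rep (ph (x, z)) = (x * q, inverse (chi q) * z)"
proof -
  have *: "rep (ph (x, z)) \<in> S' \<and> ph (rep (ph (x, z))) = ph (x, z)"
    unfolding rep_def by (rule someI[of "\<lambda>w. w \<in> S' \<and> ph w = ph (x, z)" "(x, z)"]) (use assms in simp)
  obtain y t where yt: "rep (ph (x, z)) = (y, t)" by fastforce
  show ?thesis using ph_eq[of x z y t] * assms unfolding yt by auto
qed

lemma rfac_mult: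
  assumes "x \<in> big" "q \<in> P"
  shows "rfac (x * q) = adj_mat q * rfac x"
proof -
  note sl = big_SL[OF assms(1)] P_SL[OF assms(2)] P_SL[OF rfac_P[OF assms(1)]] P_SL[OF rfac_P[OF big_mult[OF assms]]]
  have "x * q * rfac (x * q) = x * rfac x" using ufac_mult[OF assms] by (simp add: ufac_def)
  then have "adj_mat (x * q) * (x * q * rfac (x * q)) = adj_mat (x * q) * (x * rfac x)" by simp
  then show ?thesis using sl SLset_adj(1)[OF sl(1)] SLset_adj(1)[OF sl(2)]
    by (simp add: SLset_cancel SLset_adj_mult SLset_assoc del: SLset_mult) (simp add: SLset_cancel SLset_assoc)
qed

lemma rfac_cell: "A \<in> cell \<Longrightarrow> rfac A = 1\<^sub>m n"
  using cell_unique[of A "rfac A"] rfac_P[OF cell_big] ufac_cell[OF cell_big] by (simp add: ufac_def)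

text \<open>It moves \<open>w\<close> inside its class to the representative whose matrix lies in
  \<open>g\<close> times the cell. The second component is rescaled by \<open>chi\<close> to
  compensate for the right multiplication by \<open>rfac\<close>.\<close>

definition sec :: "complex mat \<Rightarrow> complex mat \<times> complex \<Rightarrow> complex mat \<times> complex" where
  "sec g w = (g * ufac (adj_mat g * fst w), chi (adj_mat (rfac (adj_mat g * fst w))) * snd w)"

definition secX :: "complex mat \<Rightarrow> 'x \<Rightarrow> complex mat" where
  "secX g x = g * ufac (adj_mat g * repX x)"

definition secE :: "complex mat \<Rightarrow> complex mat set \<Rightarrow> complex mat \<times> complex" where
  "secE g e = sec g (rep e)"

definition Xop :: "complex mat \<Rightarrow> 'x set" where "Xop g = p ` {x \<in> SLset n. adj_mat g * x \<in> big}"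
definition Eop :: "complex mat \<Rightarrow> complex mat set set" where "Eop g = ph ` {w \<in> S'. adj_mat g * fst w \<in> big}"

lemma big_act:
  assumes "g \<in> SLset n" "x \<in> SLset n" "q \<in> P"
  shows "adj_mat g * (x * q) \<in> big \<longleftrightarrow> adj_mat g * x \<in> big"
  using big_mult[of "adj_mat g * x" q] big_mult[of "adj_mat g * (x * q)" "adj_mat q"] assms P_adj[OF assms(3)]
    P_SL[OF assms(3)] SLset_adj(1)[OF assms(1)] SLset_adj(1)[OF P_SL[OF assms(3)]]
  by (auto simp: SLset_assoc SLset_cancel SLset_adj(2))

lemma Xop_iff:
  assumes "g \<in> SLset n" "x \<in> SLset n"
  shows "p x \<in> Xop g \<longleftrightarrow> adj_mat g * x \<in> big"
  unfolding Xop_def using p_eq[OF _ assms(2)] p_eq[OF assms(2)] big_act[OF assms(1)] assms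
  by auto

lemma Eop_iff:
  assumes "g \<in> SLset n" "(x, z) \<in> S'"
  shows "ph (x, z) \<in> Eop g \<longleftrightarrow> adj_mat g * x \<in> big"
proof
  assume "ph (x, z) \<in> Eop g"
  then obtain y t where y: "(y, t) \<in> S'" "ph (x, z) = ph (y, t)" "adj_mat g * y \<in> big" by (auto simp: Eop_def)
  then obtain q where "q \<in> P" "y = x * q" using ph_eq[OF assms(2) y(1)] by blast
  then show "adj_mat g * x \<in> big" using big_act[OF assms(1)] y assms(2) by (simp add: S'_iff)
qed (use assms in \<open>force simp: Eop_def\<close>)

lemma XopE:
  assumes "x \<in> Xop g" "g \<in> SLset n"
  obtains a where "a \<in> SLset n" "x = p a" "adj_mat g * a \<in> big"
  using assms by (auto simp: Xop_def)

lemma EopE: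
  assumes "e \<in> Eop g" "g \<in> SLset n"
  obtains a z where "(a, z) \<in> S'" "e = ph (a, z)" "adj_mat g * a \<in> big"
  using assms by (auto simp: Eop_def)

lemma secX_p:
  assumes "g \<in> SLset n" "x \<in> SLset n" "adj_mat g * x \<in> big"
  shows "secX g (p x) = g * ufac (adj_mat g * x)"
proof -
  obtain q where q: "q \<in> P" "repX (p x) = x * q" using repX[OF assms(2)] by blast
  then show ?thesis using ufac_mult[OF assms(3) q(1)] assms SLset_adj(1)[OF assms(1)]
    by (simp add: secX_def SLset_assoc P_SL)
qed

text \<open>Replacing \<open>x\<close> by \<open>x * q\<close> multiplies the factor
  \<open>chi (adj_mat (rfac ...))\<close> by \<open>chi q\<close>, which cancels the
  \<open>inverse (chi q)\<close> in the second component. So the arbitrary choice made by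
  \<open>rep\<close> leaves no trace.\<close>

lemma secE_ph:
  assumes "g \<in> SLset n" "(x, z) \<in> S'" "adj_mat g * x \<in> big"
  shows "secE g (ph (x, z)) = sec g (x, z)"
proof -
  obtain q where q: "q \<in> P" "rep (ph (x, z)) = (x * q, inverse (chi q) * z)" using rep[OF assms(2)] by blast
  note rP = rfac_P[OF assms(3)]
  have eq: "adj_mat g * (x * q) = adj_mat g * x * q"
    using assms SLset_adj(1)[OF assms(1)] P_SL[OF q(1)] by (simp add: SLset_assoc S'_iff)
  have "adj_mat (adj_mat q * rfac (adj_mat g * x)) = adj_mat (rfac (adj_mat g * x)) * q"
    using SLset_adj_mult[OF SLset_adj(1)[OF P_SL[OF q(1)]] P_SL[OF rP]] SLset_adj_adj[OF P_SL[OF q(1)]] by simp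
  then show ?thesis using ufac_mult[OF assms(3) q(1)] rfac_mult[OF assms(3) q(1)] chi_nonzero[OF q(1)]
    unfolding secE_def sec_def q(2) by (simp add: eq chi_mult[OF P_adj[OF rP] q(1)])
qed

lemma sec_eq:
  assumes "g \<in> SLset n" "(x, z) \<in> S'" "adj_mat g * x \<in> big"
  obtains r where "r \<in> P" "r = rfac (adj_mat g * x)" "sec g (x, z) = (x * r, inverse (chi r) * z)"
proof
  let ?r = "rfac (adj_mat g * x)"
  show "?r \<in> P" by (rule rfac_P[OF assms(3)])
  show "sec g (x, z) = (x * ?r, inverse (chi ?r) * z)"
    using assms P_SL[OF \<open>?r \<in> P\<close>] SLset_adj(1)[OF assms(1)]
    by (simp add: sec_def ufac_def chi_adj[OF \<open>?r \<in> P\<close>] S'_iff SLset_assoc SLset_cancel)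
qed simp

lemma sec_S':
  assumes "g \<in> SLset n" "(x, z) \<in> S'" "adj_mat g * x \<in> big"
  shows "sec g (x, z) \<in> S'" "ph (sec g (x, z)) = ph (x, z)"
  using sec_eq[OF assms] hat_act[OF assms(2)] ph_act[OF assms(2)] by metis+

lemma secE:
  assumes "g \<in> SLset n" "e \<in> Eop g"
  shows "secE g e \<in> S'" "ph (secE g e) = e"
  using EopE[OF assms(2,1)] secE_ph[OF assms(1)] sec_S'[OF assms(1)] by metis+

lemma secX_eq:
  assumes "g \<in> SLset n" "x \<in> SLset n" "adj_mat g * x \<in> big"
  shows "\<exists>r\<in>P. secX g (p x) = x * r"
  using assms rfac_P[OF assms(3)] P_SL[OF rfac_P[OF assms(3)]] SLset_adj(1)[OF assms(1)]
  by (intro bexI[of _ "rfac (adj_mat g * x)"]) (auto simp: secX_p ufac_def SLset_assoc SLset_cancel)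

lemma secX:
  assumes "g \<in> SLset n" "x \<in> Xop g"
  shows "secX g x \<in> SLset n" "p (secX g x) = x"
proof -
  obtain a where a: "a \<in> SLset n" "x = p a" "adj_mat g * a \<in> big" using XopE[OF assms(2,1)] by blast
  then show "secX g x \<in> SLset n" "p (secX g x) = x" using secX_eq[OF assms(1) a(1,3)] p_act P_SL by auto
qed

lemma one_big: "1\<^sub>m n \<in> big" by (rule cell_big) simp

lemma center_big: "a \<in> SLset n \<Longrightarrow> adj_mat a * a \<in> big"
  using SLset_adj(3)[of a n] one_big by simp

lemma p_in_Xop: "a \<in> SLset n \<Longrightarrow> p a \<in> Xop a"
  by (simp add: Xop_iff center_big)

lemma ph_in_Eop: "(a, z) \<in> S' \<Longrightarrow> ph (a, z) \<in> Eop a"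
  by (simp add: Eop_iff S'_iff center_big)

text \<open>Every point is the centre of a chart of its own, and there the section returns the
  chosen representative. This evaluates the separating functions at the pair to be
  separated.\<close>

lemma secX_center: "a \<in> SLset n \<Longrightarrow> secX a (p a) = a"
  using secX_p[OF _ _ center_big, of a] SLset_adj(3)[of a n] ufac_of_cell[OF one_cell] by simp

lemma secE_center: "(a, z) \<in> S' \<Longrightarrow> secE a (ph (a, z)) = (a, z)"
  using SLset_adj(3)[of a n] secE_ph[of a a z] center_big[of a]
  by (simp add: S'_iff ufac_of_cell rfac_cell sec_def)

definition proj :: "complex mat set \<Rightarrow> 'x" where "proj e = p (fst (rep e))"

lemma proj_ph: "(x, z) \<in> S' \<Longrightarrow> proj (ph (x, z)) = p x"
  using rep[of x z] by (auto simp: proj_def p_act S'_iff)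

lemma proj_Eop:
  assumes "g \<in> SLset n"
  shows "{e \<in> points E. proj e \<in> Xop g} = Eop g"
proof -
  have "proj (ph (x, z)) \<in> Xop g \<longleftrightarrow> ph (x, z) \<in> Eop g" if "(x, z) \<in> S'" for x z
    using that assms by (simp add: proj_ph Xop_iff Eop_iff S'_iff)
  then show ?thesis by (auto simp: points_E Eop_def)
qed

section \<open>Openness of the charts and regularity of the sections\<close>

lemma hat_regular:
  assumes "U \<subseteq> S'" "openin (zariski H) U"
  shows "mat_entries U (regular H U) n n fst" "snd \<in> regular H U"
proof -
  have "(\<lambda>w. fst w $$ (i, j)) \<in> regular H U" if "i < n" "j < n" for i j
    unfolding H_def using that by (intro polynomial_regular_induced polynomial_functions.coord) (auto simp: hat_coords_def)
  then show "mat_entries U (regular H U) n n fst"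
    using assms function_algebra_regular[OF local_H assms(2)] by (auto simp: mat_entries_def S'_def SLset_carrier)
  show "snd \<in> regular H U"
    unfolding H_def by (intro polynomial_regular_induced polynomial_functions.coord) (auto simp: hat_coords_def)
qed

lemma big_open:
  assumes W: "local_fspace W" and U: "openin (zariski W) U" and M: "mat_entries U (regular W U) n n M"
    and SL: "\<And>w. w \<in> U \<Longrightarrow> M w \<in> SLset n"
  shows "openin (zariski W) {w \<in> U. M w \<in> big}"
proof -
  note fa = function_algebra_regular[OF W U]
  let ?f = "\<lambda>w. \<Prod>j<n. det (leading (kap j) (M w))"
  have "?f \<in> regular W U"
  proof (rule fa_prod[OF fa], rule fa_det[OF fa])
    fix j assume "j \<in> {..<n}"
    then show "mat_entries U (regular W U) (kap j) (kap j) (\<lambda>w. leading (kap j) (M w))"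
      unfolding leading_def using kap(2)[of j] mat_entriesD[OF fa M] by (intro mat_entries_mat[OF fa]) auto
  qed
  then have "openin (zariski W) {w \<in> U. ?f w \<noteq> 0}" by (rule openin_nonzero[OF W U])
  moreover have "{w \<in> U. ?f w \<noteq> 0} = {w \<in> U. M w \<in> big}" using SL by (auto simp: big_def)
  ultimately show ?thesis by simp
qed

lemma SL_space_regular:
  "openin (zariski (SL_space n)) U \<Longrightarrow> mat_entries U (regular (SL_space n) U) n n (\<lambda>x. x)"
  using openin_subset[of "zariski (SL_space n)" U]
  by (intro SL_space_entries function_algebra_regular local_fspace_induced polynomial_regular_induced) auto

lemma open_chart_SL:
  assumes g: "g \<in> SLset n"
  shows "openin (zariski (SL_space n)) {x \<in> SLset n. adj_mat g * x \<in> big}"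
proof -
  have o: "openin (zariski (SL_space n)) (SLset n)" using openin_topspace[of "zariski (SL_space n)"] by simp
  note fa = function_algebra_regular[OF local_fspace_induced o]
  show ?thesis
    by (rule big_open[OF local_fspace_induced o mat_entries_mult[OF fa
            mat_entries_const[OF fa SLset_carrier[OF SLset_adj(1)[OF g]]] SL_space_regular[OF o]]])
      (rule SLset_mult[OF SLset_adj(1)[OF g]])
qed

lemma open_chart_H:
  assumes g: "g \<in> SLset n"
  shows "openin (zariski H) {w \<in> S'. adj_mat g * fst w \<in> big}"
proof -
  have o: "openin (zariski H) S'" using openin_topspace[of "zariski H"] by simp
  note fa = function_algebra_regular[OF local_H o]
  show ?thesis
    by (rule big_open[OF local_H o mat_entries_mult[OF fa
            mat_entries_const[OF fa SLset_carrier[OF SLset_adj(1)[OF g]]] hat_regular(1)[OF subset_refl o]]])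
      (use SLset_mult[OF SLset_adj(1)[OF g]] in \<open>auto simp: S'_def\<close>)
qed

lemma preimage_Xop: "g \<in> SLset n \<Longrightarrow> {x \<in> points (SL_space n). p x \<in> Xop g} = {x \<in> SLset n. adj_mat g * x \<in> big}"
  using Xop_iff by auto

lemma preimage_Eop: "g \<in> SLset n \<Longrightarrow> {w \<in> points H. ph w \<in> Eop g} = {w \<in> S'. adj_mat g * fst w \<in> big}"
  using Eop_iff by auto

lemma Xop_open: "g \<in> SLset n \<Longrightarrow> openin (zariski X) (Xop g)"
  unfolding X_def openin_quotient_space preimage_Xop
  using open_chart_SL by (auto simp: Xop_def)

lemma Eop_open: "g \<in> SLset n \<Longrightarrow> openin (zariski E) (Eop g)"
  unfolding E_def openin_quotient_space preimage_Eop
  using open_chart_H by (auto simp: Eop_def)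

text \<open>Regularity on a quotient is tested after composing with the projection, and there the
  section is the explicit expression in \<open>ufac\<close>.\<close>

lemma secX_regular:
  assumes g: "g \<in> SLset n"
  shows "mat_entries (Xop g) (regular X (Xop g)) n n (secX g)"
proof -
  let ?U = "{x \<in> SLset n. adj_mat g * x \<in> big}"
  note o = open_chart_SL[OF g]
  note fa = function_algebra_regular[OF local_fspace_induced o]
  have M: "mat_entries ?U (regular (SL_space n) ?U) n n (\<lambda>x. g * ufac (adj_mat g * x))"
    by (intro mat_entries_left[OF fa SLset_carrier[OF g]] regular_rfac(2)[OF local_fspace_induced o]
        mat_entries_left[OF fa SLset_carrier[OF SLset_adj(1)[OF g]]] SL_space_regular[OF o]) auto
  have "(\<lambda>x. secX g x $$ (i, j)) \<in> regular X (Xop g)" if ij: "i < n" "j < n" for i j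
    unfolding X_def regular_quotient_space preimage_Xop[OF g] comp_def
    by (rule regular_cong[OF local_fspace_induced o mat_entriesD[OF fa M ij]]) (auto simp: secX_p[OF g])
  then show ?thesis
    using secX(1)[OF g] function_algebra_regular[OF local_X Xop_open[OF g]] by (auto simp: mat_entries_def SLset_carrier)
qed

lemma secE_regular:
  assumes g: "g \<in> SLset n"
  shows "mat_entries (Eop g) (regular E (Eop g)) n n (\<lambda>e. fst (secE g e))"
    and "(\<lambda>e. snd (secE g e)) \<in> regular E (Eop g)"
proof -
  let ?U = "{w \<in> S'. adj_mat g * fst w \<in> big}"
  note o = open_chart_H[OF g]
  note fa = function_algebra_regular[OF local_H o]
  have M0: "mat_entries ?U (regular H ?U) n n (\<lambda>w. adj_mat g * fst w)"
    by (rule mat_entries_left[OF fa SLset_carrier[OF SLset_adj(1)[OF g]] hat_regular(1)[OF _ o]]) auto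
  have M: "mat_entries ?U (regular H ?U) n n (\<lambda>w. fst (sec g w))"
    unfolding sec_def fst_conv
    by (rule mat_entries_left[OF fa SLset_carrier[OF g] regular_rfac(2)[OF local_H o M0]]) auto
  have c: "(\<lambda>w. snd (sec g w)) \<in> regular H ?U"
    unfolding sec_def snd_conv
    by (intro fa_mult[OF fa] fa_chi[OF fa] mat_entries_adj[OF fa] regular_rfac(1)[OF local_H o M0] hat_regular(2)[OF _ o]) auto
  have "(\<lambda>e. fst (secE g e) $$ (i, j)) \<in> regular E (Eop g)" if ij: "i < n" "j < n" for i j
    unfolding E_def regular_quotient_space preimage_Eop[OF g] comp_def
    by (rule regular_cong[OF local_H o mat_entriesD[OF fa M ij]]) (auto simp: secE_ph[OF g])
  then show "mat_entries (Eop g) (regular E (Eop g)) n n (\<lambda>e. fst (secE g e))"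
    using secE(1)[OF g] function_algebra_regular[OF local_E Eop_open[OF g]]
    by (auto simp: mat_entries_def S'_def mem_Times_iff SLset_carrier)
  show "(\<lambda>e. snd (secE g e)) \<in> regular E (Eop g)"
    unfolding E_def regular_quotient_space preimage_Eop[OF g] comp_def
    by (rule regular_cong[OF local_H o c]) (auto simp: secE_ph[OF g])
qed

lemma morphism_hat:
  assumes W: "local_fspace W" and M: "mat_entries (points W) (regular W (points W)) n n a"
    and c: "c \<in> regular W (points W)" and im: "\<And>w. w \<in> points W \<Longrightarrow> (a w, c w) \<in> S'"
  shows "morphism W H (\<lambda>w. (a w, c w))"
  unfolding H_def
proof (rule morphism_induced[OF W im])
  fix f assume "f \<in> hat_coords"
  then show "(\<lambda>w. f (a w, c w)) \<in> regular W (points W)"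
    using mat_entriesD[OF function_algebra_regular[OF W openin_topspace] M] c by (auto simp: hat_coords_def)
qed

lemma morphism_ph: "morphism H E ph"
  unfolding E_def by (rule morphism_quotient_projection)

text \<open>The quotient \<open>E\<close> has no global coordinates to test against, so maps into it
  are recognised by regular local lifts to \<open>H\<close>.\<close>

lemma morphism_into_E:
  assumes W: "local_fspace W"
    and loc: "\<And>w. w \<in> points W \<Longrightarrow> \<exists>U a c. openin (zariski W) U \<and> w \<in> U \<and> mat_entries U (regular W U) n n a \<and>
      c \<in> regular W U \<and> (\<forall>v\<in>U. (a v, c v) \<in> S' \<and> \<phi> v = ph (a v, c v))"
  shows "morphism W E \<phi>"
proof (rule morphism_local[OF W])
  fix w assume "w \<in> points W"
  from loc[OF this] obtain U a c where U: "openin (zariski W) U" "w \<in> U" "mat_entries U (regular W U) n n a"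
      "c \<in> regular W U" "\<forall>v\<in>U. (a v, c v) \<in> S' \<and> \<phi> v = ph (a v, c v)" by (elim exE conjE)
  have pU: "points (open_subspace W U) = U" using openin_subset[OF U(1)] by auto
  have "morphism (open_subspace W U) H (\<lambda>v. (a v, c v))"
    by (rule morphism_hat[OF local_fspace_open_subspace[OF W U(1)]])
      (use U in \<open>simp_all add: pU del: points_open_subspace\<close>)
  then have "morphism (open_subspace W U) E (\<lambda>v. ph (a v, c v))" by (rule morphism_comp[OF _ morphism_ph])
  then have "morphism (open_subspace W U) E \<phi>"
    by (rule morphism_cong[OF local_fspace_open_subspace[OF W U(1)]]) (use U(5) pU in auto)
  then show "\<exists>U. openin (zariski W) U \<and> w \<in> U \<and> morphism (open_subspace W U) E \<phi>" using U by blast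
qed

lemma morphism_proj: "morphism E X proj"
proof -
  have o: "openin (zariski H) (points H)" by (rule openin_topspace)
  have "morphism H (SL_space n) fst"
    using hat_regular(1)[OF _ o] by (intro morphism_SL_space local_H) (auto simp: S'_def)
  then have "morphism H X (\<lambda>w. p (fst w))"
    unfolding X_def by (rule morphism_comp[OF _ morphism_quotient_projection])
  then show ?thesis unfolding E_def
    by (rule morphism_from_quotient_global[OF local_H]) (auto simp: proj_ph)
qed

section \<open>The commuting actions of the group and of the torus\<close>

definition actG :: "complex mat \<Rightarrow> complex mat set \<Rightarrow> complex mat set" where
  "actG g = (\<lambda>e\<in>points E. ph (g * fst (rep e), snd (rep e)))"

definition actZ :: "complex vec \<Rightarrow> complex mat set \<Rightarrow> complex mat set" where
  "actZ t = (\<lambda>e\<in>points E. ph (fst (rep e), t $ 0 * snd (rep e)))"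

lemma actG_ph:
  assumes "g \<in> SLset n" "(x, z) \<in> S'"
  shows "actG g (ph (x, z)) = ph (g * x, z)"
proof -
  obtain q where q: "q \<in> P" "rep (ph (x, z)) = (x * q, inverse (chi q) * z)" using rep[OF assms(2)] by blast
  have "g * (x * q) = g * x * q" using assms P_SL[OF q(1)] by (simp add: SLset_assoc S'_iff)
  then show ?thesis using ph_act[of "g * x" z q] assms q by (simp add: actG_def points_E S'_iff)
qed

lemma actZ_ph:
  assumes "t $ 0 \<noteq> 0" "(x, z) \<in> S'"
  shows "actZ t (ph (x, z)) = ph (x, t $ 0 * z)"
proof -
  obtain q where q: "q \<in> P" "rep (ph (x, z)) = (x * q, inverse (chi q) * z)" using rep[OF assms(2)] by blast
  then show ?thesis using ph_act[of x "t $ 0 * z" q] assms by (simp add: actZ_def points_E S'_iff mult_ac)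
qed

lemma group_actionI:
  assumes G: "group G" and ext: "\<And>g. g \<in> carrier G \<Longrightarrow> act g \<in> extensional S"
    and closed: "\<And>g e. g \<in> carrier G \<Longrightarrow> e \<in> S \<Longrightarrow> act g e \<in> S"
    and one: "\<And>e. e \<in> S \<Longrightarrow> act \<one>\<^bsub>G\<^esub> e = e"
    and mult: "\<And>g h e. g \<in> carrier G \<Longrightarrow> h \<in> carrier G \<Longrightarrow> e \<in> S \<Longrightarrow> act (g \<otimes>\<^bsub>G\<^esub> h) e = act g (act h e)"
  shows "group_action G S act"
proof -
  interpret group G by (rule G)
  have bij: "act g \<in> Bij S" if g: "g \<in> carrier G" for g
  proof -
    have "bij_betw (act g) S S"
    proof (rule bij_betwI[of _ _ _ "act (inv\<^bsub>G\<^esub> g)"])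
      show "act (inv\<^bsub>G\<^esub> g) (act g e) = e" if "e \<in> S" for e
        using that g mult[of "inv\<^bsub>G\<^esub> g" g e] one by simp
      show "act g (act (inv\<^bsub>G\<^esub> g) e) = e" if "e \<in> S" for e
        using that g mult[of g "inv\<^bsub>G\<^esub> g" e] one by simp
    qed (use g closed in auto)
    then show ?thesis using ext[OF g] by (simp add: Bij_def)
  qed
  have "act (g \<otimes>\<^bsub>G\<^esub> h) = compose S (act g) (act h)" if gh: "g \<in> carrier G" "h \<in> carrier G" for g h
    by (rule extensionalityI[of _ S]) (use gh mult ext in \<open>auto simp: compose_def\<close>)
  then have "group_hom G (BijGroup S) act"
    using bij by (intro group_hom.intro G group_BijGroup) (auto simp: group_hom_axioms_def hom_def BijGroup_def)
  then show ?thesis by (rule group_action.intro)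
qed

lemma points_EE: "e \<in> points E \<Longrightarrow> (\<And>x z. (x, z) \<in> S' \<Longrightarrow> e = ph (x, z) \<Longrightarrow> thesis) \<Longrightarrow> thesis"
  by (auto simp: points_E)

lemma algebraic_action_G: "algebraic_action (SL n) E actG"
  unfolding algebraic_action_def
proof
  show "group_action (SL n) (points E) actG"
  proof (rule group_actionI[OF group_SL])
    \<comment> \<open>\<open>group_action\<close> maps into bijections that are extensional on the
      set acted upon; this is why the actions are restricted to \<open>points E\<close>.\<close>
    show "actG g \<in> extensional (points E)" for g by (simp add: actG_def)
    show "actG g e \<in> points E" if "g \<in> carrier (SL n)" "e \<in> points E" for g e
      using that by (elim points_EE) (auto simp: actG_ph S'_iff points_E)
    show "actG \<one>\<^bsub>SL n\<^esub> e = e" if "e \<in> points E" for e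
      using that by (elim points_EE) (auto simp: actG_ph S'_iff)
    show "actG (g \<otimes>\<^bsub>SL n\<^esub> h) e = actG g (actG h e)"
      if "g \<in> carrier (SL n)" "h \<in> carrier (SL n)" "e \<in> points E" for g h e
      using that by (elim points_EE) (auto simp: actG_ph S'_iff SLset_assoc)
  qed
  have G: "local_fspace (SL_space n)" by (rule local_fspace_induced)
  let ?W = "prod_space (SL_space n) E"
  have W: "local_fspace ?W" by (rule local_fspace_prod[OF G local_E])
  have "morphism ?W E (\<lambda>(g, e). actG g e)"
  proof (rule morphism_into_E[OF W])
    fix w assume "w \<in> points ?W"
    then obtain g x z where w: "w = (g, ph (x, z))" "g \<in> SLset n" "(x, z) \<in> S'"
      by (auto simp: points_prod_space[OF G local_E] points_E)
    then have x: "x \<in> SLset n" by (simp add: S'_iff)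
    \<comment> \<open>On this box the action lifts to \<open>H\<close>: apply the section of the
      chart centred at \<open>x\<close> and multiply its matrix by the group element.\<close>
    let ?U = "SLset n \<times> Eop x"
    have oG: "openin (zariski (SL_space n)) (SLset n)" using openin_topspace[of "zariski (SL_space n)"] by simp
    have U: "openin (zariski ?W) ?U" by (rule openin_prod_Times[OF G local_E oG Eop_open[OF x]])
    note fa = function_algebra_regular[OF W U]
    have 1: "mat_entries ?U (regular ?W ?U) n n (\<lambda>v. fst v)"
      by (rule mat_entries_pullback[OF G W morphism_fst[OF G local_E] SL_space_regular[OF oG] oG U]) auto
    have 2: "mat_entries ?U (regular ?W ?U) n n (\<lambda>v. fst (secE x (snd v)))"
      by (rule mat_entries_pullback[OF local_E W morphism_snd[OF G local_E] secE_regular(1)[OF x] Eop_open[OF x] U]) auto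
    have 3: "(\<lambda>v. snd (secE x (snd v))) \<in> regular ?W ?U"
      by (rule regular_pullback[OF local_E W morphism_snd[OF G local_E] secE_regular(2)[OF x] Eop_open[OF x] U]) auto
    have 4: "(fst v * fst (secE x (snd v)), snd (secE x (snd v))) \<in> S' \<and>
        (case v of (g, e) \<Rightarrow> actG g e) = ph (fst v * fst (secE x (snd v)), snd (secE x (snd v)))" if v: "v \<in> ?U" for v
    proof -
      obtain g e where ge: "v = (g, e)" "g \<in> SLset n" "e \<in> Eop x" using v by auto
      obtain y t where yt: "secE x e = (y, t)" by fastforce
      then have "(y, t) \<in> S'" "ph (y, t) = e" using secE[OF x ge(3)] by auto
      then show ?thesis using ge yt actG_ph[OF ge(2), of y t] by (auto simp: S'_iff)
    qed
    show "\<exists>U a c. openin (zariski ?W) U \<and> w \<in> U \<and> mat_entries U (regular ?W U) n n a \<and>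
      c \<in> regular ?W U \<and> (\<forall>v\<in>U. (a v, c v) \<in> S' \<and> (case v of (g, e) \<Rightarrow> actG g e) = ph (a v, c v))"
      using U w ph_in_Eop[OF w(3)] mat_entries_mult[OF fa 1 2] 3 4
      by (intro exI[of _ ?U] exI[of _ "\<lambda>v. fst v * fst (secE x (snd v))"] exI[of _ "\<lambda>v. snd (secE x (snd v))"]) simp
  qed
  then show "morphism (prod_space (underlying_variety (SL n)) E) E (\<lambda>(g, e). actG g e)" by simp
qed

lemma algebraic_action_Z: "algebraic_action Gm E actZ"
  unfolding algebraic_action_def
proof
  show "group_action Gm (points E) actZ"
  proof (rule group_actionI[OF group_Gm])
    show "actZ g \<in> extensional (points E)" for g by (simp add: actZ_def)
    show "actZ g e \<in> points E" if "g \<in> carrier Gm" "e \<in> points E" for g e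
      using that by (elim points_EE) (auto simp: actZ_ph S'_iff points_E)
    show "actZ \<one>\<^bsub>Gm\<^esub> e = e" if "e \<in> points E" for e
      using that by (elim points_EE) (auto simp: actZ_ph S'_iff)
    show "actZ (g \<otimes>\<^bsub>Gm\<^esub> h) e = actZ g (actZ h e)"
      if "g \<in> carrier Gm" "h \<in> carrier Gm" "e \<in> points E" for g h e
      using that by (elim points_EE) (auto simp: actZ_ph S'_iff mult.assoc)
  qed
  let ?T = "{v \<in> carrier_vec 1. v $ 0 \<noteq> 0} :: complex vec set"
  let ?Z = "induced_space (vec_coords 1) ?T"
  have Z: "local_fspace ?Z" by (rule local_fspace_induced)
  let ?W = "prod_space ?Z E"
  have W: "local_fspace ?W" by (rule local_fspace_prod[OF Z local_E])
  have "morphism ?W E (\<lambda>(g, e). actZ g e)"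
  proof (rule morphism_into_E[OF W])
    fix w assume "w \<in> points ?W"
    then obtain t x z where w: "w = (t, ph (x, z))" "t \<in> ?T" "(x, z) \<in> S'"
      unfolding points_prod_space[OF Z local_E] points_induced_space by (auto simp: points_E)
    then have x: "x \<in> SLset n" by (simp add: S'_iff)
    let ?U = "?T \<times> Eop x"
    have oZ: "openin (zariski ?Z) ?T" using openin_topspace[of "zariski ?Z"] by simp
    have U: "openin (zariski ?W) ?U" by (rule openin_prod_Times[OF Z local_E oZ Eop_open[OF x]])
    note fa = function_algebra_regular[OF W U]
    have 1: "(\<lambda>v. fst v $ 0) \<in> regular ?W ?U"
      by (rule regular_pullback[OF Z W morphism_fst[OF Z local_E] _ oZ U, of "\<lambda>v. v $ 0"]) (auto intro: coord_regular_vec)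
    have 2: "mat_entries ?U (regular ?W ?U) n n (\<lambda>v. fst (secE x (snd v)))"
      by (rule mat_entries_pullback[OF local_E W morphism_snd[OF Z local_E] secE_regular(1)[OF x] Eop_open[OF x] U]) auto
    have 3: "(\<lambda>v. snd (secE x (snd v))) \<in> regular ?W ?U"
      by (rule regular_pullback[OF local_E W morphism_snd[OF Z local_E] secE_regular(2)[OF x] Eop_open[OF x] U]) auto
    have 4: "(fst (secE x (snd v)), fst v $ 0 * snd (secE x (snd v))) \<in> S' \<and>
        (case v of (g, e) \<Rightarrow> actZ g e) = ph (fst (secE x (snd v)), fst v $ 0 * snd (secE x (snd v)))" if v: "v \<in> ?U" for v
    proof -
      obtain g e where ge: "v = (g, e)" "g $ 0 \<noteq> 0" "e \<in> Eop x" using v by auto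
      obtain y t where yt: "secE x e = (y, t)" by fastforce
      then have "(y, t) \<in> S'" "ph (y, t) = e" using secE[OF x ge(3)] by auto
      then show ?thesis using ge yt actZ_ph[OF ge(2), of y t] by (auto simp: S'_iff)
    qed
    show "\<exists>U a c. openin (zariski ?W) U \<and> w \<in> U \<and> mat_entries U (regular ?W U) n n a \<and>
      c \<in> regular ?W U \<and> (\<forall>v\<in>U. (a v, c v) \<in> S' \<and> (case v of (g, e) \<Rightarrow> actZ g e) = ph (a v, c v))"
      using U w ph_in_Eop[OF w(3)] 2 fa_mult[OF fa 1 3] 4
      by (intro exI[of _ ?U] exI[of _ "\<lambda>v. fst (secE x (snd v))"] exI[of _ "\<lambda>v. fst v $ 0 * snd (secE x (snd v))"]) simp
  qed
  then show "morphism (prod_space (underlying_variety Gm) E) E (\<lambda>(z, e). actZ z e)" by simp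
qed

text \<open>The section of the base supplies the trivialisation: \<open>(u, t)\<close> goes to the
  class of \<open>(secX a u, t)\<close>. Its inverse reads the fibre coordinate off the second
  component of \<open>secE\<close>, which is \<open>t\<close> because \<open>rfac\<close> is trivial
  on the cell.\<close>

lemma local_triviality:
  assumes "x \<in> points X"
  shows "\<exists>U \<tau>. openin (zariski X) U \<and> x \<in> U \<and>
        isomorphism (prod_space (open_subspace X U) (underlying_variety Gm))
                    (open_subspace E {e \<in> points E. proj e \<in> U}) \<tau> \<and>
        (\<forall>u\<in>U. \<forall>z\<in>carrier Gm. proj (\<tau> (u, z)) = u \<and>
           (\<forall>z'\<in>carrier Gm. \<tau> (u, z' \<otimes>\<^bsub>Gm\<^esub> z) = actZ z' (\<tau> (u, z))))"
proof -
  obtain a where a: "a \<in> SLset n" "x = p a" using assms by (auto simp: points_X)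
  let ?T = "{v \<in> carrier_vec 1. v $ 0 \<noteq> 0} :: complex vec set"
  let ?Z = "induced_space (vec_coords 1) ?T" and ?XU = "open_subspace X (Xop a)" and ?EU = "open_subspace E (Eop a)"
  let ?\<tau> = "\<lambda>(u, t :: complex vec). ph (secX a u, t $ 0)"
  have Z: "local_fspace ?Z" by (rule local_fspace_induced)
  have XU: "local_fspace ?XU" by (rule local_fspace_open_subspace[OF local_X Xop_open[OF a(1)]])
  have EU: "local_fspace ?EU" by (rule local_fspace_open_subspace[OF local_E Eop_open[OF a(1)]])
  let ?W = "prod_space ?XU ?Z"
  have W: "local_fspace ?W" by (rule local_fspace_prod[OF XU Z])
  have pXU: "points ?XU = Xop a" using openin_subset[OF Xop_open[OF a(1)]] by auto
  have pEU: "points ?EU = Eop a" using openin_subset[OF Eop_open[OF a(1)]] by auto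
  have pW: "points ?W = Xop a \<times> ?T" unfolding points_prod_space[OF XU Z] pXU by simp
  have mW: "fst v \<in> Xop a" "snd v \<in> ?T" if "v \<in> points ?W" for v using that unfolding pW by auto
  have oXU: "openin (zariski ?XU) (Xop a)" using openin_topspace[of "zariski ?XU"] by (simp add: pXU del: points_open_subspace)
  have tau: "(secX a u, t $ 0) \<in> S'" "ph (secX a u, t $ 0) \<in> Eop a" "proj (ph (secX a u, t $ 0)) = u"
     "snd (secE a (ph (secX a u, t $ 0))) = t $ 0" if ut: "u \<in> Xop a" "t \<in> ?T" for u t
  proof -
    obtain y where y: "y \<in> SLset n" "u = p y" "adj_mat a * y \<in> big" using XopE[OF ut(1) a(1)] .
    have s: "secX a u = a * ufac (adj_mat a * y)" using secX_p[OF a(1) y(1,3)] y by simp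
    have c: "ufac (adj_mat a * y) \<in> cell" by (rule ufac_cell[OF y(3)])
    have as: "adj_mat a * secX a u = ufac (adj_mat a * y)" unfolding s using SLset_cancel(1)[OF a(1) cell_SL[OF c]] .
    show S: "(secX a u, t $ 0) \<in> S'" using secX(1)[OF a(1) ut(1)] ut(2) by (simp add: S'_iff)
    have b: "adj_mat a * secX a u \<in> big" unfolding as by (rule cell_big[OF c])
    show "ph (secX a u, t $ 0) \<in> Eop a" using Eop_iff[OF a(1) S] b by simp
    show "proj (ph (secX a u, t $ 0)) = u" using proj_ph[OF S] secX(2)[OF a(1) ut(1)] by simp
    show "snd (secE a (ph (secX a u, t $ 0))) = t $ 0"
      using secE_ph[OF a(1) S b] by (simp add: sec_def as rfac_cell[OF c])
  qed
  have "morphism ?W E ?\<tau>"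
  proof (rule morphism_into_E[OF W])
    fix w assume w: "w \<in> points ?W"
    let ?U = "points ?W"
    have U: "openin (zariski ?W) ?U" by simp
    have 1: "mat_entries ?U (regular ?W ?U) n n (\<lambda>v. secX a (fst v))"
      by (rule mat_entries_pullback[OF XU W morphism_fst[OF XU Z] _ oXU U])
        (use secX_regular[OF a(1)] mW(1) in \<open>unfold regular_open_subspace, blast+\<close>)
    have oZ: "openin (zariski ?Z) ?T" using openin_topspace[of "zariski ?Z"] by simp
    have 2: "(\<lambda>v. snd v $ 0) \<in> regular ?W ?U"
      by (rule regular_pullback[OF Z W morphism_snd[OF XU Z] _ oZ U, of "\<lambda>v. v $ 0"])
        (use mW(2) in \<open>blast intro: coord_regular_vec\<close>)+
    show "\<exists>U aa c. openin (zariski ?W) U \<and> w \<in> U \<and> mat_entries U (regular ?W U) n n aa \<and>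
      c \<in> regular ?W U \<and> (\<forall>v\<in>U. (aa v, c v) \<in> S' \<and> ?\<tau> v = ph (aa v, c v))"
      using U w 1 2 tau(1)
      by (intro exI[of _ ?U] exI[of _ "\<lambda>v. secX a (fst v)"] exI[of _ "\<lambda>v. snd v $ 0"] conjI ballI)
        (use mW in \<open>simp_all add: case_prod_unfold\<close>)
  qed
  then have m1: "morphism ?W ?EU ?\<tau>"
    by (rule morphism_into_open_subspace[OF _ Eop_open[OF a(1)]])
      (use mW tau(2) in \<open>simp add: case_prod_unfold\<close>)
  let ?\<sigma> = "\<lambda>e. (proj e, vec 1 (\<lambda>_. snd (secE a e)))"
  have proj_in: "proj e \<in> Xop a" if "e \<in> Eop a" for e using proj_Eop[OF a(1)] that by auto
  have "morphism ?EU ?Z (\<lambda>e. vec 1 (\<lambda>_. snd (secE a e)))"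
  proof (rule morphism_induced[OF EU])
    show "vec 1 (\<lambda>_. snd (secE a e)) \<in> ?T" if "e \<in> points ?EU" for e
      using secE(1)[OF a(1), of e] that pEU by (auto simp: S'_def)
    show "(\<lambda>e. c (vec 1 (\<lambda>_. snd (secE a e)))) \<in> regular ?EU (points ?EU)" if "c \<in> vec_coords 1" for c
      using that secE_regular(2)[OF a(1)] by (auto simp: vec_coords_def pEU simp del: points_open_subspace)
  qed
  then have m2: "morphism ?EU ?W ?\<sigma>"
    using proj_in pEU
    by (intro morphism_pair[OF XU Z EU] morphism_into_open_subspace[OF morphism_restrict[OF local_E morphism_proj Eop_open[OF a(1)]] Xop_open[OF a(1)]])
      auto
  have "isomorphism ?W ?EU ?\<tau>"
  proof (rule isomorphismI[OF EU m1 m2])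
    fix w assume "w \<in> points ?W"
    then obtain u t where w: "w = (u, t)" "u \<in> Xop a" "t \<in> ?T" unfolding pW by auto
    have "vec 1 (\<lambda>_. t $ 0) = t" using w(3) by (intro eq_vecI) auto
    then show "?\<sigma> (?\<tau> w) = w" using tau(3,4)[OF w(2,3)] w by simp
  next
    fix e assume "e \<in> points ?EU"
    then have e: "e \<in> Eop a" using pEU by simp
    obtain y z where y: "(y, z) \<in> S'" "e = ph (y, z)" "adj_mat a * y \<in> big" using EopE[OF e a(1)] .
    then have "(secX a (proj e), snd (secE a e)) = secE a e"
      using secX_p[OF a(1), of y] by (simp add: proj_ph secE_ph[OF a(1)] sec_def S'_iff)
    then show "?\<tau> (?\<sigma> e) = e" using secE(2)[OF a(1) e] by simp
  qed
  moreover have "?\<tau> (u, z' \<otimes>\<^bsub>Gm\<^esub> z) = actZ z' (?\<tau> (u, z))" if "u \<in> Xop a" "z \<in> ?T" "z' \<in> ?T" for u z z'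
    using actZ_ph[of z' "secX a u" "z $ 0"] tau(1)[OF that(1,2)] that by simp
  ultimately show ?thesis
    using Xop_open[OF a(1)] p_in_Xop[OF a(1)] a(2) tau(3) proj_Eop[OF a(1)]
    by (intro exI[of _ "Xop a"] exI[of _ ?\<tau>]) auto
qed

section \<open>Both spaces are varieties\<close>

definition cellmat :: "complex vec \<Rightarrow> complex mat" where
  "cellmat v = mat n n (\<lambda>(i, j). if R i j then (if i = j then 1 else 0)
     else v $ (THE b. b < N \<and> ei b = i \<and> ej b = j))"

lemma cellmat_index:
  assumes "b < N"
  shows "cellmat v $$ (ei b, ej b) = v $ b"
proof -
  have "(THE c. c < N \<and> ei c = ei b \<and> ej c = ej b) = b"
    by (rule the_equality) (use assms e_inj in auto)
  then show ?thesis using e_range[OF assms] by (simp add: cellmat_def)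
qed

lemma cellmat_cell [simp]: "cellmat v \<in> cell" by (simp add: cell_def cellmat_def)

lemma cell_eqI:
  assumes "A \<in> cell" "B \<in> cell" "\<And>b. b < N \<Longrightarrow> A $$ (ei b, ej b) = B $$ (ei b, ej b)"
  shows "A = B"
proof (rule eq_matI)
  fix i j assume "i < dim_row B" "j < dim_col B"
  then have ij: "i < n" "j < n" using cell_carrier[OF assms(2)] by auto
  show "A $$ (i, j) = B $$ (i, j)"
  proof (cases "R i j")
    case True
    then show ?thesis using ij cell_index[OF assms(1)] cell_index[OF assms(2)] by simp
  next
    case False
    then obtain b where "b < N" "ei b = i" "ej b = j" using e_surj ij by blast
    then show ?thesis using assms(3) by auto
  qed
qed (use cell_carrier[OF assms(1)] cell_carrier[OF assms(2)] in auto)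

lemma cellmat_of_cell: "A \<in> cell \<Longrightarrow> (\<And>b. b < N \<Longrightarrow> v $ b = A $$ (ei b, ej b)) \<Longrightarrow> cellmat v = A"
  by (rule cell_eqI) (auto simp: cellmat_index)

lemma cellmat_regular:
  assumes fa: "function_algebra D F" and v: "\<And>b. b < N \<Longrightarrow> (\<lambda>x. v x $ b) \<in> F"
  shows "mat_entries D F n n (\<lambda>x. cellmat (v x))"
  unfolding cellmat_def
proof (rule mat_entries_mat[OF fa])
  fix i j assume ij: "i < n" "j < n"
  show "(\<lambda>x. (\<lambda>(i, j). if R i j then (if i = j then 1 else 0) else v x $ (THE b. b < N \<and> ei b = i \<and> ej b = j)) (i, j)) \<in> F"
  proof (cases "R i j")
    case True
    then show ?thesis using fa_const[OF fa] by simp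
  next
    case False
    then obtain b where b: "b < N" "ei b = i" "ej b = j" using e_surj ij by blast
    have "(THE c. c < N \<and> ei c = i \<and> ej c = j) = b" by (rule the_equality) (use b e_inj in auto)
    then show ?thesis using False v[OF b(1)] by simp
  qed
qed

abbreviation A_N :: "complex vec fspace" where "A_N \<equiv> induced_space (vec_coords N) (carrier_vec N)"

definition chartX :: "complex mat \<Rightarrow> 'x \<Rightarrow> complex vec" where
  "chartX g x = vec N (\<lambda>b. (adj_mat g * secX g x) $$ (ei b, ej b))"

lemma chartX_p:
  assumes "g \<in> SLset n" "x \<in> SLset n" "adj_mat g * x \<in> big"
  shows "chartX g (p x) = vec N (\<lambda>b. ufac (adj_mat g * x) $$ (ei b, ej b))"
  using secX_p[OF assms] SLset_cancel(1)[OF assms(1) cell_SL[OF ufac_cell[OF assms(3)]]] by (simp add: chartX_def)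

text \<open>An instance of \<open>quotient_chart\<close>: \<open>v \<mapsto> g * cellmat v\<close>
  is the section, and the entries of \<open>ufac\<close> outside \<open>R\<close> form the
  retraction.\<close>

lemma chartX_iso:
  assumes g: "g \<in> SLset n"
  shows "isomorphism (open_subspace X (Xop g)) A_N (chartX g)"
  unfolding X_def
proof (rule quotient_chart[where \<phi>="\<lambda>v. g * cellmat v" and \<psi>="\<lambda>x. vec N (\<lambda>b. ufac (adj_mat g * x) $$ (ei b, ej b))"])
  let ?\<psi> = "\<lambda>x. vec N (\<lambda>b. ufac (adj_mat g * x) $$ (ei b, ej b))"
  show "local_fspace (SL_space n)" "local_fspace A_N" by (rule local_fspace_induced)+
  show "openin (zariski (quotient_space (SL_space n) p)) (Xop g)" using Xop_open[OF g] by (simp add: X_def)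
  have ag: "adj_mat g * (g * cellmat v) = cellmat v" for v by (rule SLset_cancel(1)[OF g cell_SL]) simp
  have SL: "g * cellmat v \<in> SLset n" for v using g cell_SL by simp
  have fa: "function_algebra (points A_N) (regular A_N (points A_N))"
    by (rule function_algebra_regular[OF local_fspace_induced openin_topspace])
  show "morphism A_N (SL_space n) (\<lambda>v. g * cellmat v)"
    by (intro morphism_SL_space local_fspace_induced SL
        mat_entries_left[OF fa SLset_carrier[OF g] cellmat_regular[OF fa coord_regular_vec]])
  show "p (g * cellmat v) \<in> Xop g" for v
    unfolding Xop_iff[OF g SL] ag by (simp add: cell_big)
  show "?\<psi> (g * cellmat v) = v" if "v \<in> points A_N" for v
    unfolding ag using that by (intro eq_vecI) (auto simp: ufac_of_cell cellmat_index)
  let ?U = "{x \<in> SLset n. adj_mat g * x \<in> big}"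
  have o: "openin (zariski (SL_space n)) ?U" by (rule open_chart_SL[OF g])
  note faU = function_algebra_regular[OF local_fspace_induced o]
  have M: "mat_entries ?U (regular (SL_space n) ?U) n n (\<lambda>x. ufac (adj_mat g * x))"
    by (intro regular_rfac(2)[OF local_fspace_induced o]
        mat_entries_left[OF faU SLset_carrier[OF SLset_adj(1)[OF g]]] SL_space_regular[OF o]) auto
  have pU: "points (open_subspace (SL_space n) ?U) = ?U" by auto
  show "morphism (open_subspace (SL_space n) {x \<in> points (SL_space n). p x \<in> Xop g}) A_N ?\<psi>"
    unfolding preimage_Xop[OF g]
  proof (rule morphism_induced[OF local_fspace_open_subspace[OF local_fspace_induced o]])
    fix c assume "c \<in> vec_coords N"
    then obtain b where "b < N" "c = (\<lambda>v. v $ b)" by (auto simp: vec_coords_def)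
    then show "(\<lambda>x. c (?\<psi> x)) \<in> regular (open_subspace (SL_space n) ?U) (points (open_subspace (SL_space n) ?U))"
      unfolding pU using mat_entriesD[OF faU M] e_range[of b] by simp
  qed auto
  fix x assume "x \<in> points (SL_space n)" "p x \<in> Xop g"
  then have x: "x \<in> SLset n" "adj_mat g * x \<in> big" using Xop_iff[OF g] by auto
  show "chartX g (p x) = ?\<psi> x" by (rule chartX_p[OF g x])
  have "cellmat (?\<psi> x) = ufac (adj_mat g * x)" by (rule cellmat_of_cell[OF ufac_cell[OF x(2)]]) simp
  then have "g * cellmat (?\<psi> x) = secX g (p x)" using secX_p[OF g x] by simp
  then show "p (g * cellmat (?\<psi> x)) = p x" using secX(2)[OF g] Xop_iff[OF g x(1)] x(2) by simp
qed

text \<open>After the \<open>N\<close> cell coordinates come the fibre coordinate and its inverse.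
  The second one turns the open condition that the fibre coordinate be nonzero into a closed
  equation, so that the charts of \<open>E\<close> are affine varieties.\<close>

definition hyperbola :: "complex vec set" where
  "hyperbola = {v \<in> carrier_vec (N + 2). v $ N * v $ (N + 1) = 1}"

abbreviation E_N :: "complex vec fspace" where "E_N \<equiv> induced_space (vec_coords (N + 2)) hyperbola"

definition chartE :: "complex mat \<Rightarrow> complex mat set \<Rightarrow> complex vec" where
  "chartE g e = vec (N + 2) (\<lambda>b. if b < N then (adj_mat g * fst (secE g e)) $$ (ei b, ej b)
     else if b = N then snd (secE g e) else inverse (snd (secE g e)))"

lemma chartE_iso:
  assumes g: "g \<in> SLset n"
  shows "isomorphism (open_subspace E (Eop g)) E_N (chartE g)"
proof (rule isomorphismI[where g="\<lambda>v. ph (g * cellmat v, v $ N)"])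
  show local_EN: "local_fspace E_N" by (rule local_fspace_induced)
  let ?EU = "open_subspace E (Eop g)"
  have EU: "local_fspace ?EU" by (rule local_fspace_open_subspace[OF local_E Eop_open[OF g]])
  have pEU: "points ?EU = Eop g" using openin_subset[OF Eop_open[OF g]] by auto
  note fE = function_algebra_regular[OF local_E Eop_open[OF g]]
  have nz: "snd (secE g e) \<noteq> 0" if "e \<in> Eop g" for e using secE(1)[OF g that] by (auto simp: S'_def)
  have cell: "adj_mat g * fst (secE g e) \<in> cell \<and> fst (secE g e) \<in> SLset n" if e: "e \<in> Eop g" for e
  proof -
    obtain y z where y: "(y, z) \<in> S'" "e = ph (y, z)" "adj_mat g * y \<in> big" using EopE[OF e g] .
    then show ?thesis using ufac_cell[OF y(3)] SLset_cancel(1)[OF g cell_SL[OF ufac_cell[OF y(3)]]] cell_SL g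
      by (simp add: secE_ph[OF g] sec_def)
  qed
  show "morphism ?EU E_N (chartE g)"
  proof (rule morphism_induced[OF EU])
    show "chartE g e \<in> hyperbola" if "e \<in> points ?EU" for e
      using that nz unfolding pEU by (simp add: chartE_def hyperbola_def)
    fix c assume "c \<in> vec_coords (N + 2)"
    then obtain b where b: "b < N + 2" "c = (\<lambda>v. v $ b)" by (auto simp: vec_coords_def)
    have M: "mat_entries (Eop g) (regular E (Eop g)) n n (\<lambda>e. adj_mat g * fst (secE g e))"
      by (rule mat_entries_left[OF fE SLset_carrier[OF SLset_adj(1)[OF g]] secE_regular(1)[OF g]])
    consider "b < N" | "b = N" | "b = N + 1" using b by linarith
    then show "(\<lambda>e. c (chartE g e)) \<in> regular ?EU (points ?EU)"
    proof cases
      case 1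
      then show ?thesis using b mat_entriesD[OF fE M] e_range[OF 1] unfolding pEU by (simp add: chartE_def)
    next
      case 2
      then show ?thesis using b secE_regular(2)[OF g] unfolding pEU by (simp add: chartE_def)
    next
      case 3
      then show ?thesis using b regular_inverse[OF local_E Eop_open[OF g] secE_regular(2)[OF g] nz] unfolding pEU
        by (simp add: chartE_def)
    qed
  qed
  have fa: "function_algebra (points E_N) (regular E_N (points E_N))"
    by (rule function_algebra_regular[OF local_fspace_induced openin_topspace])
  have S: "(g * cellmat v, v $ N) \<in> S'" if "v \<in> points E_N" for v
    using that g cell_SL by (auto simp: S'_iff hyperbola_def)
  have ag: "adj_mat g * (g * cellmat v) = cellmat v" for v by (rule SLset_cancel(1)[OF g cell_SL]) simp
  have inE: "ph (g * cellmat v, v $ N) \<in> Eop g" if "v \<in> points E_N" for v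
    unfolding Eop_iff[OF g S[OF that]] ag by (simp add: cell_big)
  have "morphism E_N E (\<lambda>v. ph (g * cellmat v, v $ N))"
    by (intro morphism_comp[OF morphism_hat[OF local_EN] morphism_ph] S coord_regular_vec
        mat_entries_left[OF fa SLset_carrier[OF g] cellmat_regular[OF fa coord_regular_vec]]) auto
  then show "morphism E_N ?EU (\<lambda>v. ph (g * cellmat v, v $ N))"
    by (rule morphism_into_open_subspace[OF _ Eop_open[OF g] inE])
  show "ph (g * cellmat (chartE g e), chartE g e $ N) = e" if "e \<in> points ?EU" for e
  proof -
    have e: "e \<in> Eop g" using that unfolding pEU .
    have "cellmat (chartE g e) = adj_mat g * fst (secE g e)"
      by (rule cellmat_of_cell) (use cell[OF e] in \<open>auto simp: chartE_def\<close>)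
    then have "g * cellmat (chartE g e) = fst (secE g e)" using SLset_cancel(2)[OF g] cell[OF e] by simp
    then show ?thesis using secE(2)[OF g e] by (simp add: chartE_def)
  qed
  show "chartE g (ph (g * cellmat v, v $ N)) = v" if v: "v \<in> points E_N" for v
  proof -
    have "secE g (ph (g * cellmat v, v $ N)) = (g * cellmat v, v $ N)"
      using secE_ph[OF g S[OF v]] by (simp add: ag cell_big sec_def ufac_of_cell rfac_cell)
    moreover have "inverse (v $ N) = v $ (N + 1)" using v by (auto simp: hyperbola_def intro: inverse_unique)
    ultimately show ?thesis using v
      by (intro eq_vecI) (auto simp: chartE_def ag cellmat_index hyperbola_def less_Suc_eq)
  qed
qed

lemma hyperbola_closed: "closedin (zariski (affine_space (N + 2))) hyperbola"
proof -
  let ?q = "\<lambda>v :: complex vec. v $ N * v $ (N + 1) - 1"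
  have "?q \<in> polynomial_functions (vec_coords (N + 2))"
    by (intro fa_diff[OF function_algebra_polynomial_functions] polynomial_functions.mult polynomial_functions.const
        polynomial_functions.coord) (auto simp: vec_coords_def)
  then have "openin (zariski (affine_space (N + 2))) {v \<in> carrier_vec (N + 2). ?q v \<noteq> 0}"
    unfolding affine_space_def by (rule openin_induced_principal)
  moreover have "carrier_vec (N + 2) - hyperbola = {v \<in> carrier_vec (N + 2). ?q v \<noteq> 0}" by (auto simp: hyperbola_def)
  ultimately show ?thesis by (auto simp: closedin_def affine_space_def hyperbola_def)
qed

lemma cover_element:
  assumes "x \<in> SLset n"
  obtains g where "g \<in> (\<lambda>\<sigma>. adj_mat (row_permutation n \<sigma>)) ` {\<sigma>. \<sigma> permutes {0..<n}}" "g \<in> SLset n" "adj_mat g * x \<in> big"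
proof -
  obtain \<sigma> where \<sigma>: "\<sigma> permutes {0..<n}" "row_permutation n \<sigma> * x \<in> big" using big_cover[OF assms] by blast
  note sl = row_permutation_SL[OF \<sigma>(1) n]
  show ?thesis by (rule that[of "adj_mat (row_permutation n \<sigma>)"]) (use \<sigma> sl SLset_adj_adj[OF sl] SLset_adj(1)[OF sl] in auto)
qed

lemma cover_finite: "finite ((\<lambda>\<sigma>. adj_mat (row_permutation n \<sigma>)) ` {\<sigma>. \<sigma> permutes {0..<n}})"
  by (intro finite_imageI finite_permutations) simp

lemma cover_SL: "g \<in> (\<lambda>\<sigma>. adj_mat (row_permutation n \<sigma>)) ` {\<sigma>. \<sigma> permutes {0..<n}} \<Longrightarrow> g \<in> SLset n"
  using row_permutation_SL[OF _ n] SLset_adj(1) by auto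

lemma adj_mult_P_iff:
  assumes "a \<in> SLset n" "b \<in> SLset n"
  shows "adj_mat a * b \<in> P \<longleftrightarrow> (\<exists>q\<in>P. b = a * q)"
  using SLset_cancel(1,2)[OF assms(1)] assms P_SL by (metis SLset_cancel(1,2))

lemma variety_X: "variety X"
  unfolding variety_def
proof (intro conjI)
  show "space_with_functions X" using local_X by (simp add: local_fspace_def)
  let ?F = "(\<lambda>\<sigma>. adj_mat (row_permutation n \<sigma>)) ` {\<sigma>. \<sigma> permutes {0..<n}}"
  have "\<Union>(Xop ` ?F) = points X"
  proof
    show "\<Union>(Xop ` ?F) \<subseteq> points X" unfolding points_X Xop_def by auto
    show "points X \<subseteq> \<Union>(Xop ` ?F)"
    proof
      fix x assume "x \<in> points X"
      then obtain a where a: "a \<in> SLset n" "x = p a" by (auto simp: points_X)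
      obtain g where g: "g \<in> ?F" "g \<in> SLset n" "adj_mat g * a \<in> big" using cover_element[OF a(1)] .
      then show "x \<in> \<Union>(Xop ` ?F)" using a Xop_iff[OF g(2) a(1)] by blast
    qed
  qed
  moreover have "affine_variety (open_subspace X (Xop g))" if "g \<in> ?F" for g
    unfolding affine_variety_def
    using chartX_iso[OF cover_SL[OF that]] closedin_topspace[of "zariski (affine_space N)"]
    by (intro exI[of _ N] exI[of _ "carrier_vec N"] exI[of _ "chartX g"]) (simp add: affine_space_def)
  ultimately show "\<exists>\<U>. finite \<U> \<and> \<Union>\<U> = points X \<and>
        (\<forall>U\<in>\<U>. openin (zariski X) U \<and> affine_variety (open_subspace X U))"
    using cover_finite Xop_open[OF cover_SL] by (intro exI[of _ "Xop ` ?F"]) auto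
  show "closedin (zariski (prod_space X X)) {(x, x) | x. x \<in> points X}"
  proof (rule closedin_diagonal[OF local_X])
    fix x y assume "x \<in> points X" "y \<in> points X" and xy: "x \<noteq> y"
    then obtain a b where a: "a \<in> SLset n" "x = p a" and b: "b \<in> SLset n" "y = p b" by (auto simp: points_X)
    let ?W = "Xop a \<times> Xop b" and ?PP = "prod_space X X"
    let ?M = "\<lambda>w. adj_mat (secX a (fst w)) * secX b (snd w)"
    \<comment> \<open>Distinct cosets are separated by an entry outside \<open>R\<close> of the
      quotient of the two local sections. At a diagonal point both sections lie in the same coset,
      so the entry vanishes; at \<open>(x, y)\<close> the sections return \<open>a\<close> and
      \<open>b\<close>.\<close>
    have "adj_mat a * b \<notin> P" using adj_mult_P_iff[OF a(1) b(1)] p_eq[OF a(1) b(1)] xy a b by auto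
    then obtain i j where ij: "i < n" "j < n" "\<not> R i j" "(adj_mat a * b) $$ (i, j) \<noteq> 0"
      using a b SLset_adj(1)[OF a(1)] by (auto simp: pattern_group_def)
    have W: "openin (zariski ?PP) ?W" by (intro openin_prod_Times local_X Xop_open a b)
    have PP: "local_fspace ?PP" by (rule local_fspace_prod[OF local_X local_X])
    note fa = function_algebra_regular[OF PP W]
    have M: "mat_entries ?W (regular ?PP ?W) n n ?M"
      by (intro mat_entries_mult[OF fa, where k=n] mat_entries_adj[OF fa]
          mat_entries_pullback[OF local_X PP morphism_fst[OF local_X local_X] secX_regular[OF a(1)] Xop_open[OF a(1)] W]
          mat_entries_pullback[OF local_X PP morphism_snd[OF local_X local_X] secX_regular[OF b(1)] Xop_open[OF b(1)] W]) auto
    have "?M (z, z) $$ (i, j) = 0" if z: "(z, z) \<in> ?W" for z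
    proof -
      have s: "secX a z \<in> SLset n" "secX b z \<in> SLset n" "p (secX a z) = p (secX b z)"
        using secX[OF a(1)] secX[OF b(1)] z by auto
      then have "?M (z, z) \<in> P" using adj_mult_P_iff p_eq by auto
      then show ?thesis using P_zero ij by blast
    qed
    then show "\<exists>W F. openin (zariski ?PP) W \<and> (x, y) \<in> W \<and> F \<in> regular ?PP W \<and>
        F (x, y) \<noteq> 0 \<and> (\<forall>z. (z, z) \<in> W \<longrightarrow> F (z, z) = 0)"
      using W mat_entriesD[OF fa M ij(1,2)] a b ij(4) p_in_Xop secX_center
      by (intro exI[of _ ?W] exI[of _ "\<lambda>w. ?M w $$ (i, j)"]) auto
  qed
qed

lemma variety_E: "variety E"
  unfolding variety_def
proof (intro conjI)
  show "space_with_functions E" using local_E by (simp add: local_fspace_def)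
  let ?F = "(\<lambda>\<sigma>. adj_mat (row_permutation n \<sigma>)) ` {\<sigma>. \<sigma> permutes {0..<n}}"
  have "\<Union>(Eop ` ?F) = points E"
  proof
    show "\<Union>(Eop ` ?F) \<subseteq> points E" unfolding points_E Eop_def by auto
    show "points E \<subseteq> \<Union>(Eop ` ?F)"
    proof
      fix x assume "x \<in> points E"
      then obtain a z where a: "(a, z) \<in> S'" "x = ph (a, z)" by (auto simp: points_E)
      then have aS: "a \<in> SLset n" by (simp add: S'_iff)
      obtain g where g: "g \<in> ?F" "g \<in> SLset n" "adj_mat g * a \<in> big" using cover_element[OF aS] .
      then show "x \<in> \<Union>(Eop ` ?F)" using a Eop_iff[OF g(2) a(1)] by blast
    qed
  qed
  moreover have "affine_variety (open_subspace E (Eop g))" if "g \<in> ?F" for g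
    unfolding affine_variety_def
    using chartE_iso[OF cover_SL[OF that]] hyperbola_closed
    by (intro exI[of _ "N + 2"] exI[of _ hyperbola] exI[of _ "chartE g"]) simp
  ultimately show "\<exists>\<U>. finite \<U> \<and> \<Union>\<U> = points E \<and>
        (\<forall>U\<in>\<U>. openin (zariski E) U \<and> affine_variety (open_subspace E U))"
    using cover_finite Eop_open[OF cover_SL] by (intro exI[of _ "Eop ` ?F"]) auto
  show "closedin (zariski (prod_space E E)) {(x, x) | x. x \<in> points E}"
  proof (rule closedin_diagonal[OF local_E])
    fix x y assume "x \<in> points E" "y \<in> points E" and xy: "x \<noteq> y"
    then obtain a s b t where a: "(a, s) \<in> S'" "x = ph (a, s)" and b: "(b, t) \<in> S'" "y = ph (b, t)"
      by (auto simp: points_E)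
    then have aS: "a \<in> SLset n" and bS: "b \<in> SLset n" by (auto simp: S'_iff)
    let ?W = "Eop a \<times> Eop b" and ?PP = "prod_space E E"
    let ?M = "\<lambda>w. adj_mat (fst (secE a (fst w))) * fst (secE b (snd w))"
    \<comment> \<open>This compares fibre coordinates after transport by \<open>?M\<close>. As
      \<open>chi\<close> is given by a determinant in the entries, the expression is regular also
      where \<open>?M\<close> leaves \<open>P\<close>.\<close>
    let ?c = "\<lambda>w. chi (?M w) * snd (secE b (snd w)) - snd (secE a (fst w))"
    have W: "openin (zariski ?PP) ?W" by (intro openin_prod_Times local_E Eop_open aS bS)
    have PP: "local_fspace ?PP" by (rule local_fspace_prod[OF local_E local_E])
    note fa = function_algebra_regular[OF PP W]
    note f1 = morphism_fst[OF local_E local_E] and f2 = morphism_snd[OF local_E local_E]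
    have M: "mat_entries ?W (regular ?PP ?W) n n ?M"
      by (intro mat_entries_mult[OF fa, where k=n] mat_entries_adj[OF fa]
          mat_entries_pullback[OF local_E PP f1 secE_regular(1)[OF aS] Eop_open[OF aS] W]
          mat_entries_pullback[OF local_E PP f2 secE_regular(1)[OF bS] Eop_open[OF bS] W]) auto
    have c: "?c \<in> regular ?PP ?W"
      by (intro fa_diff[OF fa] fa_mult[OF fa] fa_chi[OF fa M]
          regular_pullback[OF local_E PP f1 secE_regular(2)[OF aS] Eop_open[OF aS] W]
          regular_pullback[OF local_E PP f2 secE_regular(2)[OF bS] Eop_open[OF bS] W]) auto
    have diag: "?M (z, z) \<in> P \<and> ?c (z, z) = 0" if z: "(z, z) \<in> ?W" for z
    proof -
      obtain a' s' b' t' where st: "secE a z = (a', s')" "secE b z = (b', t')" by fastforce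
      have s: "(a', s') \<in> S'" "(b', t') \<in> S'" "ph (a', s') = ph (b', t')"
        using secE[OF aS] secE[OF bS] z st by (metis SigmaD1 SigmaD2)+
      obtain q where q: "q \<in> P" "b' = a' * q" "t' = inverse (chi q) * s'" using ph_eq[OF s(1,2)] s(3) by blast
      have "adj_mat a' * b' = q" using q s(1) P_SL SLset_cancel(1) by (auto simp: S'_iff)
      then show ?thesis using q st chi_nonzero[OF q(1)] by simp
    qed
    have cen: "secE a x = (a, s)" "secE b y = (b, t)" using secE_center a b by auto
    show "\<exists>W F. openin (zariski ?PP) W \<and> (x, y) \<in> W \<and> F \<in> regular ?PP W \<and>
        F (x, y) \<noteq> 0 \<and> (\<forall>z. (z, z) \<in> W \<longrightarrow> F (z, z) = 0)"
    \<comment> \<open>If the two points lie in the same fibre, their fibre coordinates must differ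
      and \<open>?c\<close> separates them; otherwise the base points differ and an entry outside
      \<open>R\<close> does.\<close>
    proof (cases "adj_mat a * b \<in> P")
      case True
      then have "t \<noteq> inverse (chi (adj_mat a * b)) * s"
        using ph_eq[OF a(1) b(1)] xy a b SLset_cancel(2)[OF aS bS] by auto
      then have "?c (x, y) \<noteq> 0" using cen chi_nonzero[OF True] by (auto simp: field_simps)
      then show ?thesis using W c diag a b ph_in_Eop
        by (intro exI[of _ ?W] exI[of _ ?c]) auto
    next
      case False
      then obtain i j where ij: "i < n" "j < n" "\<not> R i j" "(adj_mat a * b) $$ (i, j) \<noteq> 0"
        using aS bS SLset_adj(1)[OF aS] by (auto simp: pattern_group_def)
      then show ?thesis using W mat_entriesD[OF fa M ij(1,2)] diag P_zero a b ph_in_Eop cen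
        by (intro exI[of _ ?W] exI[of _ "\<lambda>w. ?M w $$ (i, j)"]) auto
    qed
  qed
qed

theorem equivariant_bundle_E:
  assumes act: "\<And>g a. g \<in> SLset n \<Longrightarrow> a \<in> SLset n \<Longrightarrow> actX g (p a) = p (g * a)"
  shows "equivariant_principal_bundle (SL n) actG actX Gm E actZ proj X"
  unfolding equivariant_principal_bundle_def principal_bundle_def
proof (intro conjI ballI)
  fix g e assume "g \<in> carrier (SL n)" "e \<in> points E"
  then obtain x z where g: "g \<in> SLset n" and xz: "(x, z) \<in> S'" "e = ph (x, z)" by (auto simp: points_E)
  then have gx: "(g * x, z) \<in> S'" by (simp add: S'_iff)
  show "proj (actG g e) = actX g (proj e)"
    using g xz gx act[of g x] by (simp add: actG_ph proj_ph S'_iff)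
  fix t assume "t \<in> carrier Gm"
  then show "actG g (actZ t e) = actZ t (actG g e)"
    using g xz gx by (simp add: actG_ph actZ_ph S'_iff)
qed (use variety_X variety_E morphism_proj algebraic_action_Z algebraic_action_G local_triviality in auto)

end

section \<open>Tangent vectors\<close>

context
  fixes X :: "'a fspace" and x D U
  assumes X: "local_fspace X" and D: "D \<in> tangent_space X x"
    and U: "openin (zariski X) U" and x: "x \<in> U"
begin

lemma regular_at_U: "f \<in> regular X U \<Longrightarrow> regular_at X x f"
  using U x unfolding regular_at_def by blast

lemma tangent_rules:
  assumes "regular_at X x f" "regular_at X x g"
  shows "(\<exists>U. openin (zariski X) U \<and> x \<in> U \<and> (\<forall>y\<in>U. f y = g y)) \<longrightarrow> D f = D g"
    and "\<forall>a b. D (\<lambda>y. a * f y + b * g y) = a * D f + b * D g"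
    and "D (\<lambda>y. f y * g y) = f x * D g + g x * D f"
proof -
  have "\<forall>f g. regular_at X x f \<and> regular_at X x g \<longrightarrow>
        ((\<exists>U. openin (zariski X) U \<and> x \<in> U \<and> (\<forall>y\<in>U. f y = g y)) \<longrightarrow> D f = D g) \<and>
        (\<forall>a b. D (\<lambda>y. a * f y + b * g y) = a * D f + b * D g) \<and>
        D (\<lambda>y. f y * g y) = f x * D g + g x * D f"
    using D[unfolded tangent_space_def mem_Collect_eq] by (rule conjunct2)
  note a = this[THEN spec, of f, THEN spec, of g, THEN mp, OF conjI, OF assms]
  show "(\<exists>U. openin (zariski X) U \<and> x \<in> U \<and> (\<forall>y\<in>U. f y = g y)) \<longrightarrow> D f = D g" by (rule a[THEN conjunct1])
  show "\<forall>a b. D (\<lambda>y. a * f y + b * g y) = a * D f + b * D g" by (rule a[THEN conjunct2, THEN conjunct1])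
  show "D (\<lambda>y. f y * g y) = f x * D g + g x * D f" by (rule a[THEN conjunct2, THEN conjunct2])
qed

lemma der_cong:
  assumes f: "f \<in> regular X U" and eq: "\<And>y. y \<in> U \<Longrightarrow> g y = f y"
  shows "D g = D f"
proof -
  have "g \<in> regular X U" by (rule regular_cong[OF X U f eq])
  then have "regular_at X x g" "regular_at X x f" using f regular_at_U by auto
  from tangent_rules(1)[OF this] show ?thesis using U x eq by blast
qed

lemma der_add: "f \<in> regular X U \<Longrightarrow> g \<in> regular X U \<Longrightarrow> D (\<lambda>y. f y + g y) = D f + D g"
  using tangent_rules(2)[OF regular_at_U regular_at_U, THEN spec, of f g 1, THEN spec, of 1] by simp

lemma der_mult: "f \<in> regular X U \<Longrightarrow> g \<in> regular X U \<Longrightarrow> D (\<lambda>y. f y * g y) = f x * D g + g x * D f"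
  using tangent_rules(3)[OF regular_at_U regular_at_U] by blast

lemma der_const: "D (\<lambda>_. c) = 0"
proof -
  have r: "(\<lambda>_. c) \<in> regular X U" for c by (rule fa_const[OF function_algebra_regular[OF X U]])
  have "D (\<lambda>_. 1) = 0" using der_mult[OF r[of 1] r[of 1]] by simp
  then show ?thesis
    using tangent_rules(2)[OF regular_at_U[OF r[of 1]] regular_at_U[OF r[of 1]], THEN spec, of c, THEN spec, of 0] by simp
qed

lemma der_scale: "f \<in> regular X U \<Longrightarrow> D (\<lambda>y. c * f y) = c * D f"
  using der_mult[OF fa_const[OF function_algebra_regular[OF X U]], of f c] der_const by simp

lemma der_sum:
  assumes "\<And>i. i \<in> I \<Longrightarrow> f i \<in> regular X U"
  shows "D (\<lambda>y. \<Sum>i\<in>I. f i y) = (\<Sum>i\<in>I. D (f i))"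
  using assms
proof (induction I rule: infinite_finite_induct)
  case (insert i I)
  then show ?case
    using der_add[of "f i" "\<lambda>y. \<Sum>i\<in>I. f i y"] fa_sum[OF function_algebra_regular[OF X U], of I f] by simp
qed (simp_all add: der_const)

end

lemma regular_at_morphism:
  assumes f: "morphism X Y \<phi>" and x: "x \<in> points X" and r: "regular_at Y (\<phi> x) g"
  shows "regular_at X x (g \<circ> \<phi>)"
proof -
  obtain U where U: "openin (zariski Y) U" "\<phi> x \<in> U" "g \<in> regular Y U" using r unfolding regular_at_def by blast
  then show ?thesis unfolding regular_at_def
    using morphismD(2)[OF f U(1)] morphismD(3)[OF f U(1,3)] x by blast
qed

lemma differential_tangent:
  assumes X: "local_fspace X" and Y: "local_fspace Y" and f: "morphism X Y \<phi>" and x: "x \<in> points X"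
    and D: "D \<in> tangent_space X x"
  shows "differential X Y \<phi> x D \<in> tangent_space Y (\<phi> x)"
proof -
  let ?D = "differential X Y \<phi> x D"
  have T: "openin (zariski X) (points X)" by (rule openin_topspace)
  note rules = tangent_rules[OF X D T x]
  have "((\<exists>U. openin (zariski Y) U \<and> \<phi> x \<in> U \<and> (\<forall>y\<in>U. g y = h y)) \<longrightarrow> ?D g = ?D h) \<and>
        (\<forall>a b. ?D (\<lambda>y. a * g y + b * h y) = a * ?D g + b * ?D h) \<and>
        ?D (\<lambda>y. g y * h y) = g (\<phi> x) * ?D h + h (\<phi> x) * ?D g"
    if r: "regular_at Y (\<phi> x) g" "regular_at Y (\<phi> x) h" for g h
  proof -
    obtain U where U: "openin (zariski Y) U" "\<phi> x \<in> U" "g \<in> regular Y U" using r(1) unfolding regular_at_def by blast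
    obtain V where V: "openin (zariski Y) V" "\<phi> x \<in> V" "h \<in> regular Y V" using r(2) unfolding regular_at_def by blast
    have UV: "openin (zariski Y) (U \<inter> V)" using U V by auto
    have g: "g \<in> regular Y (U \<inter> V)" and h: "h \<in> regular Y (U \<inter> V)"
      using regular_mono[OF Y U(1,3) UV] regular_mono[OF Y V(1,3) UV] by auto
    note fa = function_algebra_regular[OF Y UV]
    have lin: "(\<lambda>y. a * g y + b * h y) \<in> regular Y (U \<inter> V)" for a b
      by (intro fa_add[OF fa] fa_mult[OF fa] fa_const[OF fa] g h)
    have prod: "(\<lambda>y. g y * h y) \<in> regular Y (U \<inter> V)" by (intro fa_mult[OF fa] g h)
    have at: "k \<in> regular Y (U \<inter> V) \<Longrightarrow> regular_at Y (\<phi> x) k" for k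
      using UV U(2) V(2) unfolding regular_at_def by blast
    have Dk: "?D k = D (k \<circ> \<phi>)" if "k \<in> regular Y (U \<inter> V)" for k using at[OF that] by (simp add: differential_def)
    note rX = regular_at_morphism[OF f x r(1)] regular_at_morphism[OF f x r(2)]
    show ?thesis
    proof (intro conjI allI impI)
      assume "\<exists>U. openin (zariski Y) U \<and> \<phi> x \<in> U \<and> (\<forall>y\<in>U. g y = h y)"
      then obtain W where W: "openin (zariski Y) W" "\<phi> x \<in> W" "\<forall>y\<in>W. g y = h y" by blast
      have "D (g \<circ> \<phi>) = D (h \<circ> \<phi>)"
        by (rule rules(1)[OF rX, THEN mp])
          (use morphismD(2)[OF f W(1)] W x in \<open>intro exI[of _ "{x \<in> points X. \<phi> x \<in> W}"], auto\<close>)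
      then show "?D g = ?D h" using Dk g h by simp
    next
      show "?D (\<lambda>y. a * g y + b * h y) = a * ?D g + b * ?D h" for a b
        using rules(2)[OF rX] by (simp add: Dk lin g h comp_def)
    next
      show "?D (\<lambda>y. g y * h y) = g (\<phi> x) * ?D h + h (\<phi> x) * ?D g"
        using rules(3)[OF rX] by (simp add: Dk prod g h comp_def)
    qed
  qed
  moreover have "?D g = 0" if "\<not> regular_at Y (\<phi> x) g" for g using that by (simp add: differential_def)
  ultimately show ?thesis unfolding tangent_space_def mem_Collect_eq
    apply (intro conjI[where P="\<forall>f. \<not> regular_at Y (\<phi> x) f \<longrightarrow> _ f"] allI impI)
    subgoal premises p for g by (rule p(2)[OF p(3)])
    subgoal premises p for g h by (rule p(1)[OF p(3)[THEN conjunct1] p(3)[THEN conjunct2]])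
    done
qed

lemma openin_analytic: "openin (zariski X) U \<Longrightarrow> local_fspace X \<Longrightarrow> openin (analytic_topology X) U"
proof -
  assume U: "openin (zariski X) U" and X: "local_fspace X"
  have "(\<lambda>_. 0) \<in> regular X U" by (rule fa_const[OF function_algebra_regular[OF X U]])
  then have "U \<in> {{x \<in> U. f x \<in> B} | U f B. openin (zariski X) U \<and> f \<in> regular X U \<and> open B}"
    using U by (intro CollectI exI[of _ U] exI[of _ "\<lambda>_. 0"] exI[of _ UNIV]) auto
  then show ?thesis unfolding analytic_topology_def by (rule topology_generated_by_Basis)
qed

lemma has_sum_two:
  fixes g :: "'b \<Rightarrow> 'c :: real_normed_vector"
  assumes "a \<noteq> b" "{a, b} \<subseteq> A" "\<And>x. x \<in> A \<Longrightarrow> x \<noteq> a \<Longrightarrow> x \<noteq> b \<Longrightarrow> g x = 0"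
  shows "(g has_sum (g a + g b)) A"
proof -
  have "(g has_sum (sum g {a, b})) {a, b}" by (rule has_sum_finite) simp
  moreover have "sum g {a, b} = g a + g b" using assms(1) by simp
  moreover have "(g has_sum s) {a, b} \<longleftrightarrow> (g has_sum s) A" for s
    using assms(2,3) by (intro has_sum_cong_neutral) auto
  ultimately show ?thesis by simp
qed

text \<open>The power series has one variable, the function \<open>h - h x\<close> itself, with
  constant coefficient \<open>h x\<close> and linear coefficient 1. The radius 1 is arbitrary and
  only determines the neighbourhood \<open>W\<close>.\<close>

lemma regular_imp_holomorphic:
  assumes X: "local_fspace X" and r: "regular_at X x h"
  shows "holomorphic_at X x h"
proof -
  obtain U where U: "openin (zariski X) U" "x \<in> U" "h \<in> regular X U" using r unfolding regular_at_def by blast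
  note fa = function_algebra_regular[OF X U(1)]
  define f where "f = (\<lambda>(i::nat) y. h y - h x)"
  define e1 :: "nat \<Rightarrow> nat" where "e1 = (\<lambda>i. if i = 0 then 1 else 0)"
  define c :: "(nat \<Rightarrow> nat) \<Rightarrow> complex" where "c = (\<lambda>\<alpha>. if \<alpha> = (\<lambda>_. 0) then h x else if \<alpha> = e1 then 1 else 0)"
  define W where "W = {y \<in> U. h y \<in> {w. cmod (w - h x) < 1}}"
  have ne: "(\<lambda>_. 0) \<noteq> e1" "e1 \<noteq> (\<lambda>_. 0)" by (auto simp: e1_def fun_eq_iff)
  have mi: "{(\<lambda>_. 0), e1} \<subseteq> multi_indices 1" by (auto simp: multi_indices_def e1_def)
  have reg: "regular_at X x (f i) \<and> f i x = 0" for i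
    using U fa_diff[OF fa U(3) fa_const[OF fa]] unfolding regular_at_def f_def by auto
  have ob: "open {w. cmod (w - h x) < 1}" by (intro open_Collect_less continuous_intros)
  have "W \<in> {{x \<in> U. f x \<in> B} | U f B. openin (zariski X) U \<and> f \<in> regular X U \<and> open B}"
    unfolding W_def using U by (intro CollectI exI[of _ U] exI[of _ h] exI[of _ "{w. cmod (w - h x) < 1}"] conjI refl ob)
  then have oW: "openin (analytic_topology X) W" unfolding analytic_topology_def by (rule topology_generated_by_Basis)
  have "x \<in> W" using U by (simp add: W_def)
  have summ: "(\<lambda>\<alpha>. cmod (c \<alpha>) * 1 ^ (\<Sum>i<1. \<alpha> i)) summable_on multi_indices 1"
    using has_sum_two[OF ne(1) mi, of "\<lambda>\<alpha>. cmod (c \<alpha>) * 1 ^ (\<Sum>i<1. \<alpha> i)"]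
    unfolding summable_on_def by (auto simp: c_def)
  have "(\<forall>i<1. cmod (f i y) < 1) \<and> ((\<lambda>\<alpha>. c \<alpha> * (\<Prod>i<1. f i y ^ \<alpha> i)) has_sum h y) (multi_indices 1)"
    if y: "y \<in> W" for y
  proof
    show "\<forall>i<1. cmod (f i y) < 1" using y by (simp add: W_def f_def)
    have "c (\<lambda>_. 0) = h x" "c e1 = 1" using ne by (auto simp: c_def)
    then have "h y = c (\<lambda>_. 0) * (\<Prod>i<(1::nat). f i y ^ 0) + c e1 * (\<Prod>i<(1::nat). f i y ^ e1 i)"
      by (simp add: f_def e1_def)
    then show "((\<lambda>\<alpha>. c \<alpha> * (\<Prod>i<1. f i y ^ \<alpha> i)) has_sum h y) (multi_indices 1)"
      using has_sum_two[OF ne(1) mi, of "\<lambda>\<alpha>. c \<alpha> * (\<Prod>i<1. f i y ^ \<alpha> i)"] by (simp add: c_def)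
  qed
  then show ?thesis unfolding holomorphic_at_def
    using reg summ oW \<open>x \<in> W\<close>
    by (intro exI[of _ "1::nat"] exI[of _ f] exI[of _ c] exI[of _ "1::real"] exI[of _ W]) auto
qed

section \<open>The invariant form\<close>

context flag_quotient
begin

definition uE :: "complex mat \<Rightarrow> complex mat set \<Rightarrow> complex mat" where
  "uE g e = adj_mat g * fst (secE g e)"

definition wv :: "complex mat \<Rightarrow> (nat \<Rightarrow> complex mat set functional) \<Rightarrow> complex" where
  "wv g = wedge_differentials N (\<lambda>b e. uE g e $$ (ei b, ej b))"

text \<open>In the coordinates \<open>(u, c)\<close> of the chart at \<open>g\<close> this is the form \<open>c du\<^sub>1 \<and> \<dots> \<and> du\<^sub>N\<close>, the
  tautological form on the canonical bundle of \<open>X\<close>.\<close>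

definition omega :: "complex mat set form" where
  "omega e v = snd (rep e) * wv (fst (rep e)) v"

lemma uE_ph:
  assumes "g \<in> SLset n" "(x, z) \<in> S'" "adj_mat g * x \<in> big"
  shows "uE g (ph (x, z)) = ufac (adj_mat g * x)"
  using secE_ph[OF assms] SLset_cancel(1)[OF assms(1) cell_SL[OF ufac_cell[OF assms(3)]]]
  by (simp add: uE_def sec_def)

lemma uE_cell:
  assumes "g \<in> SLset n" "e \<in> Eop g"
  shows "uE g e \<in> cell"
proof -
  obtain y z where y: "(y, z) \<in> S'" "e = ph (y, z)" "adj_mat g * y \<in> big" using EopE[OF assms(2,1)] .
  then show ?thesis using uE_ph[OF assms(1)] ufac_cell by simp
qed

lemma uE_regular:
  assumes "g \<in> SLset n"
  shows "mat_entries (Eop g) (regular E (Eop g)) n n (uE g)"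
  unfolding uE_def
  by (rule mat_entries_left[OF function_algebra_regular[OF local_E Eop_open[OF assms]]
        SLset_carrier[OF SLset_adj(1)[OF assms]] secE_regular(1)[OF assms]])

lemma uE_center: "(x, z) \<in> S' \<Longrightarrow> uE x (ph (x, z)) = 1\<^sub>m n"
  using SLset_adj(3)[of x n] uE_ph[of x x z] center_big[of x] ufac_of_cell[OF one_cell] by (simp add: S'_iff)

lemma mat_entries_mono:
  assumes "mat_entries U (regular E U) n n M" "openin (zariski E) U" "openin (zariski E) V" "V \<subseteq> U"
  shows "mat_entries V (regular E V) n n M"
  using assms(1,4) regular_mono[OF local_E assms(2) _ assms(3,4)]
    function_algebra_regular[OF local_E assms(2)] function_algebra_regular[OF local_E assms(3)]
  by (auto simp: mat_entries_def)

text \<open>Let \<open>u\<close> and \<open>w\<close> be the cell matrices of the charts at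
  \<open>g\<close> and \<open>x\<close>. Both represent the same coset, so
  \<open>A * u * r = w * q\<close> with \<open>A\<close> and \<open>r\<close> constant and
  \<open>q\<close> valued in \<open>P\<close>. At the given point \<open>w\<close> and
  \<open>q\<close> are the identity; the product rule then gives \<open>dw = A * du * r\<close> at
  the positions outside \<open>R\<close>, where \<open>dq\<close> vanishes.\<close>

lemma derivation_change:
  assumes g: "g \<in> SLset n" and x: "(x, z) \<in> S'" and b: "adj_mat g * x \<in> big"
    and D: "D \<in> tangent_space E (ph (x, z))" and ij: "i < n" "j < n" "\<not> R i j"
  defines "r \<equiv> adj_mat (rfac (adj_mat g * x))"
  shows "D (\<lambda>e. uE x e $$ (i, j)) =
    (\<Sum>c<N. (adj_mat x * g) $$ (i, ei c) * r $$ (ej c, j) * D (\<lambda>e. uE g e $$ (ei c, ej c)))"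
proof -
  have xS: "x \<in> SLset n" using x by (simp add: S'_iff)
  define A where "A = adj_mat x * g"
  have A: "A \<in> SLset n" unfolding A_def using SLset_adj(1)[OF xS] g by simp
  have rP: "r \<in> P" unfolding r_def by (intro P_adj rfac_P b)
  note rS = P_SL[OF rP]
  \<comment> \<open>The constant \<open>r\<close> is the \<open>P\<close>-factor of
    \<open>adj_mat g * x\<close>; it normalises \<open>M\<close> to be the identity at the point
    under consideration.\<close>
  define M where "M e = A * (uE g e * r)" for e
  define q where "q e = adj_mat (uE x e) * M e" for e
  let ?U = "Eop g \<inter> Eop x" and ?y = "ph (x, z)"
  have U: "openin (zariski E) ?U" using Eop_open[OF g] Eop_open[OF xS] by auto
  have y: "?y \<in> ?U" using Eop_iff[OF g x] b ph_in_Eop[OF x] by auto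
  note fa = function_algebra_regular[OF local_E U]
  have ug: "mat_entries ?U (regular E ?U) n n (uE g)" and ux: "mat_entries ?U (regular E ?U) n n (uE x)"
    using mat_entries_mono[OF uE_regular[OF g] Eop_open[OF g] U] mat_entries_mono[OF uE_regular[OF xS] Eop_open[OF xS] U] by auto
  have ur: "mat_entries ?U (regular E ?U) n n (\<lambda>e. uE g e * r)"
    by (rule mat_entries_mult[OF fa ug mat_entries_const[OF fa SLset_carrier[OF rS]]])
  have Mr: "mat_entries ?U (regular E ?U) n n M"
    unfolding M_def by (rule mat_entries_left[OF fa SLset_carrier[OF A] ur])
  have qr: "mat_entries ?U (regular E ?U) n n q"
    unfolding q_def by (rule mat_entries_mult[OF fa mat_entries_adj[OF fa ux] Mr])
  have qP: "q e \<in> P" and Mq: "M e = uE x e * q e" if e: "e \<in> ?U" for e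
  proof -
    obtain x' z' where x': "(x', z') \<in> S'" "e = ph (x', z')" "adj_mat g * x' \<in> big"
      using EopE[of e g] e g by blast
    have x'S: "x' \<in> SLset n" using x'(1) by (simp add: S'_iff)
    have bx: "adj_mat x * x' \<in> big" using e Eop_iff[OF xS x'(1)] x'(2) by simp
    let ?r1 = "rfac (adj_mat g * x')" and ?r2 = "rfac (adj_mat x * x')"
    have r12: "?r1 \<in> P" "?r2 \<in> P" using rfac_P x'(3) bx by auto
    note sl = P_SL[OF r12(1)] P_SL[OF r12(2)] SLset_adj(1)[OF g] SLset_adj(1)[OF xS] x'S g xS rS
    have ugx: "uE g e = adj_mat g * x' * ?r1" unfolding x'(2) uE_ph[OF g x'(1,3)] ufac_def ..
    have uxx: "uE x e = adj_mat x * x' * ?r2" unfolding x'(2) uE_ph[OF xS x'(1) bx] ufac_def ..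
    have "M e = adj_mat x * x' * (?r1 * r)"
      unfolding M_def ugx A_def using sl by (simp add: SLset_assoc[of _ n] SLset_cancel(2)[of g n])
    moreover have "\<dots> = adj_mat x * x' * ?r2 * (adj_mat ?r2 * (?r1 * r))"
      using sl SLset_adj(1)[OF sl(2)] by (simp add: SLset_assoc[of _ n] SLset_cancel(2)[of ?r2 n])
    ultimately have Me: "M e = uE x e * (adj_mat ?r2 * (?r1 * r))" using uxx by simp
    have ux_SL: "uE x e \<in> SLset n" using uE_cell[OF xS, of e] e cell_SL by simp
    have in_P: "adj_mat ?r2 * (?r1 * r) \<in> P" by (intro P_mult P_adj r12 rP)
    have "q e = adj_mat ?r2 * (?r1 * r)"
      unfolding q_def Me by (rule SLset_cancel(1)[OF ux_SL P_SL[OF in_P]])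
    then show "q e \<in> P" "M e = uE x e * q e" using in_P Me by auto
  qed
  have uxy: "uE x ?y = 1\<^sub>m n" by (rule uE_center[OF x])
  have "uE g ?y * r = adj_mat g * x"
    unfolding uE_ph[OF g x b] r_def using ufac_rfac[OF b] by simp
  then have My: "M ?y = 1\<^sub>m n"
    unfolding M_def A_def using SLset_assoc[OF SLset_adj(1)[OF xS] g] SLset_cancel(2)[OF g xS] SLset_adj(1)[OF g] xS SLset_adj(3)[OF xS] by simp
  have qy: "q ?y = 1\<^sub>m n" unfolding q_def uxy My by simp
  have reg: "(\<lambda>e. uE x e $$ (a, c)) \<in> regular E ?U" "(\<lambda>e. q e $$ (a, c)) \<in> regular E ?U"
     "(\<lambda>e. uE g e $$ (a, c)) \<in> regular E ?U" if "a < n" "c < n" for a c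
    using mat_entriesD[OF fa ux that] mat_entriesD[OF fa qr that] mat_entriesD[OF fa ug that] by auto
  note der = der_cong[OF local_E D U y] der_mult[OF local_E D U y] der_sum[OF local_E D U y]
    der_const[OF local_E D U y] der_scale[OF local_E D U y]
  have carr: "uE x e \<in> carrier_mat n n" "q e \<in> carrier_mat n n" "uE g e \<in> carrier_mat n n" if "e \<in> ?U" for e
    using ux qr ug that fa by (auto simp: mat_entries_def)
  have "D (\<lambda>e. M e $$ (i, j)) = D (\<lambda>e. \<Sum>l<n. uE x e $$ (i, l) * q e $$ (l, j))"
  proof (rule der(1))
    show "(\<lambda>e. \<Sum>l<n. uE x e $$ (i, l) * q e $$ (l, j)) \<in> regular E ?U"
      using ij reg by (intro fa_sum[OF fa] fa_mult[OF fa]) auto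
    show "M e $$ (i, j) = (\<Sum>l<n. uE x e $$ (i, l) * q e $$ (l, j))" if "e \<in> ?U" for e
      unfolding Mq[OF that] by (rule index_mult_sum[OF carr(1,2)[OF that] ij(1,2)])
  qed
  also have "\<dots> = (\<Sum>l<n. D (\<lambda>e. uE x e $$ (i, l) * q e $$ (l, j)))"
    using ij reg by (intro der(3) fa_mult[OF fa]) auto
  \<comment> \<open>Both factors are the identity at this point, so the product rule leaves one term
    for each factor.\<close>
  also have "\<dots> = (\<Sum>l<n. (if l = i then D (\<lambda>e. q e $$ (i, j)) else 0) + (if l = j then D (\<lambda>e. uE x e $$ (i, j)) else 0))"
    using ij reg by (intro sum.cong refl) (simp add: der(2) uxy qy)
  also have "\<dots> = D (\<lambda>e. q e $$ (i, j)) + D (\<lambda>e. uE x e $$ (i, j))"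
    using ij by (simp add: sum.distrib)
  \<comment> \<open>Near the point \<open>q\<close> takes values in \<open>P\<close>, so its entry
    at a position outside \<open>R\<close> is identically zero.\<close>
  also have "D (\<lambda>e. q e $$ (i, j)) = D (\<lambda>_. 0)"
    by (rule der(1)[OF fa_const[OF fa]]) (use qP P_zero ij in auto)
  finally have 1: "D (\<lambda>e. M e $$ (i, j)) = D (\<lambda>e. uE x e $$ (i, j))" by (simp add: der(4))
  have "D (\<lambda>e. M e $$ (i, j)) = D (\<lambda>e. \<Sum>s<n. \<Sum>t<n. (A $$ (i, s) * r $$ (t, j)) * uE g e $$ (s, t))"
  proof (rule der(1))
    show "(\<lambda>e. \<Sum>s<n. \<Sum>t<n. (A $$ (i, s) * r $$ (t, j)) * uE g e $$ (s, t)) \<in> regular E ?U"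
      using ij reg by (intro fa_sum[OF fa] fa_mult[OF fa] fa_const[OF fa]) auto
    show "M e $$ (i, j) = (\<Sum>s<n. \<Sum>t<n. (A $$ (i, s) * r $$ (t, j)) * uE g e $$ (s, t))" if e: "e \<in> ?U" for e
    proof -
      have "M e $$ (i, j) = (\<Sum>s<n. A $$ (i, s) * (uE g e * r) $$ (s, j))"
        unfolding M_def using carr(3)[OF e] SLset_carrier[OF A] SLset_carrier[OF rS] ij by (intro index_mult_sum) auto
      also have "\<dots> = (\<Sum>s<n. A $$ (i, s) * (\<Sum>t<n. uE g e $$ (s, t) * r $$ (t, j)))"
        using index_mult_sum[OF carr(3)[OF e] SLset_carrier[OF rS]] ij by simp
      finally show ?thesis by (simp add: sum_distrib_left mult_ac)
    qed
  qed
  also have "\<dots> = (\<Sum>s<n. D (\<lambda>e. \<Sum>t<n. (A $$ (i, s) * r $$ (t, j)) * uE g e $$ (s, t)))"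
    using reg by (intro der(3) fa_sum[OF fa] fa_mult[OF fa] fa_const[OF fa]) auto
  also have "\<dots> = (\<Sum>s<n. \<Sum>t<n. D (\<lambda>e. (A $$ (i, s) * r $$ (t, j)) * uE g e $$ (s, t)))"
    using reg by (intro sum.cong refl der(3) fa_mult[OF fa] fa_const[OF fa]) auto
  also have "\<dots> = (\<Sum>s<n. \<Sum>t<n. (A $$ (i, s) * r $$ (t, j)) * D (\<lambda>e. uE g e $$ (s, t)))"
    using reg by (intro sum.cong refl der(5)) auto
  also have "\<dots> = (\<Sum>c<N. (A $$ (i, ei c) * r $$ (ej c, j)) * D (\<lambda>e. uE g e $$ (ei c, ej c)))"
  proof (rule sum_pairs[symmetric])
    fix s t assume st: "s < n" "t < n" "R s t"
    \<comment> \<open>Cell matrices have constant entries at the positions in \<open>R\<close>; the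
      double sum therefore collapses to the \<open>N\<close> chart coordinates.\<close>
    have "D (\<lambda>e. uE g e $$ (s, t)) = D (\<lambda>_. if s = t then 1 else 0)"
      by (rule der(1)[OF fa_const[OF fa]]) (use cell_index[OF uE_cell[OF g]] st in auto)
    then show "(A $$ (i, s) * r $$ (t, j)) * D (\<lambda>e. uE g e $$ (s, t)) = 0" by (simp add: der(4))
  qed
  finally show ?thesis using 1 by (simp add: A_def)
qed

text \<open>\<open>derivation_change\<close> says that the matrices of derivatives differ by the
  transpose of \<open>Ad\<close>, the Jacobian matrix of the change of chart at its new centre;
  taking determinants gives the factor.\<close>

lemma wv_change:
  assumes g: "g \<in> SLset n" and x: "(x, z) \<in> S'" and b: "adj_mat g * x \<in> big"
    and v: "\<And>a. a < N \<Longrightarrow> v a \<in> tangent_space E (ph (x, z))"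
  shows "wv x v = wv g v * det (Ad (adj_mat x * g) (adj_mat (rfac (adj_mat g * x))))"
proof -
  let ?V = "\<lambda>g. mat N N (\<lambda>(a, b). v a (\<lambda>e. uE g e $$ (ei b, ej b)))"
  let ?A = "Ad (adj_mat x * g) (adj_mat (rfac (adj_mat g * x)))"
  have "?V x = ?V g * transpose_mat ?A"
  proof (rule eq_matI)
    fix a c assume "a < dim_row (?V g * transpose_mat ?A)" "c < dim_col (?V g * transpose_mat ?A)"
    then have ac: "a < N" "c < N" by (auto simp: Ad_def)
    have "(?V g * transpose_mat ?A) $$ (a, c) = (\<Sum>k<N. ?V g $$ (a, k) * transpose_mat ?A $$ (k, c))"
      by (rule index_mult_sum[where k=N and m=N and l=N]) (use ac in \<open>auto simp: Ad_def\<close>)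
    also have "\<dots> = v a (\<lambda>e. uE x e $$ (ei c, ej c))"
      unfolding derivation_change[OF g x b v[OF ac(1)] e_range[OF ac(2)]]
      using ac by (intro sum.cong refl) (simp add: Ad_def mult_ac)
    finally show "?V x $$ (a, c) = (?V g * transpose_mat ?A) $$ (a, c)" using ac by simp
  qed (auto simp: Ad_def)
  then show ?thesis unfolding wv_def wedge_differentials_def
    using det_mult[of "?V g" N "transpose_mat ?A"] det_transpose[OF Ad_carrier, of "adj_mat x * g"] by simp
qed

lemma cell_inverse_index:
  assumes A: "A \<in> cell" and "i < n" "j < n" "i \<le> j"
  shows "adj_mat A $$ (i, j) = (if i = j then 1 else 0)"
  using assms(2-)
proof (induction i rule: less_induct)
  case (less i)
  note S = cell_SL[OF A]
  have "(if i = j then 1 else 0) = (\<Sum>l<n. A $$ (i, l) * adj_mat A $$ (l, j))"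
    using index_mult_sum[OF SLset_carrier[OF S] SLset_carrier[OF SLset_adj(1)[OF S]] less.prems(1,2)] SLset_adj(2)[OF S] less.prems
    by simp
  also have "\<dots> = (\<Sum>l<n. if l = i then adj_mat A $$ (i, j) else 0)"
  proof (intro sum.cong refl)
    fix l assume "l \<in> {..<n}"
    then have l: "l < n" by simp
    show "A $$ (i, l) * adj_mat A $$ (l, j) = (if l = i then adj_mat A $$ (i, j) else 0)"
    proof (cases "i \<le> l")
      case True
      then show ?thesis using cell_index[OF A _ l R_le[OF True l]] less.prems by auto
    next
      case False
      then show ?thesis using less.IH[of l] l less.prems by auto
    qed
  qed
  also have "\<dots> = adj_mat A $$ (i, j)" using less.prems by simp
  finally show ?case by simp
qed

text \<open>The centres \<open>x\<close> and \<open>x * q\<close> represent the same coset. The left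
  constant is then the inverse of \<open>q\<close> and the right one is \<open>q\<close>, so the
  Jacobian is exactly \<open>chi q\<close>. This computation dictates the character in the
  definition of \<open>ph\<close>.\<close>

lemma wv_right:
  assumes x: "(x, z) \<in> S'" and q: "q \<in> P"
    and v: "\<And>a. a < N \<Longrightarrow> v a \<in> tangent_space E (ph (x, z))"
  shows "wv (x * q) v = wv x v * chi q"
proof -
  have xS: "x \<in> SLset n" using x by (simp add: S'_iff)
  note qS = P_SL[OF q]
  have e1: "adj_mat x * (x * q) = q" by (rule SLset_cancel(1)[OF xS qS])
  have qb: "q \<in> big" using big_mult[OF one_big q] qS by simp
  have "rfac q = adj_mat q" using rfac_mult[OF one_big q] rfac_cell[OF one_cell] qS SLset_adj(1)[OF qS] by simp
  then have e2: "adj_mat (rfac q) = q" using SLset_adj_adj[OF qS] by simp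
  have e3: "adj_mat (x * q) * x = adj_mat q"
    using SLset_adj_mult[OF xS qS] SLset_cancel(4)[OF xS SLset_adj(1)[OF qS]] by simp
  show ?thesis
    using wv_change[OF xS hat_act[OF x q], of v, unfolded e1 e2 e3 ph_act[OF x q]] v qb unfolding chi_def by simp
qed

lemma omega_ph:
  assumes x: "(x, z) \<in> S'" and v: "\<And>a. a < N \<Longrightarrow> v a \<in> tangent_space E (ph (x, z))"
  shows "omega (ph (x, z)) v = z * wv x v"
proof -
  obtain q where q: "q \<in> P" "rep (ph (x, z)) = (x * q, inverse (chi q) * z)" using rep[OF x] by blast
  then show ?thesis using wv_right[OF x q(1) v] chi_nonzero[OF q(1)] by (simp add: omega_def)
qed

text \<open>Each point of the chart has a representative \<open>(g * u0, c)\<close> with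
  \<open>u0\<close> in the cell. Between the centres \<open>g\<close> and \<open>g * u0\<close> the
  right constant is the identity and the left one is the inverse of \<open>u0\<close>, so the
  Jacobian is unitriangular. This turns the pointwise definition into a single formula on the whole
  chart.\<close>

lemma omega_chart:
  assumes g: "g \<in> SLset n" and e: "e \<in> Eop g" and v: "\<And>a. a < N \<Longrightarrow> v a \<in> tangent_space E e"
  shows "omega e v = snd (secE g e) * wv g v"
proof -
  obtain y t where y: "(y, t) \<in> S'" "e = ph (y, t)" "adj_mat g * y \<in> big" using EopE[OF e g] .
  define u0 where "u0 = ufac (adj_mat g * y)"
  define c where "c = snd (secE g e)"
  have u0: "u0 \<in> cell" unfolding u0_def by (rule ufac_cell[OF y(3)])
  have s: "secE g e = (g * u0, c)" unfolding c_def u0_def using secE_ph[OF g y(1,3)] y(2) by (simp add: sec_def)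
  have S: "(g * u0, c) \<in> S'" "ph (g * u0, c) = e" using secE[OF g e] s by auto
  have e1: "adj_mat g * (g * u0) = u0" by (rule SLset_cancel(1)[OF g cell_SL[OF u0]])
  have e2: "adj_mat (g * u0) * g = adj_mat u0"
    using SLset_adj_mult[OF g cell_SL[OF u0]] SLset_cancel(4)[OF g SLset_adj(1)[OF cell_SL[OF u0]]] by simp
  have "wv (g * u0) v = wv g v * det (Ad (adj_mat u0) (1\<^sub>m n))"
    using wv_change[OF g S(1), of v] v cell_big[OF u0] unfolding e1 e2 S(2) rfac_cell[OF u0] by simp
  also have "det (Ad (adj_mat u0) (1\<^sub>m n)) = 1"
    by (rule det_Ad_unitriangular) (rule cell_inverse_index[OF u0])
  finally show ?thesis using omega_ph[OF S(1), of v] v S(2) by (simp add: c_def)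
qed

lemma holomorphic_omega: "holomorphic_form E N omega"
  unfolding holomorphic_form_def
proof
  fix x assume "x \<in> points E"
  then obtain a z where a: "(a, z) \<in> S'" "x = ph (a, z)" by (auto simp: points_E)
  then have aS: "a \<in> SLset n" by (simp add: S'_iff)
  note o = Eop_open[OF aS]
  let ?h = "\<lambda>_::nat. \<lambda>e. snd (secE a e)" and ?f = "\<lambda>_::nat. \<lambda>b e. uE a e $$ (ei b, ej b)"
  have reg: "holomorphic_at E y (?h k) \<and> (\<forall>b<N. regular_at E y (?f k b))" if y: "y \<in> Eop a" for y and k :: nat
  proof (intro conjI allI impI)
    show "holomorphic_at E y (?h k)"
      by (rule regular_imp_holomorphic[OF local_E]) (use o y secE_regular(2)[OF aS] in \<open>auto simp: regular_at_def\<close>)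
    fix b assume "b < N"
    then show "regular_at E y (?f k b)"
      using o y mat_entriesD[OF function_algebra_regular[OF local_E o] uE_regular[OF aS] e_range(1,2)[of b]]
      unfolding regular_at_def by blast
  qed
  have "omega y v = (\<Sum>k<1::nat. ?h k y * wedge_differentials N (?f k) v)"
    if "y \<in> Eop a" "\<forall>a<N. v a \<in> tangent_space E y" for y v
    using omega_chart[OF aS that(1), of v] that(2) by (simp add: wv_def)
  then show "\<exists>W (m::nat) h f. openin (analytic_topology E) W \<and> x \<in> W \<and>
        (\<forall>y\<in>W. \<forall>k<m. holomorphic_at E y (h k) \<and> (\<forall>b<N. regular_at E y (f k b))) \<and>
        (\<forall>y\<in>W. \<forall>v. (\<forall>a<N. v a \<in> tangent_space E y) \<longrightarrow>
           omega y v = (\<Sum>k<m. h k y * wedge_differentials N (f k) v))"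
    using openin_analytic[OF o local_E] ph_in_Eop[OF a(1)] a(2) reg
    by (intro exI[of _ "Eop a"] exI[of _ "1::nat"] exI[of _ ?h] exI[of _ ?f]) blast
qed

section \<open>Invariance under left translation\<close>

lemma morphism_actG:
  assumes g: "g \<in> SLset n"
  shows "morphism E E (actG g)"
proof (rule morphism_into_E[OF local_E])
  fix e assume "e \<in> points E"
  then obtain x z where x: "(x, z) \<in> S'" "e = ph (x, z)" by (auto simp: points_E)
  then have xS: "x \<in> SLset n" by (simp add: S'_iff)
  note o = Eop_open[OF xS]
  have M: "mat_entries (Eop x) (regular E (Eop x)) n n (\<lambda>e. g * fst (secE x e))"
    by (rule mat_entries_left[OF function_algebra_regular[OF local_E o] SLset_carrier[OF g] secE_regular(1)[OF xS]])
  have "(g * fst (secE x e), snd (secE x e)) \<in> S' \<and> actG g e = ph (g * fst (secE x e), snd (secE x e))"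
    if "e \<in> Eop x" for e
  proof -
    obtain y t where yt: "secE x e = (y, t)" by fastforce
    then have "(y, t) \<in> S'" "ph (y, t) = e" using secE[OF xS that] by auto
    then show ?thesis using yt actG_ph[OF g, of y t] g by (auto simp: S'_iff)
  qed
  then show "\<exists>U a c. openin (zariski E) U \<and> e \<in> U \<and> mat_entries U (regular E U) n n a \<and>
      c \<in> regular E U \<and> (\<forall>v\<in>U. (a v, c v) \<in> S' \<and> actG g v = ph (a v, c v))"
    using o M secE_regular(2)[OF xS] ph_in_Eop[OF x(1)] x(2)
    by (intro exI[of _ "Eop x"] exI[of _ "\<lambda>e. g * fst (secE x e)"] exI[of _ "\<lambda>e. snd (secE x e)"]) auto
qed

lemma invariant_omega: "invariant_form (SL n) actG E N omega"
  unfolding invariant_form_def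
proof (intro ballI allI impI)
  fix g e v assume "g \<in> carrier (SL n)" and eE: "e \<in> points E" and v: "\<forall>a<N. v a \<in> tangent_space E e"
  then have g: "g \<in> SLset n" by simp
  obtain x z where x: "(x, z) \<in> S'" "e = ph (x, z)" using eE by (auto simp: points_E)
  then have xS: "x \<in> SLset n" by (simp add: S'_iff)
  have gx: "(g * x, z) \<in> S'" "g * x \<in> SLset n" using g x xS by (auto simp: S'_iff)
  have ge: "actG g e = ph (g * x, z)" using actG_ph[OF g x(1)] x(2) by simp
  let ?v = "\<lambda>a. differential E E (actG g) e (v a)"
  have v': "?v a \<in> tangent_space E (ph (g * x, z))" if "a < N" for a
    using differential_tangent[OF local_E local_E morphism_actG[OF g] eE] v that ge by auto
  \<comment> \<open>The cell coordinates at \<open>g * x\<close>, composed with translation by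
    \<open>g\<close>, are those at \<open>x\<close>, because \<open>g\<close> cancels in
    \<open>adj_mat (g * x) * (g * y)\<close>.\<close>
  have eq: "?v a (\<lambda>e. uE (g * x) e $$ (ei b, ej b)) = v a (\<lambda>e. uE x e $$ (ei b, ej b))" if ab: "a < N" "b < N" for a b
  proof -
    note o = Eop_open[OF gx(2)] and ox = Eop_open[OF xS]
    have "regular_at E (actG g e) (\<lambda>e. uE (g * x) e $$ (ei b, ej b))"
      unfolding ge regular_at_def
      using o ph_in_Eop[OF gx(1)] mat_entriesD[OF function_algebra_regular[OF local_E o] uE_regular[OF gx(2)] e_range(1,2)[OF ab(2)]]
      by blast
    then have "?v a (\<lambda>e. uE (g * x) e $$ (ei b, ej b)) = v a (\<lambda>e. uE (g * x) (actG g e) $$ (ei b, ej b))"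
      by (simp add: differential_def comp_def)
    also have "\<dots> = v a (\<lambda>e. uE x e $$ (ei b, ej b))"
    proof (rule der_cong[OF local_E v[rule_format, OF ab(1)] ox ph_in_Eop[OF x(1), folded x(2)]])
      show "(\<lambda>e. uE x e $$ (ei b, ej b)) \<in> regular E (Eop x)"
        by (rule mat_entriesD[OF function_algebra_regular[OF local_E ox] uE_regular[OF xS] e_range(1,2)[OF ab(2)]])
      fix e' assume e': "e' \<in> Eop x"
      obtain y t where y: "(y, t) \<in> S'" "e' = ph (y, t)" "adj_mat x * y \<in> big" using EopE[OF e' xS] .
      have yS: "y \<in> SLset n" and gy: "(g * y, t) \<in> S'" using y(1) g by (auto simp: S'_iff)
      have "adj_mat (g * x) * (g * y) = adj_mat x * y"
        using SLset_adj_mult[OF g xS] g xS yS SLset_adj(1)[OF g] SLset_adj(1)[OF xS]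
        by (simp add: SLset_assoc[of _ n] SLset_cancel(1)[of g n])
      then show "uE (g * x) (actG g e') $$ (ei b, ej b) = uE x e' $$ (ei b, ej b)"
        using y actG_ph[OF g y(1)] uE_ph[OF gx(2) gy] uE_ph[OF xS y(1,3)] by simp
    qed
    finally show ?thesis .
  qed
  have "wv (g * x) ?v = wv x v"
    unfolding wv_def wedge_differentials_def by (rule arg_cong[where f=det], rule cong_mat) (simp_all add: eq)
  then show "omega (actG g e) ?v = omega e v"
    using omega_ph[OF gx(1), of ?v] v' omega_ph[OF x(1), of v] v x(2) ge by simp
qed

section \<open>Tangent vectors along one-parameter curves, and nonvanishing\<close>

definition elem :: "nat \<Rightarrow> complex \<Rightarrow> complex mat" where
  "elem a t = mat n n (\<lambda>(i, j). if i = j then 1 else if i = ei a \<and> j = ej a then t else 0)"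

lemma elem_cell: "a < N \<Longrightarrow> elem a t \<in> cell"
  using e_range[of a] by (auto simp: elem_def cell_def)

lemma elem_index:
  assumes "a < N" "b < N"
  shows "elem a t $$ (ei b, ej b) = (if a = b then t else 0)"
proof -
  have "ei b \<noteq> ej b" using e_range[OF assms(2)] R_le[of "ei b" "ej b"] by auto
  then show ?thesis using e_range[OF assms(2)] e_inj[OF assms] by (auto simp: elem_def)
qed

text \<open>The vectors are velocities at \<open>t = 0\<close> of the complex curves
  \<open>t \<mapsto> ph (x * elem a t, z)\<close>, along which coordinate \<open>a\<close> of the
  chart at \<open>x\<close> equals \<open>t\<close> and the others stay zero. Derivatives exist
  because a regular function on \<open>E\<close> becomes, upstairs, a fraction of polynomials in
  matrix entries.\<close>

lemma tangent_curves:
  assumes x: "(x, z) \<in> S'"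
  shows "\<exists>v. \<forall>a<N. v a \<in> tangent_space E (ph (x, z)) \<and>
     (\<forall>b<N. v a (\<lambda>e. uE x e $$ (ei b, ej b)) = (if a = b then 1 else 0))"
proof -
  let ?y = "ph (x, z)"
  have xS: "x \<in> SLset n" and z: "z \<noteq> 0" using x by (auto simp: S'_iff)
  define k where "k a t = (x * elem a t, z)" for a t
  have kS: "k a t \<in> S'" if "a < N" for a t
    using xS z cell_SL[OF elem_cell[OF that]] by (simp add: k_def S'_iff)
  have k0: "k a 0 = (x, z)" for a
  proof -
    have "elem a 0 = 1\<^sub>m n" by (rule eq_matI) (auto simp: elem_def)
    then show ?thesis using xS by (simp add: k_def)
  qed
  have diff_poly: "\<exists>d. ((\<lambda>t. f (k a t)) has_field_derivative d) (at 0)"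
    if aN: "a < N" and fp: "f \<in> polynomial_functions hat_coords" for f a
    using fp
  proof induction
    case (coord c)
    then consider "c = snd" | i j where "i < n" "j < n" "c = (\<lambda>w. fst w $$ (i, j))" by (auto simp: hat_coords_def)
    then show ?case
    proof cases
      case 1
      then show ?thesis by (auto simp: k_def intro!: exI[of _ 0])
    next
      case (2 i j)
      have "c (k a t) = (\<Sum>l<n. x $$ (i, l) * elem a t $$ (l, j))" for t
        using 2 index_mult_sum[OF SLset_carrier[OF xS] cell_carrier[OF elem_cell[OF aN]] 2(1,2)] by (simp add: k_def)
      moreover have "\<exists>d. ((\<lambda>t. elem a t $$ (l, j)) has_field_derivative d) (at 0)" if "l < n" for l
      proof -
        have "(\<lambda>t. elem a t $$ (l, j)) = (\<lambda>_. if l = j then 1 else 0) \<or> (\<lambda>t. elem a t $$ (l, j)) = (\<lambda>t. t)"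
          using that 2 by (auto simp: elem_def fun_eq_iff)
        then show ?thesis
        proof
          assume e: "(\<lambda>t. elem a t $$ (l, j)) = (\<lambda>_. if l = j then 1 else 0)"
          have "((\<lambda>_. c) has_field_derivative 0) (at (0 :: complex))" for c :: complex by (rule DERIV_const)
          then show ?thesis unfolding e by blast
        next
          assume e: "(\<lambda>t. elem a t $$ (l, j)) = (\<lambda>t. t)"
          show ?thesis unfolding e using DERIV_ident by blast
        qed
      qed
      then obtain d where "\<And>l. l < n \<Longrightarrow> ((\<lambda>t. elem a t $$ (l, j)) has_field_derivative d l) (at 0)" by metis
      then have "((\<lambda>t. \<Sum>l<n. x $$ (i, l) * elem a t $$ (l, j)) has_field_derivative (\<Sum>l<n. x $$ (i, l) * d l)) (at 0)"
        by (intro DERIV_sum DERIV_cmult) auto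
      ultimately show ?thesis by auto
    qed
  next
    case (add f g)
    then show ?case using DERIV_add by blast
  next
    case (mult f g)
    then show ?case using DERIV_mult by blast
  qed (use DERIV_const in blast)
  have near_poly: "eventually (\<lambda>t. f (k a t) \<noteq> 0) (nhds 0)"
    if aN: "a < N" "f \<in> polynomial_functions hat_coords" and nz: "f (x, z) \<noteq> 0" for f a
  proof -
    obtain d where "((\<lambda>t. f (k a t)) has_field_derivative d) (at 0)" using diff_poly[OF aN] by blast
    then have "isCont (\<lambda>t. f (k a t)) 0" by (rule DERIV_isCont)
    then have "((\<lambda>t. f (k a t)) \<longlongrightarrow> f (k a 0)) (nhds 0)" 
      using tendsto_at_iff_tendsto_nhds[of "\<lambda>t. f (k a t)" 0] by (simp add: isCont_def)
    then show ?thesis using tendsto_imp_eventually_ne[of _ "f (k a 0)" "nhds 0" 0] nz k0 by simp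
  qed
  \<comment> \<open>The curve stays in a given Zariski neighbourhood for small \<open>t\<close>, so
    that the derivative depends only on germs.\<close>
  have near: "eventually (\<lambda>t. ph (k a t) \<in> U) (nhds 0)"
    if a: "a < N" and U: "openin (zariski E) U" "?y \<in> U" for U a
  proof -
    have "openin (zariski H) {w \<in> points H. ph w \<in> U}" using U(1) unfolding E_def openin_quotient_space by simp
    moreover have "(x, z) \<in> {w \<in> points H. ph w \<in> U}" using x U by simp
    ultimately obtain s where s: "s \<in> polynomial_functions hat_coords" "s (x, z) \<noteq> 0"
      "{w \<in> S'. s w \<noteq> 0} \<subseteq> {w \<in> points H. ph w \<in> U}"
      unfolding H_def by (elim openin_inducedE)
    show ?thesis using near_poly[OF a s(1,2)] by eventually_elim (use s(3) kS[OF a] in auto)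
  qed
  have diff: "\<exists>d. ((\<lambda>t. f (ph (k a t))) has_field_derivative d) (at 0)"
    if a: "a < N" and r: "regular_at E ?y f" for f a
  proof -
    obtain U where U: "openin (zariski E) U" "?y \<in> U" "f \<in> regular E U" using r unfolding regular_at_def by blast
    let ?I = "{w \<in> points H. ph w \<in> U}"
    have "f \<circ> ph \<in> regular H ?I" using U(3) unfolding E_def regular_quotient_space .
    moreover have xI: "(x, z) \<in> ?I" using x U by simp
    ultimately obtain s q where sq: "s \<in> polynomial_functions hat_coords" "q \<in> polynomial_functions hat_coords" "q (x, z) \<noteq> 0"
      "\<forall>w\<in>?I. q w \<noteq> 0 \<longrightarrow> (f \<circ> ph) w = s w / q w"
      unfolding H_def by (elim mem_regular_inducedE)
    obtain ds where ds: "((\<lambda>t. s (k a t)) has_field_derivative ds) (at 0)" using diff_poly[OF a sq(1)] by blast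
    obtain dq where dq: "((\<lambda>t. q (k a t)) has_field_derivative dq) (at 0)" using diff_poly[OF a sq(2)] by blast
    have "q (k a 0) \<noteq> 0" using sq(3) by (simp add: k0)
    from DERIV_divide[OF ds dq this] obtain d where d: "((\<lambda>t. s (k a t) / q (k a t)) has_field_derivative d) (at 0)" by blast
    have "eventually (\<lambda>t. f (ph (k a t)) = s (k a t) / q (k a t)) (nhds 0)"
      using near[OF a U(1,2)] near_poly[OF a sq(2,3)]
    proof eventually_elim
      case (elim t)
      then show ?case using sq(4)[THEN bspec, of "k a t"] kS[OF a, of t] by simp
    qed
    then have "((\<lambda>t. f (ph (k a t))) has_field_derivative d) (at 0)"
      using d by (subst DERIV_cong_ev[OF refl _ refl])
    then show ?thesis by blast
  qed
  \<comment> \<open>The value 0 on functions that are not regular at the point is the convention of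
    \<open>tangent_space\<close>.\<close>
  define v where "v a f = (if regular_at E ?y f then (THE d. ((\<lambda>t. f (ph (k a t))) has_field_derivative d) (at 0)) else 0)" for a f
  have vI: "v a f = d" if "regular_at E ?y f" "((\<lambda>t. f (ph (k a t))) has_field_derivative d) (at 0)" for a f d
    using that DERIV_unique unfolding v_def by (auto intro!: the_equality)
  have vD: "((\<lambda>t. f (ph (k a t))) has_field_derivative v a f) (at 0)" if "a < N" "regular_at E ?y f" for a f
    using diff[OF that] vI[OF that(2)] by blast
  have tang: "v a \<in> tangent_space E ?y" if a: "a < N" for a
    unfolding tangent_space_def mem_Collect_eq
  proof (intro conjI allI impI)
    show "v a f = 0" if "\<not> regular_at E ?y f" for f using that by (simp add: v_def)
    fix f g assume "regular_at E ?y f \<and> regular_at E ?y g"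
    then have r: "regular_at E ?y f" "regular_at E ?y g" by auto
    obtain U where U: "openin (zariski E) U" "?y \<in> U" "f \<in> regular E U" using r(1) unfolding regular_at_def by blast
    obtain V where V: "openin (zariski E) V" "?y \<in> V" "g \<in> regular E V" using r(2) unfolding regular_at_def by blast
    have UV: "openin (zariski E) (U \<inter> V)" using U V by auto
    have fg: "f \<in> regular E (U \<inter> V)" "g \<in> regular E (U \<inter> V)"
      using regular_mono[OF local_E U(1,3) UV] regular_mono[OF local_E V(1,3) UV] by auto
    note fa = function_algebra_regular[OF local_E UV]
    have at: "h \<in> regular E (U \<inter> V) \<Longrightarrow> regular_at E ?y h" for h using UV U V unfolding regular_at_def by blast
    show "v a (\<lambda>y. b * f y + c * g y) = b * v a f + c * v a g" for b c
      by (intro vI at fa_add[OF fa] fa_mult[OF fa] fa_const[OF fa] fg DERIV_add DERIV_cmult vD a r)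
    have "((\<lambda>t. f (ph (k a t)) * g (ph (k a t))) has_field_derivative (v a f * g (ph (k a 0)) + v a g * f (ph (k a 0)))) (at 0)"
      by (intro DERIV_mult vD a r)
    then show "v a (\<lambda>y. f y * g y) = f ?y * v a g + g ?y * v a f"
      using vI[OF at[OF fa_mult[OF fa fg]]] by (simp add: k0 mult_ac add_ac)
    assume "\<exists>U. openin (zariski E) U \<and> ?y \<in> U \<and> (\<forall>y\<in>U. f y = g y)"
    then obtain W where W: "openin (zariski E) W" "?y \<in> W" "\<forall>y\<in>W. f y = g y" by blast
    have "eventually (\<lambda>t. f (ph (k a t)) = g (ph (k a t))) (nhds 0)"
      using near[OF a W(1,2)] by eventually_elim (use W(3) in auto)
    then have "((\<lambda>t. f (ph (k a t))) has_field_derivative v a g) (at 0)"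
      using vD[OF a r(2)] by (subst DERIV_cong_ev[OF refl _ refl])
    then show "v a f = v a g" by (rule vI[OF r(1)])
  qed
  have "v a (\<lambda>e. uE x e $$ (ei b, ej b)) = (if a = b then 1 else 0)" if ab: "a < N" "b < N" for a b
  proof (rule vI)
    note o = Eop_open[OF xS]
    show "regular_at E ?y (\<lambda>e. uE x e $$ (ei b, ej b))"
      unfolding regular_at_def
      using o ph_in_Eop[OF x] mat_entriesD[OF function_algebra_regular[OF local_E o] uE_regular[OF xS] e_range(1,2)[OF ab(2)]]
      by blast
    have "uE x (ph (k a t)) = elem a t" for t
    proof -
      note c = elem_cell[OF ab(1), of t]
      have ax: "adj_mat x * (x * elem a t) = elem a t" by (rule SLset_cancel(1)[OF xS cell_SL[OF c]])
      show ?thesis unfolding k_def using uE_ph[OF xS kS[OF ab(1), of t, unfolded k_def]] cell_big[OF c] ufac_of_cell[OF c]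
        by (simp add: ax)
    qed
    then show "((\<lambda>t. uE x (ph (k a t)) $$ (ei b, ej b)) has_field_derivative (if a = b then 1 else 0)) (at 0)"
      using elem_index[OF ab] DERIV_ident[of "at 0"] DERIV_const[of 0 "at 0"] by simp
  qed
  then show ?thesis using tang by (intro exI[of _ v]) auto
qed

lemma nonvanishing_omega: "nowhere_vanishing E N omega"
  unfolding nowhere_vanishing_def
proof
  fix e assume "e \<in> points E"
  then obtain x z where x: "(x, z) \<in> S'" "e = ph (x, z)" by (auto simp: points_E)
  obtain v where v: "\<forall>a<N. v a \<in> tangent_space E (ph (x, z)) \<and>
     (\<forall>b<N. v a (\<lambda>e. uE x e $$ (ei b, ej b)) = (if a = b then 1 else 0))" using tangent_curves[OF x(1)] by blast
  have "mat N N (\<lambda>(a, b). v a (\<lambda>e. uE x e $$ (ei b, ej b))) = 1\<^sub>m N"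
    using v by (intro eq_matI) auto
  then have "wv x v = 1" by (simp add: wv_def wedge_differentials_def)
  then have "omega e v \<noteq> 0" using omega_ph[OF x(1), of v] v x by (simp add: S'_iff)
  then show "\<exists>v. (\<forall>a<N. v a \<in> tangent_space E e) \<and> omega e v \<noteq> 0" using v x(2) by blast
qed

end

section \<open>Irreducible sets\<close>

text \<open>Phrased with open sets so that it applies to sets that are not closed; it then passes to
  images under continuous maps and to closures.\<close>

definition irreducible_in :: "'a topology \<Rightarrow> 'a set \<Rightarrow> bool" where
  "irreducible_in T C \<longleftrightarrow> C \<noteq> {} \<and>
     (\<forall>A B. openin T A \<longrightarrow> openin T B \<longrightarrow> A \<inter> C \<noteq> {} \<longrightarrow> B \<inter> C \<noteq> {} \<longrightarrow> A \<inter> B \<inter> C \<noteq> {})"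

lemma irreducible_closed_iff: "irreducible_closed T C \<longleftrightarrow> closedin T C \<and> irreducible_in T C"
proof
  assume l: "irreducible_closed T C"
  then have C: "closedin T C" "C \<noteq> {}" by (auto simp: irreducible_closed_def)
  have "A \<inter> B \<inter> C \<noteq> {}" if AB: "openin T A" "openin T B" "A \<inter> C \<noteq> {}" "B \<inter> C \<noteq> {}" for A B
  proof
    assume e: "A \<inter> B \<inter> C = {}"
    have "closedin T (C - A)" "closedin T (C - B)" using C AB by (auto intro: closedin_diff)
    moreover have "C = (C - A) \<union> (C - B)" using e by auto
    ultimately have "C = C - A \<or> C = C - B" using l unfolding irreducible_closed_def by blast
    then show False using AB by blast
  qed
  then show "closedin T C \<and> irreducible_in T C" using C by (auto simp: irreducible_in_def)
next
  assume r: "closedin T C \<and> irreducible_in T C"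
  have "C = A \<or> C = B" if AB: "closedin T A" "closedin T B" "C = A \<union> B" for A B
  proof (rule ccontr)
    assume n: "\<not> (C = A \<or> C = B)"
    have sub: "C \<subseteq> topspace T" using r closedin_subset by blast
    have o: "openin T (topspace T - A)" "openin T (topspace T - B)" using AB by auto
    have "(topspace T - A) \<inter> C \<noteq> {}" "(topspace T - B) \<inter> C \<noteq> {}" using n AB(3) sub by auto
    with r o have "(topspace T - A) \<inter> (topspace T - B) \<inter> C \<noteq> {}" unfolding irreducible_in_def by blast
    then show False using AB(3) by auto
  qed
  then show "irreducible_closed T C" using r by (auto simp: irreducible_closed_def irreducible_in_def)
qed

lemma irreducible_in_closure:
  assumes "irreducible_in T C" "C \<subseteq> topspace T"
  shows "irreducible_in T (T closure_of C)"
  unfolding irreducible_in_def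
proof (intro conjI allI impI)
  show "T closure_of C \<noteq> {}" using assms closure_of_subset[OF assms(2)] by (auto simp: irreducible_in_def)
  fix A B assume AB: "openin T A" "openin T B" "A \<inter> T closure_of C \<noteq> {}" "B \<inter> T closure_of C \<noteq> {}"
  then have "A \<inter> C \<noteq> {}" "B \<inter> C \<noteq> {}" by (simp_all add: openin_Int_closure_of_eq_empty)
  then have "A \<inter> B \<inter> C \<noteq> {}" using assms(1) AB unfolding irreducible_in_def by blast
  then show "A \<inter> B \<inter> T closure_of C \<noteq> {}" using closure_of_subset[OF assms(2)] by blast
qed

lemma irreducible_in_image:
  assumes "continuous_map S T f" "irreducible_in S C" "C \<subseteq> topspace S"
  shows "irreducible_in T (f ` C)"
  unfolding irreducible_in_def
proof (intro conjI allI impI)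
  show "f ` C \<noteq> {}" using assms(2) by (auto simp: irreducible_in_def)
  fix A B assume AB: "openin T A" "openin T B" "A \<inter> f ` C \<noteq> {}" "B \<inter> f ` C \<noteq> {}"
  let ?A = "{x \<in> topspace S. f x \<in> A}" and ?B = "{x \<in> topspace S. f x \<in> B}"
  have "openin S ?A" "openin S ?B" using AB assms(1) by (auto intro: openin_continuous_map_preimage)
  moreover have "?A \<inter> C \<noteq> {}" "?B \<inter> C \<noteq> {}" using AB assms(3) by auto
  ultimately have "?A \<inter> ?B \<inter> C \<noteq> {}" using assms(2) unfolding irreducible_in_def by blast
  then show "A \<inter> B \<inter> f ` C \<noteq> {}" by blast
qed

section \<open>The dimension of affine space\<close>

abbreviation affine_sp :: "nat \<Rightarrow> complex vec fspace" where
  "affine_sp m \<equiv> induced_space (vec_coords m) (carrier_vec m)"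

lemma polynomial_on_line:
  assumes "f \<in> polynomial_functions (vec_coords m)"
  shows "\<exists>q. \<forall>t. f (vec m (\<lambda>j. a $ j + t * (b $ j - a $ j))) = poly q t"
  using assms
proof induction
  case (const c)
  then show ?case by (intro exI[of _ "[:c:]"]) simp
next
  case (coord f)
  then obtain i where "i < m" "f = (\<lambda>v. v $ i)" by (auto simp: vec_coords_def)
  then show ?case by (intro exI[of _ "[:a $ i, b $ i - a $ i:]"]) simp
next
  case (add f g)
  then obtain q r where "\<forall>t. f (vec m (\<lambda>j. a $ j + t * (b $ j - a $ j))) = poly q t"
    "\<forall>t. g (vec m (\<lambda>j. a $ j + t * (b $ j - a $ j))) = poly r t" by blast
  then show ?case by (intro exI[of _ "q + r"]) simp
next
  case (mult f g)
  then obtain q r where "\<forall>t. f (vec m (\<lambda>j. a $ j + t * (b $ j - a $ j))) = poly q t"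
    "\<forall>t. g (vec m (\<lambda>j. a $ j + t * (b $ j - a $ j))) = poly r t" by blast
  then show ?case by (intro exI[of _ "q * r"]) simp
qed

text \<open>Polynomials that are nonzero at \<open>a\<close> and at \<open>b\<close> restrict to
  nonzero univariate polynomials on the line through these points; their product has a point on the
  line that is not a root.\<close>

lemma irreducible_convex:
  assumes L: "L \<subseteq> carrier_vec m" "L \<noteq> {}"
    and line: "\<And>a b t. a \<in> L \<Longrightarrow> b \<in> L \<Longrightarrow> vec m (\<lambda>j. a $ j + t * (b $ j - a $ j)) \<in> L"
  shows "irreducible_in (zariski (affine_sp m)) L"
  unfolding irreducible_in_def
proof (intro conjI allI impI)
  fix A B assume AB: "openin (zariski (affine_sp m)) A" "openin (zariski (affine_sp m)) B" "A \<inter> L \<noteq> {}" "B \<inter> L \<noteq> {}"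
  then obtain a b where ab: "a \<in> A" "a \<in> L" "b \<in> B" "b \<in> L" by auto
  obtain f where f: "f \<in> polynomial_functions (vec_coords m)" "f a \<noteq> 0" "{y \<in> carrier_vec m. f y \<noteq> 0} \<subseteq> A"
    by (rule openin_inducedE[OF AB(1) ab(1)])
  obtain g where g: "g \<in> polynomial_functions (vec_coords m)" "g b \<noteq> 0" "{y \<in> carrier_vec m. g y \<noteq> 0} \<subseteq> B"
    by (rule openin_inducedE[OF AB(2) ab(3)])
  let ?l = "\<lambda>t. vec m (\<lambda>j. a $ j + t * (b $ j - a $ j))"
  obtain q where q: "\<forall>t. f (?l t) = poly q t" using polynomial_on_line[OF f(1)] by blast
  obtain r where r: "\<forall>t. g (?l t) = poly r t" using polynomial_on_line[OF g(1)] by blast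
  have l01: "?l 0 = a" "?l 1 = b" using ab L(1) by (auto intro!: eq_vecI)
  have "poly q 0 \<noteq> 0" "poly r 1 \<noteq> 0" using q[rule_format, of 0] r[rule_format, of 1] l01 f(2) g(2) by simp_all
  then have "q * r \<noteq> 0" by auto
  then obtain t where "poly (q * r) t \<noteq> 0" using poly_all_0_iff_0 by blast
  then have "f (?l t) \<noteq> 0" "g (?l t) \<noteq> 0" using q r by auto
  then have "?l t \<in> A \<inter> B \<inter> L" using f(3) g(3) line[OF ab(2,4), of t] by auto
  then show "A \<inter> B \<inter> L \<noteq> {}" by blast
qed (use L in auto)

text \<open>Exponents are bounded in each variable separately, not in total degree, so that the
  number of monomials is exactly the power \<open>Suc e ^ m\<close>.\<close>

definition monomials :: "nat \<Rightarrow> nat \<Rightarrow> (nat \<Rightarrow> nat) set" where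
  "monomials m e = PiE {..<m} (\<lambda>_. {..e})"

definition bounded_polynomials :: "nat \<Rightarrow> nat \<Rightarrow> (complex vec \<Rightarrow> complex) set" where
  "bounded_polynomials m e = {f. \<exists>M. \<forall>v. f v = (\<Sum>b\<in>monomials m e. M b * (\<Prod>i<m. v $ i ^ b i))}"

lemma finite_monomials: "finite (monomials m e)" and card_monomials: "card (monomials m e) = Suc e ^ m"
  by (simp_all add: monomials_def finite_PiE card_PiE)

text \<open>Different indices may carry the same exponents, as happens when products are expanded;
  coefficients of equal monomials are collected by grouping.\<close>

lemma bounded_polynomialsI:
  assumes "finite S" "\<And>s. s \<in> S \<Longrightarrow> \<forall>i<m. d s i \<le> e" "\<And>v. f v = (\<Sum>s\<in>S. c s * (\<Prod>i<m. v $ i ^ d s i))"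
  shows "f \<in> bounded_polynomials m e"
proof -
  let ?r = "\<lambda>s. restrict (d s) {..<m}"
  have rm: "?r s \<in> monomials m e" if "s \<in> S" for s
    using assms(2)[OF that] by (auto simp: monomials_def)
  have "f v = (\<Sum>b\<in>monomials m e. (\<Sum>s\<in>{s \<in> S. ?r s = b}. c s) * (\<Prod>i<m. v $ i ^ b i))" for v
  proof -
    have "(\<Sum>b\<in>monomials m e. (\<Sum>s\<in>{s \<in> S. ?r s = b}. c s) * (\<Prod>i<m. v $ i ^ b i)) =
        (\<Sum>b\<in>monomials m e. \<Sum>s\<in>{s \<in> S. ?r s = b}. c s * (\<Prod>i<m. v $ i ^ d s i))"
      unfolding sum_distrib_right by (intro sum.cong refl) auto
    also have "\<dots> = (\<Sum>s\<in>S. c s * (\<Prod>i<m. v $ i ^ d s i))"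
      by (rule sum.group) (use assms(1) finite_monomials rm in auto)
    finally show ?thesis using assms(3) by simp
  qed
  then show ?thesis unfolding bounded_polynomials_def
    by (intro CollectI exI[of _ "\<lambda>b. \<Sum>s\<in>{s \<in> S. ?r s = b}. c s"] allI)
qed

lemma bounded_polynomialsE:
  assumes "f \<in> bounded_polynomials m e"
  obtains M where "\<And>v. f v = (\<Sum>b\<in>monomials m e. M b * (\<Prod>i<m. v $ i ^ b i))"
  using assms unfolding bounded_polynomials_def by blast

lemma monomials_le: "b \<in> monomials m e \<Longrightarrow> i < m \<Longrightarrow> b i \<le> e"
  by (auto simp: monomials_def)

lemma bounded_polynomials_mono:
  assumes "f \<in> bounded_polynomials m e" "e \<le> e'"
  shows "f \<in> bounded_polynomials m e'"
proof -
  obtain M where "\<And>v. f v = (\<Sum>b\<in>monomials m e. M b * (\<Prod>i<m. v $ i ^ b i))" using bounded_polynomialsE[OF assms(1)] by blast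
  then show ?thesis using assms(2)
    by (intro bounded_polynomialsI[where S="monomials m e" and d="\<lambda>b. b" and c=M])
      (auto simp: finite_monomials dest!: monomials_le)
qed

lemma bounded_polynomials_mult:
  assumes "f \<in> bounded_polynomials m e" "g \<in> bounded_polynomials m e'"
  shows "(\<lambda>v. f v * g v) \<in> bounded_polynomials m (e + e')"
proof -
  obtain M where M: "\<And>v. f v = (\<Sum>b\<in>monomials m e. M b * (\<Prod>i<m. v $ i ^ b i))" using bounded_polynomialsE[OF assms(1)] by blast
  obtain M' where M': "\<And>v. g v = (\<Sum>b\<in>monomials m e'. M' b * (\<Prod>i<m. v $ i ^ b i))" using bounded_polynomialsE[OF assms(2)] by blast
  show ?thesis
  proof (rule bounded_polynomialsI[where S="monomials m e \<times> monomials m e'" and d="\<lambda>s i. fst s i + snd s i"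
        and c="\<lambda>s. M (fst s) * M' (snd s)"])
    show "f v * g v = (\<Sum>s\<in>monomials m e \<times> monomials m e'. M (fst s) * M' (snd s) * (\<Prod>i<m. v $ i ^ (fst s i + snd s i)))" for v
      unfolding M M' sum_product sum.cartesian_product
      by (intro sum.cong refl) (auto simp: power_add prod.distrib)
  qed (auto simp: finite_monomials intro!: add_mono dest: monomials_le)
qed

lemma bounded_polynomials_add:
  assumes "f \<in> bounded_polynomials m e" "g \<in> bounded_polynomials m e"
  shows "(\<lambda>v. f v + g v) \<in> bounded_polynomials m e"
proof -
  obtain M where M: "\<And>v. f v = (\<Sum>b\<in>monomials m e. M b * (\<Prod>i<m. v $ i ^ b i))" using bounded_polynomialsE[OF assms(1)] by blast
  obtain M' where M': "\<And>v. g v = (\<Sum>b\<in>monomials m e. M' b * (\<Prod>i<m. v $ i ^ b i))" using bounded_polynomialsE[OF assms(2)] by blast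
  have "\<forall>v. f v + g v = (\<Sum>b\<in>monomials m e. (M b + M' b) * (\<Prod>i<m. v $ i ^ b i))"
    unfolding M M' by (simp add: sum.distrib distrib_right)
  then show ?thesis unfolding bounded_polynomials_def by (intro CollectI exI[of _ "\<lambda>b. M b + M' b"]) simp
qed

lemma bounded_polynomials_const: "(\<lambda>_. c) \<in> bounded_polynomials m e"
  by (rule bounded_polynomialsI[where S="{()}" and d="\<lambda>_ _. 0" and c="\<lambda>_. c"]) auto

lemma bounded_polynomials_power:
  "f \<in> bounded_polynomials m e \<Longrightarrow> (\<lambda>v. f v ^ k) \<in> bounded_polynomials m (k * e)"
proof (induction k)
  case 0
  then show ?case using bounded_polynomials_const[of 1] by simp
next
  case (Suc k)
  then show ?case using bounded_polynomials_mult[of f m e "\<lambda>v. f v ^ k" "k * e"] by simp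
qed

lemma bounded_polynomials_prod:
  "(\<And>i. i < k \<Longrightarrow> f i \<in> bounded_polynomials m e) \<Longrightarrow> (\<lambda>v. \<Prod>i<k. f i v) \<in> bounded_polynomials m (k * e)"
proof (induction k)
  case 0
  then show ?case using bounded_polynomials_const[of 1] by simp
next
  case (Suc k)
  then have "(\<lambda>v. (\<Prod>i<k. f i v) * f k v) \<in> bounded_polynomials m (k * e + e)"
    by (intro bounded_polynomials_mult) auto
  then show ?case by (simp add: add.commute)
qed

lemma polynomial_bounded:
  assumes "f \<in> polynomial_functions (vec_coords m)"
  shows "\<exists>e. f \<in> bounded_polynomials m e"
  using assms
proof induction
  case (const c)
  then show ?case using bounded_polynomials_const by blast
next
  case (coord f)
  then obtain i where i: "i < m" "f = (\<lambda>v. v $ i)" by (auto simp: vec_coords_def)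
  have "v $ i = (\<Prod>j<m. v $ j ^ (if j = i then 1 else 0))" for v :: "complex vec"
  proof -
    have "(\<Prod>j<m. v $ j ^ (if j = i then 1 else 0)) = (\<Prod>j<m. if j = i then v $ i else 1)"
      by (intro prod.cong) auto
    then show ?thesis using i(1) by (simp add: prod.delta)
  qed
  then have "f \<in> bounded_polynomials m 1"
    unfolding i(2) by (intro bounded_polynomialsI[where S="{()}" and d="\<lambda>_ j. if j = i then 1 else 0" and c="\<lambda>_. 1"]) auto
  then show ?case by blast
next
  case (add f g)
  then obtain e e' where "f \<in> bounded_polynomials m e" "g \<in> bounded_polynomials m e'" by blast
  then have "f \<in> bounded_polynomials m (max e e')" "g \<in> bounded_polynomials m (max e e')"
    by (auto intro: bounded_polynomials_mono)
  then show ?case using bounded_polynomials_add by blast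
next
  case (mult f g)
  then show ?case using bounded_polynomials_mult by blast
qed

text \<open>Padding the coefficient matrix with zero rows makes it square and singular, so it has a
  nonzero kernel vector. As \<open>card B < card A\<close>, there is at least one zero row, and
  Laplace expansion along it shows that the determinant vanishes.\<close>

lemma underdetermined_system:
  fixes M :: "'a \<Rightarrow> 'b \<Rightarrow> complex"
  assumes A: "finite A" and B: "finite B" and less: "card B < card A"
  shows "\<exists>c. (\<exists>a\<in>A. c a \<noteq> 0) \<and> (\<forall>b\<in>B. (\<Sum>a\<in>A. c a * M a b) = 0)"
proof -
  let ?k = "card A"
  obtain \<alpha> where \<alpha>: "bij_betw \<alpha> {0..<?k} A" using ex_bij_betw_nat_finite[OF A] by blast
  obtain \<beta> where \<beta>: "bij_betw \<beta> {0..<card B} B" using ex_bij_betw_nat_finite[OF B] by blast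
  define Q where "Q = mat ?k ?k (\<lambda>(j, i). if j < card B then M (\<alpha> i) (\<beta> j) else 0)"
  have Q: "Q \<in> carrier_mat ?k ?k" by (simp add: Q_def)
  have k: "card B < ?k" by (rule less)
  have "det Q = (\<Sum>i<?k. Q $$ (card B, i) * cofactor Q (card B) i)" by (rule laplace_expansion_row[OF Q k])
  then have "det Q = 0" using k by (simp add: Q_def)
  then obtain v where v: "v \<in> carrier_vec ?k" "v \<noteq> 0\<^sub>v ?k" "Q *\<^sub>v v = 0\<^sub>v ?k"
    using det_0_iff_vec_prod_zero[OF Q] by blast
  define c where "c a = v $ (inv_into {0..<?k} \<alpha> a)" for a
  have c\<alpha>: "c (\<alpha> i) = v $ i" if "i < ?k" for i
    using that bij_betw_inv_into_left[OF \<alpha>, of i] by (simp add: c_def)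
  have "\<exists>i<?k. v $ i \<noteq> 0"
  proof (rule ccontr)
    assume "\<not> (\<exists>i<?k. v $ i \<noteq> 0)"
    then have "v = 0\<^sub>v ?k" using v(1) by (intro eq_vecI) auto
    then show False using v(2) by simp
  qed
  then have "\<exists>a\<in>A. c a \<noteq> 0" using c\<alpha> bij_betwE[OF \<alpha>] by force
  moreover have "(\<Sum>a\<in>A. c a * M a b) = 0" if b: "b \<in> B" for b
  proof -
    obtain j where j: "j < card B" "b = \<beta> j" using b \<beta> by (force simp: bij_betw_def)
    have "(\<Sum>a\<in>A. c a * M a b) = (\<Sum>i\<in>{0..<?k}. c (\<alpha> i) * M (\<alpha> i) b)"
      using sum.reindex_bij_betw[OF \<alpha>, of "\<lambda>a. c a * M a b"] by simp
    also have "\<dots> = (\<Sum>i\<in>{0..<?k}. Q $$ (j, i) * v $ i)"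
      using j k by (intro sum.cong refl) (simp add: c\<alpha> Q_def)
    also have "\<dots> = (Q *\<^sub>v v) $ j" using j k v(1) Q by (auto simp: scalar_prod_def)
    also have "\<dots> = 0" using v(3) j k by simp
    finally show ?thesis .
  qed
  ultimately show ?thesis by blast
qed

text \<open>Divide a relation by the largest power of the last function and restrict to the
  next smaller member of the chain.\<close>

lemma chain_algebraically_independent:
  fixes D :: "nat \<Rightarrow> complex vec set"
  assumes irr: "\<And>i. i \<le> k \<Longrightarrow> irreducible_in (zariski (affine_sp m)) (D i)"
    and sub: "\<And>i. i \<le> k \<Longrightarrow> D i \<subseteq> carrier_vec m" and mono: "\<And>i. i < k \<Longrightarrow> D i \<subseteq> D (Suc i)"
    and f: "\<And>i. i < k \<Longrightarrow> f i \<in> polynomial_functions (vec_coords m)"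
    and f0: "\<And>i x. i < k \<Longrightarrow> x \<in> D i \<Longrightarrow> f i x = 0"
    and f1: "\<And>i. i < k \<Longrightarrow> \<exists>x\<in>D (Suc i). f i x \<noteq> 0"
    and A: "finite A" "\<And>a i. a \<in> A \<Longrightarrow> k \<le> i \<Longrightarrow> a i = (0::nat)"
    and rel: "\<And>x. x \<in> D k \<Longrightarrow> (\<Sum>a\<in>A. c a * (\<Prod>i<k. f i x ^ a i)) = 0"
  shows "\<forall>a\<in>A. c a = 0"
  using assms
proof (induction k arbitrary: A c)
  case 0
  show ?case
  proof
    fix a assume a: "a \<in> A"
    have "b = a" if "b \<in> A" for b using 0(8)[OF a] 0(8)[OF that] by (intro ext) simp
    then have "A = {a}" using a by blast
    moreover obtain x where "x \<in> D 0" using 0(1)[of 0] by (auto simp: irreducible_in_def)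
    ultimately show "c a = 0" using 0(9)[of x] by simp
  qed
next
  case (Suc k)
  note alg = function_algebra_polynomial_functions[of "vec_coords m"]
  show ?case
  proof (rule ccontr)
    assume "\<not> (\<forall>a\<in>A. c a = 0)"
    define A' where "A' = {a \<in> A. c a \<noteq> 0}"
    have A': "A' \<noteq> {}" "finite A'" using \<open>\<not> (\<forall>a\<in>A. c a = 0)\<close> Suc.prems(7) by (auto simp: A'_def)
    define s where "s = Min ((\<lambda>a. a k) ` A')"
    have s: "\<And>a. a \<in> A' \<Longrightarrow> s \<le> a k" "\<exists>a\<in>A'. a k = s"
    proof -
      show "s \<le> a k" if "a \<in> A'" for a unfolding s_def using A' that by (intro Min_le) auto
      have "s \<in> (\<lambda>a. a k) ` A'" unfolding s_def using A' by (intro Min_in) auto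
      then show "\<exists>a\<in>A'. a k = s" by auto
    qed
    define G where "G x = (\<Sum>a\<in>A'. c a * ((\<Prod>i<k. f i x ^ a i) * f k x ^ (a k - s)))" for x
    have pw: "(\<lambda>x. g x ^ r) \<in> polynomial_functions (vec_coords m)" if "g \<in> polynomial_functions (vec_coords m)" for g r
      using fa_prod[OF alg, of "{..<r}" "\<lambda>_. g"] that by simp
    have G: "G \<in> polynomial_functions (vec_coords m)"
      unfolding G_def using Suc.prems(4) by (intro fa_sum[OF alg] fa_mult[OF alg] fa_const[OF alg] fa_prod[OF alg] pw) auto
    have fG: "f k x ^ s * G x = 0" if x: "x \<in> D (Suc k)" for x
    proof -
      have "f k x ^ s * G x = (\<Sum>a\<in>A'. c a * (\<Prod>i<Suc k. f i x ^ a i))"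
        unfolding G_def sum_distrib_left
      proof (intro sum.cong refl)
        fix a assume "a \<in> A'"
        then have "f k x ^ a k = f k x ^ s * f k x ^ (a k - s)" using s(1) by (simp flip: power_add)
        then show "f k x ^ s * (c a * ((\<Prod>i<k. f i x ^ a i) * f k x ^ (a k - s))) = c a * (\<Prod>i<Suc k. f i x ^ a i)" by simp
      qed
      also have "\<dots> = (\<Sum>a\<in>A. c a * (\<Prod>i<Suc k. f i x ^ a i))"
        using Suc.prems(7) by (intro sum.mono_neutral_left) (auto simp: A'_def)
      finally show ?thesis using Suc.prems(9)[OF x] by simp
    qed
    \<comment> \<open>If \<open>G\<close> were not zero on \<open>D (Suc k)\<close>, the nonzero
      loci of \<open>G\<close> and of \<open>f k\<close> would both meet this irreducible set, hence
      meet inside it, contradicting \<open>fG\<close>.\<close>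
    have G0: "G x = 0" if x: "x \<in> D (Suc k)" for x
    proof (rule ccontr)
      assume "G x \<noteq> 0"
      obtain y where y: "y \<in> D (Suc k)" "f k y \<noteq> 0" using Suc.prems(6)[of k] by auto
      let ?A = "{v \<in> carrier_vec m. G v \<noteq> 0}" and ?B = "{v \<in> carrier_vec m. f k v \<noteq> 0}"
      have "openin (zariski (affine_sp m)) ?A" "openin (zariski (affine_sp m)) ?B"
        using G Suc.prems(4)[of k] by (auto intro: openin_induced_principal)
      moreover have "?A \<inter> D (Suc k) \<noteq> {}" "?B \<inter> D (Suc k) \<noteq> {}"
        using x y \<open>G x \<noteq> 0\<close> Suc.prems(2)[of "Suc k"] by auto
      ultimately have "?A \<inter> ?B \<inter> D (Suc k) \<noteq> {}"
        using Suc.prems(1)[of "Suc k"] unfolding irreducible_in_def by blast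
      then show False using fG by auto
    qed
    \<comment> \<open>On \<open>D k\<close> the function \<open>f k\<close> vanishes, so the terms
      of \<open>G\<close> that survive are those whose last exponent is exactly \<open>s\<close>.
      Deleting this exponent is injective on them and yields a shorter relation.\<close>
    let ?A1 = "{a \<in> A'. a k = s}" and ?r = "\<lambda>a. a(k := 0)"
    have inj: "inj_on ?r ?A1"
    proof (rule inj_onI)
      fix a b assume "a \<in> ?A1" "b \<in> ?A1" "?r a = ?r b"
      then show "a = b" by (metis (mono_tags, lifting) fun_upd_triv fun_upd_upd mem_Collect_eq)
    qed
    let ?c = "\<lambda>b. c (b(k := s))"
    have rs: "(?r a)(k := s) = a" if "a \<in> ?A1" for a using that by auto
    have "\<forall>b\<in>?r ` ?A1. ?c b = 0"
    proof (rule Suc.IH)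
      show "finite (?r ` ?A1)" using A'(2) by simp
      show "b i = 0" if b: "b \<in> ?r ` ?A1" "k \<le> i" for b i
      proof -
        obtain a where "a \<in> A" "b = ?r a" using b(1) by (auto simp: A'_def)
        then show ?thesis using Suc.prems(8)[of a i] b(2) by auto
      qed
      fix x assume x: "x \<in> D k"
      have fk: "f k x = 0" using Suc.prems(5)[of k x] x by simp
      have "0 = G x" using G0 x Suc.prems(3)[of k] by auto
      also have "\<dots> = (\<Sum>a\<in>?A1. c a * (\<Prod>i<k. f i x ^ a i))"
        unfolding G_def
      proof (intro sum.mono_neutral_cong_right A' ballI)
        fix a assume "a \<in> A' - ?A1"
        then have "a k - s \<noteq> 0" using s(1)[of a] by auto
        then show "c a * ((\<Prod>i<k. f i x ^ a i) * f k x ^ (a k - s)) = 0" by (simp add: fk)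
      qed auto
      also have "\<dots> = (\<Sum>a\<in>?A1. ?c (?r a) * (\<Prod>i<k. f i x ^ ?r a i))"
      proof (intro sum.cong refl)
        fix a assume a: "a \<in> ?A1"
        have "(\<Prod>i<k. f i x ^ ?r a i) = (\<Prod>i<k. f i x ^ a i)" by (intro prod.cong) auto
        then show "c a * (\<Prod>i<k. f i x ^ a i) = ?c (?r a) * (\<Prod>i<k. f i x ^ ?r a i)" using rs[OF a] by simp
      qed
      also have "\<dots> = (\<Sum>b\<in>?r ` ?A1. ?c b * (\<Prod>i<k. f i x ^ b i))" by (simp only: sum.reindex[OF inj] comp_def)
      finally show "(\<Sum>b\<in>?r ` ?A1. ?c b * (\<Prod>i<k. f i x ^ b i)) = 0" by simp
    qed (use Suc.prems in auto)
    moreover obtain a where "a \<in> ?A1" using s(2) by auto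
    ultimately have "c a = 0" using rs by force
    then show False using \<open>a \<in> ?A1\<close> by (auto simp: A'_def)
  qed
qed

text \<open>Choose \<open>f i\<close> vanishing on \<open>D i\<close> but not on
  \<open>D (Suc i)\<close>. For \<open>k > m\<close> there are more products of these functions with
  bounded exponents than monomials available to expand them, hence a nontrivial linear relation,
  which \<open>chain_algebraically_independent\<close> excludes.\<close>

lemma chain_length_le:
  fixes D :: "nat \<Rightarrow> complex vec set"
  assumes irr: "\<And>i. i \<le> k \<Longrightarrow> irreducible_in (zariski (affine_sp m)) (D i)"
    and cl: "\<And>i. i \<le> k \<Longrightarrow> closedin (zariski (affine_sp m)) (D i)" and mono: "\<And>i. i < k \<Longrightarrow> D i \<subset> D (Suc i)"
  shows "k \<le> m"
proof (rule ccontr)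
  assume km: "\<not> k \<le> m"
  have sub: "D i \<subseteq> carrier_vec m" if "i \<le> k" for i using closedin_subset[OF cl[OF that]] by simp
  have "\<exists>f. f \<in> polynomial_functions (vec_coords m) \<and> (\<forall>x\<in>D i. f x = 0) \<and> (\<exists>x\<in>D (Suc i). f x \<noteq> 0)" if i: "i < k" for i
  proof -
    obtain x where x: "x \<in> D (Suc i)" "x \<notin> D i" using mono[OF i] by blast
    have "openin (zariski (affine_sp m)) (carrier_vec m - D i)"
      using cl[of i] i by (auto simp: closedin_def)
    moreover have "x \<in> carrier_vec m - D i" using x sub[of "Suc i"] i by auto
    ultimately obtain f where f: "f \<in> polynomial_functions (vec_coords m)" "f x \<noteq> 0" "{y \<in> carrier_vec m. f y \<noteq> 0} \<subseteq> carrier_vec m - D i"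
      by (rule openin_inducedE)
    then have "\<forall>x\<in>D i. f x = 0" using sub[of i] i by auto
    then show ?thesis using f x by blast
  qed
  then have "\<forall>i. \<exists>f. i < k \<longrightarrow> f \<in> polynomial_functions (vec_coords m) \<and> (\<forall>x\<in>D i. f x = 0) \<and> (\<exists>x\<in>D (Suc i). f x \<noteq> 0)"
    by blast
  from choice[OF this] obtain f where
    f: "\<And>i. i < k \<Longrightarrow> f i \<in> polynomial_functions (vec_coords m) \<and> (\<forall>x\<in>D i. f i x = 0) \<and> (\<exists>x\<in>D (Suc i). f i x \<noteq> 0)" by blast
  have "\<forall>i. \<exists>e. i < k \<longrightarrow> f i \<in> bounded_polynomials m e" using f polynomial_bounded by blast
  from choice[OF this] obtain e' where e': "\<And>i. i < k \<Longrightarrow> f i \<in> bounded_polynomials m (e' i)" by blast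
  define e where "e = (\<Sum>i<k. e' i)"
  have e: "f i \<in> bounded_polynomials m e" if "i < k" for i
    using that unfolding e_def by (intro bounded_polynomials_mono[OF e'[OF that]] member_le_sum) auto
  \<comment> \<open>This bound makes the count work: \<open>(k * e * d + 1) ^ m\<close> is at most
    \<open>((k * e + 1) * (d + 1)) ^ m\<close>, which equals \<open>d * (d + 1) ^ m\<close> and is
    below \<open>(d + 1) ^ k\<close> as soon as \<open>k > m\<close>.\<close>
  define d where "d = Suc (k * e) ^ m"
  \<comment> \<open>Members of \<open>monomials k d\<close> are \<open>undefined\<close> beyond
    \<open>k\<close>; they are changed to 0 there, as the independence lemma requires.\<close>
  define A where "A = (\<lambda>a i. if i < k then a i else 0) ` monomials k d"
  have injA: "inj_on (\<lambda>a i. if i < k then a i else (0::nat)) (monomials k d)"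
  proof (rule inj_onI)
    fix a b assume ab: "a \<in> monomials k d" "b \<in> monomials k d" "(\<lambda>i. if i < k then a i else (0::nat)) = (\<lambda>i. if i < k then b i else 0)"
    show "a = b"
    proof (rule PiE_ext)
      show "a \<in> PiE {..<k} (\<lambda>_. {..d})" "b \<in> PiE {..<k} (\<lambda>_. {..d})" using ab by (auto simp: monomials_def)
      show "a i = b i" if "i \<in> {..<k}" for i using fun_cong[OF ab(3), of i] that by simp
    qed
  qed
  have finA: "finite A" and cardA: "card A = Suc d ^ k"
    using finite_monomials card_image[OF injA] by (auto simp: A_def card_monomials)
  have A0: "a i = 0" if "a \<in> A" "k \<le> i" for a i using that by (auto simp: A_def)
  have Ad: "a i \<le> d" if "a \<in> A" for a i using that monomials_le by (auto simp: A_def)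
  have "(\<lambda>v. \<Prod>i<k. f i v ^ a i) \<in> bounded_polynomials m (k * (d * e))" if a: "a \<in> A" for a
  proof (rule bounded_polynomials_prod)
    fix i assume "i < k"
    then show "(\<lambda>v. f i v ^ a i) \<in> bounded_polynomials m (d * e)"
      using bounded_polynomials_mono[OF bounded_polynomials_power[OF e]] Ad[OF a] by (simp add: mult_le_mono)
  qed
  then have "\<forall>a. \<exists>M. a \<in> A \<longrightarrow> (\<forall>v. (\<Prod>i<k. f i v ^ a i) = (\<Sum>b\<in>monomials m (k * (d * e)). M b * (\<Prod>i<m. v $ i ^ b i)))"
    unfolding bounded_polynomials_def by blast
  from choice[OF this] obtain M where
    M: "\<And>a v. a \<in> A \<Longrightarrow> (\<Prod>i<k. f i v ^ a i) = (\<Sum>b\<in>monomials m (k * (d * e)). M a b * (\<Prod>i<m. v $ i ^ b i))" by blast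
  have less: "card (monomials m (k * (d * e))) < card A"
  proof -
    have "Suc (k * (d * e)) \<le> Suc (k * e) * Suc d" by (simp add: algebra_simps)
    then have "Suc (k * (d * e)) ^ m \<le> (Suc (k * e) * Suc d) ^ m" by (rule power_mono) simp
    also have "\<dots> = d * Suc d ^ m" unfolding power_mult_distrib d_def ..
    also have "\<dots> < Suc d * Suc d ^ m" by simp
    also have "\<dots> = Suc d ^ Suc m" by simp
    also have "\<dots> \<le> Suc d ^ k" using km by (intro power_increasing) auto
    finally show ?thesis by (simp add: card_monomials cardA)
  qed
  obtain c where c: "\<exists>a\<in>A. c a \<noteq> 0" "\<forall>b\<in>monomials m (k * (d * e)). (\<Sum>a\<in>A. c a * M a b) = 0"
    using underdetermined_system[OF finA finite_monomials less, of M] by blast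
  have rel: "(\<Sum>a\<in>A. c a * (\<Prod>i<k. f i x ^ a i)) = 0" for x
  proof -
    have "(\<Sum>a\<in>A. c a * (\<Prod>i<k. f i x ^ a i)) = (\<Sum>a\<in>A. \<Sum>b\<in>monomials m (k * (d * e)). c a * M a b * (\<Prod>i<m. x $ i ^ b i))"
      using M by (intro sum.cong refl) (simp add: sum_distrib_left mult.assoc)
    also have "\<dots> = (\<Sum>b\<in>monomials m (k * (d * e)). (\<Sum>a\<in>A. c a * M a b) * (\<Prod>i<m. x $ i ^ b i))"
      by (subst sum.swap) (simp add: sum_distrib_right)
    also have "\<dots> = 0" using c(2) by simp
    finally show ?thesis .
  qed
  have "\<forall>a\<in>A. c a = 0"
    by (rule chain_algebraically_independent[of k m D f A c]) (use irr sub psubset_imp_subset[OF mono] f finA A0 rel in auto)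
  then show False using c(1) by blast
qed

section \<open>The dimension of the homogeneous space\<close>

context flag_quotient
begin

lemma krull_dimension_X: "krull_dimension X = enat N"
proof (rule antisym)
  show "krull_dimension X \<le> enat N"
    unfolding krull_dimension_def
  proof (rule Sup_least)
    fix e assume "e \<in> {enat k | k. \<exists>C. (\<forall>i\<le>k. irreducible_closed (zariski X) (C i)) \<and> (\<forall>i<k. C i \<subset> C (Suc i))}"
    then obtain k C where e: "e = enat k" and C: "\<And>i. i \<le> k \<Longrightarrow> irreducible_closed (zariski X) (C i)" "\<And>i. i < k \<Longrightarrow> C i \<subset> C (Suc i)"
      by blast
    have cl: "closedin (zariski X) (C i)" and irr: "irreducible_in (zariski X) (C i)" if "i \<le> k" for i
      using C(1)[OF that] by (auto simp: irreducible_closed_iff)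
    \<comment> \<open>A point of the smallest member belongs to all members, so one chart around it
      meets the whole chain.\<close>
    obtain x where x: "x \<in> C 0" using irr[of 0] by (auto simp: irreducible_in_def)
    then have "x \<in> points X" using closedin_subset[OF cl[of 0]] by auto
    then obtain g where g: "g \<in> SLset n" "x = p g" by (auto simp: points_X)
    have xU: "x \<in> Xop g" using p_in_Xop g by simp
    note oU = Xop_open[OF g(1)]
    let ?XU = "open_subspace X (Xop g)"
    have pXU: "points ?XU = Xop g" using openin_subset[OF oU] by auto
    note iso = chartX_iso[OF g(1)]
    let ?\<phi> = "inv_into (points ?XU) (chartX g)"
    have bij: "bij_betw (chartX g) (points ?XU) (carrier_vec N)" and m1: "morphism ?XU A_N (chartX g)"
      and m2: "morphism A_N ?XU ?\<phi>" using iso by (auto simp: isomorphism_def)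
    have m2': "morphism A_N X ?\<phi>" by (rule morphism_from_open_subspace[OF m2 local_X oU])
    define D where "D i = {v \<in> carrier_vec N. ?\<phi> v \<in> C i}" for i
    have mono0: "C 0 \<subseteq> C i" if "i \<le> k" for i
      using that
    proof (induction i)
      case (Suc i)
      then show ?case using C(2)[of i] by auto
    qed simp
    have inv: "chartX g y \<in> carrier_vec N \<and> ?\<phi> (chartX g y) = y" if "y \<in> Xop g" for y
      using that bij_betw_inv_into_left[OF bij] bij_betwE[OF bij] unfolding pXU by auto
    have \<phi>U: "?\<phi> v \<in> Xop g \<and> chartX g (?\<phi> v) = v" if "v \<in> carrier_vec N" for v
      using that bij_betw_inv_into_right[OF bij] morphismD(1)[OF m2] unfolding pXU by auto
    have "k \<le> N"
    proof (rule chain_length_le[where D=D])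
      show "closedin (zariski A_N) (D i)" if "i \<le> k" for i
        using closedin_continuous_map_preimage[of "zariski A_N" "zariski X" ?\<phi> "C i"] m2' cl[OF that]
        unfolding D_def morphism_def by simp
      show "irreducible_in (zariski A_N) (D i)" if i: "i \<le> k" for i
        unfolding irreducible_in_def
      proof (intro conjI allI impI)
        have "chartX g x \<in> D i" using inv[OF xU] mono0[OF i] x unfolding D_def by auto
        then show "D i \<noteq> {}" by blast
        fix A B assume AB: "openin (zariski A_N) A" "openin (zariski A_N) B" "A \<inter> D i \<noteq> {}" "B \<inter> D i \<noteq> {}"
        let ?p = "\<lambda>A. {y \<in> Xop g. chartX g y \<in> A}"
        have op: "openin (zariski X) (?p A)" if "openin (zariski A_N) A" for A
          using morphismD(2)[OF m1 that] unfolding pXU openin_open_subspace[OF oU] by simp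
        have ne: "?p A \<inter> C i \<noteq> {}" if "A \<inter> D i \<noteq> {}" for A
        proof -
          obtain v where "v \<in> A" "v \<in> carrier_vec N" "?\<phi> v \<in> C i" using \<open>A \<inter> D i \<noteq> {}\<close> unfolding D_def by blast
          then have "?\<phi> v \<in> ?p A \<inter> C i" using \<phi>U[of v] by simp
          then show ?thesis by blast
        qed
        have "?p A \<inter> ?p B \<inter> C i \<noteq> {}"
          using irr[OF i] op[OF AB(1)] op[OF AB(2)] ne[OF AB(3)] ne[OF AB(4)] unfolding irreducible_in_def by blast
        then show "A \<inter> B \<inter> D i \<noteq> {}" using inv by (fastforce simp: D_def)
      qed
      show "D i \<subset> D (Suc i)" if i: "i < k" for i
      proof -
        \<comment> \<open>Strictness survives the restriction to the chart: the complement of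
          \<open>C i\<close> and the chart are open sets meeting the irreducible
          \<open>C (Suc i)\<close>, so they meet within it.\<close>
        have "openin (zariski X) (points X - C i)" using cl[of i] i by auto
        moreover have "(points X - C i) \<inter> C (Suc i) \<noteq> {}"
          using C(2)[OF i] closedin_subset[OF cl[of "Suc i"]] i by auto
        moreover have "Xop g \<inter> C (Suc i) \<noteq> {}" using xU x mono0[of "Suc i"] i by auto
        ultimately have "(points X - C i) \<inter> Xop g \<inter> C (Suc i) \<noteq> {}"
          using irr[of "Suc i"] i oU unfolding irreducible_in_def by (simp add: Suc_leI)
        then obtain y where y: "y \<in> Xop g" "y \<in> C (Suc i)" "y \<notin> C i" by blast
        then have "chartX g y \<in> D (Suc i)" "chartX g y \<notin> D i" using inv by (auto simp: D_def)
        moreover have "D i \<subseteq> D (Suc i)" using C(2)[OF i] by (auto simp: D_def)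
        ultimately show ?thesis by blast
      qed
    qed
    then show "e \<le> enat N" by (simp add: e)
  qed
next
  let ?g = "1\<^sub>m n :: complex mat"
  have g: "?g \<in> SLset n" by simp
  note oU = Xop_open[OF g]
  let ?XU = "open_subspace X (Xop ?g)"
  have pXU: "points ?XU = Xop ?g" using openin_subset[OF oU] by auto
  note iso = chartX_iso[OF g]
  let ?\<phi> = "inv_into (points ?XU) (chartX ?g)"
  have bij: "bij_betw (chartX ?g) (points ?XU) (carrier_vec N)" and m1: "morphism ?XU A_N (chartX ?g)"
    and m2: "morphism A_N ?XU ?\<phi>" using iso by (auto simp: isomorphism_def)
  have m2': "morphism A_N X ?\<phi>" by (rule morphism_from_open_subspace[OF m2 local_X oU])
  have \<phi>U: "?\<phi> v \<in> Xop ?g \<and> chartX ?g (?\<phi> v) = v" if "v \<in> carrier_vec N" for v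
    using that bij_betw_inv_into_right[OF bij] morphismD(1)[OF m2] unfolding pXU by auto
  \<comment> \<open>The flag of coordinate subspaces gives a chain of length \<open>N\<close>; its
    images in the chart are closed up in the whole space.\<close>
  define L where "L i = {v :: complex vec. v \<in> carrier_vec N \<and> (\<forall>j<N. i \<le> j \<longrightarrow> v $ j = 0)}" for i
  define C where "C i = zariski X closure_of (?\<phi> ` L i)" for i
  have irrL: "irreducible_in (zariski A_N) (L i)" for i
  proof (rule irreducible_convex)
    show "L i \<subseteq> carrier_vec N" by (auto simp: L_def)
    have "0\<^sub>v N \<in> L i" by (simp add: L_def)
    then show "L i \<noteq> {}" by blast
  qed (auto simp: L_def)
  have imX: "?\<phi> ` L i \<subseteq> points X" for i using morphismD(1)[OF m2'] by (auto simp: L_def)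
  have irr: "irreducible_closed (zariski X) (C i)" for i
    unfolding irreducible_closed_iff C_def
    using m2' irrL[of i] imX[of i]
    by (intro conjI closedin_closure_of irreducible_in_closure irreducible_in_image[of "zariski A_N"])
      (auto simp: morphism_def L_def)
  have strict: "C i \<subset> C (Suc i)" if i: "i < N" for i
  proof -
    have "C i \<subseteq> C (Suc i)" unfolding C_def by (intro closure_of_mono image_mono) (auto simp: L_def)
    moreover have "?\<phi> (unit_vec N i) \<in> C (Suc i)"
      unfolding C_def using closure_of_subset[OF imX[of "Suc i"]] i by (force simp: L_def)
    moreover have "?\<phi> (unit_vec N i) \<notin> C i"
    proof
      assume a: "?\<phi> (unit_vec N i) \<in> C i"
      \<comment> \<open>Where coordinate \<open>i\<close> is nonzero there is an open set containing
        the image of \<open>unit_vec N i\<close> and avoiding the image of \<open>L i\<close>; hence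
        it also avoids the closure \<open>C i\<close>.\<close>
      let ?O = "{y \<in> points ?XU. chartX ?g y \<in> {v \<in> carrier_vec N. v $ i \<noteq> 0}}"
      have "(\<lambda>v. v $ i) \<in> polynomial_functions (vec_coords N)"
        by (intro polynomial_functions.coord) (use i in \<open>auto simp: vec_coords_def\<close>)
      then have "openin (zariski A_N) {v \<in> carrier_vec N. v $ i \<noteq> 0}" by (rule openin_induced_principal)
      from morphismD(2)[OF m1 this] have o: "openin (zariski X) ?O"
        using openin_open_subspace[OF oU] by blast
      have "?\<phi> (unit_vec N i) \<in> ?O" using \<phi>U[of "unit_vec N i"] i unfolding pXU by simp
      then have "?O \<inter> C i \<noteq> {}" using a by blast
      then have "?O \<inter> ?\<phi> ` L i \<noteq> {}" unfolding C_def using openin_Int_closure_of_eq_empty[OF o] by blast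
      then obtain v where "v \<in> L i" "?\<phi> v \<in> ?O" by blast
      then show False using \<phi>U[of v] i by (auto simp: L_def)
    qed
    ultimately show ?thesis by blast
  qed
  show "enat N \<le> krull_dimension X"
    unfolding krull_dimension_def by (rule Sup_upper) (use irr strict in blast)
qed

end

section \<open>The theorem of Lie and Kolchin\<close>

text \<open>This is the only consequence of Zariski connectedness that the theorem needs.\<close>

definition rigid :: "nat \<Rightarrow> complex mat set \<Rightarrow> bool" where
  "rigid n K \<longleftrightarrow> (\<forall>f\<in>polynomial_functions (mat_coords n). finite (f ` K) \<longrightarrow> (\<forall>x\<in>K. \<forall>y\<in>K. f x = f y))"

definition poly_on :: "nat \<Rightarrow> complex mat set \<Rightarrow> (complex mat \<Rightarrow> complex) set" where
  "poly_on n K = {f. \<exists>p\<in>polynomial_functions (mat_coords n). \<forall>x\<in>K. f x = p x}"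

lemma poly_on_algebra: "function_algebra K (poly_on n K)"
  unfolding poly_on_def by (rule function_algebra_polynomial_on)

lemma poly_on_entries: "K \<subseteq> SLset n \<Longrightarrow> mat_entries K (poly_on n K) n n (\<lambda>x. x)"
  by (rule SL_space_entries[OF _ poly_on_algebra]) (auto simp: poly_on_def)

lemma rigidD:
  assumes "rigid n K" "f \<in> poly_on n K" "finite (f ` K)" "x \<in> K" "y \<in> K"
  shows "f x = f y"
proof -
  obtain p where p: "p \<in> polynomial_functions (mat_coords n)" "\<forall>x\<in>K. f x = p x"
    using assms(2) by (auto simp: poly_on_def)
  then have "f ` K = p ` K" by auto
  then show ?thesis using assms p unfolding rigid_def by auto
qed

lemma poly_on_compose:
  assumes f: "f \<in> poly_on n L" and fa: "function_algebra K F" and M: "mat_entries K F n n M"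
    and im: "\<And>x. x \<in> K \<Longrightarrow> M x \<in> L"
  shows "(\<lambda>x. f (M x)) \<in> F"
proof -
  obtain p where p: "p \<in> polynomial_functions (mat_coords n)" "\<forall>x\<in>L. f x = p x" using f by (auto simp: poly_on_def)
  have "(\<lambda>x. p (M x)) \<in> F"
    by (rule fa_polynomial[OF fa p(1)]) (use mat_entriesD[OF fa M] in auto)
  then show ?thesis by (rule fa_cong[OF fa]) (use p im in auto)
qed

text \<open>If \<open>f\<close> took several but finitely many values on \<open>K\<close>, the locus
  \<open>f \<noteq> f x\<close> and the locus where the product of \<open>f - c\<close> over the
  other values \<open>c\<close> is nonzero would be open and disconnect \<open>K\<close>.\<close>

lemma connected_rigid:
  assumes "connectedin (zariski (SL_space n)) K"
  shows "rigid n K"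
  unfolding rigid_def
proof (intro ballI impI)
  fix f x y assume f: "f \<in> polynomial_functions (mat_coords n)" and fin: "finite (f ` K)" and x: "x \<in> K" and y: "y \<in> K"
  show "f x = f y"
  proof (rule ccontr)
    assume ne: "f x \<noteq> f y"
    have K: "K \<subseteq> SLset n" using connectedin_subset_topspace[OF assms] by simp
    let ?C = "f ` K - {f x}"
    let ?g = "\<lambda>v. \<Prod>c\<in>?C. f v - c"
    note fa = function_algebra_polynomial_functions[of "mat_coords n"]
    let ?U = "{v \<in> SLset n. f v - f x \<noteq> 0}" and ?V = "{v \<in> SLset n. ?g v \<noteq> 0}"
    have "openin (zariski (SL_space n)) ?U"
      by (intro openin_induced_principal fa_diff[OF fa] f fa_const[OF fa])
    moreover have "openin (zariski (SL_space n)) ?V"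
      by (intro openin_induced_principal fa_prod[OF fa] fa_diff[OF fa] f fa_const[OF fa])
    moreover have "K \<subseteq> ?U \<union> ?V" using K fin by auto
    moreover have "?U \<inter> ?V \<inter> K = {}" using fin by auto
    moreover have "?U \<inter> K \<noteq> {}" using y ne K by auto
    moreover have "?V \<inter> K \<noteq> {}" using x K fin by auto
    ultimately show False using assms unfolding connectedin by blast
  qed
qed

section \<open>Rigidity of the derived subgroup\<close>

lemma inv_commutator_SL:
  assumes "a \<in> SLset n" "b \<in> SLset n"
  shows "adj_mat (a * b * adj_mat a * adj_mat b) = b * a * adj_mat b * adj_mat a"
  using assms SLset_adj(1)[OF assms(1)] SLset_adj(1)[OF assms(2)]
  by (simp add: SLset_adj_mult SLset_adj_adj SLset_assoc[of _ n])

text \<open>The inverse of a commutator is again a commutator, so every element of the derived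
  subgroup is reached from the identity by multiplying commutators on the right.\<close>

lemma derived_SL_induct [consumes 2, case_names one step]:
  assumes K: "subgroup K (SL n)" and w: "w \<in> derived (SL n) K"
    and one: "Q (1\<^sub>m n)"
    and step: "\<And>y a b. y \<in> derived (SL n) K \<Longrightarrow> a \<in> K \<Longrightarrow> b \<in> K \<Longrightarrow> Q y \<Longrightarrow> Q (y * (a * b * adj_mat a * adj_mat b))"
  shows "Q w"
proof -
  interpret G: group "SL n" by (rule group_SL)
  have KS: "K \<subseteq> SLset n" using subgroup.subset[OF K] by simp
  have D: "derived (SL n) K \<subseteq> SLset n" using G.derived_in_carrier[of K] KS by simp
  have comm: "\<exists>a\<in>K. \<exists>b\<in>K. h = a * b * adj_mat a * adj_mat b" if "h \<in> derived_set (SL n) K" for h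
    using that KS by (auto simp: inv_SL subset_iff)
  \<comment> \<open>The statement is strengthened to an arbitrary left factor \<open>y\<close>,
    which is what the product case of \<open>generate\<close> needs.\<close>
  have "\<forall>y\<in>derived (SL n) K. Q y \<longrightarrow> Q (y * w)" if "w \<in> generate (SL n) (derived_set (SL n) K)" for w
    using that
  proof induction
    case one
    then show ?case using D by auto
  next
    case (incl h)
    then obtain a b where ab: "a \<in> K" "b \<in> K" "h = a * b * adj_mat a * adj_mat b" using comm by blast
    show ?case unfolding ab(3) using step[OF _ ab(1,2)] by simp
  next
    case (inv h)
    then obtain a b where ab: "a \<in> K" "b \<in> K" "h = a * b * adj_mat a * adj_mat b" using comm by blast
    then have S: "a \<in> SLset n" "b \<in> SLset n" using KS by auto
    then have "h \<in> SLset n" using ab SLset_adj(1)[OF S(1)] SLset_adj(1)[OF S(2)] by simp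
    then have "inv\<^bsub>SL n\<^esub> h = b * a * adj_mat b * adj_mat a" using inv_SL inv_commutator_SL[OF S] ab by simp
    then show ?case using step[OF _ ab(2,1)] by simp
  next
    case (eng h1 h2)
    have h: "h1 \<in> derived (SL n) K" "h2 \<in> derived (SL n) K" using eng.hyps by (auto simp: derived_def)
    show ?case
    proof (intro ballI impI)
      fix y assume y: "y \<in> derived (SL n) K" "Q y"
      have "y * h1 \<in> derived (SL n) K"
        using subgroup.m_closed[OF G.derived_is_subgroup y(1) h(1)] KS by simp
      then have "Q (y * h1 * h2)" using eng.IH y by blast
      moreover have "y * h1 * h2 = y * (h1 * h2)" using y(1) h D by (intro SLset_assoc[of _ n]) auto
      ultimately show "Q (y * (h1 \<otimes>\<^bsub>SL n\<^esub> h2))" by simp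
    qed
  qed
  from this[of w] w have "\<forall>y\<in>derived (SL n) K. Q y \<longrightarrow> Q (y * w)" by (simp add: derived_def)
  moreover have "1\<^sub>m n \<in> derived (SL n) K"
    using subgroup.one_closed[OF G.derived_is_subgroup, of K] KS by simp
  moreover have "1\<^sub>m n * w = w" using w D by auto
  ultimately show ?thesis using one by metis
qed

lemma commutator_entries:
  assumes K: "K \<subseteq> SLset n" and a: "a \<in> SLset n" and y: "y \<in> SLset n"
  shows "mat_entries K (poly_on n K) n n (\<lambda>x. y * (x * a * adj_mat x * adj_mat a))"
    and "mat_entries K (poly_on n K) n n (\<lambda>x. a * x * adj_mat a * adj_mat x)"
    and "mat_entries K (poly_on n K) n n (\<lambda>x. adj_mat x * a * x)"
proof -
  note fa = poly_on_algebra[of K n] and id = poly_on_entries[OF K]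
  note adj = mat_entries_adj[OF fa id]
  note c = mat_entries_const[OF fa SLset_carrier[OF a]] mat_entries_const[OF fa SLset_carrier[OF SLset_adj(1)[OF a]]]
    mat_entries_const[OF fa SLset_carrier[OF y]]
  show "mat_entries K (poly_on n K) n n (\<lambda>x. y * (x * a * adj_mat x * adj_mat a))"
    by (rule mat_entries_mult[OF fa c(3) mat_entries_mult[OF fa mat_entries_mult[OF fa mat_entries_mult[OF fa id c(1)] adj] c(2)]])
  show "mat_entries K (poly_on n K) n n (\<lambda>x. a * x * adj_mat a * adj_mat x)"
    by (rule mat_entries_mult[OF fa mat_entries_mult[OF fa mat_entries_mult[OF fa c(1) id] c(2)] adj])
  show "mat_entries K (poly_on n K) n n (\<lambda>x. adj_mat x * a * x)"
    by (rule mat_entries_mult[OF fa mat_entries_mult[OF fa adj c(1)] id])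
qed

lemma derived_commutator:
  assumes K: "K \<subseteq> SLset n" and "a \<in> K" "b \<in> K"
  shows "a * b * adj_mat a * adj_mat b \<in> derived (SL n) K"
proof -
  have "a * b * adj_mat a * adj_mat b \<in> derived_set (SL n) K"
    using assms by (intro UN_I[of a] UN_I[of b]) (auto simp: inv_SL subset_iff)
  then show ?thesis unfolding derived_def by (rule generate.incl)
qed

text \<open>With \<open>y\<close> and \<open>b\<close> fixed, the value of \<open>f\<close> at
  \<open>y\<close> times the commutator of \<open>a\<close> and \<open>b\<close> is a polynomial in
  \<open>a\<close> on \<open>K\<close> with finitely many values. Rigidity of \<open>K\<close> makes
  it constant, and \<open>a = 1\<close> gives \<open>f y\<close>. So commutators can be stripped off
  one by one.\<close>

lemma rigid_derived:
  assumes K: "subgroup K (SL n)" and r: "rigid n K"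
  shows "rigid n (derived (SL n) K)"
  unfolding rigid_def
proof (intro ballI impI)
  interpret G: group "SL n" by (rule group_SL)
  let ?D = "derived (SL n) K"
  have KS: "K \<subseteq> SLset n" using subgroup.subset[OF K] by simp
  have D: "?D \<subseteq> SLset n" using G.derived_in_carrier[of K] KS by simp
  have one: "1\<^sub>m n \<in> K" using subgroup.one_closed[OF K] by simp
  fix f x y assume f: "f \<in> polynomial_functions (mat_coords n)" and fin: "finite (f ` ?D)" and xy: "x \<in> ?D" "y \<in> ?D"
  have *: "f w = f (1\<^sub>m n)" if "w \<in> ?D" for w
    using K that
  proof (induction rule: derived_SL_induct)
    case (step y a b)
    have S: "a \<in> SLset n" "b \<in> SLset n" "y \<in> SLset n" using step KS D by auto
    let ?M = "\<lambda>x. y * (x * b * adj_mat x * adj_mat b)"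
    have MD: "?M x \<in> ?D" if "x \<in> K" for x
      using subgroup.m_closed[OF G.derived_is_subgroup step(1) derived_commutator[OF KS that step(3)]] KS by simp
    have "(\<lambda>x. f (?M x)) \<in> poly_on n K"
      by (rule poly_on_compose[OF _ poly_on_algebra commutator_entries(1)[OF KS S(2,3)], of f UNIV])
        (use f in \<open>auto simp: poly_on_def\<close>)
    moreover have "finite ((\<lambda>x. f (?M x)) ` K)" by (rule finite_subset[OF _ fin]) (use MD in auto)
    ultimately have "f (?M a) = f (?M (1\<^sub>m n))" using rigidD[OF r] step(2) one by blast
    also have "?M (1\<^sub>m n) = y" using S SLset_adj[OF S(2)] by simp
    finally show ?case using step(4) by simp
  qed simp
  show "f x = f y" using *[OF xy(1)] *[OF xy(2)] by simp
qed

text \<open>General polynomial representations are needed, although the theorem is applied to the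
  standard one, because the induction passes to the diagonal blocks.\<close>

definition is_rep :: "nat \<Rightarrow> complex mat set \<Rightarrow> nat \<Rightarrow> (complex mat \<Rightarrow> complex mat) \<Rightarrow> bool" where
  "is_rep n K m \<rho> \<longleftrightarrow> (\<forall>x\<in>K. \<rho> x \<in> carrier_mat m m) \<and> (\<forall>i<m. \<forall>j<m. (\<lambda>x. \<rho> x $$ (i, j)) \<in> poly_on n K) \<and>
     \<rho> (1\<^sub>m n) = 1\<^sub>m m \<and> (\<forall>x\<in>K. \<forall>y\<in>K. \<rho> (x * y) = \<rho> x * \<rho> y)"

definition triangularizable :: "complex mat set \<Rightarrow> nat \<Rightarrow> (complex mat \<Rightarrow> complex mat) \<Rightarrow> bool" where
  "triangularizable K m \<rho> \<longleftrightarrow> (\<exists>S T. S \<in> carrier_mat m m \<and> T \<in> carrier_mat m m \<and> S * T = 1\<^sub>m m \<and> T * S = 1\<^sub>m m \<and>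
     (\<forall>x\<in>K. \<forall>i<m. \<forall>j<i. (T * \<rho> x * S) $$ (i, j) = 0))"

section \<open>Bases adapted to an invariant subspace\<close>

definition subspace_vec :: "nat \<Rightarrow> complex vec set \<Rightarrow> bool" where
  "subspace_vec m V \<longleftrightarrow> V \<subseteq> carrier_vec m \<and> 0\<^sub>v m \<in> V \<and> (\<forall>v\<in>V. \<forall>w\<in>V. v + w \<in> V) \<and> (\<forall>c. \<forall>v\<in>V. c \<cdot>\<^sub>v v \<in> V)"

lemma mat_inverse_exists:
  assumes "S \<in> carrier_mat m m" "det S \<noteq> (0::complex)"
  obtains T where "T \<in> carrier_mat m m" "S * T = 1\<^sub>m m" "T * S = 1\<^sub>m m"
proof -
  let ?T = "inverse (det S) \<cdot>\<^sub>m adj_mat S"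
  have T: "?T \<in> carrier_mat m m" using adj_mat(1)[OF assms(1)] by simp
  have "S * ?T = inverse (det S) \<cdot>\<^sub>m (S * adj_mat S)" by (rule mult_smult_distrib[OF assms(1) adj_mat(1)[OF assms(1)]])
  also have "\<dots> = 1\<^sub>m m" using adj_mat(2)[OF assms(1)] assms(2) by (intro eq_matI) auto
  finally have "S * ?T = 1\<^sub>m m" .
  then show ?thesis using that T mat_mult_left_right_inverse[OF assms(1) T] by blast
qed

lemma subspace_combination:
  assumes V: "subspace_vec m V" and S: "S \<in> carrier_mat m m" and z: "z \<in> carrier_vec m"
    and col: "\<And>j. j < m \<Longrightarrow> col S j \<in> V"
  shows "S *\<^sub>v z \<in> V"
proof -
  have "vec m (\<lambda>a. \<Sum>j<k. S $$ (a, j) * z $ j) \<in> V" if "k \<le> m" for k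
    using that
  proof (induction k)
    case 0
    have "vec m (\<lambda>a. \<Sum>j<(0::nat). S $$ (a, j) * z $ j) = 0\<^sub>v m" by (intro eq_vecI) auto
    then show ?case using V by (simp add: subspace_vec_def)
  next
    case (Suc k)
    have "vec m (\<lambda>a. \<Sum>j<Suc k. S $$ (a, j) * z $ j) = vec m (\<lambda>a. \<Sum>j<k. S $$ (a, j) * z $ j) + z $ k \<cdot>\<^sub>v col S k"
      using S Suc.prems by (intro eq_vecI) (auto simp: mult.commute)
    then show ?case using V Suc col[of k] by (simp add: subspace_vec_def)
  qed
  from this[of m] have "vec m (\<lambda>a. \<Sum>j<m. S $$ (a, j) * z $ j) \<in> V" by simp
  moreover have "vec m (\<lambda>a. \<Sum>j<m. S $$ (a, j) * z $ j) = S *\<^sub>v z"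
    using S z by (intro eq_vecI) (auto simp: scalar_prod_def lessThan_atLeast0)
  ultimately show ?thesis by simp
qed

text \<open>Take an invertible matrix with as many leading columns in \<open>V\<close> as possible.
  If some \<open>v\<close> in \<open>V\<close> had a nonzero coordinate beyond them, exchanging a
  column for \<open>v\<close> would give one column more.\<close>

lemma adapted_basis:
  assumes V: "subspace_vec m V" and ne: "\<exists>v\<in>V. v \<noteq> 0\<^sub>v m" and proper: "V \<noteq> carrier_vec m"
  obtains S T r where "S \<in> carrier_mat m m" "T \<in> carrier_mat m m" "S * T = 1\<^sub>m m" "T * S = 1\<^sub>m m" "0 < r" "r < m"
    "\<And>j. j < r \<Longrightarrow> col S j \<in> V" "\<And>v i. v \<in> V \<Longrightarrow> r \<le> i \<Longrightarrow> i < m \<Longrightarrow> (T *\<^sub>v v) $ i = 0"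
proof -
  have VC: "V \<subseteq> carrier_vec m" using V by (simp add: subspace_vec_def)
  define Q where "Q r \<longleftrightarrow> r \<le> m \<and> (\<exists>S\<in>carrier_mat m m. det S \<noteq> 0 \<and> (\<forall>j<r. col S j \<in> V))" for r
  have "Q 0" unfolding Q_def by (intro conjI bexI[of _ "1\<^sub>m m"]) auto
  have fin: "finite {k. Q k}" by (rule finite_subset[of _ "{..m}"]) (auto simp: Q_def)
  define r where "r = Max {k. Q k}"
  have "r \<in> {k. Q k}" unfolding r_def by (rule Max_in[OF fin]) (use \<open>Q 0\<close> in blast)
  moreover have "k \<le> r" if "Q k" for k unfolding r_def by (rule Max_ge[OF fin]) (use that in simp)
  ultimately have r: "Q r" "\<And>k. Q k \<Longrightarrow> k \<le> r" by auto
  then obtain S where S: "S \<in> carrier_mat m m" "det S \<noteq> 0" "\<And>j. j < r \<Longrightarrow> col S j \<in> V" and rm: "r \<le> m"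
    unfolding Q_def by blast
  obtain T where T: "T \<in> carrier_mat m m" "S * T = 1\<^sub>m m" "T * S = 1\<^sub>m m" by (rule mat_inverse_exists[OF S(1,2)])
  have ST: "S *\<^sub>v (T *\<^sub>v v) = v" if "v \<in> carrier_vec m" for v
    using that assoc_mult_mat_vec[OF S(1) T(1) that, symmetric] T(2) by simp
  have zero: "(T *\<^sub>v v) $ i = 0" if v: "v \<in> V" and i: "r \<le> i" "i < m" for v i
  proof (rule ccontr)
    assume xi: "(T *\<^sub>v v) $ i \<noteq> 0"
    define x where "x = T *\<^sub>v v"
    have vc: "v \<in> carrier_vec m" using v VC by auto
    have x: "x \<in> carrier_vec m" using T vc by (simp add: x_def)
    \<comment> \<open>The exchange matrix: column \<open>r\<close> receives the coordinates of
      \<open>v\<close>, the former column \<open>r\<close> moves to place \<open>i\<close>, and the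
      others stay. It is injective because coordinate \<open>i\<close> of \<open>v\<close> is
      nonzero.\<close>
    define M where "M = mat m m (\<lambda>(a, b). if b = r then x $ a else if b = i then (if a = r then 1 else 0) else if a = b then 1 else 0)"
    have M: "M \<in> carrier_mat m m" by (simp add: M_def)
    have rm': "r < m" using i by simp
    have ker: "z = 0\<^sub>v m" if z: "z \<in> carrier_vec m" "M *\<^sub>v z = 0\<^sub>v m" for z
    proof -
      have Mz: "(\<Sum>b<m. M $$ (a, b) * z $ b) = 0" if "a < m" for a
      proof -
        have "(\<Sum>b<m. M $$ (a, b) * z $ b) = (M *\<^sub>v z) $ a"
          using M z(1) that by (auto simp: scalar_prod_def lessThan_atLeast0)
        then show ?thesis using z(2) that by simp
      qed
      have "(\<Sum>b<m. M $$ (i, b) * z $ b) = (\<Sum>b<m. if b = r then x $ i * z $ r else 0)"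
        using i rm' by (intro sum.cong) (auto simp: M_def)
      then have zr: "z $ r = 0" using Mz[of i] i rm' xi by (simp add: x_def)
      have "z $ a = 0" if a: "a < m" for a
      proof -
        consider "a = r" | "a = i" "i \<noteq> r" | "a \<noteq> r" "a \<noteq> i" by blast
        then show ?thesis
        proof cases
          case 2
          have "(\<Sum>b<m. M $$ (r, b) * z $ b) = (\<Sum>b<m. if b = i then z $ i else 0)"
            using i rm' zr 2 by (intro sum.cong) (auto simp: M_def)
          then show ?thesis using Mz[of r] rm' i 2 by simp
        next
          case 3
          have "(\<Sum>b<m. M $$ (a, b) * z $ b) = (\<Sum>b<m. if b = a then z $ a else 0)"
            using i rm' zr 3 a by (intro sum.cong) (auto simp: M_def)
          then show ?thesis using Mz[of a] a by simp
        qed (use zr in simp)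
      qed
      then show ?thesis using z(1) by (intro eq_vecI) auto
    qed
    then have "det M \<noteq> 0" using det_0_iff_vec_prod_zero[OF M] by blast
    then have dSM: "det (S * M) \<noteq> 0" using S(2) det_mult[OF S(1) M] by simp
    have "col (S * M) j \<in> V" if j: "j < Suc r" for j
    proof (cases "j = r")
      case True
      have "col M r = x" using x rm' by (intro eq_vecI) (auto simp: M_def)
      then have "col (S * M) r = S *\<^sub>v x" using col_mult2[OF S(1) M rm'] by simp
      then show ?thesis using ST[OF vc] v True by (simp add: x_def)
    next
      case False
      then have jr: "j < r" "j < m" using j rm' by auto
      have "col M j = unit_vec m j" using jr i by (intro eq_vecI) (auto simp: M_def)
      then have "col (S * M) j = S *\<^sub>v unit_vec m j" using col_mult2[OF S(1) M jr(2)] by simp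
      also have "\<dots> = col S j" using S(1) jr by (intro eq_vecI) auto
      finally show ?thesis using S(3)[OF jr(1)] by simp
    qed
    then have "Q (Suc r)" unfolding Q_def using dSM rm' S(1) M by (intro conjI bexI[of _ "S * M"]) auto
    then show False using r(2) by fastforce
  qed
  have "0 < r"
  proof (rule ccontr)
    assume "\<not> 0 < r"
    obtain v where v: "v \<in> V" "v \<noteq> 0\<^sub>v m" using ne by blast
    then have vc: "v \<in> carrier_vec m" using VC by auto
    have "T *\<^sub>v v = 0\<^sub>v m" using zero[OF v(1)] \<open>\<not> 0 < r\<close> T(1) by (intro eq_vecI) auto
    then have "v = S *\<^sub>v 0\<^sub>v m" using ST[OF vc] by simp
    also have "\<dots> = 0\<^sub>v m" using S(1) by (intro eq_vecI) auto
    finally show False using v(2) by simp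
  qed
  moreover have "r < m"
  proof (rule ccontr)
    assume "\<not> r < m"
    then have "col S j \<in> V" if "j < m" for j using S(3) that by simp
    then have "v \<in> V" if "v \<in> carrier_vec m" for v
      using subspace_combination[OF V S(1), of "T *\<^sub>v v"] ST[OF that] T(1) that by simp
    then show False using proper VC by blast
  qed
  ultimately show ?thesis using that S T zero by blast
qed

lemma is_repD:
  assumes "is_rep n K m \<rho>"
  shows "x \<in> K \<Longrightarrow> \<rho> x \<in> carrier_mat m m" "i < m \<Longrightarrow> j < m \<Longrightarrow> (\<lambda>x. \<rho> x $$ (i, j)) \<in> poly_on n K"
    "\<rho> (1\<^sub>m n) = 1\<^sub>m m" "x \<in> K \<Longrightarrow> y \<in> K \<Longrightarrow> \<rho> (x * y) = \<rho> x * \<rho> y"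
  using assms by (auto simp: is_rep_def)

lemma is_rep_entries: "is_rep n K m \<rho> \<Longrightarrow> mat_entries K (poly_on n K) m m \<rho>"
  using poly_on_algebra by (auto simp: is_rep_def mat_entries_def)

lemma is_rep_conj:
  assumes \<rho>: "is_rep n K m \<rho>" and S: "S \<in> carrier_mat m m" and T: "T \<in> carrier_mat m m" and ST: "S * T = 1\<^sub>m m" "T * S = 1\<^sub>m m"
  shows "is_rep n K m (\<lambda>x. T * \<rho> x * S)"
proof -
  note fa = poly_on_algebra[of K n]
  have "mat_entries K (poly_on n K) m m (\<lambda>x. T * \<rho> x * S)"
    by (rule mat_entries_mult[OF fa mat_entries_mult[OF fa mat_entries_const[OF fa T] is_rep_entries[OF \<rho>]] mat_entries_const[OF fa S]])
  moreover have "T * \<rho> (x * y) * S = T * \<rho> x * S * (T * \<rho> y * S)" if "x \<in> K" "y \<in> K" for x y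
  proof -
    note c = is_repD(1)[OF \<rho> that(1)] is_repD(1)[OF \<rho> that(2)]
    have "T * \<rho> x * S * (T * \<rho> y * S) = T * \<rho> x * (S * T) * \<rho> y * S"
      using c S T by (simp add: assoc_mult_mat[of _ m m _ m _ m])
    then show ?thesis using c S T ST is_repD(4)[OF \<rho> that] by (simp add: assoc_mult_mat[of _ m m _ m _ m])
  qed
  ultimately show ?thesis using ST S T is_repD(3)[OF \<rho>] fa by (auto simp: is_rep_def mat_entries_def)
qed

lemma triangularizable_trivial: "(\<And>x. x \<in> K \<Longrightarrow> \<rho> x = 1\<^sub>m m) \<Longrightarrow> triangularizable K m \<rho>"
  unfolding triangularizable_def by (intro exI[of _ "1\<^sub>m m"]) auto

text \<open>The zero block makes both diagonal blocks multiplicative, hence representations, and the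
  direct sum of their triangularising bases triangularises the whole.\<close>

lemma triangularizable_block:
  assumes \<rho>: "is_rep n K (r + s) \<rho>" and zero: "\<And>x i j. x \<in> K \<Longrightarrow> r \<le> i \<Longrightarrow> i < r + s \<Longrightarrow> j < r \<Longrightarrow> \<rho> x $$ (i, j) = 0"
    and IH: "\<And>\<rho>'. is_rep n K r \<rho>' \<Longrightarrow> triangularizable K r \<rho>'" "\<And>\<rho>'. is_rep n K s \<rho>' \<Longrightarrow> triangularizable K s \<rho>'"
    and one: "1\<^sub>m n \<in> K" and mult: "\<And>x y. x \<in> K \<Longrightarrow> y \<in> K \<Longrightarrow> x * y \<in> K"
  shows "triangularizable K (r + s) \<rho>"
proof -
  define A where "A x = mat r r (\<lambda>(i, j). \<rho> x $$ (i, j))" for x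
  define B where "B x = mat r s (\<lambda>(i, j). \<rho> x $$ (i, j + r))" for x
  define D where "D x = mat s s (\<lambda>(i, j). \<rho> x $$ (i + r, j + r))" for x
  have c: "A x \<in> carrier_mat r r" "B x \<in> carrier_mat r s" "D x \<in> carrier_mat s s" for x
    by (simp_all add: A_def B_def D_def)
  have z: "0\<^sub>m s r \<in> carrier_mat s r" "0\<^sub>m r s \<in> carrier_mat r s" by auto
  have blk: "\<rho> x = four_block_mat (A x) (B x) (0\<^sub>m s r) (D x)" if x: "x \<in> K" for x
    using is_repD(1)[OF \<rho> x] zero[OF x] by (intro eq_matI) (auto simp: A_def B_def D_def)
  have blk_mult: "\<rho> x * \<rho> y = four_block_mat (A x * A y) (A x * B y + B x * D y) (0\<^sub>m s r) (D x * D y)" if "x \<in> K" "y \<in> K" for x y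
    unfolding blk[OF that(1)] blk[OF that(2)] mult_four_block_mat[OF c(1,2) z(1) c(3) c(1,2) z(1) c(3)]
    using c[of x] c[of y] by simp
  have idx: "A (x * y) = A x * A y" "D (x * y) = D x * D y" if xy: "x \<in> K" "y \<in> K" for x y
  proof -
    have e: "\<rho> (x * y) = four_block_mat (A x * A y) (A x * B y + B x * D y) (0\<^sub>m s r) (D x * D y)"
      using is_repD(4)[OF \<rho> xy] blk_mult[OF xy] by simp
    show "A (x * y) = A x * A y"
      by (rule eq_matI) (use c[of x] c[of y] in \<open>auto simp: A_def[of "x * y"] e\<close>)
    show "D (x * y) = D x * D y"
      by (rule eq_matI) (use c[of x] c[of y] in \<open>auto simp: D_def[of "x * y"] e\<close>)
  qed
  have "is_rep n K r A" "is_rep n K s D"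
    unfolding is_rep_def using idx is_repD(2,3)[OF \<rho>] c by (auto simp: A_def D_def intro!: eq_matI)
  then obtain S1 T1 S2 T2 where 1: "S1 \<in> carrier_mat r r" "T1 \<in> carrier_mat r r" "S1 * T1 = 1\<^sub>m r" "T1 * S1 = 1\<^sub>m r"
      "\<And>x i j. x \<in> K \<Longrightarrow> i < r \<Longrightarrow> j < i \<Longrightarrow> (T1 * A x * S1) $$ (i, j) = 0"
    and 2: "S2 \<in> carrier_mat s s" "T2 \<in> carrier_mat s s" "S2 * T2 = 1\<^sub>m s" "T2 * S2 = 1\<^sub>m s"
      "\<And>x i j. x \<in> K \<Longrightarrow> i < s \<Longrightarrow> j < i \<Longrightarrow> (T2 * D x * S2) $$ (i, j) = 0"
    using IH unfolding triangularizable_def by metis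
  let ?S = "four_block_mat S1 (0\<^sub>m r s) (0\<^sub>m s r) S2" and ?T = "four_block_mat T1 (0\<^sub>m r s) (0\<^sub>m s r) T2"
  have S: "?S \<in> carrier_mat (r + s) (r + s)" and T: "?T \<in> carrier_mat (r + s) (r + s)" using 1 2 by auto
  have ST: "?S * ?T = 1\<^sub>m (r + s)" "?T * ?S = 1\<^sub>m (r + s)"
    using mult_four_block_mat[OF 1(1) z(2,1) 2(1) 1(2) z(2,1) 2(2)] mult_four_block_mat[OF 1(2) z(2,1) 2(2) 1(1) z(2,1) 2(1)] 1 2
    by (simp_all add: four_block_one_mat)
  have "(?T * \<rho> x * ?S) $$ (i, j) = 0" if x: "x \<in> K" and ij: "i < r + s" "j < i" for x i j
  proof -
    have "?T * \<rho> x = four_block_mat (T1 * A x) (T1 * B x) (0\<^sub>m s r) (T2 * D x)"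
      unfolding blk[OF x] mult_four_block_mat[OF 1(2) z(2,1) 2(2) c(1,2) z(1) c(3)] using 1(2) 2(2) c[of x] by simp
    then have "?T * \<rho> x * ?S = four_block_mat (T1 * A x * S1) (T1 * B x * S2) (0\<^sub>m s r) (T2 * D x * S2)"
      using mult_four_block_mat[OF mult_carrier_mat[OF 1(2) c(1)[of x]] mult_carrier_mat[OF 1(2) c(2)[of x]] z(1) mult_carrier_mat[OF 2(2) c(3)[of x]] 1(1) z(2,1) 2(1)]
        1 2 c[of x] by simp
    then show ?thesis using 1(5)[OF x, of i j] 2(5)[OF x, of "i - r" "j - r"] ij 1 2 c[of x] by (auto simp: not_less)
  qed
  then show ?thesis unfolding triangularizable_def using S T ST by blast
qed

lemma eigenvector_nonzero_value:
  assumes A: "A \<in> carrier_mat m m" and B: "B \<in> carrier_mat m m" and BA: "B * A = 1\<^sub>m m" and v: "eigenvector A v k"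
  shows "k \<noteq> (0 :: complex)"
proof
  assume "k = 0"
  have vc: "v \<in> carrier_vec m" "v \<noteq> 0\<^sub>v m" "A *\<^sub>v v = k \<cdot>\<^sub>v v" using v A by (auto simp: eigenvector_def)
  have "v = B *\<^sub>v (A *\<^sub>v v)" using assoc_mult_mat_vec[OF B A vc(1), symmetric] BA vc(1) by simp
  also have "\<dots> = 0\<^sub>v m" using vc \<open>k = 0\<close> B by (intro eq_vecI) (auto simp: scalar_prod_def)
  finally show False using vc(2) by simp
qed

text \<open>\<open>K\<close> permutes the finitely many weights of the derived subgroup, hence fixes each by rigidity and
  preserves a weight space \<open>V\<close>.  If \<open>V\<close> is everything, the commutators \<open>[a, b]\<close> act by
  scalars that map the spectrum of \<open>\<rho> a\<close> into itself, so for fixed \<open>a\<close> they take finitely many values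
  and are \<open>1\<close>.  Then \<open>\<rho> ` K\<close> is commutative, and an eigenspace of a nonscalar \<open>\<rho> a\<close> is invariant.\<close>

lemma invariant_subspace:
  assumes K: "subgroup K (SL n)" and r: "rigid n K" and \<rho>: "is_rep n K m \<rho>" and m: "m \<ge> 2"
    and D: "triangularizable (derived (SL n) K) m \<rho>"
  shows "\<exists>V. subspace_vec m V \<and> (\<exists>v\<in>V. v \<noteq> 0\<^sub>v m) \<and> V \<noteq> carrier_vec m \<and> (\<forall>x\<in>K. \<forall>v\<in>V. \<rho> x *\<^sub>v v \<in> V)"
proof -
  interpret G: group "SL n" by (rule group_SL)
  let ?D = "derived (SL n) K"
  have KS: "K \<subseteq> SLset n" using subgroup.subset[OF K] by simp
  have DK: "?D \<subseteq> K" using G.derived_incl[OF subset_refl K] .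
  have one: "1\<^sub>m n \<in> K" using subgroup.one_closed[OF K] by simp
  have adjK: "adj_mat x \<in> K" if "x \<in> K" for x
    using subgroup.m_inv_closed[OF K that] inv_SL[of x n] that KS by auto
  have multK: "x * y \<in> K" if "x \<in> K" "y \<in> K" for x y using subgroup.m_closed[OF K that] by simp
  note \<rho>c = is_repD(1)[OF \<rho>] and \<rho>m = is_repD(4)[OF \<rho>]
  have \<rho>inv: "\<rho> (adj_mat x) * \<rho> x = 1\<^sub>m m" if "x \<in> K" for x
    using \<rho>m[OF adjK[OF that] that] SLset_adj(3)[of x n] that KS is_repD(3)[OF \<rho>] by auto
  note fa = poly_on_algebra[of K n]
  obtain S T where S: "S \<in> carrier_mat m m" "T \<in> carrier_mat m m" "S * T = 1\<^sub>m m" "T * S = 1\<^sub>m m"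
    "\<And>x i j. x \<in> ?D \<Longrightarrow> i < m \<Longrightarrow> j < i \<Longrightarrow> (T * \<rho> x * S) $$ (i, j) = 0"
    using D unfolding triangularizable_def by blast
  \<comment> \<open>The first vector of a triangularising basis is a common eigenvector of the
    derived subgroup; its weight is the function \<open>\<chi>\<close> below.\<close>
  define v0 where "v0 = col S 0"
  have v0: "v0 \<in> carrier_vec m" unfolding v0_def by (rule col_carrier_vec[OF _ S(1)]) (use m in simp)
  have v0n: "v0 \<noteq> 0\<^sub>v m"
  proof
    assume "v0 = 0\<^sub>v m"
    have "1\<^sub>m m $$ (0, 0) = (\<Sum>a<m. T $$ (0, a) * S $$ (a, 0))"
      using index_mult_sum[OF S(2,1), of 0 0] S(4) m by simp
    also have "\<dots> = (\<Sum>a<m. T $$ (0, a) * v0 $ a)" using S m by (intro sum.cong) (auto simp: v0_def)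
    also have "\<dots> = 0" using \<open>v0 = 0\<^sub>v m\<close> by simp
    finally show False using m by simp
  qed
  have "\<exists>c. \<rho> d *\<^sub>v v0 = c \<cdot>\<^sub>v v0" if d: "d \<in> ?D" for d
  proof -
    have dc: "\<rho> d \<in> carrier_mat m m" using \<rho>c d DK by blast
    let ?U = "T * \<rho> d * S"
    have U: "?U \<in> carrier_mat m m" using S dc by simp
    have "\<rho> d * S = S * ?U" using S dc assoc_mult_mat[of S m m T m "\<rho> d * S" m] by (simp add: assoc_mult_mat[of _ m m _ m _ m])
    then have e: "col (\<rho> d * S) 0 = col (S * ?U) 0" by simp
    have cU: "col ?U 0 = ?U $$ (0, 0) \<cdot>\<^sub>v unit_vec m 0"
    proof (rule eq_vecI)
      fix i assume "i < dim_vec (?U $$ (0, 0) \<cdot>\<^sub>v unit_vec m 0)"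
      then have "i < m" by simp
      then show "col ?U 0 $ i = (?U $$ (0, 0) \<cdot>\<^sub>v unit_vec m 0) $ i"
        using S(5)[OF d, of i 0] U m by (cases "i = 0") (simp_all del: index_mult_mat)
    qed (use U S in simp)
    have "\<rho> d *\<^sub>v v0 = col (\<rho> d * S) 0" unfolding v0_def using col_mult2[OF dc S(1), of 0] m by simp
    also have "\<dots> = S *\<^sub>v col ?U 0" unfolding e using col_mult2[OF S(1) U, of 0] m by simp
    also have "\<dots> = ?U $$ (0, 0) \<cdot>\<^sub>v (S *\<^sub>v unit_vec m 0)" unfolding cU by (rule mult_mat_vec[OF S(1)]) simp
    also have "S *\<^sub>v unit_vec m 0 = v0" unfolding v0_def using S(1) m by (intro eq_vecI) auto
    finally show ?thesis by blast
  qed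
  then obtain \<chi> where \<chi>: "\<And>d. d \<in> ?D \<Longrightarrow> \<rho> d *\<^sub>v v0 = \<chi> d \<cdot>\<^sub>v v0" by metis
  have fin_spec: "finite {c. \<exists>v\<in>carrier_vec m. v \<noteq> 0\<^sub>v m \<and> \<rho> x *\<^sub>v v = c \<cdot>\<^sub>v v}" if "x \<in> K" for x
  proof -
    have "{c. \<exists>v\<in>carrier_vec m. v \<noteq> 0\<^sub>v m \<and> \<rho> x *\<^sub>v v = c \<cdot>\<^sub>v v} = spectrum (\<rho> x)"
      using \<rho>c[OF that] by (auto simp: spectrum_def eigenvalue_def eigenvector_def)
    then show ?thesis using card_finite_spectrum(1)[OF \<rho>c[OF that]] by simp
  qed
  define V where "V = {v \<in> carrier_vec m. \<forall>d\<in>?D. \<rho> d *\<^sub>v v = \<chi> d \<cdot>\<^sub>v v}"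
  have v0V: "v0 \<in> V" using v0 \<chi> by (simp add: V_def)
  have subV: "subspace_vec m V"
    unfolding subspace_vec_def
  proof (intro conjI ballI allI)
    show "V \<subseteq> carrier_vec m" by (auto simp: V_def)
    have "\<rho> d *\<^sub>v 0\<^sub>v m = \<chi> d \<cdot>\<^sub>v 0\<^sub>v m" if "d \<in> ?D" for d
      using \<rho>c[of d] that DK by (intro eq_vecI) auto
    then show "0\<^sub>v m \<in> V" by (simp add: V_def)
    show "v + w \<in> V" if "v \<in> V" "w \<in> V" for v w
    proof -
      have vw: "v \<in> carrier_vec m" "w \<in> carrier_vec m" using that by (auto simp: V_def)
      have "\<rho> d *\<^sub>v (v + w) = \<chi> d \<cdot>\<^sub>v (v + w)" if "d \<in> ?D" for d
        using mult_add_distrib_mat_vec[OF \<rho>c vw, of d] smult_add_distrib_vec[OF vw] \<open>v \<in> V\<close> \<open>w \<in> V\<close> that DK by (auto simp: V_def)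
      then show ?thesis using vw by (simp add: V_def)
    qed
    show "c \<cdot>\<^sub>v v \<in> V" if "v \<in> V" for c v
    proof -
      have v: "v \<in> carrier_vec m" using that by (auto simp: V_def)
      have "\<rho> d *\<^sub>v (c \<cdot>\<^sub>v v) = \<chi> d \<cdot>\<^sub>v (c \<cdot>\<^sub>v v)" if "d \<in> ?D" for d
        using mult_mat_vec[OF \<rho>c v, of d c] \<open>v \<in> V\<close> that DK by (auto simp: V_def smult_smult_assoc mult.commute)
      then show ?thesis using v by (simp add: V_def)
    qed
  qed
  have conj_D: "adj_mat g * d * g \<in> ?D" if "g \<in> K" "d \<in> ?D" for g d
  proof -
    have S': "g \<in> SLset n" "d \<in> SLset n" "adj_mat g \<in> SLset n" "adj_mat d \<in> SLset n"
      using that KS DK SLset_adj(1)[of g n] SLset_adj(1)[of d n] by auto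
    have "adj_mat g * d * g = adj_mat g * d * adj_mat (adj_mat g) * adj_mat d * d"
      using S' SLset_adj_adj[OF S'(1)] SLset_cancel(4)[OF S'(2), of "adj_mat g * d * g"] by simp
    moreover have "adj_mat g * d * adj_mat (adj_mat g) * adj_mat d \<in> ?D"
      using derived_commutator[OF KS adjK[OF that(1)], of d] that(2) DK by auto
    ultimately show ?thesis using subgroup.m_closed[OF G.derived_is_subgroup[of K] _ that(2)] KS by simp
  qed
  have \<chi>_inv: "\<chi> (adj_mat g * d * g) = \<chi> d" if g: "g \<in> K" and d: "d \<in> ?D" for g d
  proof -
    have dK: "d \<in> K" "d \<in> SLset n" using d DK KS by auto
    have gS: "g \<in> SLset n" using g KS by auto
    let ?f = "\<lambda>x. \<rho> (adj_mat x * d * x)"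
    have ent: "mat_entries K (poly_on n K) m m ?f"
    proof -
      have "(\<lambda>x. ?f x $$ (i, j)) \<in> poly_on n K" if "i < m" "j < m" for i j
        by (rule poly_on_compose[OF is_repD(2)[OF \<rho> that] fa commutator_entries(3)[OF KS dK(2) dK(2)]])
          (use conj_D d DK in auto)
      then show ?thesis using \<rho>c conj_D d DK fa by (auto simp: mat_entries_def subset_iff)
    qed
    \<comment> \<open>Reading the eigenvalue off a nonzero coordinate of \<open>v0\<close> shows
      that it depends polynomially on \<open>x\<close>.\<close>
    obtain i where i: "i < m" "v0 $ i \<noteq> 0"
    proof (rule ccontr)
      assume "\<not> thesis"
      then have "v0 = 0\<^sub>v m" using that v0 by (intro eq_vecI) auto
      then show False using v0n by simp
    qed
    have val: "\<chi> (adj_mat x * d * x) = (\<Sum>j<m. ?f x $$ (i, j) * v0 $ j) * inverse (v0 $ i)" if "x \<in> K" for x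
    proof -
      have "?f x \<in> carrier_mat m m" using \<rho>c conj_D[OF that d] DK by blast
      then have "(?f x *\<^sub>v v0) $ i = (\<Sum>j<m. ?f x $$ (i, j) * v0 $ j)"
        using v0 i by (auto simp: scalar_prod_def lessThan_atLeast0)
      moreover have "(?f x *\<^sub>v v0) $ i = \<chi> (adj_mat x * d * x) * v0 $ i" using \<chi>[OF conj_D[OF that d]] v0 i by simp
      ultimately have "\<chi> (adj_mat x * d * x) * v0 $ i = (\<Sum>j<m. ?f x $$ (i, j) * v0 $ j)" by simp
      then show ?thesis using i(2) by (metis divide_inverse nonzero_mult_div_cancel_right)
    qed
    have "(\<lambda>x. (\<Sum>j<m. ?f x $$ (i, j) * v0 $ j) * inverse (v0 $ i)) \<in> poly_on n K"
      using mat_entriesD[OF fa ent] i by (intro fa_mult[OF fa] fa_sum[OF fa] fa_const[OF fa]) auto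
    then have p: "(\<lambda>x. \<chi> (adj_mat x * d * x)) \<in> poly_on n K" by (rule fa_cong[OF fa]) (rule val)
    \<comment> \<open>The vector \<open>\<rho> x *\<^sub>v v0\<close> is an eigenvector of
      \<open>\<rho> d\<close> with this value, so only the finitely many eigenvalues of
      \<open>\<rho> d\<close> can occur.\<close>
    have "\<chi> (adj_mat x * d * x) \<in> {c. \<exists>v\<in>carrier_vec m. v \<noteq> 0\<^sub>v m \<and> \<rho> d *\<^sub>v v = c \<cdot>\<^sub>v v}" if x: "x \<in> K" for x
    proof -
      have xS: "x \<in> SLset n" using x KS by auto
      have v1: "\<rho> x *\<^sub>v v0 \<in> carrier_vec m" using \<rho>c[OF x] v0 by simp
      have "\<rho> d *\<^sub>v (\<rho> x *\<^sub>v v0) = \<rho> (d * x) *\<^sub>v v0"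
        using \<rho>m[OF dK(1) x] assoc_mult_mat_vec[OF \<rho>c[OF dK(1)] \<rho>c[OF x] v0] by simp
      also have "d * x = x * (adj_mat x * d * x)"
        using SLset_cancel(2)[OF xS, of "d * x"] dK(2) xS SLset_adj(1)[OF xS] by (simp add: SLset_assoc[of _ n])
      also have "\<rho> \<dots> *\<^sub>v v0 = \<rho> x *\<^sub>v (\<rho> (adj_mat x * d * x) *\<^sub>v v0)"
        using \<rho>m[OF x, of "adj_mat x * d * x"] assoc_mult_mat_vec[OF \<rho>c[OF x] \<rho>c v0, of "adj_mat x * d * x"] conj_D[OF x d] DK by auto
      also have "\<dots> = \<chi> (adj_mat x * d * x) \<cdot>\<^sub>v (\<rho> x *\<^sub>v v0)"
        unfolding \<chi>[OF conj_D[OF x d]] by (rule mult_mat_vec[OF \<rho>c[OF x] v0])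
      finally have "\<rho> d *\<^sub>v (\<rho> x *\<^sub>v v0) = \<chi> (adj_mat x * d * x) \<cdot>\<^sub>v (\<rho> x *\<^sub>v v0)" .
      moreover have "\<rho> x *\<^sub>v v0 \<noteq> 0\<^sub>v m"
      proof
        assume a: "\<rho> x *\<^sub>v v0 = 0\<^sub>v m"
        have "v0 = \<rho> (adj_mat x) *\<^sub>v (\<rho> x *\<^sub>v v0)"
          using assoc_mult_mat_vec[OF \<rho>c[OF adjK[OF x]] \<rho>c[OF x] v0, symmetric] \<rho>inv[OF x] v0 by simp
        also have "\<dots> = 0\<^sub>v m" unfolding a using \<rho>c[OF adjK[OF x]] by (intro eq_vecI) auto
        finally show False using v0n by simp
      qed
      ultimately show ?thesis using v1 by blast
    qed
    then have "finite ((\<lambda>x. \<chi> (adj_mat x * d * x)) ` K)"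
      by (intro finite_subset[OF _ fin_spec[OF dK(1)]]) auto
    then have "\<chi> (adj_mat g * d * g) = \<chi> (adj_mat (1\<^sub>m n) * d * 1\<^sub>m n)" using rigidD[OF r p] g one by blast
    then show ?thesis using dK(2) by simp
  qed
  have stabV: "\<rho> x *\<^sub>v v \<in> V" if x: "x \<in> K" and v: "v \<in> V" for x v
  proof -
    have vc: "v \<in> carrier_vec m" using v by (simp add: V_def)
    have xS: "x \<in> SLset n" using x KS by auto
    have "\<rho> d *\<^sub>v (\<rho> x *\<^sub>v v) = \<chi> d \<cdot>\<^sub>v (\<rho> x *\<^sub>v v)" if d: "d \<in> ?D" for d
    proof -
      have dK: "d \<in> K" "d \<in> SLset n" using d DK KS by auto
      have "\<rho> d *\<^sub>v (\<rho> x *\<^sub>v v) = \<rho> (d * x) *\<^sub>v v"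
        using \<rho>m[OF dK(1) x] assoc_mult_mat_vec[OF \<rho>c[OF dK(1)] \<rho>c[OF x] vc] by simp
      also have "d * x = x * (adj_mat x * d * x)"
        using SLset_cancel(2)[OF xS, of "d * x"] dK(2) xS SLset_adj(1)[OF xS] by (simp add: SLset_assoc[of _ n])
      also have "\<rho> \<dots> *\<^sub>v v = \<rho> x *\<^sub>v (\<rho> (adj_mat x * d * x) *\<^sub>v v)"
        using \<rho>m[OF x, of "adj_mat x * d * x"] assoc_mult_mat_vec[OF \<rho>c[OF x] \<rho>c vc, of "adj_mat x * d * x"] conj_D[OF x d] DK by auto
      also have "\<rho> (adj_mat x * d * x) *\<^sub>v v = \<chi> d \<cdot>\<^sub>v v" using v conj_D[OF x d] \<chi>_inv[OF x d] by (simp add: V_def)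
      also have "\<rho> x *\<^sub>v (\<chi> d \<cdot>\<^sub>v v) = \<chi> d \<cdot>\<^sub>v (\<rho> x *\<^sub>v v)" by (rule mult_mat_vec[OF \<rho>c[OF x] vc])
      finally show ?thesis .
    qed
    then show ?thesis using \<rho>c[OF x] vc by (simp add: V_def)
  qed
  show ?thesis
  proof (cases "V = carrier_vec m")
    case False
    then show ?thesis using subV v0V v0n stabV by blast
  next
    case True
    have scal: "\<rho> d *\<^sub>v v = \<chi> d \<cdot>\<^sub>v v" if "d \<in> ?D" "v \<in> carrier_vec m" for d v using True that by (auto simp: V_def)
    have comm: "\<rho> a *\<^sub>v (\<rho> b *\<^sub>v v) = \<rho> b *\<^sub>v (\<rho> a *\<^sub>v v)" if a: "a \<in> K" and b: "b \<in> K" and v: "v \<in> carrier_vec m" for a b v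
    proof -
      have aS: "a \<in> SLset n" using a KS by auto
      let ?k = "\<lambda>b. a * b * adj_mat a * adj_mat b"
      have swap: "\<rho> a *\<^sub>v (\<rho> b *\<^sub>v w) = \<chi> (?k b) \<cdot>\<^sub>v (\<rho> b *\<^sub>v (\<rho> a *\<^sub>v w))" if b: "b \<in> K" and w: "w \<in> carrier_vec m" for b w
      proof -
        have bS: "b \<in> SLset n" using b KS by auto
        note kD = derived_commutator[OF KS a b]
        have kK: "?k b \<in> K" using kD DK by auto
        have ba: "b * a \<in> K" using multK[OF b a] .
        have "a * b = ?k b * (b * a)"
          using aS bS SLset_adj(1)[OF aS] SLset_adj(1)[OF bS]
          by (simp add: SLset_assoc[of _ n] SLset_cancel(1)[of b n] SLset_adj(3))
        then have "\<rho> (a * b) *\<^sub>v w = (\<rho> (?k b) * \<rho> (b * a)) *\<^sub>v w" using \<rho>m[OF kK ba] by simp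
        also have "\<dots> = \<rho> (?k b) *\<^sub>v (\<rho> (b * a) *\<^sub>v w)" by (rule assoc_mult_mat_vec[OF \<rho>c[OF kK] \<rho>c[OF ba] w])
        also have "\<dots> = \<chi> (?k b) \<cdot>\<^sub>v (\<rho> (b * a) *\<^sub>v w)" using scal[OF kD] \<rho>c[OF ba] w by simp
        finally show ?thesis
          using \<rho>m[OF a b] \<rho>m[OF b a] assoc_mult_mat_vec[OF \<rho>c[OF a] \<rho>c[OF b] w] assoc_mult_mat_vec[OF \<rho>c[OF b] \<rho>c[OF a] w] by simp
      qed
      obtain l w where w: "eigenvector (\<rho> a) w l"
        using spectrum_non_empty[OF \<rho>c[OF a]] m by (auto simp: spectrum_def eigenvalue_def)
      have l: "l \<noteq> 0" by (rule eigenvector_nonzero_value[OF \<rho>c[OF a] \<rho>c[OF adjK[OF a]] \<rho>inv[OF a] w])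
      have wc: "w \<in> carrier_vec m" "w \<noteq> 0\<^sub>v m" "\<rho> a *\<^sub>v w = l \<cdot>\<^sub>v w" using w \<rho>c[OF a] by (auto simp: eigenvector_def)
      have val: "\<chi> (?k b) = \<rho> (?k b) $$ (0, 0)" if b: "b \<in> K" for b
      proof -
        have kD: "?k b \<in> ?D" by (rule derived_commutator[OF KS a b])
        then have c: "\<rho> (?k b) \<in> carrier_mat m m" using \<rho>c DK by blast
        have "(\<rho> (?k b) *\<^sub>v unit_vec m 0) $ 0 = \<rho> (?k b) $$ (0, 0)" using c m by simp
        moreover have "(\<rho> (?k b) *\<^sub>v unit_vec m 0) $ 0 = \<chi> (?k b)" using scal[OF kD, of "unit_vec m 0"] m by simp
        ultimately show ?thesis by simp
      qed
      have "(\<lambda>b. \<rho> (?k b) $$ (0, 0)) \<in> poly_on n K"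
        by (rule poly_on_compose[OF is_repD(2)[OF \<rho>, of 0 0] fa commutator_entries(2)[OF KS aS aS]])
          (use m derived_commutator[OF KS a] DK in auto)
      then have p: "(\<lambda>b. \<chi> (?k b)) \<in> poly_on n K" by (rule fa_cong[OF fa]) (rule val)
      \<comment> \<open>If \<open>w\<close> is an eigenvector of \<open>\<rho> a\<close> for
        \<open>l\<close>, then \<open>\<rho> b *\<^sub>v w\<close> is one for
        \<open>\<chi> (?k b) * l\<close>. As \<open>l\<close> is nonzero, the scalar is a ratio of
        two eigenvalues of \<open>\<rho> a\<close>.\<close>
      have "\<chi> (?k b) \<in> (\<lambda>c. c / l) ` {c. \<exists>v\<in>carrier_vec m. v \<noteq> 0\<^sub>v m \<and> \<rho> a *\<^sub>v v = c \<cdot>\<^sub>v v}" if b: "b \<in> K" for b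
      proof -
        have u: "\<rho> b *\<^sub>v w \<in> carrier_vec m" using \<rho>c[OF b] wc by simp
        have "\<rho> b *\<^sub>v w \<noteq> 0\<^sub>v m"
        proof
          assume z: "\<rho> b *\<^sub>v w = 0\<^sub>v m"
          have "w = \<rho> (adj_mat b) *\<^sub>v (\<rho> b *\<^sub>v w)"
            using assoc_mult_mat_vec[OF \<rho>c[OF adjK[OF b]] \<rho>c[OF b] wc(1), symmetric] \<rho>inv[OF b] wc(1) by simp
          also have "\<dots> = 0\<^sub>v m" unfolding z using \<rho>c[OF adjK[OF b]] by (intro eq_vecI) auto
          finally show False using wc by simp
        qed
        moreover have "\<rho> a *\<^sub>v (\<rho> b *\<^sub>v w) = (\<chi> (?k b) * l) \<cdot>\<^sub>v (\<rho> b *\<^sub>v w)"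
          unfolding swap[OF b wc(1)] wc(3) mult_mat_vec[OF \<rho>c[OF b] wc(1)] by (simp add: smult_smult_assoc)
        ultimately have "\<chi> (?k b) * l \<in> {c. \<exists>v\<in>carrier_vec m. v \<noteq> 0\<^sub>v m \<and> \<rho> a *\<^sub>v v = c \<cdot>\<^sub>v v}" using u by blast
        then show ?thesis using l by (intro image_eqI[of _ _ "\<chi> (?k b) * l"]) auto
      qed
      then have "finite ((\<lambda>b. \<chi> (?k b)) ` K)"
        by (intro finite_subset[OF _ finite_imageI[OF fin_spec[OF a]]]) auto
      then have "\<chi> (?k b) = \<chi> (?k (1\<^sub>m n))" using rigidD[OF r p] b one by blast
      also have "?k (1\<^sub>m n) = 1\<^sub>m n" using aS SLset_adj[OF aS] by simp
      also have "\<chi> (1\<^sub>m n) = 1"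
        using val[OF one] is_repD(3)[OF \<rho>] m aS SLset_adj[OF aS] by simp
      finally show ?thesis using swap[OF b v] \<rho>c[OF a] \<rho>c[OF b] v by simp
    qed
    show ?thesis
    proof (cases "\<exists>a\<in>K. \<exists>l w. eigenvector (\<rho> a) w l \<and> {v \<in> carrier_vec m. \<rho> a *\<^sub>v v = l \<cdot>\<^sub>v v} \<noteq> carrier_vec m")
      case True
      then obtain a l w where a: "a \<in> K" and w: "eigenvector (\<rho> a) w l"
        and W: "{v \<in> carrier_vec m. \<rho> a *\<^sub>v v = l \<cdot>\<^sub>v v} \<noteq> carrier_vec m" by blast
      let ?W = "{v \<in> carrier_vec m. \<rho> a *\<^sub>v v = l \<cdot>\<^sub>v v}"
      have "subspace_vec m ?W"
        unfolding subspace_vec_def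
      proof (intro conjI ballI allI)
        have "\<rho> a *\<^sub>v 0\<^sub>v m = l \<cdot>\<^sub>v 0\<^sub>v m" using \<rho>c[OF a] by (intro eq_vecI) auto
        then show "0\<^sub>v m \<in> ?W" by simp
        show "v + w \<in> ?W" if "v \<in> ?W" "w \<in> ?W" for v w
          using that mult_add_distrib_mat_vec[OF \<rho>c[OF a], of v w] smult_add_distrib_vec[of v m w l] by simp
        show "c \<cdot>\<^sub>v v \<in> ?W" if "v \<in> ?W" for c v
          using that mult_mat_vec[OF \<rho>c[OF a], of v c] by (simp add: smult_smult_assoc mult.commute)
      qed auto
      moreover have "w \<in> ?W" "w \<noteq> 0\<^sub>v m" using w \<rho>c[OF a] by (auto simp: eigenvector_def)
      moreover have "\<rho> x *\<^sub>v v \<in> ?W" if x: "x \<in> K" and v: "v \<in> ?W" for x v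
        using comm[OF a x, of v] v mult_mat_vec[OF \<rho>c[OF x], of v l] \<rho>c[OF x] by auto
      ultimately show ?thesis using W by blast
    next
      case False
      \<comment> \<open>Now each \<open>\<rho> x\<close> has an eigenspace equal to the whole space,
        hence is a scalar. Every line is invariant, and a line is proper because
        \<open>m \<ge> 2\<close>.\<close>
      let ?W = "{c \<cdot>\<^sub>v unit_vec m 0 | c. True} :: complex vec set"
      have sc: "\<exists>c. \<rho> x *\<^sub>v unit_vec m 0 = c \<cdot>\<^sub>v unit_vec m 0" if x: "x \<in> K" for x
      proof -
        obtain l w where w: "eigenvector (\<rho> x) w l"
          using spectrum_non_empty[OF \<rho>c[OF x]] m by (auto simp: spectrum_def eigenvalue_def)
        then have "{v \<in> carrier_vec m. \<rho> x *\<^sub>v v = l \<cdot>\<^sub>v v} = carrier_vec m" using False x by blast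
        then have "unit_vec m 0 \<in> {v \<in> carrier_vec m. \<rho> x *\<^sub>v v = l \<cdot>\<^sub>v v}" by simp
        then show ?thesis by blast
      qed
      have "subspace_vec m ?W"
        unfolding subspace_vec_def
      proof (intro conjI ballI allI)
        have "0\<^sub>v m = (0 :: complex) \<cdot>\<^sub>v unit_vec m 0" by (intro eq_vecI) auto
        then show "0\<^sub>v m \<in> ?W" by blast
        show "v + w \<in> ?W" if vw: "v \<in> ?W" "w \<in> ?W" for v w
        proof -
          obtain c d where "v = c \<cdot>\<^sub>v unit_vec m 0" "w = d \<cdot>\<^sub>v unit_vec m 0" using vw by blast
          then have "v + w = (c + d) \<cdot>\<^sub>v unit_vec m 0" by (simp add: add_smult_distrib_vec)
          then show ?thesis by blast
        qed
        show "c \<cdot>\<^sub>v v \<in> ?W" if v: "v \<in> ?W" for c v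
        proof -
          obtain d where "v = d \<cdot>\<^sub>v unit_vec m 0" using v by blast
          then have "c \<cdot>\<^sub>v v = (c * d) \<cdot>\<^sub>v unit_vec m 0" by (simp add: smult_smult_assoc)
          then show ?thesis by blast
        qed
      qed auto
      moreover have "unit_vec m 0 \<in> ?W" by (intro CollectI exI[of _ 1]) simp
      moreover have "unit_vec m 0 \<noteq> (0\<^sub>v m :: complex vec)"
      proof
        assume "unit_vec m 0 = (0\<^sub>v m :: complex vec)"
        then have "unit_vec m 0 $ 0 = (0\<^sub>v m :: complex vec) $ 0" by simp
        then show False using m by simp
      qed
      moreover have "unit_vec m 1 \<notin> ?W"
      proof
        assume "unit_vec m 1 \<in> ?W"
        then obtain c :: complex where "unit_vec m 1 = c \<cdot>\<^sub>v unit_vec m 0" by blast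
        then have "unit_vec m 1 $ 1 = (c \<cdot>\<^sub>v unit_vec m 0) $ 1" by simp
        then show False using m by simp
      qed
      moreover have "\<rho> x *\<^sub>v v \<in> ?W" if x: "x \<in> K" and v: "v \<in> ?W" for x v
      proof -
        obtain c where c: "v = c \<cdot>\<^sub>v unit_vec m 0" using v by blast
        obtain d where d: "\<rho> x *\<^sub>v unit_vec m 0 = d \<cdot>\<^sub>v unit_vec m 0" using sc[OF x] by blast
        have "\<rho> x *\<^sub>v v = (c * d) \<cdot>\<^sub>v unit_vec m 0"
          unfolding c using mult_mat_vec[OF \<rho>c[OF x], of "unit_vec m 0" c] d by (simp add: smult_smult_assoc)
        then show ?thesis by blast
      qed
      moreover have "unit_vec m 1 \<in> carrier_vec m" by simp
      ultimately show ?thesis by blast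
    qed
  qed
qed

lemma is_rep_mono: "is_rep n K m \<rho> \<Longrightarrow> L \<subseteq> K \<Longrightarrow> is_rep n L m \<rho>"
  unfolding is_rep_def poly_on_def by blast

text \<open>Two nested inductions. The outer one, on the derived length, triangularises the derived
  subgroup in the same representation, which produces an invariant subspace; the inner one, on the
  dimension, treats the two diagonal blocks.\<close>

theorem lie_kolchin_rep:
  assumes "subgroup K (SL n)" "rigid n K" "(derived (SL n) ^^ k) K = {1\<^sub>m n}" "is_rep n K m \<rho>"
  shows "triangularizable K m \<rho>"
  using assms
proof (induction k arbitrary: K m \<rho>)
  case 0
  then show ?case using is_repD(3)[OF 0(4)] by (intro triangularizable_trivial) auto
next
  case (Suc k)
  interpret G: group "SL n" by (rule group_SL)
  note K = Suc.prems(1)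
  have KS: "K \<subseteq> SLset n" using subgroup.subset[OF K] by simp
  let ?D = "derived (SL n) K"
  have D: "subgroup ?D (SL n)" "rigid n ?D" "(derived (SL n) ^^ k) ?D = {1\<^sub>m n}" "?D \<subseteq> K"
    using G.derived_is_subgroup[of K] KS rigid_derived[OF K Suc.prems(2)] Suc.prems(3) G.derived_incl[OF subset_refl K]
    by (simp_all add: funpow_swap1)
  show ?case using Suc.prems(4)
  proof (induction m arbitrary: \<rho> rule: less_induct)
    case (less m)
    show ?case
    proof (cases "m \<ge> 2")
      case False
      then show ?thesis unfolding triangularizable_def by (intro exI[of _ "1\<^sub>m m"]) auto
    next
      case True
      have "triangularizable ?D m \<rho>" by (rule Suc.IH[OF D(1-3) is_rep_mono[OF less.prems D(4)]])
      from invariant_subspace[OF K Suc.prems(2) less.prems True this]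
      obtain V where V: "subspace_vec m V" "\<exists>v\<in>V. v \<noteq> 0\<^sub>v m" "V \<noteq> carrier_vec m" "\<And>x v. x \<in> K \<Longrightarrow> v \<in> V \<Longrightarrow> \<rho> x *\<^sub>v v \<in> V" by blast
      obtain S T r where S: "S \<in> carrier_mat m m" "T \<in> carrier_mat m m" "S * T = 1\<^sub>m m" "T * S = 1\<^sub>m m" and r: "0 < r" "r < m"
        and col: "\<And>j. j < r \<Longrightarrow> col S j \<in> V" and zero: "\<And>v i. v \<in> V \<Longrightarrow> r \<le> i \<Longrightarrow> i < m \<Longrightarrow> (T *\<^sub>v v) $ i = 0"
        using adapted_basis[OF V(1-3)] by metis
      let ?\<sigma> = "\<lambda>x. T * \<rho> x * S"
      have \<sigma>: "is_rep n K m ?\<sigma>" by (rule is_rep_conj[OF less.prems S])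
      have "triangularizable K (r + (m - r)) ?\<sigma>"
      proof (rule triangularizable_block)
        show "is_rep n K (r + (m - r)) ?\<sigma>" using \<sigma> r by simp
        show "triangularizable K r \<rho>'" if "is_rep n K r \<rho>'" for \<rho>' using less.IH[OF r(2) that] .
        show "triangularizable K (m - r) \<rho>'" if "is_rep n K (m - r) \<rho>'" for \<rho>' using less.IH[OF _ that] r by simp
        fix x i j assume x: "x \<in> K" and ij: "r \<le> i" "i < r + (m - r)" "j < r"
        note xc = is_repD(1)[OF less.prems x]
        have im: "i < m" "j < m" using ij r by auto
        have "?\<sigma> x $$ (i, j) = col (?\<sigma> x) j $ i" using S xc im by simp
        also have "col (?\<sigma> x) j = T *\<^sub>v (\<rho> x *\<^sub>v col S j)"
          using col_mult2[of "T * \<rho> x" m m S m j] S xc im assoc_mult_mat_vec[OF S(2) xc, of "col S j"] by simp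
        also have "\<dots> $ i = 0" using zero[OF V(4)[OF x col[OF ij(3)]] ij(1) im(1)] .
        finally show "?\<sigma> x $$ (i, j) = 0" .
      qed (use subgroup.one_closed[OF K] subgroup.m_closed[OF K] in auto)
      then have "triangularizable K m ?\<sigma>" using r by simp
      then obtain S' T' where S': "S' \<in> carrier_mat m m" "T' \<in> carrier_mat m m" "S' * T' = 1\<^sub>m m" "T' * S' = 1\<^sub>m m"
        "\<And>x i j. x \<in> K \<Longrightarrow> i < m \<Longrightarrow> j < i \<Longrightarrow> (T' * ?\<sigma> x * S') $$ (i, j) = 0" unfolding triangularizable_def by blast
      show ?thesis unfolding triangularizable_def
      proof (rule exI[of _ "S * S'"], rule exI[of _ "T' * T"], intro conjI ballI allI impI)
        have "S * S' * (T' * T) = S * (S' * T') * T" using S(1,2) S'(1,2) by (simp add: assoc_mult_mat[of _ m m _ m _ m])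
        then show "S * S' * (T' * T) = 1\<^sub>m m" using S S' by simp
        have "T' * T * (S * S') = T' * (T * S) * S'" using S(1,2) S'(1,2) by (simp add: assoc_mult_mat[of _ m m _ m _ m])
        then show "T' * T * (S * S') = 1\<^sub>m m" using S S' by simp
        fix x i j assume x: "x \<in> K" and ij: "i < m" "j < i"
        have "T' * T * \<rho> x * (S * S') = T' * ?\<sigma> x * S'"
          using S(1,2) S'(1,2) is_repD(1)[OF less.prems x] by (simp add: assoc_mult_mat[of _ m m _ m _ m])
        then show "(T' * T * \<rho> x * (S * S')) $$ (i, j) = 0" using S'(5)[OF x ij] by simp
      qed (use S S' in auto)
    qed
  qed
qed

section \<open>The upper triangular Borel subgroup\<close>

abbreviation upper :: "nat \<Rightarrow> complex mat set" where "upper n \<equiv> pattern_group n (\<le>)"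

lemma upper_SL: "h \<in> upper n \<Longrightarrow> h \<in> SLset n" by (simp add: pattern_group_def)

lemma upper_zero: "h \<in> upper n \<Longrightarrow> i < n \<Longrightarrow> j < i \<Longrightarrow> h $$ (i, j) = 0" by (simp add: pattern_group_def)

lemma upper_one: "1\<^sub>m n \<in> upper n" by (auto simp: pattern_group_def)

lemma det_upper:
  assumes A: "A \<in> carrier_mat n n" and z: "\<And>i j. i < n \<Longrightarrow> j < i \<Longrightarrow> A $$ (i, j) = (0 :: complex)"
  shows "det A = (\<Prod>i<n. A $$ (i, i))"
proof -
  have "det A = prod_list (diag_mat A)"
    by (rule det_upper_triangular[OF _ A]) (use A z in auto)
  also have "\<dots> = (\<Prod>i<n. A $$ (i, i))"
    using A by (simp add: diag_mat_def prod.list_conv_set_nth lessThan_atLeast0)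
  finally show ?thesis .
qed

lemma upper_diag:
  assumes "h \<in> upper n"
  shows "(\<Prod>i<n. h $$ (i, i)) = 1" "i < n \<Longrightarrow> h $$ (i, i) \<noteq> 0"
proof -
  show 1: "(\<Prod>i<n. h $$ (i, i)) = 1"
    using det_upper[of h n] upper_zero[OF assms] SLset_carrier[OF upper_SL[OF assms]] SLset_det[OF upper_SL[OF assms]] by simp
  show "h $$ (i, i) \<noteq> 0" if "i < n"
  proof
    assume "h $$ (i, i) = 0"
    then have "(\<Prod>i<n. h $$ (i, i)) = 0" using that by (intro prod_zero) auto
    then show False using 1 by simp
  qed
qed

lemma upper_adj:
  assumes h: "h \<in> upper n"
  shows "adj_mat h \<in> upper n"
proof -
  note S = upper_SL[OF h]
  have "adj_mat h $$ (i, j) = 0" if "i < n" "j < i" for i j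
    using that
  proof (induction "n - i" arbitrary: i rule: less_induct)
    case less
    have "0 = (h * adj_mat h) $$ (i, j)" using SLset_adj(2)[OF S] less.prems by simp
    also have "\<dots> = (\<Sum>l<n. h $$ (i, l) * adj_mat h $$ (l, j))"
      using index_mult_sum[OF SLset_carrier[OF S] SLset_carrier[OF SLset_adj(1)[OF S]]] less.prems by simp
    also have "\<dots> = (\<Sum>l<n. if l = i then h $$ (i, i) * adj_mat h $$ (i, j) else 0)"
    proof (intro sum.cong refl)
      fix l assume l: "l \<in> {..<n}"
      consider "l < i" | "l = i" | "i < l" by linarith
      then show "h $$ (i, l) * adj_mat h $$ (l, j) = (if l = i then h $$ (i, i) * adj_mat h $$ (i, j) else 0)"
      proof cases
        case 1
        then show ?thesis using upper_zero[OF h less.prems(1)] by simp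
      next
        case 3
        then show ?thesis using less.hyps[of l] less.prems l by auto
      qed simp
    qed
    also have "\<dots> = h $$ (i, i) * adj_mat h $$ (i, j)" using less.prems by simp
    finally show ?case using upper_diag(2)[OF h less.prems(1)] by simp
  qed
  then show ?thesis using SLset_adj(1)[OF S] by (auto simp: pattern_group_def)
qed

lemma subgroup_SLI:
  assumes "L \<subseteq> SLset n" "1\<^sub>m n \<in> L" "\<And>x y. x \<in> L \<Longrightarrow> y \<in> L \<Longrightarrow> x * y \<in> L" "\<And>x. x \<in> L \<Longrightarrow> adj_mat x \<in> L"
  shows "subgroup L (SL n)"
  using assms by (intro subgroup.intro) (auto simp: inv_SL subset_iff)

lemma subgroup_SLD:
  assumes "subgroup L (SL n)"
  shows "L \<subseteq> SLset n" "1\<^sub>m n \<in> L" "x \<in> L \<Longrightarrow> y \<in> L \<Longrightarrow> x * y \<in> L" "x \<in> L \<Longrightarrow> adj_mat x \<in> L"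
proof -
  show L: "L \<subseteq> SLset n" using subgroup.subset[OF assms] by simp
  show "1\<^sub>m n \<in> L" using subgroup.one_closed[OF assms] by simp
  show "x \<in> L \<Longrightarrow> y \<in> L \<Longrightarrow> x * y \<in> L" using subgroup.m_closed[OF assms] by simp
  show "x \<in> L \<Longrightarrow> adj_mat x \<in> L" using subgroup.m_inv_closed[OF assms, of x] inv_SL[of x n] L by auto
qed

lemma subgroup_upper: "subgroup (upper n) (SL n)"
  by (rule subgroup_SLI) (auto simp: upper_SL upper_one upper_adj intro: pattern_group_mult)

lemma exists_log: "z \<noteq> 0 \<Longrightarrow> \<exists>\<theta>. exp \<theta> = (z :: complex)"
proof -
  assume "z \<noteq> 0"
  then have "exp (Complex (ln (cmod z)) (Arg z)) = z"
    by (simp add: exp_eq_polar) (metis rcis_cmod_Arg rcis_def)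
  then show ?thesis by blast
qed

text \<open>Each element is joined to the identity by a real path of upper triangular matrices of
  determinant one. The path is Zariski continuous because polynomials in its entries are continuous
  in \<open>t\<close>. The union of these connected sets through the identity is the group.\<close>

lemma upper_connected:
  assumes n: "n \<ge> 1"
  shows "connectedin (zariski (SL_space n)) (upper n)"
proof -
  have "\<exists>S. connectedin (zariski (SL_space n)) S \<and> h \<in> S \<and> 1\<^sub>m n \<in> S \<and> S \<subseteq> upper n" if h: "h \<in> upper n" for h
  proof -
    have "\<forall>i. \<exists>\<theta>. i < n \<longrightarrow> exp \<theta> = h $$ (i, i)" using exists_log upper_diag(2)[OF h] by blast
    from choice[OF this] obtain \<theta>' where \<theta>': "\<And>i. i < n \<Longrightarrow> exp (\<theta>' i) = h $$ (i, i)" by blast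
    \<comment> \<open>The last logarithm is not chosen freely but as minus the sum of the others,
      which keeps the determinant at one along the path. It is still a logarithm of the last
      diagonal entry because the diagonal entries have product one.\<close>
    define \<theta> where "\<theta> i = (if i = n - 1 then - (\<Sum>j<n - 1. \<theta>' j) else \<theta>' i)" for i
    have nn: "{..<n} = insert (n - 1) {..<n - 1}" using n by auto
    have s0: "(\<Sum>i<n. \<theta> i) = 0" unfolding nn by (simp add: \<theta>_def)
    have ex: "exp (\<theta> i) = h $$ (i, i)" if i: "i < n" for i
    proof (cases "i = n - 1")
      case False
      then show ?thesis using \<theta>'[OF i] by (simp add: \<theta>_def)
    next
      case True
      have "h $$ (n - 1, n - 1) * (\<Prod>j<n - 1. h $$ (j, j)) = 1"
        using upper_diag(1)[OF h] unfolding nn by simp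
      moreover have "(\<Prod>j<n - 1. h $$ (j, j)) = exp (\<Sum>j<n - 1. \<theta>' j)"
        by (simp add: exp_sum \<theta>')
      ultimately show ?thesis using True by (simp add: \<theta>_def exp_minus inverse_unique mult.commute)
    qed
    define M where "M t = mat n n (\<lambda>(i, j). if i = j then exp (of_real t * \<theta> i) else if i < j then of_real t * h $$ (i, j) else 0)" for t :: real
    have M: "M t \<in> upper n" for t
    proof -
      have "det (M t) = (\<Prod>i<n. M t $$ (i, i))" by (rule det_upper) (auto simp: M_def)
      also have "\<dots> = (\<Prod>i<n. exp (of_real t * \<theta> i))" by (intro prod.cong) (auto simp: M_def)
      also have "\<dots> = exp (\<Sum>i<n. of_real t * \<theta> i)" by (simp add: exp_sum)
      also have "\<dots> = 1" using s0 by (simp flip: sum_distrib_left)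
      finally show ?thesis by (auto simp: pattern_group_def SLset_def M_def)
    qed
    have cont: "continuous_on UNIV (\<lambda>t. f (M t))" if "f \<in> polynomial_functions (mat_coords n)" for f
      using that
    proof induction
      case (coord f)
      then obtain i j where "i < n" "j < n" "f = (\<lambda>A. A $$ (i, j))" by blast
      then have *: "(\<lambda>t. f (M t)) = (if i = j then (\<lambda>t. exp (of_real t * \<theta> i)) else if i < j then (\<lambda>t. of_real t * h $$ (i, j)) else (\<lambda>_. 0))"
        by (auto simp: M_def)
      show ?case unfolding * by (simp add: continuous_intros)
    qed (auto intro!: continuous_intros)
    have "continuous_map euclideanreal (zariski (SL_space n)) M"
      unfolding continuous_map
    proof (intro conjI allI impI)
      show "M ` topspace euclideanreal \<subseteq> points (SL_space n)" using M upper_SL by auto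
      fix U assume U: "openin (zariski (SL_space n)) U"
      show "openin euclideanreal {x \<in> topspace euclideanreal. M x \<in> U}"
      proof (subst openin_subopen, intro ballI)
        fix t assume t: "t \<in> {x \<in> topspace euclideanreal. M x \<in> U}"
        then have tU: "M t \<in> U" by simp
        obtain f where f: "f \<in> polynomial_functions (mat_coords n)" "f (M t) \<noteq> 0" "{y \<in> SLset n. f y \<noteq> 0} \<subseteq> U"
          by (rule openin_inducedE[OF U tU])
        have "open {s. f (M s) \<noteq> 0}" by (intro open_Collect_neq cont[OF f(1)] continuous_on_const)
        then show "\<exists>T. openin euclideanreal T \<and> t \<in> T \<and> T \<subseteq> {x \<in> topspace euclideanreal. M x \<in> U}"
          using f M upper_SL by (intro exI[of _ "{s. f (M s) \<noteq> 0}"]) auto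
      qed
    qed
    moreover have "connectedin euclideanreal {0..1}" by simp
    ultimately have "connectedin (zariski (SL_space n)) (M ` {0..1})" by (rule connectedin_continuous_map_image)
    moreover have "h \<in> M ` {0..1}"
    proof (rule image_eqI)
      show "h = M 1"
        using SLset_carrier[OF upper_SL[OF h]] ex upper_zero[OF h] by (intro eq_matI) (auto simp: M_def)
    qed simp
    moreover have "1\<^sub>m n \<in> M ` {0..1}"
    proof (rule image_eqI)
      show "1\<^sub>m n = M 0" by (intro eq_matI) (auto simp: M_def)
    qed simp
    moreover have "M ` {0..1} \<subseteq> upper n" using M by blast
    ultimately show ?thesis by (intro exI conjI)
  qed
  then have "\<forall>h\<in>upper n. \<exists>S. connectedin (zariski (SL_space n)) S \<and> h \<in> S \<and> 1\<^sub>m n \<in> S \<and> S \<subseteq> upper n"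
    by (rule ballI)
  from bchoice[OF this] obtain S where "\<forall>h\<in>upper n. connectedin (zariski (SL_space n)) (S h) \<and> h \<in> S h \<and> 1\<^sub>m n \<in> S h \<and> S h \<subseteq> upper n"
    by (elim exE)
  note S = bspec[OF this]
  have "connectedin (zariski (SL_space n)) (\<Union>(S ` upper n))"
  proof (rule connectedin_Union)
    show "connectedin (zariski (SL_space n)) T" if "T \<in> S ` upper n" for T using S that by auto
    have "1\<^sub>m n \<in> \<Inter>(S ` upper n)" using S by auto
    then show "\<Inter>(S ` upper n) \<noteq> {}" by blast
  qed
  moreover have "\<Union>(S ` upper n) = upper n" using S by blast
  ultimately show ?thesis by simp
qed

section \<open>Solvability of the upper triangular group\<close>

definition band :: "nat \<Rightarrow> nat \<Rightarrow> complex mat set" where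
  "band n k = {A \<in> carrier_mat n n. \<forall>i<n. \<forall>j<n. j < i + k \<longrightarrow> A $$ (i, j) = 0}"

lemma band_mult:
  assumes "A \<in> band n k" "B \<in> band n l"
  shows "A * B \<in> band n (k + l)"
proof -
  have c: "A \<in> carrier_mat n n" "B \<in> carrier_mat n n" using assms by (auto simp: band_def)
  have "(A * B) $$ (i, j) = 0" if ij: "i < n" "j < n" "j < i + (k + l)" for i j
  proof -
    have "A $$ (i, a) * B $$ (a, j) = 0" if "a < n" for a
    proof (cases "a < i + k")
      case True
      then show ?thesis using assms(1) ij that by (simp add: band_def)
    next
      case False
      then show ?thesis using assms(2) ij that by (simp add: band_def)
    qed
    then show ?thesis unfolding index_mult_sum[OF c ij(1,2)] by (intro sum.neutral) simp
  qed
  then show ?thesis using c by (simp add: band_def)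
qed

lemma band_add: "A \<in> band n k \<Longrightarrow> B \<in> band n k \<Longrightarrow> A + B \<in> band n k"
  and band_minus: "A \<in> band n k \<Longrightarrow> B \<in> band n k \<Longrightarrow> A - B \<in> band n k"
  and band_mono: "A \<in> band n k \<Longrightarrow> l \<le> k \<Longrightarrow> A \<in> band n l"
  by (auto simp: band_def)

lemma upper_band: "h \<in> upper n \<Longrightarrow> h \<in> band n 0"
  using upper_SL[of h n] SLset_carrier[of h n] by (auto simp: band_def pattern_group_def)

text \<open>Index 0 is made exceptional so that the descending series starts with the full upper
  triangular group rather than with matrices congruent to the identity.\<close>

definition unip :: "nat \<Rightarrow> nat \<Rightarrow> complex mat set" where
  "unip n k = {h \<in> upper n. k \<noteq> 0 \<longrightarrow> h - 1\<^sub>m n \<in> band n k}"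

lemma subgroup_unip: "subgroup (unip n k) (SL n)"
proof (rule subgroup_SLI)
  show "unip n k \<subseteq> SLset n" by (auto simp: unip_def upper_SL)
  show "1\<^sub>m n \<in> unip n k" using upper_one[of n] by (auto simp: unip_def band_def)
  show "x * y \<in> unip n k" if "x \<in> unip n k" "y \<in> unip n k" for x y
  proof -
    have u: "x \<in> upper n" "y \<in> upper n" using that by (auto simp: unip_def)
    note c = SLset_carrier[OF upper_SL[OF u(1)]] SLset_carrier[OF upper_SL[OF u(2)]]
    have "x * y - 1\<^sub>m n = (x - 1\<^sub>m n) * y + (y - 1\<^sub>m n)"
      using c by (simp add: minus_mult_distrib_mat[of _ n n _ _ n]) (intro eq_matI, auto)
    moreover have "(x - 1\<^sub>m n) * y + (y - 1\<^sub>m n) \<in> band n k" if "k \<noteq> 0"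
      using band_mult[of "x - 1\<^sub>m n" n k y 0] upper_band[OF u(2)] \<open>x \<in> unip n k\<close> \<open>y \<in> unip n k\<close> that
      by (intro band_add) (auto simp: unip_def)
    ultimately show ?thesis using subgroup_SLD(3)[OF subgroup_upper u] by (simp add: unip_def)
  qed
  show "adj_mat x \<in> unip n k" if "x \<in> unip n k" for x
  proof -
    have u: "x \<in> upper n" using that by (auto simp: unip_def)
    note S = upper_SL[OF u]
    note c = SLset_carrier[OF S] SLset_carrier[OF SLset_adj(1)[OF S]]
    have "adj_mat x - 1\<^sub>m n = 0\<^sub>m n n - adj_mat x * (x - 1\<^sub>m n)"
      using c SLset_adj(3)[OF S] by (simp add: mult_minus_distrib_mat[of _ n n _ n]) (intro eq_matI, auto)
    moreover have "0\<^sub>m n n - adj_mat x * (x - 1\<^sub>m n) \<in> band n k" if "k \<noteq> 0"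
      using band_mult[of "adj_mat x" n 0 "x - 1\<^sub>m n" k] upper_band[OF upper_adj[OF u]] \<open>x \<in> unip n k\<close> that
      by (intro band_minus) (auto simp: unip_def band_def[of n k])
    ultimately show ?thesis using upper_adj[OF u] by (simp add: unip_def)
  qed
qed

text \<open>The commutator minus the identity is \<open>(a * b - b * a)\<close> times the inverses
  of \<open>a\<close> and \<open>b\<close>. For \<open>k = 0\<close> the diagonals of
  \<open>a * b\<close> and \<open>b * a\<close> agree. For \<open>k > 0\<close> the bracket equals
  that of \<open>a - 1\<close> and \<open>b - 1\<close>, which lies in band \<open>2 k\<close>, and
  \<open>2 k \<ge> k + 1\<close>.\<close>

lemma unip_commutator:
  assumes a: "a \<in> unip n k" and b: "b \<in> unip n k"
  shows "a * b * adj_mat a * adj_mat b \<in> unip n (Suc k)"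
proof -
  have u: "a \<in> upper n" "b \<in> upper n" using a b by (auto simp: unip_def)
  note S = upper_SL[OF u(1)] upper_SL[OF u(2)]
  note SA = SLset_adj(1)[OF S(1)] SLset_adj(1)[OF S(2)]
  note c = SLset_carrier[OF S(1)] SLset_carrier[OF S(2)] SLset_carrier[OF SA(1)] SLset_carrier[OF SA(2)]
  have mem: "a * b * adj_mat a * adj_mat b \<in> upper n"
    using u upper_adj by (intro subgroup_SLD(3)[OF subgroup_upper]) auto
  have "a * b - b * a \<in> band n (Suc k)"
  proof (cases "k = 0")
    case True
    have "(a * b) $$ (i, j) = (b * a) $$ (i, j)" if ij: "i < n" "j \<le> i" for i j
    proof (cases "j = i")
      case False
      then show ?thesis using upper_zero[OF subgroup_SLD(3)[OF subgroup_upper u]] upper_zero[OF subgroup_SLD(3)[OF subgroup_upper u(2,1)]] ij by auto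
    next
      case True
      have "(x * y) $$ (i, i) = x $$ (i, i) * y $$ (i, i)" if x: "x \<in> upper n" and y: "y \<in> upper n" for x y
      proof -
        have "(x * y) $$ (i, i) = (\<Sum>l<n. x $$ (i, l) * y $$ (l, i))"
          by (rule index_mult_sum[OF SLset_carrier[OF upper_SL[OF x]] SLset_carrier[OF upper_SL[OF y]] ij(1) ij(1)])
        also have "\<dots> = (\<Sum>l<n. if l = i then x $$ (i, i) * y $$ (i, i) else 0)"
        proof (rule sum.cong[OF refl])
          fix l assume "l \<in> {..<n}"
          then show "x $$ (i, l) * y $$ (l, i) = (if l = i then x $$ (i, i) * y $$ (i, i) else 0)"
            using upper_zero[OF x ij(1), of l] upper_zero[OF y, of l i] by (cases l i rule: linorder_cases) auto
        qed
        also have "\<dots> = x $$ (i, i) * y $$ (i, i)" using ij(1) by simp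
        finally show ?thesis .
      qed
      from this[OF u] this[OF u(2) u(1)] show ?thesis using True by simp
    qed
    then show ?thesis using True c by (auto simp: band_def)
  next
    case False
    have "a * b - b * a = (a - 1\<^sub>m n) * (b - 1\<^sub>m n) - (b - 1\<^sub>m n) * (a - 1\<^sub>m n)"
      using c by (simp add: minus_mult_distrib_mat[of _ n n _ _ n] mult_minus_distrib_mat[of _ n n _ n] minus_carrier_mat)
        (intro eq_matI, auto)
    moreover have "(a - 1\<^sub>m n) * (b - 1\<^sub>m n) - (b - 1\<^sub>m n) * (a - 1\<^sub>m n) \<in> band n (k + k)"
      by (rule band_minus[OF band_mult band_mult]) (use a b False in \<open>auto simp: unip_def\<close>)
    ultimately show ?thesis using band_mono[of _ n "k + k" "Suc k"] False by simp
  qed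
  then have "(a * b - b * a) * (adj_mat a * adj_mat b) \<in> band n (Suc k + 0)"
    using upper_band[OF subgroup_SLD(3)[OF subgroup_upper upper_adj[OF u(1)] upper_adj[OF u(2)]]] by (rule band_mult)
  moreover have "(a * b - b * a) * (adj_mat a * adj_mat b) = a * b * adj_mat a * adj_mat b - 1\<^sub>m n"
  proof -
    have "(a * b - b * a) * (adj_mat a * adj_mat b) = a * b * (adj_mat a * adj_mat b) - b * a * (adj_mat a * adj_mat b)"
      using c by (intro minus_mult_distrib_mat[of _ n n _ _ n]) auto
    also have "a * b * (adj_mat a * adj_mat b) = a * b * adj_mat a * adj_mat b"
      using S SA by (simp add: SLset_assoc[of _ n])
    also have "b * a * (adj_mat a * adj_mat b) = 1\<^sub>m n"
      using S SA by (simp add: SLset_assoc[of _ n] SLset_cancel(2)[of a n] SLset_adj(2))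
    finally show ?thesis .
  qed
  ultimately show ?thesis using mem by (simp add: unip_def)
qed

lemma upper_derived_trivial: "\<exists>k. (derived (SL n) ^^ k) (upper n) = {1\<^sub>m n}"
proof -
  interpret G: group "SL n" by (rule group_SL)
  have sub: "(derived (SL n) ^^ k) (upper n) \<subseteq> unip n k" for k
  proof (induction k)
    case 0
    then show ?case by (auto simp: unip_def)
  next
    case (Suc k)
    have "derived_set (SL n) (unip n k) \<subseteq> unip n (Suc k)"
      using unip_commutator subgroup_SLD(1)[OF subgroup_unip, of n k] by (auto simp: inv_SL subset_iff)
    then have "derived (SL n) (unip n k) \<subseteq> unip n (Suc k)"
      unfolding derived_def by (rule G.generate_subgroup_incl[OF _ subgroup_unip])
    then show ?case using G.mono_derived[OF Suc] by auto
  qed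
  \<comment> \<open>Band \<open>Suc n\<close> contains only the zero matrix, and the index
    \<open>Suc n\<close> is never the exceptional index 0.\<close>
  have "unip n (Suc n) \<subseteq> {1\<^sub>m n}"
  proof
    fix h assume h: "h \<in> unip n (Suc n)"
    then have c: "h \<in> carrier_mat n n" and z: "h - 1\<^sub>m n \<in> band n (Suc n)" by (auto simp: unip_def upper_SL SLset_carrier)
    have "h $$ (i, j) = 1\<^sub>m n $$ (i, j)" if "i < n" "j < n" for i j
    proof -
      have "(h - 1\<^sub>m n) $$ (i, j) = 0" using z that by (simp add: band_def)
      then show ?thesis using c that by simp
    qed
    then show "h \<in> {1\<^sub>m n}" using c by (auto intro!: eq_matI)
  qed
  moreover have "1\<^sub>m n \<in> (derived (SL n) ^^ Suc n) (upper n)"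
    using subgroup.one_closed[OF G.exp_of_derived_is_subgroup[OF subgroup_upper, of "Suc n"]] by simp
  ultimately have "(derived (SL n) ^^ Suc n) (upper n) = {1\<^sub>m n}" using sub[of "Suc n"] by auto
  then show ?thesis by blast
qed

lemma solvable_subgroup_iff:
  assumes H: "subgroup H (SL n)"
  shows "solvable ((SL n)\<lparr>carrier := H\<rparr>) \<longleftrightarrow> (\<exists>k. (derived (SL n) ^^ k) H = {1\<^sub>m n})"
proof -
  interpret G: group "SL n" by (rule group_SL)
  interpret H: group "(SL n)\<lparr>carrier := H\<rparr>" by (rule G.subgroup_imp_group[OF H])
  have in_H: "(derived (SL n) ^^ k) H \<subseteq> H" for k
  proof (induction k)
    case (Suc k)
    then show ?case using G.derived_incl[OF _ H] by simp
  qed simp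
  have "(derived ((SL n)\<lparr>carrier := H\<rparr>) ^^ k) H = (derived (SL n) ^^ k) H" for k
  proof (induction k)
    case (Suc k)
    then show ?case using G.derived_consistent[OF in_H[of k] H] by simp
  qed simp
  then show ?thesis using H.solvable_iff_trivial_derived_seq by simp
qed

text \<open>The conjugate of \<open>L\<close> by \<open>g\<close>, written as a preimage rather than
  as an image, so that closedness is a matter of pulling back equations.\<close>

definition conj_set :: "nat \<Rightarrow> complex mat \<Rightarrow> complex mat set \<Rightarrow> complex mat set" where
  "conj_set n g L = {x \<in> SLset n. adj_mat g * x * g \<in> L}"

lemma conj_set_image:
  assumes g: "g \<in> SLset n" and L: "L \<subseteq> SLset n"
  shows "conj_set n g L = (\<lambda>x. g * x * adj_mat g) ` L"
proof
  note ga = SLset_adj(1)[OF g]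
  show "conj_set n g L \<subseteq> (\<lambda>x. g * x * adj_mat g) ` L"
  proof
    fix x assume x: "x \<in> conj_set n g L"
    then have "x = g * (adj_mat g * x * g) * adj_mat g" "adj_mat g * x * g \<in> L"
      using g ga by (auto simp: conj_set_def SLset_assoc[of _ n] SLset_cancel(2)[of g n] SLset_adj(2))
    then show "x \<in> (\<lambda>x. g * x * adj_mat g) ` L" by blast
  qed
  show "(\<lambda>x. g * x * adj_mat g) ` L \<subseteq> conj_set n g L"
  proof
    fix x assume "x \<in> (\<lambda>x. g * x * adj_mat g) ` L"
    then obtain y where y: "y \<in> L" "x = g * y * adj_mat g" by blast
    then have yS: "y \<in> SLset n" using L by auto
    have "adj_mat g * x * g = y" using y yS g ga by (simp add: SLset_assoc[of _ n] SLset_cancel(1)[of g n] SLset_adj(3))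
    then show "x \<in> conj_set n g L" using y yS g ga by (simp add: conj_set_def)
  qed
qed

lemma subgroup_conj_set:
  assumes g: "g \<in> SLset n" and L: "subgroup L (SL n)"
  shows "subgroup (conj_set n g L) (SL n)"
proof (rule subgroup_SLI)
  note ga = SLset_adj(1)[OF g]
  show "conj_set n g L \<subseteq> SLset n" by (auto simp: conj_set_def)
  show "1\<^sub>m n \<in> conj_set n g L" using g ga subgroup_SLD(2)[OF L] SLset_adj(3)[OF g] by (simp add: conj_set_def)
  show "x * y \<in> conj_set n g L" if "x \<in> conj_set n g L" "y \<in> conj_set n g L" for x y
  proof -
    have xy: "x \<in> SLset n" "y \<in> SLset n" using that by (auto simp: conj_set_def)
    have "adj_mat g * (x * y) * g = adj_mat g * x * g * (adj_mat g * y * g)"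
      using xy g ga by (simp add: SLset_assoc[of _ n] SLset_cancel(2)[of g n])
    then show ?thesis using subgroup_SLD(3)[OF L] that by (simp add: conj_set_def)
  qed
  show "adj_mat x \<in> conj_set n g L" if "x \<in> conj_set n g L" for x
  proof -
    have x: "x \<in> SLset n" using that by (simp add: conj_set_def)
    have "adj_mat g * adj_mat x * g = adj_mat (adj_mat g * x * g)"
      using x g ga SLset_adj(1)[OF x] by (simp add: SLset_adj_mult[of _ n] SLset_adj_adj[of g n] SLset_assoc[of _ n])
    then show ?thesis using subgroup_SLD(4)[OF L] that SLset_adj(1)[OF x] by (simp add: conj_set_def)
  qed
qed

text \<open>This makes conjugates of the upper triangular group eligible in the maximality condition
  that defines Borel subgroups.\<close>

lemma conj_upper_ccs:
  assumes n: "n \<ge> 1" and g: "g \<in> SLset n"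
  shows "closed_connected_solvable n (conj_set n g (upper n))"
  unfolding closed_connected_solvable_def closed_subgroup_def
proof (intro conjI)
  interpret G: group "SL n" by (rule group_SL)
  note ga = SLset_adj(1)[OF g]
  let ?C = "conj_set n g (upper n)" and ?c = "\<lambda>x. g * x * adj_mat g"
  have US: "upper n \<subseteq> SLset n" using upper_SL by blast
  show sg: "subgroup ?C (SL n)" by (rule subgroup_conj_set[OF g subgroup_upper])
  have o: "openin (zariski (SL_space n)) (SLset n)" using openin_topspace[of "zariski (SL_space n)"] by simp
  note fa = function_algebra_regular[OF local_fspace_induced o]
  note c = mat_entries_const[OF fa SLset_carrier[OF g]] mat_entries_const[OF fa SLset_carrier[OF ga]]
  have id: "mat_entries (SLset n) (regular (SL_space n) (SLset n)) n n (\<lambda>x. x)"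
    by (rule SL_space_entries[OF subset_refl fa polynomial_regular_induced])
  let ?U = "\<lambda>ij. {x \<in> SLset n. (adj_mat g * x * g) $$ ij \<noteq> 0}" and ?I = "{(i, j). i < n \<and> j < i}"
  have "openin (zariski (SL_space n)) (\<Union>ij\<in>?I. ?U ij)"
  proof (rule openin_Union, elim imageE)
    fix U ij assume U: "U = ?U ij" and "ij \<in> ?I"
    then obtain i j where ij: "i < n" "j < i" "ij = (i, j)" by auto
    have "(\<lambda>x. (adj_mat g * x * g) $$ (i, j)) \<in> regular (SL_space n) (SLset n)"
      by (rule mat_entriesD[OF fa mat_entries_mult[OF fa mat_entries_mult[OF fa c(2) id] c(1)]]) (use ij in auto)
    then show "openin (zariski (SL_space n)) U" unfolding U ij(3) by (rule openin_nonzero[OF local_fspace_induced o])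
  qed
  moreover have "(\<Union>ij\<in>?I. ?U ij) = SLset n - ?C"
  proof (rule Set.set_eqI)
    fix x
    have "x \<in> SLset n - ?C \<longleftrightarrow> x \<in> SLset n \<and> (\<exists>i j. i < n \<and> j < i \<and> (adj_mat g * x * g) $$ (i, j) \<noteq> 0)"
    proof (cases "x \<in> SLset n")
      case True
      then have "adj_mat g * x * g \<in> SLset n" using g ga by simp
      then have "x \<in> ?C \<longleftrightarrow> (\<forall>i<n. \<forall>j<n. \<not> i \<le> j \<longrightarrow> (adj_mat g * x * g) $$ (i, j) = 0)"
        using True by (simp add: conj_set_def pattern_group_def)
      then show ?thesis using True by (meson DiffD2 DiffI less_trans not_le)
    qed simp
    then show "x \<in> (\<Union>ij\<in>?I. ?U ij) \<longleftrightarrow> x \<in> SLset n - ?C" by auto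
  qed
  ultimately show "closedin (zariski (underlying_variety (SL n))) ?C"
    using subgroup_SLD(1)[OF sg] by (simp add: closedin_def)
  have "morphism (SL_space n) (SL_space n) ?c"
    by (rule morphism_SL_space[OF local_fspace_induced])
      (use mat_entries_mult[OF fa mat_entries_mult[OF fa c(1) id] c(2)] g ga in auto)
  then have "continuous_map (zariski (SL_space n)) (zariski (SL_space n)) ?c" by (simp add: morphism_def)
  from connectedin_continuous_map_image[OF this upper_connected[OF n]]
  show "connectedin (zariski (underlying_variety (SL n))) ?C" by (simp add: conj_set_image[OF g US])
  have hom: "group_hom (SL n) (SL n) ?c"
  proof (intro group_hom.intro group_hom_axioms.intro group_SL homI)
    fix x y assume "x \<in> carrier (SL n)" "y \<in> carrier (SL n)"
    then show "?c (x \<otimes>\<^bsub>SL n\<^esub> y) = ?c x \<otimes>\<^bsub>SL n\<^esub> ?c y" using g ga by (simp add: SLset_assoc[of _ n] SLset_cancel(1)[of g n])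
  qed (use g ga in auto)
  obtain k where "(derived (SL n) ^^ k) (upper n) = {1\<^sub>m n}" using upper_derived_trivial by blast
  then have "solvable_seq (SL n) (upper n)" using G.trivial_derived_seq_imp_solvable[OF subgroup_upper] by simp
  from group_hom.solvable_imp_solvable_img[OF hom this]
  have "solvable_seq (SL n) ?C" by (simp add: conj_set_image[OF g US])
  from G.solvable_imp_trivial_derived_seq[OF this]
  show "solvable ((SL n)\<lparr>carrier := ?C\<rparr>)" by (simp add: solvable_subgroup_iff[OF sg])
qed

text \<open>Triangularisation places \<open>B\<close> inside a conjugate of the upper triangular
  group, and maximality of \<open>B\<close> gives equality.\<close>

lemma borel_conjugate:
  assumes n: "n \<ge> 1" and B: "borel_subgroup n B"
  shows "\<exists>g\<in>SLset n. B = conj_set n g (upper n)"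
proof -
  have ccs: "closed_connected_solvable n B" and max: "\<And>H. closed_connected_solvable n H \<Longrightarrow> B \<subseteq> H \<Longrightarrow> H = B"
    using B by (auto simp: borel_subgroup_def)
  then have sg: "subgroup B (SL n)" and con: "connectedin (zariski (SL_space n)) B" and "solvable ((SL n)\<lparr>carrier := B\<rparr>)"
    by (auto simp: closed_connected_solvable_def closed_subgroup_def)
  then obtain k where k: "(derived (SL n) ^^ k) B = {1\<^sub>m n}" using solvable_subgroup_iff by blast
  note BS = subgroup_SLD(1)[OF sg]
  have "is_rep n B n (\<lambda>x. x)"
    using poly_on_entries[OF BS] poly_on_algebra[of B n] by (auto simp: is_rep_def mat_entries_def)
  from lie_kolchin_rep[OF sg connected_rigid[OF con] k this]
  obtain S T where S: "S \<in> carrier_mat n n" "T \<in> carrier_mat n n" "S * T = 1\<^sub>m n" "T * S = 1\<^sub>m n"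
    and tri: "\<And>x i j. x \<in> B \<Longrightarrow> i < n \<Longrightarrow> j < i \<Longrightarrow> (T * x * S) $$ (i, j) = 0" unfolding triangularizable_def by blast
  have dS: "det S * det T = 1" using det_mult[OF S(1,2)] S(3) by simp
  then have dS0: "det S \<noteq> 0" by auto
  let ?d = "\<lambda>s i. if i = (0::nat) then s else (1::complex)"
  define D where "D s = mat n n (\<lambda>(a, b). if a = b then (if a = 0 then s else 1) else (0::complex))" for s
  have D: "D s \<in> carrier_mat n n" for s by (simp add: D_def)
  have Dl: "(D s * A) $$ (i, j) = ?d s i * A $$ (i, j)" if "A \<in> carrier_mat n n" "i < n" "j < n" for s A i j
  proof -
    have "(D s * A) $$ (i, j) = (\<Sum>a<n. if a = i then ?d s i * A $$ (i, j) else 0)"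
      unfolding index_mult_sum[OF D that] using that by (intro sum.cong) (auto simp: D_def)
    then show ?thesis using that by simp
  qed
  have Dr: "(A * D s) $$ (i, j) = A $$ (i, j) * ?d s j" if "A \<in> carrier_mat n n" "i < n" "j < n" for s A i j
  proof -
    have "(A * D s) $$ (i, j) = (\<Sum>a<n. if a = j then A $$ (i, j) * ?d s j else 0)"
      unfolding index_mult_sum[OF that(1) D that(2,3)] using that by (intro sum.cong) (auto simp: D_def)
    then show ?thesis using that by simp
  qed
  have DD: "D s * D (inverse s) = 1\<^sub>m n" if "s \<noteq> 0" for s
  proof (rule eq_matI)
    show "(D s * D (inverse s)) $$ (i, j) = 1\<^sub>m n $$ (i, j)" if "i < dim_row (1\<^sub>m n)" "j < dim_col (1\<^sub>m n)" for i j
      using that Dl[OF D, of i j s "inverse s"] \<open>s \<noteq> 0\<close> by (auto simp: D_def)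
  qed (auto simp: D_def)
  \<comment> \<open>Scaling the first column of the triangularising matrix by this constant brings
    its determinant to one; a diagonal change of basis keeps the matrices triangular.\<close>
  define s where "s = inverse (det S)"
  have s0: "s \<noteq> 0" using dS0 by (simp add: s_def)
  have dD: "det (D s) = s" unfolding D_def using det_sign_diag[of n s] n by simp
  define g where "g = S * D s"
  have g: "g \<in> SLset n" unfolding SLset_def g_def using S D det_mult[OF S(1) D] dD dS0 by (simp add: s_def)
  have dDi: "det (D (inverse s)) = inverse s" unfolding D_def using det_sign_diag[of n "inverse s"] n by simp
  have "det (D (inverse s) * T) = 1"
    using det_mult[OF D S(2)] dDi dS by (simp add: s_def)
  then have gi: "D (inverse s) * T \<in> SLset n" using mult_carrier_mat[OF D S(2)] by (simp add: SLset_def)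
  have "g * (D (inverse s) * T) = S * (D s * D (inverse s)) * T"
    unfolding g_def assoc_mult_mat[OF S(1) D mult_carrier_mat[OF D S(2)]]
      assoc_mult_mat[OF D D S(2), symmetric] assoc_mult_mat[OF S(1) mult_carrier_mat[OF D D] S(2)] ..
  also have "\<dots> = 1\<^sub>m n" using DD[OF s0] S by simp
  finally have ga: "adj_mat g = D (inverse s) * T" using SLset_inverse_unique[OF g gi] by simp
  have "B \<subseteq> conj_set n g (upper n)"
  proof
    fix x assume x: "x \<in> B"
    then have xS: "x \<in> SLset n" using BS by auto
    have xc: "x \<in> carrier_mat n n" using xS by (rule SLset_carrier)
    have e: "adj_mat g * x * g = D (inverse s) * (T * x * S * D s)"
      unfolding ga unfolding g_def using S D xc by (simp add: assoc_mult_mat[of _ n n _ n _ n])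
    have "(adj_mat g * x * g) $$ (i, j) = 0" if ij: "i < n" "j < i" for i j
    proof -
      note m = mult_carrier_mat[OF mult_carrier_mat[OF S(2) xc] S(1)]
      note m = m mult_carrier_mat[OF m D]
      show ?thesis unfolding e using Dl[OF m(2), of i j "inverse s"] Dr[OF m(1), of i j s] tri[OF x ij] ij by simp
    qed
    moreover have "adj_mat g * x * g \<in> SLset n" using g xS SLset_adj(1)[OF g] by simp
    ultimately show "x \<in> conj_set n g (upper n)" using xS by (auto simp: conj_set_def pattern_group_def)
  qed
  then have "conj_set n g (upper n) = B" by (rule max[OF conj_upper_ccs[OF n g]])
  then show ?thesis using g by auto
qed

section \<open>Overgroups of the upper triangular group\<close>

definition transv :: "nat \<Rightarrow> nat \<Rightarrow> nat \<Rightarrow> complex \<Rightarrow> complex mat" where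
  "transv n i j t = mat n n (\<lambda>(a, b). if a = b then 1 else if a = i \<and> b = j then t else 0)"

lemma transv_carrier [simp]: "transv n i j t \<in> carrier_mat n n" by (simp add: transv_def)

lemma transv_mult:
  assumes "A \<in> carrier_mat n n" "i < n" "j < n" "i \<noteq> j" "a < n" "b < n"
  shows "(transv n i j t * A) $$ (a, b) = A $$ (a, b) + (if a = i then t * A $$ (j, b) else 0)"
proof -
  have "(transv n i j t * A) $$ (a, b) = (\<Sum>l<n. transv n i j t $$ (a, l) * A $$ (l, b))"
    by (rule index_mult_sum) (use assms in auto)
  also have "\<dots> = (\<Sum>l<n. (if l = a then A $$ (a, b) else 0) + (if l = j then (if a = i then t * A $$ (j, b) else 0) else 0))"
    using assms by (intro sum.cong) (auto simp: transv_def)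
  also have "\<dots> = A $$ (a, b) + (if a = i then t * A $$ (j, b) else 0)"
    using assms by (simp add: sum.distrib)
  finally show ?thesis .
qed

lemma transv_SL:
  assumes "i \<noteq> j"
  shows "transv n i j t \<in> SLset n"
proof (cases "i < j")
  case True
  have "det (transv n i j t) = (\<Prod>a<n. transv n i j t $$ (a, a))"
    by (rule det_upper) (use True in \<open>auto simp: transv_def\<close>)
  also have "\<dots> = 1" by (intro prod.neutral) (auto simp: transv_def)
  finally show ?thesis by (simp add: SLset_def)
next
  case False
  have "det (transv n i j t) = 1"
    by (rule det_unitriangular) (use False assms in \<open>auto simp: transv_def\<close>)
  then show ?thesis by (simp add: SLset_def)
qed

lemma transv_inverse:
  assumes "i < n" "j < n" "i \<noteq> j"
  shows "adj_mat (transv n i j t) = transv n i j (- t)"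
proof -
  have "transv n i j t * transv n i j (- t) = 1\<^sub>m n"
  proof (rule eq_matI)
    fix a b assume "a < dim_row (1\<^sub>m n :: complex mat)" "b < dim_col (1\<^sub>m n :: complex mat)"
    then have ab: "a < n" "b < n" by auto
    then show "(transv n i j t * transv n i j (- t)) $$ (a, b) = (1\<^sub>m n :: complex mat) $$ (a, b)"
      using transv_mult[OF transv_carrier assms ab, of t i j "- t"] assms by (auto simp: transv_def)
  qed (auto simp: transv_def)
  then show ?thesis using SLset_inverse_unique[OF transv_SL transv_SL] assms by metis
qed

text \<open>The elementary commutator relation. It is what makes the relation read off from the
  transvections of a subgroup transitive.\<close>

lemma transv_commutator:
  assumes "i < n" "j < n" "k < n" "i \<noteq> j" "j \<noteq> k" "i \<noteq> k"
  shows "transv n i j t * (transv n j k 1 * (transv n i j (- t) * transv n j k (- 1))) = transv n i k t" (is "?L = _")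
proof (rule eq_matI)
  fix a b assume "a < dim_row (transv n i k t)" "b < dim_col (transv n i k t)"
  then have ab: "a < n" "b < n" by (auto simp: transv_def)
  let ?C = "transv n i j (- t) * transv n j k (- 1)"
  let ?B = "transv n j k 1 * ?C"
  have C: "?C \<in> carrier_mat n n" and B: "?B \<in> carrier_mat n n"
    by (intro mult_carrier_mat[of _ n n] transv_carrier)+
  have Ci: "?C $$ (x, b) = transv n j k (- 1) $$ (x, b) + (if x = i then - t * transv n j k (- 1) $$ (j, b) else 0)" if "x < n" for x
    using transv_mult[OF transv_carrier assms(1,2,4) that ab(2)] .
  have Bi: "?B $$ (x, b) = ?C $$ (x, b) + (if x = j then 1 * ?C $$ (k, b) else 0)" if "x < n" for x
    using transv_mult[OF C assms(2,3,5) that ab(2)] .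
  have Li: "?L $$ (a, b) = ?B $$ (a, b) + (if a = i then t * ?B $$ (j, b) else 0)"
    using transv_mult[OF B assms(1,2,4) ab] .
  show "?L $$ (a, b) = transv n i k t $$ (a, b)"
    unfolding Li Bi[OF ab(1)] Bi[OF assms(2)] Ci[OF ab(1)] Ci[OF assms(2)] Ci[OF assms(3)]
    using ab assms by (auto simp: transv_def)
qed (auto simp: transv_def)

context
  fixes n :: nat and Q :: "complex mat set"
  assumes Q: "subgroup Q (SL n)" and UQ: "upper n \<subseteq> Q"
begin

definition rel :: "nat \<Rightarrow> nat \<Rightarrow> bool" where
  "rel i j \<longleftrightarrow> i \<le> j \<or> (\<forall>t. transv n i j t \<in> Q)"

lemma transv_upper: "i < j \<Longrightarrow> transv n i j t \<in> upper n"
  using transv_SL[of i j n t] by (auto simp: pattern_group_def transv_def)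

lemma rel_transv: "rel i j \<Longrightarrow> i \<noteq> j \<Longrightarrow> transv n i j t \<in> Q"
  using transv_upper[of i j t] UQ by (auto simp: rel_def)

lemma rel_trans:
  assumes "i < n" "j < n" "k < n" "rel i j" "rel j k"
  shows "rel i k"
proof (cases "i = j \<or> j = k \<or> i \<le> k")
  case True
  then show ?thesis using assms by (auto simp: rel_def)
next
  case False
  then have "transv n i k t \<in> Q" for t
    using transv_commutator[of i n j k t] assms rel_transv
    by (metis subgroup_SLD(3)[OF Q] order_refl)
  then show ?thesis by (simp add: rel_def)
qed

lemma upper_pattern: "upper n \<subseteq> pattern_group n rel"
  by (auto simp: pattern_group_def rel_def)

lemma pattern_mult: "g \<in> pattern_group n rel \<Longrightarrow> h \<in> pattern_group n rel \<Longrightarrow> g * h \<in> pattern_group n rel"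
  by (rule pattern_group_mult[of n rel]) (rule rel_trans)

lemma transv_pattern: "rel i j \<Longrightarrow> i \<noteq> j \<Longrightarrow> transv n i j t \<in> pattern_group n rel"
  using transv_SL[of i j n t] by (auto simp: pattern_group_def transv_def rel_def)

text \<open>The progress measure of the elimination: the first \<open>c\<close> columns are already
  diagonal.\<close>

definition diagc :: "nat \<Rightarrow> complex mat \<Rightarrow> bool" where
  "diagc c h \<longleftrightarrow> (\<forall>j<c. \<forall>i<n. i \<noteq> j \<longrightarrow> h $$ (i, j) = 0)"

text \<open>As the first \<open>c\<close> columns are diagonal with nonzero entries, row
  \<open>c\<close> of the inverse vanishes before place \<open>c\<close>. Without a pivot, the
  diagonal entry of \<open>adj_mat h * h\<close> at \<open>c\<close> would be 0 instead of
  1.\<close>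

lemma pivot:
  assumes h: "h \<in> SLset n" and c: "c < n" and d: "diagc c h"
  shows "\<exists>i<n. c \<le> i \<and> h $$ (i, c) \<noteq> 0"
proof (rule ccontr)
  assume no: "\<not> ?thesis"
  let ?k = "adj_mat h"
  have mult: "(\<Sum>l<n. ?k $$ (a, l) * h $$ (l, b)) = (if a = b then 1 else 0)" if "a < n" "b < n" for a b
    using index_mult_sum[OF SLset_carrier[OF SLset_adj(1)[OF h]] SLset_carrier[OF h] that] SLset_adj(3)[OF h] that by simp
  have col: "?k $$ (a, b) * h $$ (b, b) = (if a = b then 1 else 0)" if "a < n" "b < c" for a b
  proof -
    have "(\<Sum>l<n. ?k $$ (a, l) * h $$ (l, b)) = (\<Sum>l<n. if l = b then ?k $$ (a, b) * h $$ (b, b) else 0)"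
      using d that by (intro sum.cong) (auto simp: diagc_def)
    then show ?thesis using mult[of a b] that c by simp
  qed
  have k0: "?k $$ (c, l) = 0" if "l < c" for l
    using col[of l l] col[of c l] that c by auto
  have "(\<Sum>l<n. ?k $$ (c, l) * h $$ (l, c)) = 0"
  proof (intro sum.neutral ballI)
    fix l assume "l \<in> {..<n}"
    then show "?k $$ (c, l) * h $$ (l, c) = 0" using k0[of l] no by (cases "l < c") auto
  qed
  then show False using mult[OF c c] by simp
qed

lemma diagonal_upper: "h \<in> SLset n \<Longrightarrow> diagc n h \<Longrightarrow> h \<in> upper n"
  by (auto simp: pattern_group_def diagc_def)

text \<open>Elimination in column \<open>c\<close>: the pivot \<open>\<gamma>\<close> in row \<open>i > c\<close> yields the transvections
  \<open>1 + t \<gamma> e\<^sub>i\<^sub>c = h (1 + t e\<^sub>c (row\<^sub>c h)) h\<^sup>-\<^sup>1\<close>, where the second factor on the right is upper triangular.\<close>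

lemma overgroup_subset:
  assumes "h \<in> Q" "c \<le> n" "diagc c h"
  shows "h \<in> pattern_group n rel"
  using assms
proof (induction "n - c" arbitrary: c h)
  case 0
  then have "c = n" by simp
  then show ?case using diagonal_upper[of h] 0 subgroup_SLD(1)[OF Q] upper_pattern by auto
next
  case (Suc m)
  then have c: "c < n" and m: "m = n - Suc c" by auto
  have hS: "h \<in> SLset n" using Suc.prems(1) subgroup_SLD(1)[OF Q] by auto
  define I where "I = {i. i < n \<and> h $$ (i, c) \<noteq> 0}"
  obtain i0 where i0: "i0 < n" "c \<le> i0" "h $$ (i0, c) \<noteq> 0" using pivot[OF hS c Suc.prems(3)] by blast
  have finI: "finite I" "i0 \<in> I" using i0 by (auto simp: I_def)
  define i where "i = Max I"
  have "i \<in> I" using Max_in[OF finI(1)] finI(2) unfolding i_def by blast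
  then have i: "i < n" "h $$ (i, c) \<noteq> 0" by (auto simp: I_def)
  have ci: "c \<le> i" using Max_ge[OF finI] i0(2) by (simp add: i_def)
  have above: "h $$ (a, c) = 0" if "i < a" "a < n" for a
  proof (rule ccontr)
    assume "h $$ (a, c) \<noteq> 0"
    then have "a \<le> i" using that Max_ge[OF finI(1), of a] by (simp add: i_def I_def)
    then show False using that by simp
  qed
  \<comment> \<open>Row \<open>i\<close> is the last row with a nonzero entry in column
    \<open>c\<close>, so the other entries of that column lie above it and are cleared by an upper
    triangular matrix.\<close>
  define b where "b = mat n n (\<lambda>(a, d). if a = d then 1 else if d = i \<and> a < i then - h $$ (a, c) / h $$ (i, c) else 0)"
  have bU: "b \<in> upper n"
  proof -
    have "det b = (\<Prod>a<n. b $$ (a, a))" by (rule det_upper) (auto simp: b_def)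
    also have "\<dots> = 1" by (intro prod.neutral) (auto simp: b_def)
    finally show ?thesis by (auto simp: pattern_group_def SLset_def b_def)
  qed
  define h1 where "h1 = b * h"
  have h1: "h1 \<in> Q" unfolding h1_def using subgroup_SLD(3)[OF Q] bU UQ Suc.prems(1) by blast
  have h1S: "h1 \<in> SLset n" using h1 subgroup_SLD(1)[OF Q] by auto
  have h1i: "h1 $$ (a, d) = h $$ (a, d) + (if a < i then - h $$ (a, c) / h $$ (i, c) * h $$ (i, d) else 0)"
    if ad: "a < n" "d < n" for a d
  proof -
    have "h1 $$ (a, d) = (\<Sum>l<n. b $$ (a, l) * h $$ (l, d))"
      unfolding h1_def using index_mult_sum[OF SLset_carrier[OF upper_SL[OF bU]] SLset_carrier[OF hS] ad] .
    also have "\<dots> = (\<Sum>l<n. (if l = a then h $$ (a, d) else 0) + (if l = i then (if a < i then - h $$ (a, c) / h $$ (i, c) * h $$ (i, d) else 0) else 0))"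
      using ad i by (intro sum.cong) (auto simp: b_def)
    finally show ?thesis using ad i by (simp add: sum.distrib)
  qed
  define \<gamma> where "\<gamma> = h $$ (i, c)"
  have \<gamma>: "\<gamma> \<noteq> 0" using i by (simp add: \<gamma>_def)
  have h1c: "h1 $$ (a, c) = (if a = i then \<gamma> else 0)" if "a < n" for a
    using h1i[OF that c] above[of a] that i by (cases a i rule: linorder_cases) (auto simp: \<gamma>_def)
  have h1d: "diagc c h1"
    unfolding diagc_def
  proof (intro allI impI)
    fix j a assume ja: "j < c" "a < n" "a \<noteq> j"
    then have "h $$ (a, j) = 0" "h $$ (i, j) = 0" using Suc.prems(3) i ci by (auto simp: diagc_def)
    then show "h1 $$ (a, j) = 0" using h1i[of a j] ja c by simp
  qed
  have hb: "h = adj_mat b * h1" unfolding h1_def using SLset_cancel(1)[OF upper_SL[OF bU] hS] by simp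
  have bP: "adj_mat b \<in> pattern_group n rel" using upper_adj[OF bU] upper_pattern by blast
  have "h1 \<in> pattern_group n rel"
  proof (cases "i = c")
    case True
    have "diagc (Suc c) h1"
      using h1d h1c True unfolding diagc_def by (auto simp: less_Suc_eq)
    then show ?thesis using Suc.hyps(1)[OF m h1] c by simp
  next
    case False
    then have ic: "c < i" using ci by simp
    have tr: "transv n i c (t * \<gamma>) \<in> Q" for t
    proof -
      \<comment> \<open>Right multiplication of \<open>h1\<close> by \<open>W\<close> adds column
        \<open>c\<close>, whose only entry is \<open>\<gamma>\<close>, times a multiple of row
        \<open>c\<close>. Row \<open>c\<close> of \<open>h1\<close> vanishes up to column
        \<open>c\<close> because \<open>i \<noteq> c\<close>; this makes \<open>W\<close> upper
        unitriangular.\<close>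
      define W where "W = mat n n (\<lambda>(a, d). (if a = d then 1 else 0) + (if a = c then t * h1 $$ (c, d) else 0))"
      have h1cd: "h1 $$ (c, d) = 0" if "d \<le> c" for d
        using that h1d h1c[OF c] False c unfolding diagc_def by (cases "d = c") auto
      have WU: "W \<in> upper n"
      proof -
        have z: "W $$ (a, d) = 0" if "a < n" "d < a" for a d using that h1cd[of d] by (auto simp: W_def)
        have "det W = (\<Prod>a<n. W $$ (a, a))" by (rule det_upper) (use z in \<open>auto simp: W_def\<close>)
        also have "\<dots> = 1" by (intro prod.neutral) (use h1cd[of c] in \<open>auto simp: W_def\<close>)
        finally show ?thesis using z by (auto simp: pattern_group_def SLset_def W_def)
      qed
      have "h1 * W = transv n i c (t * \<gamma>) * h1"
      proof (rule eq_matI)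
        fix a d assume "a < dim_row (transv n i c (t * \<gamma>) * h1)" "d < dim_col (transv n i c (t * \<gamma>) * h1)"
        then have ad: "a < n" "d < n" using h1S by (auto simp: transv_def)
        have "(h1 * W) $$ (a, d) = (\<Sum>l<n. h1 $$ (a, l) * W $$ (l, d))"
          by (rule index_mult_sum[OF SLset_carrier[OF h1S] SLset_carrier[OF upper_SL[OF WU]] ad])
        also have "\<dots> = (\<Sum>l<n. (if l = d then h1 $$ (a, d) else 0) + (if l = c then h1 $$ (a, c) * (t * h1 $$ (c, d)) else 0))"
          using ad c by (intro sum.cong) (auto simp: W_def distrib_left)
        also have "\<dots> = h1 $$ (a, d) + h1 $$ (a, c) * (t * h1 $$ (c, d))" using ad c by (simp add: sum.distrib)
        also have "\<dots> = (transv n i c (t * \<gamma>) * h1) $$ (a, d)"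
          using transv_mult[OF SLset_carrier[OF h1S] i(1) c False ad] h1c[OF ad(1)] by simp
        finally show "(h1 * W) $$ (a, d) = (transv n i c (t * \<gamma>) * h1) $$ (a, d)" .
      qed (use h1S in \<open>auto simp: transv_def W_def\<close>)
      then have "h1 * W * adj_mat h1 = transv n i c (t * \<gamma>)"
        using SLset_cancel(3)[OF h1S transv_SL[OF False]] by simp
      moreover have "h1 * W * adj_mat h1 \<in> Q"
        using subgroup_SLD(3,4)[OF Q] h1 WU UQ by blast
      ultimately show ?thesis by simp
    qed
    have rel: "rel i c"
      unfolding rel_def using tr[of "t / \<gamma>" for t] \<gamma> by simp
    \<comment> \<open>The pivot is carried from row \<open>i\<close> to the diagonal by adding row
      \<open>i\<close> to row \<open>c\<close> and subtracting row \<open>c\<close> from row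
      \<open>i\<close>; both transvections lie in \<open>Q\<close>.\<close>
    define h2 where "h2 = transv n c i 1 * h1"
    define h3 where "h3 = transv n i c (- 1) * h2"
    have E: "transv n c i 1 \<in> Q" "transv n i c (- 1) \<in> Q"
      using rel_transv[of c i] rel_transv[OF rel] ic by (auto simp: rel_def)
    have h2: "h2 \<in> Q" and h3: "h3 \<in> Q" unfolding h3_def h2_def using subgroup_SLD(3)[OF Q] E h1 by blast+
    have S: "h2 \<in> SLset n" "h3 \<in> SLset n" using h2 h3 subgroup_SLD(1)[OF Q] by auto
    have h2i: "h2 $$ (a, d) = h1 $$ (a, d) + (if a = c then h1 $$ (i, d) else 0)" if "a < n" "d < n" for a d
      unfolding h2_def using transv_mult[OF SLset_carrier[OF h1S] c i(1) _ that, of 1] ic by simp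
    have h3i: "h3 $$ (a, d) = h2 $$ (a, d) - (if a = i then h2 $$ (c, d) else 0)" if "a < n" "d < n" for a d
      unfolding h3_def using transv_mult[OF SLset_carrier[OF S(1)] i(1) c False that, of "- 1"] by simp
    have "diagc (Suc c) h3"
      unfolding diagc_def
    proof (intro allI impI)
      fix j a assume ja: "j < Suc c" "a < n" "a \<noteq> j"
      then have jn: "j < n" using c by simp
      show "h3 $$ (a, j) = 0"
      proof (cases "j = c")
        case True
        then show ?thesis using h3i[OF ja(2) c] h2i[OF ja(2) c] h2i[OF c c] h1c[OF ja(2)] h1c[OF c] h1c[OF i(1)] False ja by auto
      next
        case False
        then have "h1 $$ (a, j) = 0" "h1 $$ (i, j) = 0" "h1 $$ (c, j) = 0" using h1d ja i c ic by (auto simp: diagc_def)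
        then show ?thesis using h3i[OF ja(2) jn] h2i[OF ja(2) jn] h2i[OF c jn] by simp
      qed
    qed
    then have h3P: "h3 \<in> pattern_group n rel" using Suc.hyps(1)[OF m h3] c by simp
    have "h2 = adj_mat (transv n i c (- 1)) * h3" unfolding h3_def using SLset_cancel(1)[OF transv_SL[OF False] S(1)] by simp
    then have "h2 = transv n i c 1 * h3" using transv_inverse[OF i(1) c False, of "- 1"] by simp
    then have h2P: "h2 \<in> pattern_group n rel" using pattern_mult[OF transv_pattern[OF rel False] h3P] by simp
    have "h1 = adj_mat (transv n c i 1) * h2" unfolding h2_def using SLset_cancel(1)[OF transv_SL[of c i] h1S] ic by simp
    then have "h1 = transv n c i (- 1) * h2" using transv_inverse[OF c i(1), of 1] ic by simp
    then show ?thesis using pattern_mult[OF transv_pattern[of c i] h2P] ic by (simp add: rel_def)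
  qed
  then show ?case unfolding hb by (rule pattern_mult[OF bP])
qed

text \<open>Elimination again, now with transvections at the positions allowed by
  \<open>rel\<close>, all of which lie in \<open>Q\<close>: a nonzero entry at \<open>(k, c)\<close>
  of a pattern matrix already implies \<open>rel k c\<close>, so it can be cleared. What remains is
  diagonal.\<close>

lemma pattern_subset:
  assumes "h \<in> pattern_group n rel" "c \<le> n" "diagc c h"
  shows "h \<in> Q"
  using assms
proof (induction "n - c" arbitrary: c h)
  case 0
  then have "c = n" by simp
  then show ?case using diagonal_upper[of h] 0 UQ by (auto simp: pattern_group_def)
next
  case (Suc m)
  then have c: "c < n" and m: "m = n - Suc c" by auto
  have clear: "h \<in> Q"
    if "k \<le> n" "h \<in> pattern_group n rel" "diagc c h" "h $$ (c, c) \<noteq> 0" "\<And>a. k \<le> a \<Longrightarrow> a < n \<Longrightarrow> a \<noteq> c \<Longrightarrow> h $$ (a, c) = 0" for k h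
    using that
  proof (induction k arbitrary: h)
    case 0
    then have "diagc (Suc c) h" unfolding diagc_def by (auto simp: less_Suc_eq)
    then show ?case using Suc.hyps(1)[OF m 0(2)] c by simp
  next
    case (Suc k)
    show ?case
    proof (cases "k = c \<or> h $$ (k, c) = 0")
      case True
      have "h $$ (a, c) = 0" if "k \<le> a" "a < n" "a \<noteq> c" for a using Suc.prems(5)[of a] True that by (cases "a = k") auto
      then show ?thesis using Suc.IH[of h] Suc.prems by simp
    next
      case False
      then have kc: "k \<noteq> c" and k: "k < n" using Suc.prems(1) by auto
      have hS: "h \<in> SLset n" using Suc.prems(2) by (simp add: pattern_group_def)
      have rel: "rel k c" using Suc.prems(2) False k c by (auto simp: pattern_group_def)
      define s where "s = - h $$ (k, c) / h $$ (c, c)"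
      define h' where "h' = transv n k c s * h"
      have h'i: "h' $$ (a, d) = h $$ (a, d) + (if a = k then s * h $$ (c, d) else 0)" if "a < n" "d < n" for a d
        unfolding h'_def using transv_mult[OF SLset_carrier[OF hS] k c kc that] .
      have "h' \<in> Q"
      proof (rule Suc.IH)
        show "h' \<in> pattern_group n rel" unfolding h'_def by (rule pattern_mult[OF transv_pattern[OF rel kc] Suc.prems(2)])
        show "diagc c h'" unfolding diagc_def
        proof (intro allI impI)
          fix j a assume "j < c" "a < n" "a \<noteq> j"
          then show "h' $$ (a, j) = 0" using h'i[of a j] Suc.prems(3) c by (auto simp: diagc_def)
        qed
        show "h' $$ (c, c) \<noteq> 0" using h'i[OF c c] kc Suc.prems(4) by simp
        show "h' $$ (a, c) = 0" if a: "k \<le> a" "a < n" "a \<noteq> c" for a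
          using h'i[OF a(2) c] Suc.prems(4,5) a by (cases "a = k") (auto simp: s_def)
      qed (use Suc.prems in simp)
      moreover have "h = adj_mat (transv n k c s) * h'" unfolding h'_def using SLset_cancel(1)[OF transv_SL[OF kc] hS] by simp
      ultimately show ?thesis using subgroup_SLD(3)[OF Q] subgroup_SLD(4)[OF Q rel_transv[OF rel kc]] by metis
    qed
  qed
  have hS: "h \<in> SLset n" using Suc.prems(1) by (simp add: pattern_group_def)
  show ?case
  proof (cases "h $$ (c, c) = 0")
    case False
    then show ?thesis using clear[of n h] Suc.prems by simp
  next
    case True
    obtain i where i: "i < n" "c \<le> i" "h $$ (i, c) \<noteq> 0" using pivot[OF hS c Suc.prems(3)] by blast
    then have ic: "c < i" using True by (cases "i = c") auto
    \<comment> \<open>A vanishing diagonal entry is repaired by adding the pivot row, which lies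
      below; the transvection used is upper triangular.\<close>
    define h' where "h' = transv n c i 1 * h"
    have h'i: "h' $$ (a, d) = h $$ (a, d) + (if a = c then h $$ (i, d) else 0)" if "a < n" "d < n" for a d
      unfolding h'_def using transv_mult[OF SLset_carrier[OF hS] c i(1) _ that, of 1] ic by simp
    have "h' \<in> Q"
    proof (rule clear[of n])
      show "h' \<in> pattern_group n rel"
        unfolding h'_def using upper_pattern transv_upper[OF ic] by (intro pattern_mult Suc.prems) blast
      show "diagc c h'" unfolding diagc_def
      proof (intro allI impI)
        fix j a assume "j < c" "a < n" "a \<noteq> j"
        then show "h' $$ (a, j) = 0" using h'i[of a j] Suc.prems(3) c i ic by (auto simp: diagc_def)
      qed
      show "h' $$ (c, c) \<noteq> 0" using h'i[OF c c] True i by simp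
    qed auto
    moreover have "h = adj_mat (transv n c i 1) * h'" unfolding h'_def using SLset_cancel(1)[OF transv_SL[of c i] hS] ic by simp
    moreover have "adj_mat (transv n c i 1) \<in> Q" using subgroup_SLD(4)[OF Q] transv_upper[OF ic] UQ by blast
    ultimately show ?thesis using subgroup_SLD(3)[OF Q] by metis
  qed
qed

lemma overgroup_eq: "Q = pattern_group n rel"
  using overgroup_subset[of _ 0] pattern_subset[of _ 0] by (auto simp: diagc_def)

lemma overgroup_pattern: "n \<ge> 1 \<Longrightarrow> pattern n rel"
proof
  show "adj_mat h \<in> pattern_group n rel" if "h \<in> pattern_group n rel" for h
    using subgroup_SLD(4)[OF Q, of h] that unfolding overgroup_eq[symmetric] .
  show "rel i j" if "i \<le> j" for i j using that by (simp add: rel_def)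
  show "rel i k" if "i < n" "j < n" "k < n" "rel i j" "rel j k" for i j k by (rule rel_trans[OF that])
qed

end

section \<open>Right translations of the quotient\<close>

lemma coset_eq_iff:
  assumes P: "subgroup P (SL n)" and a: "a \<in> SLset n" and b: "b \<in> SLset n"
  shows "a <#\<^bsub>SL n\<^esub> P = b <#\<^bsub>SL n\<^esub> P \<longleftrightarrow> adj_mat a * b \<in> P"
proof
  note PS = subgroup_SLD(1)[OF P]
  have cos: "x <#\<^bsub>SL n\<^esub> P = (\<lambda>h. x * h) ` P" for x by (auto simp: l_coset_def)
  { assume "a <#\<^bsub>SL n\<^esub> P = b <#\<^bsub>SL n\<^esub> P"
    moreover have "b \<in> b <#\<^bsub>SL n\<^esub> P" unfolding cos using subgroup_SLD(2)[OF P] b by (intro image_eqI[of _ _ "1\<^sub>m n"]) auto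
    ultimately obtain h where h: "h \<in> P" "b = a * h" unfolding cos by blast
    then show "adj_mat a * b \<in> P" using SLset_cancel(1)[OF a, of h] PS by auto }
  assume ab: "adj_mat a * b \<in> P"
  have sub: "x <#\<^bsub>SL n\<^esub> P \<subseteq> y <#\<^bsub>SL n\<^esub> P" if x: "x \<in> SLset n" and y: "y \<in> SLset n" and yx: "adj_mat y * x \<in> P" for x y
  proof
    fix z assume "z \<in> x <#\<^bsub>SL n\<^esub> P"
    then obtain h where h: "h \<in> P" "z = x * h" unfolding cos by blast
    have "z = y * (adj_mat y * x * h)"
      using h x y PS SLset_adj(1)[OF y] SLset_cancel(2)[OF y, of "x * h"] by (auto simp: SLset_assoc[of _ n] subset_iff)
    then show "z \<in> y <#\<^bsub>SL n\<^esub> P" unfolding cos using subgroup_SLD(3)[OF P yx h(1)] by blast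
  qed
  have "adj_mat (adj_mat a * b) = adj_mat b * a"
    using SLset_adj_mult[OF SLset_adj(1)[OF a] b] SLset_adj_adj[OF a] by simp
  then have "adj_mat b * a \<in> P" using subgroup_SLD(4)[OF P ab] by simp
  then show "a <#\<^bsub>SL n\<^esub> P = b <#\<^bsub>SL n\<^esub> P" using sub[OF a b] sub[OF b a] ab by blast
qed

lemma right_translation:
  assumes g: "g \<in> SLset n"
  shows "openin (zariski (SL_space n)) W \<Longrightarrow> openin (zariski (SL_space n)) {x \<in> SLset n. x * g \<in> W}"
    and "f \<in> regular (SL_space n) W \<Longrightarrow> (\<lambda>x. f (x * g)) \<in> regular (SL_space n) {x \<in> SLset n. x * g \<in> W}"
proof -
  have fa: "function_algebra (SLset n) (poly_on n (SLset n))" by (rule poly_on_algebra)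
  have M: "mat_entries (SLset n) (poly_on n (SLset n)) n n (\<lambda>x. x * g)"
    by (rule mat_entries_mult[OF fa poly_on_entries[OF subset_refl] mat_entries_const[OF fa SLset_carrier[OF g]]])
  have tr: "\<exists>q\<in>polynomial_functions (mat_coords n). \<forall>x\<in>SLset n. p (x * g) = q x"
    if "p \<in> polynomial_functions (mat_coords n)" for p
  proof -
    have "(\<lambda>x. p (x * g)) \<in> poly_on n (SLset n)"
      by (rule poly_on_compose[OF _ fa M, of p UNIV]) (use that in \<open>auto simp: poly_on_def\<close>)
    then show ?thesis by (simp add: poly_on_def)
  qed
  show "openin (zariski (SL_space n)) {x \<in> SLset n. x * g \<in> W}" if W: "openin (zariski (SL_space n)) W"
    unfolding openin_induced_space
  proof (intro conjI ballI)
    fix x assume x: "x \<in> {x \<in> SLset n. x * g \<in> W}"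
    then have xg: "x * g \<in> W" by simp
    obtain p where p: "p \<in> polynomial_functions (mat_coords n)" "p (x * g) \<noteq> 0" "{y \<in> SLset n. p y \<noteq> 0} \<subseteq> W"
      by (rule openin_inducedE[OF W xg])
    obtain q where q: "q \<in> polynomial_functions (mat_coords n)" "\<forall>x\<in>SLset n. p (x * g) = q x" using tr[OF p(1)] by blast
    have "{y \<in> SLset n. q y \<noteq> 0} \<subseteq> {x \<in> SLset n. x * g \<in> W}"
    proof
      fix y assume y: "y \<in> {y \<in> SLset n. q y \<noteq> 0}"
      then have "y * g \<in> {y \<in> SLset n. p y \<noteq> 0}" using q(2) g by auto
      then show "y \<in> {x \<in> SLset n. x * g \<in> W}" using p(3) y by auto
    qed
    moreover have "q x \<noteq> 0" using p(2) q(2) x by auto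
    ultimately show "\<exists>p\<in>polynomial_functions (mat_coords n). p x \<noteq> 0 \<and> {y \<in> SLset n. p y \<noteq> 0} \<subseteq> {x \<in> SLset n. x * g \<in> W}"
      using q(1) by (intro bexI[of _ q]) auto
  qed auto
  show "(\<lambda>x. f (x * g)) \<in> regular (SL_space n) {x \<in> SLset n. x * g \<in> W}" if f: "f \<in> regular (SL_space n) W"
    unfolding mem_regular_induced_space
  proof
    fix x assume x: "x \<in> {x \<in> SLset n. x * g \<in> W}"
    then have xg: "x * g \<in> W" by simp
    obtain p q where pq: "p \<in> polynomial_functions (mat_coords n)" "q \<in> polynomial_functions (mat_coords n)" "q (x * g) \<noteq> 0"
      "\<forall>y\<in>W. q y \<noteq> 0 \<longrightarrow> f y = p y / q y"
      by (rule mem_regular_inducedE[OF f xg])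
    obtain p' where p': "p' \<in> polynomial_functions (mat_coords n)" "\<forall>x\<in>SLset n. p (x * g) = p' x" using tr[OF pq(1)] by blast
    obtain q' where q': "q' \<in> polynomial_functions (mat_coords n)" "\<forall>x\<in>SLset n. q (x * g) = q' x" using tr[OF pq(2)] by blast
    have "f (y * g) = p' y / q' y" if y: "y \<in> {x \<in> SLset n. x * g \<in> W}" "q' y \<noteq> 0" for y
      using pq(4) p'(2) q'(2) y by force
    moreover have "q' x \<noteq> 0" using pq(3) q'(2) x by auto
    ultimately show "\<exists>p\<in>polynomial_functions (mat_coords n). \<exists>q\<in>polynomial_functions (mat_coords n). q x \<noteq> 0 \<and>
        (\<forall>y\<in>{x \<in> SLset n. x * g \<in> W}. q y \<noteq> 0 \<longrightarrow> f (y * g) = p y / q y)"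
      using p'(1) q'(1) by (intro bexI[of _ p'] bexI[of _ q']) auto
  qed
qed

text \<open>Right translation is an automorphism of the variety of the group, so composing a
  projection with it changes neither the image nor the open sets nor the regular functions. The
  result is equality of spaces, not just isomorphism.\<close>

lemma quotient_right_translation:
  assumes g: "g \<in> SLset n"
  shows "quotient_space (SL_space n) (\<lambda>x. q (x * g)) = quotient_space (SL_space n) q"
proof -
  note ga = SLset_adj(1)[OF g]
  have im: "(\<lambda>x. q (x * g)) ` SLset n = q ` SLset n"
  proof
    show "(\<lambda>x. q (x * g)) ` SLset n \<subseteq> q ` SLset n" using g by auto
    show "q ` SLset n \<subseteq> (\<lambda>x. q (x * g)) ` SLset n"
    proof
      fix y assume "y \<in> q ` SLset n"
      then obtain x where x: "x \<in> SLset n" "y = q x" by blast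
      then show "y \<in> (\<lambda>x. q (x * g)) ` SLset n"
        using ga SLset_cancel(4)[OF g x(1)] by (intro image_eqI[of _ _ "x * adj_mat g"]) auto
    qed
  qed
  have pre1: "{x \<in> SLset n. q (x * g) \<in> U} = {x \<in> SLset n. x * g \<in> {x \<in> SLset n. q x \<in> U}}" for U using g by auto
  have pre2: "{x \<in> SLset n. q x \<in> U} = {x \<in> SLset n. x * adj_mat g \<in> {x \<in> SLset n. q (x * g) \<in> U}}" for U
    using ga SLset_cancel(4)[OF g] by auto
  have "openin (zariski (SL_space n)) {x \<in> SLset n. q (x * g) \<in> U} \<longleftrightarrow> openin (zariski (SL_space n)) {x \<in> SLset n. q x \<in> U}" for U
    using right_translation(1)[OF g, of "{x \<in> SLset n. q x \<in> U}"] right_translation(1)[OF ga, of "{x \<in> SLset n. q (x * g) \<in> U}"]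
    unfolding pre1[symmetric] pre2[symmetric] by blast
  moreover have "(\<lambda>x. f (q (x * g))) \<in> regular (SL_space n) {x \<in> SLset n. q (x * g) \<in> U} \<longleftrightarrow>
      (\<lambda>x. f (q x)) \<in> regular (SL_space n) {x \<in> SLset n. q x \<in> U}" for f U
  proof
    assume "(\<lambda>x. f (q x)) \<in> regular (SL_space n) {x \<in> SLset n. q x \<in> U}"
    from right_translation(2)[OF g this] show "(\<lambda>x. f (q (x * g))) \<in> regular (SL_space n) {x \<in> SLset n. q (x * g) \<in> U}"
      unfolding pre1[symmetric] .
  next
    assume "(\<lambda>x. f (q (x * g))) \<in> regular (SL_space n) {x \<in> SLset n. q (x * g) \<in> U}"
    from right_translation(2)[OF ga this]
    have r: "(\<lambda>x. f (q (x * adj_mat g * g))) \<in> regular (SL_space n) {x \<in> SLset n. q x \<in> U}" unfolding pre2[symmetric] .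
    then show "(\<lambda>x. f (q x)) \<in> regular (SL_space n) {x \<in> SLset n. q x \<in> U}"
      unfolding mem_regular_induced_space using SLset_cancel(4)[OF g] by auto
  qed
  ultimately show ?thesis unfolding quotient_space_def by (simp add: im comp_def)
qed

theorem theorem2p1:
  fixes n d :: nat and P :: "complex mat set" and X :: "complex mat set fspace"
  assumes "n \<ge> 1"
    and "parabolic_subgroup n P"
    and "X = homogeneous_space n P"
    and "krull_dimension X = enat d"
  shows "\<exists>(Z :: complex vec algebraic_group) (E :: complex mat set fspace) \<pi> actZ actG \<Omega>.
           algebraic_torus Z \<and>
           equivariant_principal_bundle (SL n) actG (\<lambda>g x. g <#\<^bsub>SL n\<^esub> x) Z E actZ \<pi> X \<and>
           holomorphic_form E d \<Omega> \<and> nowhere_vanishing E d \<Omega> \<and>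
           invariant_form (SL n) actG E d \<Omega>"
proof -
  have P: "subgroup P (SL n)" using assms(2) by (auto simp: parabolic_subgroup_def closed_subgroup_def)
  note PS = subgroup_SLD(1)[OF P]
  obtain B where B: "borel_subgroup n B" "B \<subseteq> P" using assms(2) by (auto simp: parabolic_subgroup_def)
  obtain g where g: "g \<in> SLset n" and Bg: "B = conj_set n g (upper n)" using borel_conjugate[OF assms(1) B(1)] by blast
  note ga = SLset_adj(1)[OF g]
  \<comment> \<open>\<open>B\<close> is the conjugate of the upper triangular group by
    \<open>g\<close>; conjugating \<open>P\<close> back therefore gives a group containing the upper
    triangular matrices.\<close>
  define Q where "Q = conj_set n (adj_mat g) P"
  have Q: "subgroup Q (SL n)" unfolding Q_def by (rule subgroup_conj_set[OF ga P])
  have UQ: "upper n \<subseteq> Q"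
  proof
    fix x assume x: "x \<in> upper n"
    note xS = upper_SL[OF x]
    have "g * x * adj_mat g \<in> B" unfolding Bg using conj_set_image[OF g, of "upper n"] x upper_SL by blast
    then show "x \<in> Q" using B(2) xS SLset_adj_adj[OF g] by (auto simp: Q_def conj_set_def)
  qed
  define R where "R = rel n Q"
  have QR: "Q = pattern_group n R" unfolding R_def by (rule overgroup_eq[OF Q UQ])
  \<comment> \<open>The fibres are the cosets of \<open>Q\<close>, but the values are cosets of
    \<open>P\<close>. The quotient is then \<open>X\<close> itself, and the left action on it is the
    one required.\<close>
  define p where "p x = (x * adj_mat g) <#\<^bsub>SL n\<^esub> P" for x
  interpret pattern n R unfolding R_def by (rule overgroup_pattern[OF Q UQ assms(1)])
  have p_eq: "p x = p y \<longleftrightarrow> (\<exists>q\<in>pattern_group n R. y = x * q)" if x: "x \<in> SLset n" and y: "y \<in> SLset n" for x y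
  proof -
    note xa = SLset_adj(1)[OF x]
    have "p x = p y \<longleftrightarrow> adj_mat (x * adj_mat g) * (y * adj_mat g) \<in> P"
      unfolding p_def using x y ga by (intro coset_eq_iff[OF P]) auto
    also have "adj_mat (x * adj_mat g) * (y * adj_mat g) = g * (adj_mat x * y) * adj_mat g"
      using SLset_adj_mult[OF x ga] SLset_adj_adj[OF g] x y g ga xa by (simp add: SLset_assoc[of _ n])
    also have "\<dots> \<in> P \<longleftrightarrow> adj_mat x * y \<in> Q"
      using xa y SLset_adj_adj[OF g] by (simp add: Q_def conj_set_def)
    also have "\<dots> \<longleftrightarrow> (\<exists>q\<in>pattern_group n R. y = x * q)" unfolding QR
    proof
      assume "adj_mat x * y \<in> pattern_group n R"
      moreover have "y = x * (adj_mat x * y)" using SLset_cancel(2)[OF x y] by simp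
      ultimately show "\<exists>q\<in>pattern_group n R. y = x * q" by blast
    next
      assume "\<exists>q\<in>pattern_group n R. y = x * q"
      then obtain q where q: "q \<in> pattern_group n R" "y = x * q" by blast
      then show "adj_mat x * y \<in> pattern_group n R" using SLset_cancel(1)[OF x P_SL[OF q(1)]] by simp
    qed
    finally show ?thesis .
  qed
  interpret F: flag_quotient n R p by unfold_locales (rule p_eq)
  have XX: "X = F.X"
    unfolding assms(3) homogeneous_space_def F.X_def p_def
    using quotient_right_translation[OF ga, of "\<lambda>x. x <#\<^bsub>SL n\<^esub> P"] by simp
  have act: "h <#\<^bsub>SL n\<^esub> p a = p (h * a)" if h: "h \<in> SLset n" and a: "a \<in> SLset n" for h a
    unfolding p_def l_coset_def using h a ga PS by (auto simp: SLset_assoc[of _ n] subset_iff)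
  have N: "N = d" using F.krull_dimension_X assms(4) unfolding XX by simp
  show ?thesis
    unfolding XX
  proof (intro exI conjI)
    show "algebraic_torus Gm" by (rule torus_Gm)
    show "equivariant_principal_bundle (SL n) F.actG (\<lambda>g x. g <#\<^bsub>SL n\<^esub> x) Gm F.E F.actZ F.proj F.X"
      by (rule F.equivariant_bundle_E) (rule act)
    show "holomorphic_form F.E d F.omega" "nowhere_vanishing F.E d F.omega" "invariant_form (SL n) F.actG F.E d F.omega"
      using F.holomorphic_omega F.nonvanishing_omega F.invariant_omega by (simp_all only: N)
  qed
qed

end
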